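(* Let $\tau$ be an ergodic transformation on the probability space $(\Omega,\mu)$ and let $\mathbf f=(\mathbf f_\omega)_{\omega\in\Omega}\in\mathcal E_\Omega(\Delta,\beta,\epsilon)$ be Bochner-measurable. Suppose there is $n_0<\infty$ such that almost surely the sequence $\mathcal F_\omega=(\mathbf f_{\tau^{n-1}\omega})_{n\in\mathbb N}$ is $(n_0,\Delta)$-mixing, and suppose that $\mathbb E\log\|D\mathbf f_\omega\|<+\infty$. (a) For any $s\ge0$, $\mu$-almost surely, the lower pressure $\underline P(s,\mathcal F_\omega)$ is independent of $\omega$; write $\underline P(s,\mathbf f)$ for this almost sure value. The Hausdorff, lower box and upper box dimensions of the random conformal repeller $\Lambda(\mathcal F_\omega)$ agree almost surely. Their common value is almost surely constant and given by $$\dim\Lambda(\mathcal F_\omega)=\sup\{s\ge0:\underline P(s,\mathbf f)>0\}\in[0,+\infty].$$ (b) The almost sure dimension is finite if and only if $\underline P(0,\mathbf f)<+\infty$ (this is the case, e.g., if $\mathbb E\log d^o_{\max}(\mathbf f)<\infty$), and one has the estimate $$\frac{\mathbb E\log d^o_{\min}(\mathbf f)}{\mathbb E\log\|D\mathbf f\|}\le\dim\Lambda(\mathcal F_\omega)\le\frac{\mathbb E\log d^o_{\max}(\mathbf f)}{-\mathbb E\log\|1/D\mathbf f\|}.$$ (c) The mapping $\mathbf f\in(\mathcal E_\Omega,d_{\mathcal E,\Omega})\mapsto\log\dim\Lambda(\mathcal F_\omega)$ is $\frac{2}{\log\beta}$-Lipschitz at distances $\le\epsilon(\Delta)$; that is,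 if $\mathbf f,\tilde{\mathbf f}\in\mathcal E_\Omega$ are such that, for some $n_0<\infty$, almost surely both sequences $(\mathbf f_{\tau^{n-1}\omega})_{n\in\mathbb N}$ and $(\tilde{\mathbf f}_{\tau^{n-1}\omega})_{n\in\mathbb N}$ are $(n_0,\Delta)$-mixing, if $\mathbb E\log\|D\mathbf f_\omega\|<+\infty$ and $\mathbb E\log\|D\tilde{\mathbf f}_\omega\|<+\infty$, and if $r=d_{\mathcal E,\Omega}(\mathbf f,\tilde{\mathbf f})\le\epsilon(\Delta)$, then their almost sure dimensions $D,\tilde D\in[0,+\infty]$ satisfy $e^{-2r/\log\beta}\tilde D\le D\le e^{2r/\log\beta}\tilde D$.
   Context: $B(x,r)$ denotes the open ball. $(K,d)$ is a complete metric space without isolated points and $\Delta>0$ is such that $K$ is covered by finitely many balls of radius $\Delta$. $K$ is assumed $\Delta$-homogeneous: there is $0<\delta<\Delta$ with $B(y,\Delta)\setminus B(y,\delta)\ne\emptyset$ for all $y\in K$. Let $\beta>1$ and let $\epsilon:[0,\infty)\to[0,\infty)$ be continuous, strictly increasing and concave with $\epsilon(0)=0$. A map $f:\Omega_f\to K$, $\Omega_f\subset K$, is $C^1$-conformal if for each $x\in\Omega_f$ the limit $Df(x)=\lim_{u\ne v\to x}d(f(u),f(v))/d(u,v)$ exists. Divided difference: $f[u,v]=d(f(u),f(v))/d(u,v)$ if $u\neq v$, $f[u,u]=Df(u)$. Distortion, for $x\in\Omega_f$, $r>0$: $$\epsilon_f(x,r)=\sup\Bigl\{\Bigl|\log\tfrac{f[u_1,x]}{Df(u_2)}\Bigr|:u_1,u_2\in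 B(x,\delta_f(x))\cap f^{-1}B(f(x),r)\Bigr\}.$$ $\mathcal E=\mathcal E(\Delta,\beta,\epsilon)$ is the class of $C^1$-conformal unramified covering maps $f:\Omega_f\to K$ of finite maximal degree, from a non-empty (not necessarily connected) domain $\Omega_f\subset K$ onto $K$, for which there are constants $\delta(f)>0$, $\lambda_1(f)<\infty$ and a function $\delta_f:\Omega_f\to[\delta(f),\Delta]$ such that (T0) for all distinct $x,x'\in f^{-1}\{y\}$ ($y\in K$) the balls $B(x,\delta_f(x))$ and $B(x',\delta_f(x'))$ are disjoint; (T1) for all $x\in\Omega_f$: $B(f(x),\Delta)\subset f(B(x,\delta_f(x))\cap\Omega_f)$; (T2) $\beta\le f[u,x]\le\lambda_1(f)$ for all $u,x\in\Omega_f$ with $d(u,x)<\delta_f(x)$; (T3) $\epsilon_f(x,r)\le\epsilon(r)$ for all $x\in\Omega_f$ and $0<r\le\Delta$. Write $d^o_{\max}(f)$, $d^o_{\min}(f)$ for the maximum and minimum over $y\in K$ of $\#f^{-1}(y)$, and $\|Df\|=\sup_{\Omega_f}Df$, $\|1/Df\|=\sup_{\Omega_f}1/Df$. **Metric on $\mathcal E$.** $d_{\mathcal E}(f,\tilde f)=+\infty$ if $\#f^{-1}(y)\ne\#\tilde f^{-1}(y)$ for some $y\in K$; otherwise $$d_{\mathcal E}(f,\tilde f)=\sup_{y\in K}\inf_{\pi}\sup_{x\in f^{-1}(y)}\Bigl[\epsilon\bigl(\tfrac{\beta}{\beta-1}d(x,\pi(x))\bigr)+\Bigl|\log\tfrac{D\tilde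 f(\pi(x))}{Df(x)}\Bigr|\Bigr],$$ the infimum over bijections $\pi:f^{-1}(y)\to\tilde f^{-1}(y)$. $\mathcal E$ carries the Borel $\sigma$-algebra of $d_{\mathcal E}$. **Random setting.** $\tau:\Omega\to\Omega$ is (measure-preserving and) $\mu$-ergodic. $\mathcal E_\Omega$ is the space of Bochner-measurable maps $\mathbf f:\omega\in(\Omega,\mu)\mapsto\mathbf f_\omega\in(\mathcal E,d_{\mathcal E})$, i.e. measurable maps for which the image of some subset of full measure contains a countable dense set. $d_{\mathcal E,\Omega}(\mathbf f,\tilde{\mathbf f})=\mu\text{-ess}\sup_\omega d_{\mathcal E}(\mathbf f_\omega,\tilde{\mathbf f}_\omega)\in[0,+\infty]$. For a sequence $\mathcal F=(f_k)_{k\ge1}\subset\mathcal E$: $\Lambda(\mathcal F)=\bigcap_{n\ge1}f_1^{-1}\circ\cdots\circ f_n^{-1}(K)$; $f_t^{(k)}=f_{t+k}\circ\cdots\circ f_{t+1}$, $f^{(n)}=f^{(n)}_0$. $\mathcal F$ is $(n_0,\Delta)$-mixing if for every $y\in K$, $t\ge0$ the set $(f_t^{(n_0)})^{-1}\{y\}$ is $\Delta$-dense in $(f_t^{(n_0)})^{-1}K$. The lower pressure is $$\underline P(s,\mathcal F)=\liminf_{n}\frac1n\log\inf_{y\in K}\sum_{x\in(f^{(n)})^{-1}\{y\}}(Df^{(n)}(x))^{-s}.$$ *)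

theory Defs
  imports "HOL-Probability.Probability"
begin

text \<open>
  The ambient space \<open>K\<close> is the whole of a type \<open>'a\<close>: completeness is the class
  \<open>complete_space\<close>, absence of isolated points the class \<open>perfect_space\<close>.

  A map \<open>f : \<Omega>\<^sub>f \<rightarrow> K\<close> with \<open>\<Omega>\<^sub>f \<subseteq> K\<close> is a partial function \<open>f :: 'a \<rightharpoonup> 'a\<close> with
  \<open>dom f = \<Omega>\<^sub>f\<close>. So two maps are equal iff they have the same domain and the same values on
  it, and \<open>g \<circ>\<^sub>m f\<close> is the composition on its natural domain \<open>f\<^sup>-\<^sup>1(\<Omega>\<^sub>g)\<close>.
\<close>

definition mpreim :: "('a \<rightharpoonup> 'a) \<Rightarrow> 'a set \<Rightarrow> 'a set" where
  "mpreim f A = {x \<in> dom f. the (f x) \<in> A}"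

definition fibre :: "('a \<rightharpoonup> 'a) \<Rightarrow> 'a \<Rightarrow> 'a set" where
  "fibre f y = mpreim f {y}"

definition diff_quot :: "('a::metric_space \<rightharpoonup> 'a) \<Rightarrow> 'a \<times> 'a \<Rightarrow> real" where
  "diff_quot f = (\<lambda>(u, v). dist (the (f u)) (the (f v)) / dist u v)"

text \<open>The filter of pairs \<open>(u, v) \<in> \<Omega>\<^sub>f \<times> \<Omega>\<^sub>f\<close> with \<open>u \<noteq> v\<close> and \<open>u, v \<rightarrow> x\<close>
  (\<open>u = x \<noteq> v\<close> and \<open>v = x \<noteq> u\<close> are allowed).\<close>

definition offdiag_at :: "('a::metric_space \<rightharpoonup> 'a) \<Rightarrow> 'a \<Rightarrow> ('a \<times> 'a) filter" where
  "offdiag_at f x = at (x, x) within {(u, v). u \<in> dom f \<and> v \<in> dom f \<and> u \<noteq> v}"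

definition C1_conformal :: "('a::metric_space \<rightharpoonup> 'a) \<Rightarrow> bool" where
  "C1_conformal f \<longleftrightarrow> (\<forall>x\<in>dom f. \<exists>L. (diff_quot f \<longlongrightarrow> L) (offdiag_at f x))"

definition conf_deriv :: "('a::metric_space \<rightharpoonup> 'a) \<Rightarrow> 'a \<Rightarrow> real" where
  "conf_deriv f x = Lim (offdiag_at f x) (diff_quot f)"

definition div_diff :: "('a::metric_space \<rightharpoonup> 'a) \<Rightarrow> 'a \<Rightarrow> 'a \<Rightarrow> real" where
  "div_diff f u v = (if u = v then conf_deriv f u else diff_quot f (u, v))"

definition distortion ::
  "('a::metric_space \<rightharpoonup> 'a) \<Rightarrow> ('a \<Rightarrow> real) \<Rightarrow> 'a \<Rightarrow> real \<Rightarrow> ennreal" where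
  "distortion f \<delta>f x r =
     (let U = ball x (\<delta>f x) \<inter> mpreim f (ball (the (f x)) r)
      in SUP u1\<in>U. SUP u2\<in>U. ennreal \<bar>ln (div_diff f u1 x / conf_deriv f u2)\<bar>)"

definition finitely_covered :: "'a::metric_space itself \<Rightarrow> real \<Rightarrow> bool" where
  "finitely_covered _ \<Delta> \<longleftrightarrow> (\<exists>C::'a set. finite C \<and> (\<Union>x\<in>C. ball x \<Delta>) = UNIV)"

definition homogeneous :: "'a::metric_space itself \<Rightarrow> real \<Rightarrow> bool" where
  "homogeneous _ \<Delta> \<longleftrightarrow> (\<exists>\<delta>. 0 < \<delta> \<and> \<delta> < \<Delta> \<and> (\<forall>y::'a. ball y \<Delta> - ball y \<delta> \<noteq> {}))"

text \<open>The domain is an arbitrary non-empty subset of \<open>K\<close>, not required to be open. (By the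
  conditions below it is automatically closed in \<open>K\<close>, so openness would exclude, for instance,
  every example on a connected \<open>K\<close> whose domain is not all of \<open>K\<close>.)\<close>

definition conf_class ::
  "real \<Rightarrow> real \<Rightarrow> (real \<Rightarrow> real) \<Rightarrow> ('a::metric_space \<rightharpoonup> 'a) set" where
  "conf_class \<Delta> \<beta> \<epsilon> =
     {f. dom f \<noteq> {} \<and> covering_space (dom f) (\<lambda>x. the (f x)) UNIV \<and> C1_conformal f \<and>
         (\<exists>N. \<forall>y. finite (fibre f y) \<and> card (fibre f y) \<le> N) \<and>
         (\<exists>\<delta>0 L1 \<delta>f.
            0 < \<delta>0 \<and> (\<forall>x\<in>dom f. \<delta>f x \<in> {\<delta>0..\<Delta>}) \<and>
            (\<forall>y. \<forall>x\<in>fibre f y. \<forall>x'\<in>fibre f y. x \<noteq> x' \<longrightarrow>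
               ball x (\<delta>f x) \<inter> ball x' (\<delta>f x') = {}) \<and>
            (\<forall>x\<in>dom f. ball (the (f x)) \<Delta> \<subseteq> (\<lambda>u. the (f u)) ` (ball x (\<delta>f x) \<inter> dom f)) \<and>
            (\<forall>u\<in>dom f. \<forall>x\<in>dom f. dist u x < \<delta>f x \<longrightarrow> div_diff f u x \<in> {\<beta>..L1}) \<and>
            (\<forall>x\<in>dom f. \<forall>r. 0 < r \<and> r \<le> \<Delta> \<longrightarrow> distortion f \<delta>f x r \<le> ennreal (\<epsilon> r)))}"

definition dmax :: "('a \<rightharpoonup> 'a) \<Rightarrow> nat" where
  "dmax f = Max (range (\<lambda>y. card (fibre f y)))"

definition dmin :: "('a \<rightharpoonup> 'a) \<Rightarrow> nat" where
  "dmin f = Min (range (\<lambda>y. card (fibre f y)))"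

definition norm_D :: "('a::metric_space \<rightharpoonup> 'a) \<Rightarrow> real" where
  "norm_D f = (SUP x\<in>dom f. conf_deriv f x)"

definition norm_inv_D :: "('a::metric_space \<rightharpoonup> 'a) \<Rightarrow> real" where
  "norm_inv_D f = (SUP x\<in>dom f. 1 / conf_deriv f x)"

definition dE ::
  "real \<Rightarrow> (real \<Rightarrow> real) \<Rightarrow> ('a::metric_space \<rightharpoonup> 'a) \<Rightarrow> ('a \<rightharpoonup> 'a) \<Rightarrow> ennreal" where
  "dE \<beta> \<epsilon> f g =
     (if \<exists>y. card (fibre f y) \<noteq> card (fibre g y) then \<infinity>
      else SUP y. INF \<pi>\<in>{\<pi>. bij_betw \<pi> (fibre f y) (fibre g y)}. SUP x\<in>fibre f y.
             ennreal (\<epsilon> (\<beta> / (\<beta> - 1) * dist x (\<pi> x))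
                      + \<bar>ln (conf_deriv g (\<pi> x) / conf_deriv f x)\<bar>))"

definition dE_open ::
  "real \<Rightarrow> real \<Rightarrow> (real \<Rightarrow> real) \<Rightarrow> ('a::metric_space \<rightharpoonup> 'a) set \<Rightarrow> bool" where
  "dE_open \<Delta> \<beta> \<epsilon> U \<longleftrightarrow>
     U \<subseteq> conf_class \<Delta> \<beta> \<epsilon> \<and>
     (\<forall>f\<in>U. \<exists>e>0. \<forall>g\<in>conf_class \<Delta> \<beta> \<epsilon>. dE \<beta> \<epsilon> f g < e \<longrightarrow> g \<in> U)"

definition borel_E ::
  "real \<Rightarrow> real \<Rightarrow> (real \<Rightarrow> real) \<Rightarrow> ('a::metric_space \<rightharpoonup> 'a) measure" where
  "borel_E \<Delta> \<beta> \<epsilon> = sigma (conf_class \<Delta> \<beta> \<epsilon>) {U. dE_open \<Delta> \<beta> \<epsilon> U}"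

definition ergodic_transformation :: "'w measure \<Rightarrow> ('w \<Rightarrow> 'w) \<Rightarrow> bool" where
  "ergodic_transformation M \<tau> \<longleftrightarrow>
     \<tau> \<in> measurable M M \<and> distr M M \<tau> = M \<and>
     (\<forall>A\<in>sets M. \<tau> -` A \<inter> space M = A \<longrightarrow> measure M A = 0 \<or> measure M A = 1)"

definition random_maps ::
  "'w measure \<Rightarrow> real \<Rightarrow> real \<Rightarrow> (real \<Rightarrow> real) \<Rightarrow> ('w \<Rightarrow> ('a::metric_space \<rightharpoonup> 'a)) set" where
  "random_maps M \<Delta> \<beta> \<epsilon> =
     {f \<in> measurable M (borel_E \<Delta> \<beta> \<epsilon>).
        \<exists>A\<in>sets M. measure M A = 1 \<and>
          (\<exists>C. countable C \<and> C \<subseteq> f ` A \<and> (\<forall>\<omega>\<in>A. \<forall>e>0. \<exists>c\<in>C. dE \<beta> \<epsilon> (f \<omega>) c < e))}"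

text \<open>The essential supremum is written out rather than taken from the library, whose
  \<open>esssup\<close> is \<open>\<infinity>\<close> on functions that are measurable only up to a null set.\<close>

definition dE_random ::
  "'w measure \<Rightarrow> real \<Rightarrow> (real \<Rightarrow> real) \<Rightarrow>
     ('w \<Rightarrow> ('a::metric_space \<rightharpoonup> 'a)) \<Rightarrow> ('w \<Rightarrow> ('a \<rightharpoonup> 'a)) \<Rightarrow> ennreal" where
  "dE_random M \<beta> \<epsilon> f g = Inf {c. AE \<omega> in M. dE \<beta> \<epsilon> (f \<omega>) (g \<omega>) \<le> c}"

text \<open>Expectation with values in the extended reals. It is only applied to random variables
  that are bounded below or bounded above by a constant, so \<open>\<infinity> - \<infinity>\<close> does not occur.\<close>

definition expect :: "'w measure \<Rightarrow> ('w \<Rightarrow> real) \<Rightarrow> ereal" where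
  "expect M X =
     enn2ereal (\<integral>\<^sup>+\<omega>. ennreal (X \<omega>) \<partial>M) - enn2ereal (\<integral>\<^sup>+\<omega>. ennreal (- X \<omega>) \<partial>M)"

text \<open>A sequence \<open>(f\<^sub>k)\<close> with \<open>k \<ge> 1\<close> is a function on the naturals whose value at 0 is never
  used. \<open>iter_seq F t n\<close> is \<open>f\<^bsub>t+n\<^esub> \<circ> \<dots> \<circ> f\<^bsub>t+1\<^esub>\<close>.\<close>

primrec iter_seq :: "(nat \<Rightarrow> ('a \<rightharpoonup> 'a)) \<Rightarrow> nat \<Rightarrow> nat \<Rightarrow> ('a \<rightharpoonup> 'a)" where
  "iter_seq F t 0 = Some"
| "iter_seq F t (Suc n) = F (t + Suc n) \<circ>\<^sub>m iter_seq F t n"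

definition orbit_seq ::
  "('w \<Rightarrow> 'w) \<Rightarrow> ('w \<Rightarrow> ('a \<rightharpoonup> 'a)) \<Rightarrow> 'w \<Rightarrow> nat \<Rightarrow> ('a \<rightharpoonup> 'a)" where
  "orbit_seq \<tau> f \<omega> n = f ((\<tau> ^^ (n - 1)) \<omega>)"

definition repeller :: "(nat \<Rightarrow> ('a \<rightharpoonup> 'a)) \<Rightarrow> 'a set" where
  "repeller F = (\<Inter>n\<in>{1..}. mpreim (iter_seq F 0 n) UNIV)"

definition mixing :: "nat \<Rightarrow> real \<Rightarrow> (nat \<Rightarrow> ('a::metric_space \<rightharpoonup> 'a)) \<Rightarrow> bool" where
  "mixing n0 \<Delta> F \<longleftrightarrow>
     (\<forall>y t. \<forall>x\<in>mpreim (iter_seq F t n0) UNIV. \<exists>z\<in>fibre (iter_seq F t n0) y. dist x z < \<Delta>)"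

definition lower_pressure :: "real \<Rightarrow> (nat \<Rightarrow> ('a::metric_space \<rightharpoonup> 'a)) \<Rightarrow> ereal" where
  "lower_pressure s F =
     liminf (\<lambda>n. ereal (1 / real n *
       ln (INF y. \<Sum>x\<in>fibre (iter_seq F 0 n) y. conf_deriv (iter_seq F 0 n) x powr (- s))))"

text \<open>The power \<open>diam(U)\<^sup>s\<close> with the usual conventions for \<open>s = 0\<close> (1 for non-empty \<open>U\<close>, even
  if the diameter is 0) and for the empty set.\<close>

definition diam_pow :: "real \<Rightarrow> 'a::metric_space set \<Rightarrow> ennreal" where
  "diam_pow s U = (if U = {} then 0 else if s = 0 then 1 else ennreal (diameter U powr s))"

definition hausdorff_premeasure :: "real \<Rightarrow> real \<Rightarrow> 'a::metric_space set \<Rightarrow> ennreal" where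
  "hausdorff_premeasure s \<rho> A =
     Inf {(\<Sum>i. diam_pow s (U i)) | U :: nat \<Rightarrow> 'a set.
            A \<subseteq> (\<Union>i. U i) \<and> (\<forall>i. bounded (U i) \<and> diameter (U i) \<le> \<rho>)}"

definition hausdorff_measure :: "real \<Rightarrow> 'a::metric_space set \<Rightarrow> ennreal" where
  "hausdorff_measure s A = (SUP \<rho>\<in>{0<..}. hausdorff_premeasure s \<rho> A)"

definition hausdorff_dim :: "'a::metric_space set \<Rightarrow> ennreal" where
  "hausdorff_dim A = Inf {ennreal s | s. 0 \<le> s \<and> hausdorff_measure s A = 0}"

definition ball_cover :: "'a::metric_space set \<Rightarrow> real \<Rightarrow> 'a set \<Rightarrow> bool" where
  "ball_cover A r C \<longleftrightarrow> finite C \<and> A \<subseteq> (\<Union>x\<in>C. ball x r)"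

definition covering_number :: "'a::metric_space set \<Rightarrow> real \<Rightarrow> nat" where
  "covering_number A r = Inf {card C | C. ball_cover A r C}"

definition box_quotient :: "'a::metric_space set \<Rightarrow> real \<Rightarrow> ennreal" where
  "box_quotient A r =
     (if \<exists>C. ball_cover A r C then ennreal (ln (real (covering_number A r)) / (- ln r)) else \<infinity>)"

definition lower_box_dim :: "'a::metric_space set \<Rightarrow> ennreal" where
  "lower_box_dim A = Liminf (at_right 0) (box_quotient A)"

definition upper_box_dim :: "'a::metric_space set \<Rightarrow> ennreal" where
  "upper_box_dim A = Limsup (at_right 0) (box_quotient A)"

definition all_dims_eq :: "'a::metric_space set \<Rightarrow> ennreal \<Rightarrow> bool" where
  "all_dims_eq A D \<longleftrightarrow> hausdorff_dim A = D \<and> lower_box_dim A = D \<and> upper_box_dim A = D"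

end

theory Submission
  imports Defs
begin

text \<open>
  Write \<open>X s n \<omega>\<close> for the logarithm of the infimum over \<open>y\<close> of
  the partition sum of exponent \<open>s\<close> over the \<open>n\<close>-th fibre of
  \<open>y\<close>. Cutting an orbit into two pieces bounds the sum over the long fibre below by
  a product, so \<open>X\<close> is superadditive along \<open>\<tau>\<close>
  (\<open>ln_pinf_superadd\<close>). Hence the lower pressure can only decrease under
  \<open>\<tau>\<close>, and ergodicity makes it a constant \<open>P s\<close>
  (\<open>pressure_exists\<close>). Expansion by at least \<open>\<beta>\<close> per step gives
  \<open>P (s + h) \<le> P s - h ln \<beta>\<close> and integrability of \<open>log
  \<parallel>D\<parallel>\<close> gives an inequality in the other direction, so
  \<open>P\<close> is either infinite everywhere, or finite and strictly decreasing, and the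
  dimension is the exponent at which it vanishes.

  Mixing makes \<open>X\<close> almost subadditive as well. Two preimages of points at distance
  less than \<open>\<Delta>\<close> under the same inverse branch stay together, and their
  derivatives along \<open>n\<close> steps differ by a factor of at most \<open>exp
  c\<^sub>n\<close>, where \<open>c\<^sub>n\<close> is the sum of \<open>\<epsilon> (\<Delta> /
  \<beta>\<^sup>i)\<close> over \<open>i < n\<close>, which is \<open>o(n)\<close>
  (\<open>distortion_sum_sublinear\<close>). So the sums over the fibres of any two points are
  comparable after \<open>n0\<close> further steps, at a cost that is integrable in
  \<open>\<omega>\<close> (\<open>ln_pinf_mixing\<close>). A greedy covering of the time axis,
  as in proofs of Kingman's theorem, then shows that \<open>X s n / n\<close> has upper limit at
  most \<open>P s\<close> when \<open>P 0\<close> is finite (\<open>subadditive_upper\<close>,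
  \<open>P_lt\<close>): whenever the lower pressure is below a number \<open>c\<close>, the sums
  are at most \<open>exp (c n)\<close> for all large \<open>n\<close>.

  The upper bound. If \<open>P s < 0\<close>, follow every point of the repeller until the
  derivative along its orbit exceeds \<open>\<Delta> / r\<close> up to the distortion. At that
  time the orbit is \<open>\<Delta>\<close>-close to a point of a fixed fibre, and pulling back
  gives a centre of a ball of radius \<open>r\<close> that contains the point
  (\<open>stopping_cover\<close>). The number of centres used at time \<open>n\<close> is at
  most \<open>r\<^sup>-\<^sup>s\<close> times a summable quantity, so the upper box dimension is
  at most \<open>s\<close> (\<open>upper_box_le\<close>).

  The lower bound. If \<open>P s > 0\<close>, one looks for a large tree of preimages of one
  point in which a set of diameter \<open>d\<close> can hold only a fraction of order
  \<open>d\<^sup>s\<close> of the weight. Time is cut into blocks. Inside a block two selected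
  points that are not shadowed by the same inverse branch must be separated by a definite
  distance, for the first time at which points of a set \<open>U\<close> separate decides how
  much weight \<open>U\<close> carries. The obstruction is that the separation scale of a single
  map has no integrability at all: the constants \<open>\<lambda>\<^sub>1\<close> are arbitrary.
  So all branches are used only in blocks that start at a good time, when norms and separation
  scales over the whole block are controlled by a constant and the partition sum is large; such
  times have probability close to one. At a bad time the block has length one and a single
  inverse branch is used, which needs no separation. Single branches make sense only near one
  orbit, and the homogeneity of \<open>K\<close> provides the radius at which this works
  uniformly (\<open>branch_scale\<close>, \<open>branch_transitive\<close>); each good block
  brings the selected points back into this neighbourhood by a few steps along the orbit and
  \<open>n0\<close> steps of mixing (\<open>reset_branches\<close>). The loss caused by bad
  times is the part of the norm sum that sits on a set of small probability, which is small by
  integrability (\<open>hausdorff_pos\<close>).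

  The random map takes values, up to a null set, in a separable part of the space of maps. Every
  quantity above depends continuously on finitely many maps, so it agrees almost surely with a
  measurable function (\<open>measurable_version\<close>). Continuity, and part (c) of the
  theorem, come from shadowing: maps at distance \<open>r \<le> \<epsilon> \<Delta>\<close> have
  fibres in bijection such that corresponding points never drift apart and derivatives differ by
  at most \<open>exp (2 r)\<close> per step (\<open>ln_pinf_shadow\<close>). Hence
  \<open>P\<close> changes by at most \<open>2 r s\<close>, and the bound on the slope of
  \<open>P\<close> turns this into the factor \<open>exp (2 r / ln \<beta>)\<close> for the
  dimension.
\<close>

section \<open>Ergodic averages\<close>

locale ergodic_system = prob_space M for M :: "'w measure" +
  fixes T :: "'w \<Rightarrow> 'w"
  assumes ergodic: "ergodic_transformation M T"
begin

lemma T_measurable [measurable]: "T \<in> measurable M M"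
  using ergodic by (simp add: ergodic_transformation_def)

lemma distr_T: "distr M M T = M"
  using ergodic by (simp add: ergodic_transformation_def)

lemma funpow_T_measurable [measurable]: "(T ^^ n) \<in> measurable M M"
proof (induction n)
  case (Suc n)
  then show ?case by (simp add: measurable_comp[OF _ T_measurable])
qed (simp add: id_def)

lemma distr_funpow_T: "distr M M (T ^^ n) = M"
proof (induction n)
  case 0
  then show ?case by (simp add: id_def distr_id2)
next
  case (Suc n)
  have "distr M M (T ^^ Suc n) = distr (distr M M (T ^^ n)) M T"
    by (subst distr_distr) (simp_all)
  also have "\<dots> = M" unfolding Suc distr_T ..
  finally show ?case .
qed

lemma funpow_T_space: "x \<in> space M \<Longrightarrow> (T ^^ n) x \<in> space M"
  using measurable_space[OF funpow_T_measurable] .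

lemma AE_shift: "AE x in M. P x \<Longrightarrow> AE x in M. P ((T ^^ n) x)"
  using AE_distrD[OF funpow_T_measurable[of n], of P] unfolding distr_funpow_T .

lemma AE_all_shifts: "AE x in M. P x \<Longrightarrow> AE x in M. \<forall>n. P ((T ^^ n) x)"
  unfolding AE_all_countable using AE_shift by blast

lemma prob_shift:
  assumes [measurable]: "Measurable.pred M Q"
  shows "prob {x \<in> space M. Q ((T ^^ n) x)} = prob {x \<in> space M. Q x}"
proof -
  have "prob {x \<in> space M. Q x} = measure (distr M M (T ^^ n)) {x \<in> space M. Q x}"
    by (simp add: distr_funpow_T)
  also have "\<dots> = prob ((T ^^ n) -` {x \<in> space M. Q x} \<inter> space M)"
    by (rule measure_distr) auto
  also have "(T ^^ n) -` {x \<in> space M. Q x} \<inter> space M = {x \<in> space M. Q ((T ^^ n) x)}"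
    using funpow_T_space by auto
  finally show ?thesis by simp
qed

lemma integrable_shift:
  fixes \<phi> :: "'w \<Rightarrow> real"
  assumes "integrable M \<phi>"
  shows "integrable M (\<lambda>x. \<phi> ((T ^^ n) x))"
  using integrable_distr[OF funpow_T_measurable[of n], of \<phi>] assms by (simp add: distr_funpow_T)

lemma integral_shift:
  fixes \<phi> :: "'w \<Rightarrow> real"
  assumes [measurable]: "\<phi> \<in> borel_measurable M"
  shows "(\<integral>x. \<phi> ((T ^^ n) x) \<partial>M) = (\<integral>x. \<phi> x \<partial>M)"
  using integral_distr[of "T ^^ n" M M \<phi>] by (simp add: distr_funpow_T)

lemma zero_one_invariant:
  assumes [measurable]: "Measurable.pred M Q" and inv: "\<And>x. x \<in> space M \<Longrightarrow> Q (T x) \<longleftrightarrow> Q x"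
  shows "prob {x \<in> space M. Q x} = 0 \<or> prob {x \<in> space M. Q x} = 1"
proof -
  have "T -` {x \<in> space M. Q x} \<inter> space M = {x \<in> space M. Q x}"
    using inv measurable_space[OF T_measurable] by auto
  moreover have "{x \<in> space M. Q x} \<in> sets M" by measurable
  ultimately show ?thesis
    using ergodic unfolding ergodic_transformation_def by blast
qed

text \<open>
  The set of points whose orbit meets \<open>Q\<close> infinitely often is strictly invariant.
  Almost every such point lies in \<open>Q\<close>, because membership propagates backwards
  along its orbit; and since \<open>T\<close> preserves the measure, the set is not smaller than
  \<open>Q\<close>. So \<open>Q\<close> has the probability of an invariant set.
\<close>

lemma zero_one_subinvariant:
  assumes [measurable]: "Measurable.pred M Q" and sub: "AE x in M. Q (T x) \<longrightarrow> Q x"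
  shows "prob {x \<in> space M. Q x} = 0 \<or> prob {x \<in> space M. Q x} = 1"
proof -
  define R where "R = (\<lambda>x. \<forall>n. \<exists>k\<ge>n. Q ((T ^^ k) x))"
  have [measurable]: "Measurable.pred M R"
    unfolding R_def by measurable
  have shift: "(T ^^ k) (T x) = (T ^^ Suc k) x" for k x
    by (simp add: funpow_swap1)
  have "R (T x) \<longleftrightarrow> R x" for x
  proof
    assume "R (T x)"
    then show "R x" unfolding R_def shift by (meson Suc_leD Suc_le_mono)
  next
    assume *: "R x"
    show "R (T x)" unfolding R_def shift
    proof
      fix n
      from * obtain k where "k \<ge> Suc n" "Q ((T ^^ k) x)" unfolding R_def by blast
      then show "\<exists>k\<ge>n. Q ((T ^^ Suc k) x)"
        by (intro exI[of _ "k - 1"]) auto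
    qed
  qed
  then have R01: "prob {x \<in> space M. R x} = 0 \<or> prob {x \<in> space M. R x} = 1"
    by (intro zero_one_invariant) auto
  have "AE x in M. \<forall>n. Q (T ((T ^^ n) x)) \<longrightarrow> Q ((T ^^ n) x)"
    by (rule AE_all_shifts[OF sub])
  then have "AE x in M. R x \<longrightarrow> Q x"
  proof (rule AE_mp, intro AE_I2 impI)
    fix x assume x: "\<forall>n. Q (T ((T ^^ n) x)) \<longrightarrow> Q ((T ^^ n) x)" and "R x"
    then obtain k where "Q ((T ^^ k) x)" unfolding R_def by blast
    then show "Q x" using x by (induction k) auto
  qed
  then have le: "prob {x \<in> space M. R x} \<le> prob {x \<in> space M. Q x}"
    by (intro finite_measure_mono_AE) auto
  define B where "B = (\<lambda>n. {x \<in> space M. \<exists>k\<ge>n. Q ((T ^^ k) x)})"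
  have [measurable]: "B n \<in> sets M" for n
    unfolding B_def by measurable
  have "(\<lambda>n. prob (B n)) \<longlonglongrightarrow> prob (\<Inter>n. B n)"
    by (rule finite_Lim_measure_decseq) (auto simp: B_def decseq_def intro: order_trans)
  moreover have "(\<Inter>n. B n) = {x \<in> space M. R x}"
    by (auto simp: B_def R_def)
  moreover have "prob {x \<in> space M. Q x} \<le> prob (B n)" for n
  proof -
    have "prob {x \<in> space M. Q x} = prob {x \<in> space M. Q ((T ^^ n) x)}"
      by (simp add: prob_shift)
    also have "\<dots> \<le> prob (B n)"
      by (intro finite_measure_mono) (auto simp: B_def)
    finally show ?thesis .
  qed
  ultimately have "prob {x \<in> space M. Q x} \<le> prob {x \<in> space M. R x}"
    by (metis (mono_tags, lifting) LIMSEQ_le_const)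
  with le R01 show ?thesis by linarith
qed

text \<open>
  Each superlevel set of a subinvariant function obeys the zero-one law, so the function equals
  the supremum of the levels that are exceeded almost surely.
\<close>

lemma subinvariant_AE_const:
  fixes h :: "'w \<Rightarrow> ereal"
  assumes [measurable]: "h \<in> borel_measurable M" and sub: "AE x in M. h (T x) \<le> h x"
  obtains c where "AE x in M. h x = c"
proof -
  define p where "p = (\<lambda>q::real. prob {x \<in> space M. ereal q < h x})"
  have p01: "p q = 0 \<or> p q = 1" for q
    unfolding p_def
    by (rule zero_one_subinvariant) (use sub in \<open>auto intro: less_le_trans\<close>)
  have p_mono: "p q' \<le> p q" if "q \<le> q'" for q q'
    unfolding p_def
  proof (rule finite_measure_mono)
    show "{x \<in> space M. ereal q' < h x} \<subseteq> {x \<in> space M. ereal q < h x}"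
      using that ereal_less_eq(3) order.strict_trans1 by blast
  qed measurable
  have "AE x in M. ereal (of_rat q) < h x \<longleftrightarrow> p (of_rat q) = 1" for q :: rat
  proof (cases "p (of_rat q) = 1")
    case True
    then have "AE x in M. x \<in> {x \<in> space M. ereal (of_rat q) < h x}"
      unfolding p_def by (subst AE_in_set_eq_1) auto
    then show ?thesis using True by auto
  next
    case False
    then have "prob {x \<in> space M. ereal (of_rat q) < h x} = 0" using p01 p_def by blast
    then have "AE x in M. x \<notin> {x \<in> space M. ereal (of_rat q) < h x}"
      by (subst (asm) prob_eq_0) (auto)
    then show ?thesis using False by auto
  qed
  then have all: "AE x in M. \<forall>q::rat. ereal (of_rat q) < h x \<longleftrightarrow> p (of_rat q) = 1"
    by (simp add: AE_all_countable)
  define c where "c = Sup {ereal q | q. p q = 1}"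
  have "AE x in M. h x = c"
    using all
  proof (rule AE_mp, intro AE_I2 impI)
    fix x assume x: "\<forall>q::rat. ereal (of_rat q) < h x \<longleftrightarrow> p (of_rat q) = 1"
    show "h x = c"
    proof (rule antisym; rule ccontr)
      assume "\<not> h x \<le> c"
      then obtain r where r: "c < ereal (of_rat r)" "ereal (of_rat r) < h x"
        using ereal_dense3 not_le by meson
      then have "p (of_rat r) = 1" using x by simp
      then have "ereal (of_rat r) \<le> c" unfolding c_def by (auto intro!: Sup_upper)
      with r show False by simp
    next
      assume "\<not> c \<le> h x"
      then obtain r where r: "h x < ereal (of_rat r)" "ereal (of_rat r) < c"
        using ereal_dense3 not_le by meson
      then obtain q where q: "p q = 1" "ereal (of_rat r) < ereal q"
        unfolding c_def less_Sup_iff by auto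
      then have "p (of_rat r) = 1"
        using p_mono[of "of_rat r" q] p01[of "of_rat r"] by auto
      with x have "ereal (of_rat r) < h x" by blast
      with r(1) show False by simp
    qed
  qed
  then show ?thesis by (rule that)
qed

definition birkhoff_sum :: "('w \<Rightarrow> real) \<Rightarrow> nat \<Rightarrow> 'w \<Rightarrow> real" where
  "birkhoff_sum \<phi> n x = (\<Sum>t<n. \<phi> ((T ^^ t) x))"

lemma birkhoff_sum_measurable [measurable]:
  "\<phi> \<in> borel_measurable M \<Longrightarrow> birkhoff_sum \<phi> n \<in> borel_measurable M"
  unfolding birkhoff_sum_def
  by (intro borel_measurable_sum measurable_compose[OF funpow_T_measurable])

lemma birkhoff_sum_Suc: "birkhoff_sum \<phi> (Suc n) x = \<phi> x + birkhoff_sum \<phi> n (T x)"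
  unfolding birkhoff_sum_def by (simp add: sum.lessThan_Suc_shift funpow_swap1 del: sum.lessThan_Suc)

text \<open>
  The half of Birkhoff's theorem from which everything else follows: sums of a function with
  negative mean cannot be unbounded above. Otherwise, by ergodicity, they would be unbounded
  almost everywhere; but then \<open>m\<^sub>n\<^sub>+\<^sub>1 - m\<^sub>n \<circ> T\<close>,
  where \<open>m\<^sub>n\<close> is the maximum of the first \<open>n + 1\<close> nonempty sums,
  has nonnegative integral and converges to the function itself.
\<close>

lemma birkhoff_sum_bounded:
  fixes \<psi> :: "'w \<Rightarrow> real"
  assumes int: "integrable M \<psi>" and neg: "(\<integral>x. \<psi> x \<partial>M) < 0"
  shows "AE x in M. \<exists>K. \<forall>n. birkhoff_sum \<psi> n x \<le> K"
proof -
  have [measurable]: "\<psi> \<in> borel_measurable M" using int by simp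
  define Q where "Q = (\<lambda>x. \<forall>K::nat. \<exists>n. birkhoff_sum \<psi> n x > real K)"
  have [measurable]: "Measurable.pred M Q" unfolding Q_def by measurable
  have Q_inv: "Q (T x) \<longleftrightarrow> Q x" for x
  proof
    assume Q: "Q (T x)"
    show "Q x" unfolding Q_def
    proof
      fix K :: nat
      obtain K' :: nat where "real K' > real K - \<psi> x" using reals_Archimedean2 by blast
      moreover obtain n where "birkhoff_sum \<psi> n (T x) > real K'" using Q unfolding Q_def by blast
      ultimately show "\<exists>n. birkhoff_sum \<psi> n x > real K"
        by (intro exI[of _ "Suc n"]) (simp add: birkhoff_sum_Suc)
    qed
  next
    assume Q: "Q x"
    show "Q (T x)" unfolding Q_def
    proof
      fix K :: nat
      obtain K' :: nat where K': "real K' > max 0 (real K + \<psi> x)" using reals_Archimedean2 by blast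
      obtain n where n: "birkhoff_sum \<psi> n x > real K'" using Q unfolding Q_def by blast
      then obtain m where "n = Suc m" using K' by (cases n) (auto simp: birkhoff_sum_def)
      then show "\<exists>n. birkhoff_sum \<psi> n (T x) > real K"
        using n K' by (intro exI[of _ m]) (simp add: birkhoff_sum_Suc)
    qed
  qed
  have "prob {x \<in> space M. Q x} \<noteq> 1"
  proof
    assume "prob {x \<in> space M. Q x} = 1"
    then have "AE x in M. x \<in> {x \<in> space M. Q x}" by (subst AE_in_set_eq_1) auto
    then have QT: "AE x in M. Q (T x)" using Q_inv by auto
    define m where "m = rec_nat \<psi> (\<lambda>n u x. \<psi> x + max 0 (u (T x)))"
    have m0: "m 0 = \<psi>" and mS: "m (Suc n) x = \<psi> x + max 0 (m n (T x))" for n x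
      by (simp_all add: m_def)
    have m_int: "integrable M (m n)" for n
    proof (induction n)
      case (Suc n)
      have "m (Suc n) = (\<lambda>x. \<psi> x + max 0 (m n ((T ^^ 1) x)))" by (auto simp: mS)
      moreover have "integrable M (\<lambda>x. m n ((T ^^ 1) x))" using Suc by (rule integrable_shift)
      ultimately show ?case using int by auto
    qed (simp add: m0 int)
    have m_mono: "m n x \<le> m (Suc n) x" for n x
      by (induction n arbitrary: x) (auto simp: mS m0 max.coboundedI2 intro: max.mono)
    then have m_mono': "i \<le> j \<Longrightarrow> m i x \<le> m j x" for i j x
      by (rule lift_Suc_mono_le)
    have m_ge: "birkhoff_sum \<psi> (Suc n) x \<le> m n x" for n x
    proof (induction n arbitrary: x)
      case 0 then show ?case by (simp add: m0 birkhoff_sum_def)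
    next
      case (Suc n) then show ?case unfolding birkhoff_sum_Suc[of _ "Suc n"] mS
        by (simp add: max.coboundedI2)
    qed
    \<comment> \<open>the increment \<open>m (n+1) - m n \<circ> T\<close> written so that its limit is visible:
      the second summand vanishes as soon as some sum starting at \<open>T x\<close> is positive\<close>
    define v where "v = (\<lambda>n x. \<psi> x + max 0 (- m n (T x)))"
    have v_eq: "v n x = m (Suc n) x - m n ((T ^^ 1) x)" for n x
      by (auto simp: v_def mS max_def)
    have mT: "integrable M (\<lambda>x. m n ((T ^^ 1) x))" for n
      using m_int by (rule integrable_shift)
    have v_int: "integrable M (v n)" for n
      unfolding v_eq[abs_def] using m_int mT by auto
    have "0 \<le> (\<integral>x. v n x \<partial>M)" for n
    proof -
      have "(\<integral>x. v n x \<partial>M) = (\<integral>x. m (Suc n) x \<partial>M) - (\<integral>x. m n ((T ^^ 1) x) \<partial>M)"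
        unfolding v_eq using m_int mT by (intro Bochner_Integration.integral_diff) auto
      also have "(\<integral>x. m n ((T ^^ 1) x) \<partial>M) = (\<integral>x. m n x \<partial>M)"
        using m_int by (intro integral_shift) auto
      finally show ?thesis
        using integral_mono[OF m_int m_int, of n "Suc n"] m_mono by auto
    qed
    moreover have "(\<lambda>n. \<integral>x. v n x \<partial>M) \<longlonglongrightarrow> (\<integral>x. \<psi> x \<partial>M)"
    proof (rule integral_dominated_convergence)
      show "integrable M (\<lambda>x. \<bar>\<psi> x\<bar> + \<bar>m 0 ((T ^^ 1) x)\<bar>)"
        using int mT by auto
      show "AE x in M. norm (v n x) \<le> \<bar>\<psi> x\<bar> + \<bar>m 0 ((T ^^ 1) x)\<bar>" for n
      proof (rule AE_I2)
        fix x
        have "m 0 (T x) \<le> m n (T x)" by (rule m_mono') simp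
        then show "norm (v n x) \<le> \<bar>\<psi> x\<bar> + \<bar>m 0 ((T ^^ 1) x)\<bar>" unfolding v_def by auto
      qed
      show "AE x in M. (\<lambda>n. v n x) \<longlonglongrightarrow> \<psi> x"
        using QT
      proof (rule AE_mp, intro AE_I2 impI)
        fix x assume Q: "Q (T x)"
        obtain n where n: "birkhoff_sum \<psi> n (T x) > real 0" using Q unfolding Q_def by blast
        then obtain k where k: "n = Suc k" by (cases n) (auto simp: birkhoff_sum_def)
        have "v j x = \<psi> x" if "j \<ge> k" for j
          using m_mono'[OF that, of "T x"] m_ge[of k "T x"] n k by (auto simp: v_def)
        then show "(\<lambda>n. v n x) \<longlonglongrightarrow> \<psi> x"
          by (intro tendsto_eventually eventually_sequentiallyI[of k]) auto
      qed
      show "v n \<in> borel_measurable M" for n using v_int by blast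
    qed simp
    ultimately have "0 \<le> (\<integral>x. \<psi> x \<partial>M)"
      by (meson LIMSEQ_le_const)
    with neg show False by simp
  qed
  then have "prob {x \<in> space M. Q x} = 0"
    using zero_one_invariant[of Q] Q_inv by auto
  then have "AE x in M. x \<notin> {x \<in> space M. Q x}"
    by (subst (asm) prob_eq_0) auto
  then show ?thesis
  proof (rule AE_mp, intro AE_I2 impI)
    fix x assume "x \<notin> {x \<in> space M. Q x}" "x \<in> space M"
    then show "\<exists>K. \<forall>n. birkhoff_sum \<psi> n x \<le> K" unfolding Q_def by (auto simp: not_less)
  qed
qed

lemma birkhoff_sum_upper:
  fixes \<phi> :: "'w \<Rightarrow> real"
  assumes int: "integrable M \<phi>" and c: "(\<integral>x. \<phi> x \<partial>M) < c"
  shows "AE x in M. eventually (\<lambda>n. birkhoff_sum \<phi> n x \<le> c * real n) sequentially"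
proof -
  obtain c' where c': "(\<integral>x. \<phi> x \<partial>M) < c'" "c' < c" using dense[OF c] by blast
  have "AE x in M. \<exists>K. \<forall>n. birkhoff_sum (\<lambda>x. \<phi> x - c') n x \<le> K"
    by (rule birkhoff_sum_bounded) (use int c' in \<open>auto simp: prob_space\<close>)
  then show ?thesis
  proof (rule AE_mp, intro AE_I2 impI)
    fix x assume "\<exists>K. \<forall>n. birkhoff_sum (\<lambda>x. \<phi> x - c') n x \<le> K"
    then obtain K where "\<And>n. birkhoff_sum (\<lambda>x. \<phi> x - c') n x \<le> K" by blast
    then have K: "birkhoff_sum \<phi> n x \<le> c' * real n + K" for n
      unfolding birkhoff_sum_def sum_subtractf by (simp add: algebra_simps)
    obtain N :: nat where "real N \<ge> K / (c - c')" using real_arch_simple by blast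
    then have "K \<le> (c - c') * real N" using c' by (simp add: field_simps)
    then have "K \<le> (c - c') * real n" if "n \<ge> N" for n
      using that c' by (smt (verit) mult_left_mono of_nat_mono)
    then have "birkhoff_sum \<phi> n x \<le> c * real n" if "n \<ge> N" for n
      using K[of n] that by (fastforce simp: algebra_simps)
    then show "eventually (\<lambda>n. birkhoff_sum \<phi> n x \<le> c * real n) sequentially"
      by (rule eventually_sequentiallyI)
  qed
qed

theorem birkhoff_ergodic:
  fixes \<phi> :: "'w \<Rightarrow> real"
  assumes int: "integrable M \<phi>"
  shows "AE x in M. (\<lambda>n. birkhoff_sum \<phi> n x / real n) \<longlonglongrightarrow> (\<integral>x. \<phi> x \<partial>M)"
proof -
  let ?I = "\<integral>x. \<phi> x \<partial>M"
  have "AE x in M. \<forall>k::nat. eventually (\<lambda>n. birkhoff_sum \<phi> n x \<le> (?I + 1 / Suc k) * real n) sequentially"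
    unfolding AE_all_countable using int by (auto intro!: birkhoff_sum_upper)
  moreover have "AE x in M. \<forall>k::nat. eventually (\<lambda>n. birkhoff_sum (\<lambda>x. - \<phi> x) n x
      \<le> (- ?I + 1 / Suc k) * real n) sequentially"
    unfolding AE_all_countable using int by (auto intro!: birkhoff_sum_upper)
  ultimately show ?thesis
  proof eventually_elim
    fix x
    assume 1: "\<forall>k::nat. eventually (\<lambda>n. birkhoff_sum \<phi> n x \<le> (?I + 1 / Suc k) * real n) sequentially"
     and 2: "\<forall>k::nat. eventually (\<lambda>n. birkhoff_sum (\<lambda>x. - \<phi> x) n x \<le> (- ?I + 1 / Suc k) * real n) sequentially"
    show "(\<lambda>n. birkhoff_sum \<phi> n x / real n) \<longlonglongrightarrow> ?I"
    proof (rule tendstoI)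
      fix e :: real assume "e > 0"
      then obtain k :: nat where k: "1 / Suc k < e" using nat_approx_posE by blast
      have neg: "birkhoff_sum (\<lambda>x. - \<phi> x) n x = - birkhoff_sum \<phi> n x" for n
        by (simp add: birkhoff_sum_def sum_negf)
      show "eventually (\<lambda>n. dist (birkhoff_sum \<phi> n x / real n) ?I < e) sequentially"
        using 1[rule_format, of k] 2[rule_format, of k] eventually_gt_at_top[of 0]
      proof eventually_elim
        case (elim n)
        from elim have "birkhoff_sum \<phi> n x / real n \<le> ?I + 1 / Suc k"
          by (simp add: pos_divide_le_eq)
        moreover have "?I - 1 / Suc k \<le> birkhoff_sum \<phi> n x / real n"
        proof -
          have "(?I - 1 / Suc k) * real n \<le> birkhoff_sum \<phi> n x"
            using elim(2) neg[of n] by (simp add: algebra_simps)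
          then show ?thesis using elim(3) by (simp add: pos_le_divide_eq)
        qed
        ultimately show ?case using k by (auto simp: dist_real_def)
      qed
    qed
  qed
qed

text \<open>
  Consecutive Birkhoff averages have the same limit, so a single term of the sum is
  \<open>o(n)\<close>.
\<close>

lemma shift_over_n_tendsto_0:
  fixes \<phi> :: "'w \<Rightarrow> real"
  assumes int: "integrable M \<phi>"
  shows "AE x in M. (\<lambda>n. \<phi> ((T ^^ n) x) / real n) \<longlonglongrightarrow> 0"
  using birkhoff_ergodic[OF int]
proof (rule AE_mp, intro AE_I2 impI)
  fix x assume lim: "(\<lambda>n. birkhoff_sum \<phi> n x / real n) \<longlonglongrightarrow> (\<integral>x. \<phi> x \<partial>M)"
  have "(\<lambda>n. birkhoff_sum \<phi> (Suc n) x / real (Suc n)) \<longlonglongrightarrow> (\<integral>x. \<phi> x \<partial>M)"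
    using LIMSEQ_Suc[OF lim] .
  moreover have "(\<lambda>n. real (Suc n) / real n) \<longlonglongrightarrow> 1"
    by real_asymp
  ultimately have "(\<lambda>n. birkhoff_sum \<phi> (Suc n) x / real (Suc n) * (real (Suc n) / real n)
      - birkhoff_sum \<phi> n x / real n) \<longlonglongrightarrow> (\<integral>x. \<phi> x \<partial>M) * 1 - (\<integral>x. \<phi> x \<partial>M)"
    using lim by (intro tendsto_intros)
  moreover have "eventually (\<lambda>n. birkhoff_sum \<phi> (Suc n) x / real (Suc n) * (real (Suc n) / real n)
      - birkhoff_sum \<phi> n x / real n = \<phi> ((T ^^ n) x) / real n) sequentially"
    using eventually_gt_at_top[of 0]
    by eventually_elim (simp add: birkhoff_sum_def divide_simps)
  ultimately show "(\<lambda>n. \<phi> ((T ^^ n) x) / real n) \<longlonglongrightarrow> 0"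
    by (simp add: filterlim_cong[OF refl refl])
qed

text \<open>
  The integral may be infinite: truncation reduces the claim to bounded functions.
\<close>

lemma birkhoff_sum_lower_nonneg:
  fixes \<phi> :: "'w \<Rightarrow> real"
  assumes [measurable]: "\<phi> \<in> borel_measurable M" and nn: "\<And>x. 0 \<le> \<phi> x"
    and c: "ereal c < enn2ereal (\<integral>\<^sup>+x. ennreal (\<phi> x) \<partial>M)"
  shows "AE x in M. eventually (\<lambda>n. c * real n \<le> birkhoff_sum \<phi> n x) sequentially"
proof -
  have int: "integrable M (\<lambda>x. min (\<phi> x) (real k))" for k
    by (rule integrable_const_bound[of _ "real k"]) (auto simp: nn)
  have "(\<integral>\<^sup>+x. ennreal (\<phi> x) \<partial>M) = (\<integral>\<^sup>+x. (SUP k. ennreal (min (\<phi> x) (real k))) \<partial>M)"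
  proof (rule nn_integral_cong)
    fix x
    obtain k :: nat where k: "\<phi> x \<le> real k" using real_arch_simple by blast
    show "ennreal (\<phi> x) = (SUP k. ennreal (min (\<phi> x) (real k)))"
      by (rule antisym, rule SUP_upper2[of k], use k in \<open>auto intro!: SUP_least ennreal_leI\<close>)
  qed
  also have "\<dots> = (SUP k. \<integral>\<^sup>+x. ennreal (min (\<phi> x) (real k)) \<partial>M)"
    by (rule nn_integral_monotone_convergence_SUP)
       (auto simp: incseq_def le_fun_def intro!: ennreal_leI)
  finally have eq: "(\<integral>\<^sup>+x. ennreal (\<phi> x) \<partial>M) = (SUP k. \<integral>\<^sup>+x. ennreal (min (\<phi> x) (real k)) \<partial>M)" .
  have "\<exists>k. c < (\<integral>x. min (\<phi> x) (real k) \<partial>M)"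
  proof (cases "c < 0")
    case True
    have "0 \<le> (\<integral>x. min (\<phi> x) (real 0) \<partial>M)" using nn by (intro integral_nonneg_AE) auto
    with True show ?thesis by (intro exI[of _ 0]) auto
  next
    case False
    then have "ennreal c < (\<integral>\<^sup>+x. ennreal (\<phi> x) \<partial>M)"
      using c by (metis enn2ereal_ennreal less_ennreal.rep_eq not_le)
    then obtain k where "ennreal c < (\<integral>\<^sup>+x. ennreal (min (\<phi> x) (real k)) \<partial>M)"
      unfolding eq less_SUP_iff by auto
    also have "\<dots> = ennreal (\<integral>x. min (\<phi> x) (real k) \<partial>M)"
      by (rule nn_integral_eq_integral[OF int]) (auto simp: nn)
    finally show ?thesis using False by (auto simp: ennreal_less_iff)
  qed
  then obtain k where k: "c < (\<integral>x. min (\<phi> x) (real k) \<partial>M)" by blast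
  then have "AE x in M. eventually (\<lambda>n. birkhoff_sum (\<lambda>x. - min (\<phi> x) (real k)) n x \<le> - c * real n) sequentially"
    by (intro birkhoff_sum_upper Bochner_Integration.integrable_minus int) auto
  then show ?thesis
  proof (rule AE_mp, intro AE_I2 impI)
    fix x assume "eventually (\<lambda>n. birkhoff_sum (\<lambda>x. - min (\<phi> x) (real k)) n x \<le> - c * real n) sequentially"
    then show "eventually (\<lambda>n. c * real n \<le> birkhoff_sum \<phi> n x) sequentially"
    proof (rule eventually_mono)
      fix n assume "birkhoff_sum (\<lambda>x. - min (\<phi> x) (real k)) n x \<le> - c * real n"
      moreover have "birkhoff_sum (\<lambda>x. min (\<phi> x) (real k)) n x \<le> birkhoff_sum \<phi> n x"
        unfolding birkhoff_sum_def by (intro sum_mono) auto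
      ultimately show "c * real n \<le> birkhoff_sum \<phi> n x"
        by (auto simp: birkhoff_sum_def sum_negf)
    qed
  qed
qed

text \<open>
  A replacement for Kingman's theorem. The function \<open>X\<close> is subadditive only after a
  correction: removing an initial piece of length \<open>a\<close> costs \<open>Z a\<close>, and
  it is only possible when at least \<open>n0\<close> steps remain. Almost every point admits
  some length \<open>a\<close> with \<open>Z a \<le> 0\<close>, and except on a set where
  \<open>max 0 (Z 1)\<close> has a small integral this length is at most some constant
  \<open>N\<close>. Along an orbit one removes pieces greedily: such a piece where there is one,
  and a piece of length one otherwise. The pieces of the first kind are free, those of the
  second kind are bounded by a Birkhoff sum of an integrand with small mean, and what remains at
  the end has bounded length.
\<close>

lemma subadditive_upper:
  fixes X Z :: "nat \<Rightarrow> 'w \<Rightarrow> real"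
  assumes [measurable]: "\<And>n. X n \<in> borel_measurable M" "\<And>n. Z n \<in> borel_measurable M"
    and X_int: "\<And>n. integrable M (\<lambda>x. max 0 (X n x))"
    and Z_int: "integrable M (\<lambda>x. max 0 (Z 1 x))"
    and sub: "AE x in M. \<forall>a b. 1 \<le> a \<longrightarrow> n0 \<le> b \<longrightarrow> X (a + b) x \<le> Z a x + X b ((T ^^ a) x)"
    and good: "AE x in M. \<exists>a\<ge>1. Z a x \<le> 0"
    and "e > 0"
  shows "AE x in M. eventually (\<lambda>n. X n x \<le> e * real n) sequentially"
proof -
  define B where "B = (\<lambda>N. {x \<in> space M. \<forall>a\<in>{1..N}. Z a x > 0})"
  have [measurable]: "B N \<in> sets M" for N unfolding B_def by measurable
  define W where "W = (\<lambda>N x. max 0 (Z 1 x) * indicator (B N) x)"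
  have "(\<lambda>N. \<integral>x. W N x \<partial>M) \<longlonglongrightarrow> (\<integral>x. 0 \<partial>M)"
  proof (rule integral_dominated_convergence[OF _ _ Z_int])
    show "AE x in M. norm (W N x) \<le> max 0 (Z 1 x)" for N
      by (auto simp: W_def indicator_def)
    show "AE x in M. (\<lambda>N. W N x) \<longlonglongrightarrow> 0"
      using good
    proof (rule AE_mp, intro AE_I2 impI)
      fix x assume "\<exists>a\<ge>1. Z a x \<le> 0"
      then obtain a where "a \<ge> 1" "Z a x \<le> 0" by blast
      then have "x \<notin> B N" if "N \<ge> a" for N using that by (force simp: B_def)
      then show "(\<lambda>N. W N x) \<longlonglongrightarrow> 0"
        by (intro tendsto_eventually eventually_sequentiallyI[of a]) (auto simp: W_def)
    qed
  qed (auto simp: W_def)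
  then have "eventually (\<lambda>N. (\<integral>x. W N x \<partial>M) < e / 2) sequentially"
    using \<open>e > 0\<close> order_tendstoD(2)[of "\<lambda>N. \<integral>x. W N x \<partial>M" 0 sequentially "e / 2"] by simp
  then obtain N where N: "(\<integral>x. W N x \<partial>M) < e / 2"
    by (auto simp: eventually_sequentially)
  have W_int: "integrable M (W N)"
    by (rule Bochner_Integration.integrable_bound[OF Z_int]) (auto simp: W_def indicator_def)
  define K where "K = n0 + N + 1"
  have "AE x in M. \<forall>n. \<forall>a b. 1 \<le> a \<longrightarrow> n0 \<le> b \<longrightarrow>
      X (a + b) ((T ^^ n) x) \<le> Z a ((T ^^ n) x) + X b ((T ^^ a) ((T ^^ n) x))"
    using AE_all_shifts[OF sub] .
  moreover have "AE x in M. eventually (\<lambda>n. birkhoff_sum (W N) n x \<le> (e/2) * real n) sequentially"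
    using birkhoff_sum_upper[OF W_int N] .
  moreover have "AE x in M. \<forall>b. (\<lambda>n. max 0 (X b ((T ^^ n) x)) / real n) \<longlonglongrightarrow> 0"
    unfolding AE_all_countable using shift_over_n_tendsto_0[OF X_int] by blast
  ultimately show ?thesis using AE_space
  proof eventually_elim
    fix x
    assume s: "\<forall>n. \<forall>a b. 1 \<le> a \<longrightarrow> n0 \<le> b \<longrightarrow>
      X (a + b) ((T ^^ n) x) \<le> Z a ((T ^^ n) x) + X b ((T ^^ a) ((T ^^ n) x))"
    and w: "eventually (\<lambda>n. birkhoff_sum (W N) n x \<le> (e/2) * real n) sequentially"
    and r: "\<forall>b. (\<lambda>n. max 0 (X b ((T ^^ n) x)) / real n) \<longlonglongrightarrow> 0"
    and xs: "x \<in> space M"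
    have W0: "0 \<le> W N y" for y by (auto simp: W_def)
    \<comment> \<open>greedy decomposition of \<open>[i, i + n)\<close>; the last sum accounts for the final
      piece, whose length is not known in advance but is less than \<open>K\<close>\<close>
    have claim: "X n ((T ^^ i) x) \<le> (\<Sum>t<n. W N ((T ^^ (i + t)) x))
        + (\<Sum>b<K. max 0 (X b ((T ^^ (i + n - b)) x)))" if "n \<ge> n0" for n i
      using that
    proof (induction n arbitrary: i rule: less_induct)
      case (less n)
      show ?case
      proof (cases "n < K")
        case True
        have "X n ((T ^^ i) x) \<le> max 0 (X n ((T ^^ (i + n - n)) x))" by simp
        also have "\<dots> \<le> (\<Sum>b<K. max 0 (X b ((T ^^ (i + n - b)) x)))"
          using True by (intro member_le_sum) auto
        finally show ?thesis using W0 by (simp add: add_increasing sum_nonneg)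
      next
        case False
        obtain a where a: "1 \<le> a" "a \<le> N + 1" and Za: "Z a ((T ^^ i) x) \<le> W N ((T ^^ i) x)"
        proof (cases "(T ^^ i) x \<in> B N")
          case True
          then show ?thesis by (intro that[of 1]) (auto simp: W_def)
        next
          case F: False
          then obtain a where "a \<in> {1..N}" "Z a ((T ^^ i) x) \<le> 0"
            using funpow_T_space[OF xs, of i] by (auto simp: B_def not_less)
          then show ?thesis using W0[of "(T ^^ i) x"] by (intro that[of a]) (auto intro: order_trans)
        qed
        have n: "n = a + (n - a)" "n - a \<ge> n0" "n - a < n" using a False by (auto simp: K_def)
        have "X n ((T ^^ i) x) \<le> Z a ((T ^^ i) x) + X (n - a) ((T ^^ a) ((T ^^ i) x))"
          using s a n by metis
        also have "(T ^^ a) ((T ^^ i) x) = (T ^^ (i + a)) x"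
          by (simp add: funpow_add add.commute)
        also have "X (n - a) ((T ^^ (i + a)) x) \<le> (\<Sum>t<n - a. W N ((T ^^ (i + a + t)) x))
            + (\<Sum>b<K. max 0 (X b ((T ^^ (i + a + (n - a) - b)) x)))"
          by (rule less.IH[OF n(3) n(2)])
        also have "(\<Sum>t<n - a. W N ((T ^^ (i + a + t)) x)) = (\<Sum>t\<in>{a..<n}. W N ((T ^^ (i + t)) x))"
          using n by (intro sum.reindex_bij_witness[of _ "\<lambda>t. t - a" "\<lambda>t. t + a"]) (auto simp: algebra_simps)
        also have "i + a + (n - a) = i + n" using n by linarith
        finally have "X n ((T ^^ i) x) \<le> (W N ((T ^^ i) x) + (\<Sum>t\<in>{a..<n}. W N ((T ^^ (i + t)) x)))
            + (\<Sum>b<K. max 0 (X b ((T ^^ (i + n - b)) x)))" using Za by linarith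
        also have "W N ((T ^^ i) x) + (\<Sum>t\<in>{a..<n}. W N ((T ^^ (i + t)) x))
            = (\<Sum>t\<in>insert 0 {a..<n}. W N ((T ^^ (i + t)) x))" using a by simp
        also have "\<dots> \<le> (\<Sum>t<n. W N ((T ^^ (i + t)) x))"
          using W0 a n by (intro sum_mono2) auto
        finally show ?thesis by simp
      qed
    qed
    have "(\<lambda>n. max 0 (X b ((T ^^ (n - b)) x)) / real n) \<longlonglongrightarrow> 0" for b
    proof (rule LIMSEQ_offset[where k = b])
      have "(\<lambda>n. max 0 (X b ((T ^^ n) x)) / real n * (real n / real (n + b))) \<longlonglongrightarrow> 0 * 1"
        by (intro tendsto_mult r[rule_format]) real_asymp
      moreover have "eventually (\<lambda>n. max 0 (X b ((T ^^ n) x)) / real n * (real n / real (n + b))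
          = max 0 (X b ((T ^^ (n + b - b)) x)) / real (n + b)) sequentially"
        using eventually_gt_at_top[of 0] by eventually_elim auto
      ultimately show "(\<lambda>n. max 0 (X b ((T ^^ (n + b - b)) x)) / real (n + b)) \<longlonglongrightarrow> 0"
        using Lim_transform_eventually by fastforce
    qed
    then have "(\<lambda>n. \<Sum>b<K. max 0 (X b ((T ^^ (n - b)) x)) / real n) \<longlonglongrightarrow> (\<Sum>b<K. 0)"
      by (intro tendsto_sum)
    then have "eventually (\<lambda>n. (\<Sum>b<K. max 0 (X b ((T ^^ (n - b)) x)) / real n) < e / 2) sequentially"
      using \<open>e > 0\<close> order_tendstoD(2)[of "\<lambda>n. \<Sum>b<K. max 0 (X b ((T ^^ (n - b)) x)) / real n" 0 sequentially "e / 2"]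
      by simp
    with w eventually_ge_at_top[of "n0 + 1"]
    show "eventually (\<lambda>n. X n x \<le> e * real n) sequentially"
    proof eventually_elim
      case (elim n)
      have "X n x \<le> birkhoff_sum (W N) n x + (\<Sum>b<K. max 0 (X b ((T ^^ (n - b)) x)))"
        using claim[of n 0] elim by (auto simp: birkhoff_sum_def)
      also have "(\<Sum>b<K. max 0 (X b ((T ^^ (n - b)) x))) \<le> e / 2 * real n"
        using elim by (simp add: sum_divide_distrib[symmetric] pos_divide_less_eq)
      finally show ?case using elim by (simp add: algebra_simps)
    qed
  qed
qed

end

section \<open>Conformal expanding maps and their inverse branches\<close>

lemma fibre_iff: "x \<in> fibre f y \<longleftrightarrow> f x = Some y"
  unfolding fibre_def mpreim_def by auto

lemma mpreim_UNIV: "mpreim f UNIV = dom f"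
  unfolding mpreim_def by auto

locale conf_params =
  fixes \<Delta> \<beta> :: real and \<epsilon> :: "real \<Rightarrow> real"
  assumes \<Delta>_pos: "0 < \<Delta>" and \<beta>_gt_1: "1 < \<beta>"
    and \<epsilon>_cont: "continuous_on {0..} \<epsilon>" and \<epsilon>_strict: "strict_mono_on {0..} \<epsilon>"
    and \<epsilon>_concave: "concave_on {0..} \<epsilon>" and \<epsilon>_0: "\<epsilon> 0 = 0"
begin

lemma \<epsilon>_mono: "0 \<le> a \<Longrightarrow> a \<le> b \<Longrightarrow> \<epsilon> a \<le> \<epsilon> b"
  using \<epsilon>_strict by (cases "a = b") (auto simp: strict_mono_on_def less_le)

lemma \<epsilon>_less_iff: "0 \<le> a \<Longrightarrow> 0 \<le> b \<Longrightarrow> \<epsilon> a < \<epsilon> b \<longleftrightarrow> a < b"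
  using \<epsilon>_mono \<epsilon>_strict by (meson atLeast_iff linorder_not_less strict_mono_on_def)

lemma \<epsilon>_nonneg: "0 \<le> a \<Longrightarrow> 0 \<le> \<epsilon> a"
  using \<epsilon>_mono[of 0 a] by (simp add: \<epsilon>_0)

text \<open>
  A concave function that vanishes at zero is subadditive.
\<close>

lemma \<epsilon>_subadd:
  assumes "0 \<le> a" "0 \<le> b"
  shows "\<epsilon> (a + b) \<le> \<epsilon> a + \<epsilon> b"
proof (cases "a + b = 0")
  case True
  then show ?thesis using assms by (simp add: \<epsilon>_0 add_nonneg_eq_0_iff)
next
  case False
  then have pos: "a + b > 0" using assms by linarith
  have *: "c / (a + b) * \<epsilon> (a + b) \<le> \<epsilon> c" if "0 \<le> c" "c \<le> a + b" for c
    using concave_onD[OF \<epsilon>_concave, of "c / (a + b)" 0 "a + b"] that pos assms by (simp add: \<epsilon>_0)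
  have "a / (a + b) * \<epsilon> (a + b) + b / (a + b) * \<epsilon> (a + b) \<le> \<epsilon> a + \<epsilon> b"
    using *[of a] *[of b] assms by linarith
  moreover have "a / (a + b) * \<epsilon> (a + b) + b / (a + b) * \<epsilon> (a + b) = \<epsilon> (a + b)"
    using pos by (simp add: divide_simps) (simp add: algebra_simps)
  ultimately show ?thesis by simp
qed

lemma \<epsilon>_tendsto:
  assumes "0 \<le> a" "(h \<longlongrightarrow> a) F" "eventually (\<lambda>x. 0 \<le> h x) F"
  shows "((\<lambda>x. \<epsilon> (h x)) \<longlongrightarrow> \<epsilon> a) F"
  using continuous_on_tendsto_compose[OF \<epsilon>_cont assms(2)] assms by simp

lemma \<epsilon>_small:
  assumes "0 < e"
  obtains d where "0 < d" "\<epsilon> d < e"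
proof -
  have "((\<lambda>x. \<epsilon> x) \<longlongrightarrow> \<epsilon> 0) (at_right 0)"
    by (rule \<epsilon>_tendsto) (auto simp: eventually_at_right_less eventually_at_filter)
  then have "eventually (\<lambda>x. \<epsilon> x < e) (at_right 0)"
    using assms by (simp add: \<epsilon>_0 order_tendstoD)
  then obtain b where "b > 0" "\<And>y. 0 < y \<Longrightarrow> y < b \<Longrightarrow> \<epsilon> y < e"
    unfolding eventually_at_right_field by auto
  then show ?thesis using that[of "b / 2"] by auto
qed

text \<open>
  The distortion over an open ball of radius \<open>r\<close> is bounded by \<open>\<epsilon>
  r\<close>; two points at distance exactly \<open>a\<close> lie in all balls of radius larger
  than \<open>a\<close>, and continuity of \<open>\<epsilon>\<close> gives the bound
  \<open>\<epsilon> a\<close>.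
\<close>

lemma le_\<epsilon>_right_limit:
  assumes a: "0 \<le> a" "a < b" and le: "\<And>r. a < r \<Longrightarrow> r \<le> b \<Longrightarrow> z \<le> \<epsilon> r"
  shows "z \<le> \<epsilon> a"
proof (rule tendsto_lowerbound)
  show "((\<lambda>r. \<epsilon> r) \<longlongrightarrow> \<epsilon> a) (at_right a)"
    using a by (intro \<epsilon>_tendsto) (auto simp: eventually_at_right_field intro!: exI[of _ b])
  show "eventually (\<lambda>r. z \<le> \<epsilon> r) (at_right a)"
    unfolding eventually_at_right_field using a le by (intro exI[of _ b]) auto
qed simp

abbreviation conf :: "('a::metric_space \<rightharpoonup> 'a) set" where
  "conf \<equiv> conf_class \<Delta> \<beta> \<epsilon>"

text \<open>
  The conditions (T0)--(T3) for a given radius function, so that one radius function can be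
  chosen per map.
\<close>

definition branch_radius :: "('a::metric_space \<rightharpoonup> 'a) \<Rightarrow> ('a \<Rightarrow> real) \<Rightarrow> bool" where
  "branch_radius f \<delta>f \<longleftrightarrow> (\<exists>\<delta>0 L1.
            0 < \<delta>0 \<and> (\<forall>x\<in>dom f. \<delta>f x \<in> {\<delta>0..\<Delta>}) \<and>
            (\<forall>y. \<forall>x\<in>fibre f y. \<forall>x'\<in>fibre f y. x \<noteq> x' \<longrightarrow>
               ball x (\<delta>f x) \<inter> ball x' (\<delta>f x') = {}) \<and>
            (\<forall>x\<in>dom f. ball (the (f x)) \<Delta> \<subseteq> (\<lambda>u. the (f u)) ` (ball x (\<delta>f x) \<inter> dom f)) \<and>
            (\<forall>u\<in>dom f. \<forall>x\<in>dom f. dist u x < \<delta>f x \<longrightarrow> div_diff f u x \<in> {\<beta>..L1}) \<and>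
            (\<forall>x\<in>dom f. \<forall>r. 0 < r \<and> r \<le> \<Delta> \<longrightarrow> distortion f \<delta>f x r \<le> ennreal (\<epsilon> r)))"

definition rad :: "('a::metric_space \<rightharpoonup> 'a) \<Rightarrow> 'a \<Rightarrow> real" where
  "rad f = (SOME \<delta>f. branch_radius f \<delta>f)"

lemma conf_iff:
  "f \<in> conf \<longleftrightarrow> dom f \<noteq> {} \<and> covering_space (dom f) (\<lambda>x. the (f x)) UNIV \<and> C1_conformal f
    \<and> (\<exists>N. \<forall>y. finite (fibre f y) \<and> card (fibre f y) \<le> N) \<and> (\<exists>\<delta>f. branch_radius f \<delta>f)"
proof -
  have swap: "(\<exists>a b c. P a b c) = (\<exists>c a b. P a b c)" for P :: "real \<Rightarrow> real \<Rightarrow> ('a \<Rightarrow> real) \<Rightarrow> bool" by meson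
  show ?thesis unfolding conf_class_def mem_Collect_eq branch_radius_def by (subst swap) (rule refl)
qed

lemma branch_radius_rad:
  assumes "f \<in> conf" shows "branch_radius f (rad f)"
proof -
  have "\<exists>\<delta>f. branch_radius f \<delta>f"
    using assms unfolding conf_iff by (elim conjE)
  then show ?thesis unfolding rad_def by (rule someI_ex)
qed

context
  fixes f :: "'a::metric_space \<rightharpoonup> 'a"
  assumes f: "f \<in> conf"
begin

lemma conf_dom_nonempty: "dom f \<noteq> {}"
  and conf_continuous: "continuous_on (dom f) (\<lambda>x. the (f x))"
  and conf_C1: "C1_conformal f"
  and conf_fibre_finite: "finite (fibre f y)"
  and conf_card_bounded: "\<exists>N. \<forall>y. card (fibre f y) \<le> N"
proof -
  have *: "dom f \<noteq> {} \<and> covering_space (dom f) (\<lambda>x. the (f x)) UNIV \<and> C1_conformal f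
      \<and> (\<exists>N. \<forall>y. finite (fibre f y) \<and> card (fibre f y) \<le> N)"
    using f unfolding conf_iff by (elim conjE) (intro conjI; assumption)
  show "dom f \<noteq> {}" "C1_conformal f" using * by blast+
  show "continuous_on (dom f) (\<lambda>x. the (f x))" using * unfolding covering_space_def by blast
  show "finite (fibre f y)" "\<exists>N. \<forall>y. card (fibre f y) \<le> N" using * by blast+
qed

lemma conf_fibre_nonempty: "fibre f y \<noteq> {}"
proof -
  have "covering_space (dom f) (\<lambda>x. the (f x)) UNIV"
    using f unfolding conf_iff by (elim conjE)
  then have "(\<lambda>x. the (f x)) ` dom f = UNIV"
    unfolding covering_space_def by blast
  then obtain x where "x \<in> dom f" "the (f x) = y" by (metis UNIV_I imageE)
  then show ?thesis by (auto simp: fibre_iff)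
qed

lemma rad_props:
  obtains \<delta>0 L1 where "0 < \<delta>0" "\<forall>x\<in>dom f. \<delta>0 \<le> rad f x \<and> rad f x \<le> \<Delta>"
    "\<forall>y. \<forall>x\<in>fibre f y. \<forall>x'\<in>fibre f y. x \<noteq> x' \<longrightarrow> ball x (rad f x) \<inter> ball x' (rad f x') = {}"
    "\<forall>x\<in>dom f. ball (the (f x)) \<Delta> \<subseteq> (\<lambda>u. the (f u)) ` (ball x (rad f x) \<inter> dom f)"
    "\<forall>u\<in>dom f. \<forall>x\<in>dom f. dist u x < rad f x \<longrightarrow> \<beta> \<le> div_diff f u x \<and> div_diff f u x \<le> L1"
    "\<forall>x\<in>dom f. \<forall>r. 0 < r \<and> r \<le> \<Delta> \<longrightarrow> distortion f (rad f) x r \<le> ennreal (\<epsilon> r)"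
proof -
  from branch_radius_rad[OF f] obtain \<delta>0 L1 where
    "0 < \<delta>0 \<and> (\<forall>x\<in>dom f. rad f x \<in> {\<delta>0..\<Delta>}) \<and>
            (\<forall>y. \<forall>x\<in>fibre f y. \<forall>x'\<in>fibre f y. x \<noteq> x' \<longrightarrow>
               ball x (rad f x) \<inter> ball x' (rad f x') = {}) \<and>
            (\<forall>x\<in>dom f. ball (the (f x)) \<Delta> \<subseteq> (\<lambda>u. the (f u)) ` (ball x (rad f x) \<inter> dom f)) \<and>
            (\<forall>u\<in>dom f. \<forall>x\<in>dom f. dist u x < rad f x \<longrightarrow> div_diff f u x \<in> {\<beta>..L1}) \<and>
            (\<forall>x\<in>dom f. \<forall>r. 0 < r \<and> r \<le> \<Delta> \<longrightarrow> distortion f (rad f) x r \<le> ennreal (\<epsilon> r))"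
    unfolding branch_radius_def by (elim exE)
  then show ?thesis unfolding atLeastAtMost_iff by (elim conjE) (rule that[of \<delta>0 L1]; assumption)
qed

lemma rad_le: "x \<in> dom f \<Longrightarrow> rad f x \<le> \<Delta>"
  by (rule rad_props) blast

lemma rad_uniform: "\<exists>\<delta>0>0. \<forall>x\<in>dom f. \<delta>0 \<le> rad f x"
  by (rule rad_props) blast

lemma rad_pos: "x \<in> dom f \<Longrightarrow> 0 < rad f x"
  using rad_uniform by (metis less_le_trans)

lemma rad_disjoint:
  "f x = Some y \<Longrightarrow> f x' = Some y \<Longrightarrow> x \<noteq> x' \<Longrightarrow> ball x (rad f x) \<inter> ball x' (rad f x') = {}"
  by (rule rad_props) (simp add: fibre_iff)

lemma rad_onto:
  assumes "x \<in> dom f" "dist y (the (f x)) < \<Delta>"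
  obtains u where "f u = Some y" "dist u x < rad f x"
proof -
  have "ball (the (f x)) \<Delta> \<subseteq> (\<lambda>u. the (f u)) ` (ball x (rad f x) \<inter> dom f)"
  proof (rule rad_props)
    assume "\<forall>x\<in>dom f. ball (the (f x)) \<Delta> \<subseteq> (\<lambda>u. the (f u)) ` (ball x (rad f x) \<inter> dom f)"
    then show ?thesis using assms(1) by (rule bspec)
  qed
  moreover have "y \<in> ball (the (f x)) \<Delta>" using assms by (simp add: dist_commute)
  ultimately obtain u where "u \<in> ball x (rad f x)" "u \<in> dom f" "y = the (f u)" by blast
  then show ?thesis using that[of u] by (auto simp: dist_commute)
qed

lemma div_diff_ge: "u \<in> dom f \<Longrightarrow> x \<in> dom f \<Longrightarrow> dist u x < rad f x \<Longrightarrow> \<beta> \<le> div_diff f u x"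
  by (rule rad_props) simp

lemma div_diff_bounded:
  "\<exists>L1. \<forall>u\<in>dom f. \<forall>x\<in>dom f. dist u x < rad f x \<longrightarrow> div_diff f u x \<le> L1"
proof (rule rad_props)
  fix L1 assume "\<forall>u\<in>dom f. \<forall>x\<in>dom f. dist u x < rad f x \<longrightarrow> \<beta> \<le> div_diff f u x \<and> div_diff f u x \<le> L1"
  then show ?thesis by (intro exI[of _ L1]) simp
qed

lemma conf_deriv_ge: "x \<in> dom f \<Longrightarrow> \<beta> \<le> conf_deriv f x"
  using div_diff_ge[of x x] rad_pos[of x] by (simp add: div_diff_def)

lemma conf_deriv_pos: "x \<in> dom f \<Longrightarrow> 0 < conf_deriv f x"
  using conf_deriv_ge[of x] \<beta>_gt_1 by linarith

lemma conf_deriv_bounded: "bdd_above (conf_deriv f ` dom f)"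
proof -
  obtain L1 where "\<forall>u\<in>dom f. \<forall>x\<in>dom f. dist u x < rad f x \<longrightarrow> div_diff f u x \<le> L1"
    using div_diff_bounded by blast
  then have "conf_deriv f x \<le> L1" if "x \<in> dom f" for x
    using that rad_pos[of x] by (force simp: div_diff_def)
  then show ?thesis by (rule bdd_aboveI2)
qed

lemma div_diff_dist: "div_diff f u x * dist u x = dist (the (f u)) (the (f x))"
  by (simp add: div_diff_def diff_quot_def)

lemma branch_expands:
  assumes "u \<in> dom f" "x \<in> dom f" "dist u x < rad f x"
  shows "\<beta> * dist u x \<le> dist (the (f u)) (the (f x))"
  using mult_right_mono[OF div_diff_ge[OF assms], of "dist u x"] by (simp add: div_diff_dist)

lemma branch_dist_le:
  assumes "u \<in> dom f" "x \<in> dom f" "dist u x < rad f x"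
  shows "dist u x \<le> dist (the (f u)) (the (f x)) / \<beta>"
  using branch_expands[OF assms] \<beta>_gt_1 by (simp add: field_simps)

lemma distortion_bound:
  assumes x: "x \<in> dom f" and r: "0 < r" "r \<le> \<Delta>"
    and u: "u1 \<in> dom f" "dist u1 x < rad f x" "dist (the (f u1)) (the (f x)) < r"
    and v: "u2 \<in> dom f" "dist u2 x < rad f x" "dist (the (f u2)) (the (f x)) < r"
  shows "\<bar>ln (div_diff f u1 x / conf_deriv f u2)\<bar> \<le> \<epsilon> r"
proof -
  have "distortion f (rad f) x r \<le> ennreal (\<epsilon> r)"
  proof (rule rad_props)
    assume "\<forall>x\<in>dom f. \<forall>r. 0 < r \<and> r \<le> \<Delta> \<longrightarrow> distortion f (rad f) x r \<le> ennreal (\<epsilon> r)"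
    then show ?thesis using x r by simp
  qed
  moreover have "ennreal \<bar>ln (div_diff f u1 x / conf_deriv f u2)\<bar> \<le> distortion f (rad f) x r"
    unfolding distortion_def Let_def
    by (rule SUP_upper2[of u1], use u x in \<open>simp add: mpreim_def dist_commute\<close>,
        rule SUP_upper, use v x in \<open>simp add: mpreim_def dist_commute\<close>)
  ultimately have "ennreal \<bar>ln (div_diff f u1 x / conf_deriv f u2)\<bar> \<le> ennreal (\<epsilon> r)"
    by (rule order_trans[rotated])
  then show ?thesis using \<epsilon>_nonneg[of r] r by simp
qed

text \<open>
  The bound (T3) is used with both derivative slots: first the difference quotient against the
  derivative at the centre, then the two derivatives against each other, the quotient at the
  centre being the derivative there.
\<close>

lemma branch_distortion:
  assumes x: "x \<in> dom f" and u: "u \<in> dom f" "dist u x < rad f x"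
    and d: "dist (the (f u)) (the (f x)) < \<Delta>"
  shows "\<bar>ln (div_diff f u x) - ln (conf_deriv f x)\<bar> \<le> \<epsilon> (dist (the (f u)) (the (f x)))" (is ?A)
    and "\<bar>ln (conf_deriv f u) - ln (conf_deriv f x)\<bar> \<le> \<epsilon> (dist (the (f u)) (the (f x)))" (is ?B)
proof -
  have pos: "div_diff f u x > 0" "conf_deriv f x > 0" "conf_deriv f u > 0"
    using div_diff_ge[OF u(1) x u(2)] \<beta>_gt_1 conf_deriv_pos x u by auto
  show ?A
  proof (rule le_\<epsilon>_right_limit[OF zero_le_dist d])
    fix r assume r: "dist (the (f u)) (the (f x)) < r" "r \<le> \<Delta>"
    then have "0 < r" using zero_le_dist[of "the (f u)" "the (f x)"] by linarith
    then have "\<bar>ln (div_diff f u x / conf_deriv f x)\<bar> \<le> \<epsilon> r"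
      using distortion_bound[OF x _ r(2) u(1,2) r(1) x] rad_pos[OF x] by simp
    then show "\<bar>ln (div_diff f u x) - ln (conf_deriv f x)\<bar> \<le> \<epsilon> r"
      using pos by (simp add: ln_div)
  qed
  show ?B
  proof (rule le_\<epsilon>_right_limit[OF zero_le_dist d])
    fix r assume r: "dist (the (f u)) (the (f x)) < r" "r \<le> \<Delta>"
    then have "0 < r" using zero_le_dist[of "the (f u)" "the (f x)"] by linarith
    then have "\<bar>ln (div_diff f x x / conf_deriv f u)\<bar> \<le> \<epsilon> r"
      using distortion_bound[OF x _ r(2) x _ _ u(1,2) r(1)] rad_pos[OF x] by simp
    then show "\<bar>ln (conf_deriv f u) - ln (conf_deriv f x)\<bar> \<le> \<epsilon> r"
      using pos by (simp add: ln_div div_diff_def abs_minus_commute)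
  qed
qed

lemma branch_dist_bounds:
  assumes x: "x \<in> dom f" and u: "u \<in> dom f" "dist u x < rad f x"
    and d: "dist (the (f u)) (the (f x)) < \<Delta>"
  defines "e \<equiv> \<epsilon> (dist (the (f u)) (the (f x)))"
  shows "dist u x * conf_deriv f x \<le> exp e * dist (the (f u)) (the (f x))"
    and "dist (the (f u)) (the (f x)) \<le> exp e * conf_deriv f x * dist u x"
    and "conf_deriv f u \<le> exp e * conf_deriv f x"
    and "conf_deriv f x \<le> exp e * conf_deriv f u"
proof -
  have pos: "div_diff f u x > 0" "conf_deriv f x > 0" "conf_deriv f u > 0"
    using div_diff_ge[OF u(1) x u(2)] \<beta>_gt_1 conf_deriv_pos x u by auto
  note b = branch_distortion[OF x u d, folded e_def]
  have exp_ln_le: "p \<le> exp e * q" if "ln p - ln q \<le> e" "p > 0" "q > 0" for p q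
  proof -
    have "ln p \<le> ln (exp e * q)" using that by (simp add: ln_mult)
    then show ?thesis using that by simp
  qed
  have 1: "conf_deriv f x \<le> exp e * div_diff f u x" "div_diff f u x \<le> exp e * conf_deriv f x"
    by (rule exp_ln_le; use b pos in linarith)+
  show "conf_deriv f u \<le> exp e * conf_deriv f x" "conf_deriv f x \<le> exp e * conf_deriv f u"
    by (rule exp_ln_le; use b pos in linarith)+
  show "dist u x * conf_deriv f x \<le> exp e * dist (the (f u)) (the (f x))"
    using mult_right_mono[OF 1(1), of "dist u x"]
    by (simp add: div_diff_dist[symmetric] mult_ac)
  show "dist (the (f u)) (the (f x)) \<le> exp e * conf_deriv f x * dist u x"
    using mult_right_mono[OF 1(2), of "dist u x"] by (simp add: div_diff_dist)
qed

text \<open>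
  By (T1) every point of the fibre of \<open>y\<close> has a partner in the fibre of
  \<open>w\<close> within its own radius, and (T0) makes partners of different points different.
\<close>

lemma fibre_injection:
  assumes "dist y w < \<Delta>"
  shows "\<exists>\<pi>. inj_on \<pi> (fibre f y) \<and> \<pi> ` fibre f y \<subseteq> fibre f w \<and>
    (\<forall>x\<in>fibre f y. dist (\<pi> x) x < rad f x)"
proof -
  have "\<exists>u. f u = Some w \<and> dist u x < rad f x" if "x \<in> fibre f y" for x
  proof -
    from that have x: "x \<in> dom f" "dist w (the (f x)) < \<Delta>"
      using assms by (auto simp: fibre_iff dist_commute)
    show ?thesis by (rule rad_onto[OF x]) blast
  qed
  then obtain \<pi> where \<pi>: "\<And>x. x \<in> fibre f y \<Longrightarrow> f (\<pi> x) = Some w \<and> dist (\<pi> x) x < rad f x"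
    by metis
  have "inj_on \<pi> (fibre f y)"
  proof (rule inj_onI, rule ccontr)
    fix x x' assume *: "x \<in> fibre f y" "x' \<in> fibre f y" "\<pi> x = \<pi> x'" "x \<noteq> x'"
    then have "\<pi> x \<in> ball x (rad f x) \<inter> ball x' (rad f x')"
      using \<pi>[of x] \<pi>[of x'] by (simp add: dist_commute)
    with * show False using rad_disjoint[of x y x'] by (auto simp: fibre_iff)
  qed
  then show ?thesis using \<pi> by (intro exI[of _ \<pi>]) (auto simp: fibre_iff)
qed

text \<open>
  The injections in both directions between finite fibres force the first one to be onto:
  near-by points have equally many preimages, matched along inverse branches.
\<close>

lemma fibre_pairing:
  assumes "dist y w < \<Delta>"
  obtains \<pi> where "bij_betw \<pi> (fibre f y) (fibre f w)" "\<And>x. x \<in> fibre f y \<Longrightarrow> dist (\<pi> x) x < rad f x"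
proof -
  obtain \<pi> where \<pi>: "inj_on \<pi> (fibre f y)" "\<pi> ` fibre f y \<subseteq> fibre f w"
    "\<forall>x\<in>fibre f y. dist (\<pi> x) x < rad f x" using fibre_injection[OF assms] by blast
  have "dist w y < \<Delta>" using assms by (simp add: dist_commute)
  then obtain \<pi>' where \<pi>': "inj_on \<pi>' (fibre f w)" "\<pi>' ` fibre f w \<subseteq> fibre f y"
    using fibre_injection by blast
  have "card (fibre f w) \<le> card (fibre f y)"
    using card_inj_on_le[OF \<pi>' conf_fibre_finite] .
  also have "\<dots> = card (\<pi> ` fibre f y)" using \<pi>(1) by (simp add: card_image)
  finally have "\<pi> ` fibre f y = fibre f w"
    using card_seteq[OF conf_fibre_finite \<pi>(2)] by blast
  then show ?thesis using that[of \<pi>] \<pi> by (auto simp: bij_betw_def)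
qed

end

text \<open>
  Images of a convergent sequence in the domain form a Cauchy sequence, since the map is locally
  Lipschitz at a uniform scale. The limit of the images has a preimage on the inverse branch of
  each late term, at a distance that tends to zero; so these preimages converge to the limit of
  the sequence, and they lie in a finite fibre.
\<close>

lemma conf_dom_closed:
  fixes f :: "'a::complete_space \<rightharpoonup> 'a"
  assumes f: "f \<in> conf" shows "closed (dom f)"
proof -
  have seq: "x \<in> dom f" if u: "\<And>n. u n \<in> dom f" "u \<longlonglongrightarrow> x" for u :: "nat \<Rightarrow> 'a" and x
  proof -
    obtain \<delta>0 where \<delta>0: "\<delta>0 > 0" "\<forall>x\<in>dom f. \<delta>0 \<le> rad f x"
      using rad_uniform[OF f] by (elim exE conjE)
    obtain L1 where L1: "\<forall>u\<in>dom f. \<forall>x\<in>dom f. dist u x < rad f x \<longrightarrow> div_diff f u x \<le> L1"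
      using div_diff_bounded[OF f] by (elim exE)
    have lip: "dist (the (f a)) (the (f b)) \<le> \<bar>L1\<bar> * dist a b" if "a \<in> dom f" "b \<in> dom f" "dist a b < \<delta>0" for a b
    proof -
      have "div_diff f a b \<le> L1" using bspec[OF bspec[OF L1 that(1)] that(2)] bspec[OF \<delta>0(2) that(2)] that(3) by simp
      then have "div_diff f a b \<le> \<bar>L1\<bar>" by simp
      from mult_right_mono[OF this, of "dist a b"] show ?thesis by (simp add: div_diff_dist[OF f])
    qed
    have "Cauchy u" using u(2) by (simp add: LIMSEQ_imp_Cauchy)
    have "Cauchy (\<lambda>n. the (f (u n)))"
    proof (rule metric_CauchyI)
      fix e :: real assume "e > 0"
      define d where "d = min \<delta>0 (e / (\<bar>L1\<bar> + 1))"
      have "d > 0" using \<open>e > 0\<close> \<delta>0 by (simp add: d_def)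
      then obtain N where N: "\<And>m n. m \<ge> N \<Longrightarrow> n \<ge> N \<Longrightarrow> dist (u m) (u n) < d"
        using metric_CauchyD[OF \<open>Cauchy u\<close> \<open>d > 0\<close>] by blast
      have "dist (the (f (u m))) (the (f (u n))) < e" if "m \<ge> N" "n \<ge> N" for m n
      proof -
        have d: "dist (u m) (u n) < \<delta>0" "dist (u m) (u n) < e / (\<bar>L1\<bar> + 1)"
          using N[OF that] by (auto simp: d_def)
        have "dist (the (f (u m))) (the (f (u n))) \<le> \<bar>L1\<bar> * dist (u m) (u n)"
          by (rule lip[OF u(1) u(1) d(1)])
        also have "\<dots> \<le> (\<bar>L1\<bar> + 1) * dist (u m) (u n)" by (simp add: mult_right_mono)
        also have "\<dots> < e" using d(2) by (simp add: field_simps)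
        finally show ?thesis .
      qed
      then show "\<exists>N. \<forall>m\<ge>N. \<forall>n\<ge>N. dist (the (f (u m))) (the (f (u n))) < e" by blast
    qed
    then obtain y where y: "(\<lambda>n. the (f (u n))) \<longlonglongrightarrow> y"
      using Cauchy_convergent[of "\<lambda>n. the (f (u n))"] unfolding convergent_def by blast
    define G where "G = (\<lambda>n. SOME v. f v = Some y \<and> dist v (u n) < rad f (u n))"
    have G: "f (G n) = Some y \<and> dist (G n) (u n) \<le> dist y (the (f (u n))) / \<beta>"
      if "dist y (the (f (u n))) < \<Delta>" for n
    proof -
      have "\<exists>v. f v = Some y \<and> dist v (u n) < rad f (u n)"
        by (rule rad_onto[OF f u(1)[of n] that]) blast
      then have *: "f (G n) = Some y \<and> dist (G n) (u n) < rad f (u n)" unfolding G_def by (rule someI_ex)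
      then show ?thesis using branch_dist_le[OF f, of "G n" "u n"] u(1)[of n] by auto
    qed
    have ylim: "(\<lambda>n. dist y (the (f (u n)))) \<longlonglongrightarrow> 0" using iffD1[OF tendsto_dist_iff y] by (simp only: dist_commute)
    then have ev: "eventually (\<lambda>n. dist y (the (f (u n))) < \<Delta>) sequentially"
      by (rule order_tendstoD(2)) (rule \<Delta>_pos)
    have upper: "eventually (\<lambda>n. dist (G n) (u n) \<le> dist y (the (f (u n))) / \<beta>) sequentially"
      using ev by (rule eventually_mono) (rule conjunct2[OF G])
    have "(\<lambda>n. dist y (the (f (u n))) / \<beta>) \<longlonglongrightarrow> 0"
      using tendsto_divide[OF ylim tendsto_const[of \<beta>]] \<beta>_gt_1 by simp
    with upper have "(\<lambda>n. dist (G n) (u n)) \<longlonglongrightarrow> 0"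
      by (intro tendsto_sandwich[OF always_eventually[OF allI[OF zero_le_dist]] _ tendsto_const])
    moreover have "(\<lambda>n. dist (u n) x) \<longlonglongrightarrow> 0" using iffD1[OF tendsto_dist_iff u(2)] .
    ultimately have "(\<lambda>n. dist (G n) (u n) + dist (u n) x) \<longlonglongrightarrow> 0 + 0" by (rule tendsto_add)
    then have lim0: "(\<lambda>n. dist (G n) (u n) + dist (u n) x) \<longlonglongrightarrow> 0" by simp
    have "(\<lambda>n. dist (G n) x) \<longlonglongrightarrow> 0"
      by (rule tendsto_sandwich[OF _ _ tendsto_const lim0])
         (intro always_eventually allI zero_le_dist dist_triangle)+
    then have Glim: "G \<longlonglongrightarrow> x" by (rule iffD2[OF tendsto_dist_iff])
    have "x \<in> fibre f y"
    proof (rule Lim_in_closed_set[OF _ _ _ Glim])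
      show "closed (fibre f y)" using conf_fibre_finite[OF f] by (rule finite_imp_closed)
      show "eventually (\<lambda>n. G n \<in> fibre f y) sequentially"
        using ev by (rule eventually_mono) (simp add: fibre_iff conjunct1[OF G])
    qed simp
    then show ?thesis by (auto simp: fibre_iff)
  qed
  show ?thesis unfolding closed_sequential_limits
  proof (intro allI impI)
    fix u l assume "(\<forall>n. u n \<in> dom f) \<and> u \<longlonglongrightarrow> l"
    then show "l \<in> dom f" using seq[of u l] by blast
  qed
qed

end

section \<open>Chain rule\<close>

text \<open>
  Local openness supplies pairs of distinct points of the domain near \<open>x\<close>. Without
  them the filter that defines the derivative would be trivial, and \<open>Lim\<close> would say
  nothing.
\<close>

definition open_at :: "('a::metric_space \<rightharpoonup> 'a) \<Rightarrow> 'a \<Rightarrow> bool" where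
  "open_at h x \<longleftrightarrow> (\<forall>e>0. \<exists>d>0. \<forall>w. dist w (the (h x)) < d \<longrightarrow> (\<exists>u. h u = Some w \<and> dist u x < e))"

definition conformal_at :: "('a::metric_space \<rightharpoonup> 'a) \<Rightarrow> 'a \<Rightarrow> real \<Rightarrow> bool" where
  "conformal_at h x L \<longleftrightarrow> (diff_quot h \<longlongrightarrow> L) (offdiag_at h x)"

lemma open_atD:
  "open_at h x \<Longrightarrow> e > 0 \<Longrightarrow> \<exists>d>0. \<forall>w. dist w (the (h x)) < d \<longrightarrow> (\<exists>u. h u = Some w \<and> dist u x < e)"
  unfolding open_at_def by simp

lemma open_at_offdiag:
  fixes h :: "'a::{metric_space, perfect_space} \<rightharpoonup> 'a"
  assumes "open_at h x" "x \<in> dom h"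
  shows "offdiag_at h x \<noteq> bot"
  unfolding offdiag_at_def not_trivial_limit_within_ball
proof (intro allI impI)
  fix e :: real assume "e > 0"
  then obtain d where d: "d > 0" "\<forall>w. dist w (the (h x)) < d \<longrightarrow> (\<exists>u. h u = Some w \<and> dist u x < e)"
    using open_atD[OF assms(1) \<open>e > 0\<close>] by (elim exE conjE)
  have "at (the (h x)) within UNIV \<noteq> bot" by simp
  then have "UNIV \<inter> ball (the (h x)) d - {the (h x)} \<noteq> {}"
    using d(1) unfolding not_trivial_limit_within_ball by (elim allE[of _ d]) simp
  then obtain w where "w \<in> ball (the (h x)) d" "w \<noteq> the (h x)" by blast
  then have w: "w \<noteq> the (h x)" "dist w (the (h x)) < d" by (simp_all add: dist_commute)
  then obtain u where u: "h u = Some w" "dist u x < e" using d(2) by blast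
  then have "u \<noteq> x" using w by auto
  with u assms(2) have "(u, x) \<in> {(u, v). u \<in> dom h \<and> v \<in> dom h \<and> u \<noteq> v} \<inter> ball (x, x) e - {(x, x)}"
    by (auto simp: dist_Pair_Pair dist_commute)
  then show "{(u, v). u \<in> dom h \<and> v \<in> dom h \<and> u \<noteq> v} \<inter> ball (x, x) e - {(x, x)} \<noteq> {}" by blast
qed

lemma conformal_at_deriv:
  fixes h :: "'a::{metric_space, perfect_space} \<rightharpoonup> 'a"
  assumes "open_at h x" "x \<in> dom h" "conformal_at h x L"
  shows "conf_deriv h x = L"
  unfolding conf_deriv_def
  by (rule tendsto_Lim[OF open_at_offdiag[OF assms(1,2)]]) (use assms(3) in \<open>simp add: conformal_at_def\<close>)

lemma dom_map_comp_iff: "x \<in> dom (g \<circ>\<^sub>m h) \<longleftrightarrow> x \<in> dom h \<and> the (h x) \<in> dom g"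
  by (auto simp: map_comp_def split: option.splits)

lemma the_map_comp: "x \<in> dom h \<Longrightarrow> (g \<circ>\<^sub>m h) x = g (the (h x))"
  by (auto simp: map_comp_def split: option.splits)

lemma open_at_comp:
  assumes "open_at h x" "open_at g (the (h x))" "x \<in> dom h"
  shows "open_at (g \<circ>\<^sub>m h) x"
  unfolding open_at_def
proof (intro allI impI)
  fix e :: real assume "e > 0"
  then obtain d where d: "d > 0" "\<forall>w. dist w (the (h x)) < d \<longrightarrow> (\<exists>u. h u = Some w \<and> dist u x < e)"
    using open_atD[OF assms(1) \<open>e > 0\<close>] by (elim exE conjE)
  obtain d' where d': "d' > 0" "\<forall>w. dist w (the (g (the (h x)))) < d' \<longrightarrow> (\<exists>u. g u = Some w \<and> dist u (the (h x)) < d)"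
    using open_atD[OF assms(2) d(1)] by (elim exE conjE)
  have "\<exists>u. (g \<circ>\<^sub>m h) u = Some w \<and> dist u x < e" if w: "dist w (the ((g \<circ>\<^sub>m h) x)) < d'" for w
  proof -
    have "dist w (the (g (the (h x)))) < d'" using w by (simp only: the_map_comp[OF assms(3)])
    then obtain v where v: "g v = Some w" "dist v (the (h x)) < d" using d'(2) by blast
    obtain u where "h u = Some v" "dist u x < e" using d(2) v(2) by blast
    then show ?thesis using v by (intro exI[of _ u]) (simp add: map_comp_def)
  qed
  then show "\<exists>d>0. \<forall>w. dist w (the ((g \<circ>\<^sub>m h) x)) < d \<longrightarrow> (\<exists>u. (g \<circ>\<^sub>m h) u = Some w \<and> dist u x < e)"
    using d'(1) by blast
qed

lemma continuous_on_map_comp: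
  assumes "continuous_on (dom h) (\<lambda>x. the (h x))" "continuous_on (dom g) (\<lambda>x. the (g x))"
  shows "continuous_on (dom (g \<circ>\<^sub>m h)) (\<lambda>x. the ((g \<circ>\<^sub>m h) x))"
proof -
  have sub: "dom (g \<circ>\<^sub>m h) \<subseteq> dom h" by (rule subsetI) (simp only: dom_map_comp_iff)
  have "continuous_on (dom (g \<circ>\<^sub>m h)) (\<lambda>x. the (g (the (h x))))"
    by (rule continuous_on_compose2[OF assms(2) continuous_on_subset[OF assms(1) sub]])
       (rule image_subsetI, simp only: dom_map_comp_iff)
  then show ?thesis
    by (rule continuous_on_eq) (simp only: dom_map_comp_iff the_map_comp)
qed

text \<open>
  The positive derivative of the inner map keeps distinct points distinct, so difference
  quotients multiply.
\<close>

lemma conformal_at_comp: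
  fixes g h :: "'a::metric_space \<rightharpoonup> 'a"
  assumes h: "conformal_at h x L" "0 < L" "continuous_on (dom h) (\<lambda>x. the (h x))"
    and g: "conformal_at g (the (h x)) L'" and x: "x \<in> dom h"
  shows "conformal_at (g \<circ>\<^sub>m h) x (L' * L)"
proof -
  let ?S = "{(u, v). u \<in> dom (g \<circ>\<^sub>m h) \<and> v \<in> dom (g \<circ>\<^sub>m h) \<and> u \<noteq> v}"
  let ?p = "\<lambda>(u, v). (the (h u), the (h v))"
  have sub: "?S \<subseteq> {(u, v). u \<in> dom h \<and> v \<in> dom h \<and> u \<noteq> v}"
    by (rule subsetI) (simp only: mem_Collect_eq case_prod_beta dom_map_comp_iff simp_thms)
  have le: "offdiag_at (g \<circ>\<^sub>m h) x \<le> offdiag_at h x" unfolding offdiag_at_def by (rule at_le[OF sub])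
  have lim_h: "(diff_quot h \<longlongrightarrow> L) (offdiag_at (g \<circ>\<^sub>m h) x)"
    using h(1) le unfolding conformal_at_def by (rule tendsto_mono[rotated])
  then have ne: "eventually (\<lambda>p. diff_quot h p > 0) (offdiag_at (g \<circ>\<^sub>m h) x)"
    using h(2) by (rule order_tendstoD(1))
  have inS: "eventually (\<lambda>p. p \<in> ?S) (offdiag_at (g \<circ>\<^sub>m h) x)"
    unfolding offdiag_at_def eventually_at_filter by simp
  have ev: "eventually (\<lambda>p. ?p p \<in> {(u, v). u \<in> dom g \<and> v \<in> dom g \<and> u \<noteq> v} \<and> ?p p \<noteq> (the (h x), the (h x)))
      (offdiag_at (g \<circ>\<^sub>m h) x)"
    using ne inS
  proof eventually_elim
    case (elim p)
    obtain u v where p: "p = (u, v)" by (cases p)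
    have uv: "u \<in> dom h" "the (h u) \<in> dom g" "v \<in> dom h" "the (h v) \<in> dom g"
      using elim(2) unfolding p mem_Collect_eq prod.case dom_map_comp_iff by simp_all
    have "the (h u) \<noteq> the (h v)" using elim(1) unfolding p diff_quot_def by auto
    then show ?case using uv(2,4) unfolding p by (simp, metis)
  qed
  have lim_x: "((\<lambda>p. p) \<longlongrightarrow> (x, x)) (offdiag_at (g \<circ>\<^sub>m h) x)"
    unfolding offdiag_at_def by (rule tendsto_ident_at)
  have comp: "((\<lambda>p. the (h (pr p))) \<longlongrightarrow> the (h x)) (offdiag_at (g \<circ>\<^sub>m h) x)"
    if pr: "((\<lambda>p. pr p) \<longlongrightarrow> x) (offdiag_at (g \<circ>\<^sub>m h) x)" and D: "\<And>p. p \<in> ?S \<Longrightarrow> pr p \<in> dom h" for pr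
    by (rule continuous_on_tendsto_compose[OF h(3) pr x]) (rule eventually_mono[OF inS D])
  have "((\<lambda>p. the (h (fst p))) \<longlongrightarrow> the (h x)) (offdiag_at (g \<circ>\<^sub>m h) x)"
  proof (rule comp)
    show "(fst \<longlongrightarrow> x) (offdiag_at (g \<circ>\<^sub>m h) x)" using tendsto_fst[OF lim_x] by simp
    show "fst p \<in> dom h" if "p \<in> ?S" for p using subsetD[OF sub that] by (simp add: case_prod_beta del: dom_def)
  qed
  moreover have "((\<lambda>p. the (h (snd p))) \<longlongrightarrow> the (h x)) (offdiag_at (g \<circ>\<^sub>m h) x)"
  proof (rule comp)
    show "(snd \<longlongrightarrow> x) (offdiag_at (g \<circ>\<^sub>m h) x)" using tendsto_snd[OF lim_x] by simp
    show "snd p \<in> dom h" if "p \<in> ?S" for p using subsetD[OF sub that] by (simp add: case_prod_beta del: dom_def)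
  qed
  ultimately have "(?p \<longlongrightarrow> (the (h x), the (h x))) (offdiag_at (g \<circ>\<^sub>m h) x)"
    unfolding case_prod_beta by (rule tendsto_Pair)
  then have "filterlim ?p (offdiag_at g (the (h x))) (offdiag_at (g \<circ>\<^sub>m h) x)"
    unfolding offdiag_at_def[of g] filterlim_at using ev by blast
  then have "((\<lambda>p. diff_quot g (?p p)) \<longlongrightarrow> L') (offdiag_at (g \<circ>\<^sub>m h) x)"
    using g unfolding conformal_at_def by (rule filterlim_compose[rotated])
  then have "((\<lambda>p. diff_quot g (?p p) * diff_quot h p) \<longlongrightarrow> L' * L) (offdiag_at (g \<circ>\<^sub>m h) x)"
    using lim_h by (rule tendsto_mult)
  moreover have "eventually (\<lambda>p. diff_quot g (?p p) * diff_quot h p = diff_quot (g \<circ>\<^sub>m h) p) (offdiag_at (g \<circ>\<^sub>m h) x)"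
    using ne inS
  proof eventually_elim
    case (elim p)
    obtain u v where p: "p = (u, v)" by (cases p)
    have uv: "u \<in> dom h" "v \<in> dom h"
      using elim(2) unfolding p mem_Collect_eq prod.case dom_map_comp_iff by simp_all
    have "dist (the (h u)) (the (h v)) \<noteq> 0" using elim(1) unfolding p diff_quot_def by auto
    then show ?case unfolding p diff_quot_def prod.case the_map_comp[OF uv(1)] the_map_comp[OF uv(2)] by simp
  qed
  ultimately show ?thesis unfolding conformal_at_def by (rule Lim_transform_eventually)
qed

section \<open>Iterated sequences of maps\<close>

lemma iter_seq_add: "iter_seq F t (m + n) = iter_seq F (t + m) n \<circ>\<^sub>m iter_seq F t m"
proof (induction n)
  case 0
  then show ?case by (auto simp: map_comp_def split: option.splits)
next
  case (Suc n)
  have "iter_seq F t (m + Suc n) = F (t + m + Suc n) \<circ>\<^sub>m (iter_seq F (t + m) n \<circ>\<^sub>m iter_seq F t m)"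
    using Suc by (simp add: add.assoc)
  also have "\<dots> = iter_seq F (t + m) (Suc n) \<circ>\<^sub>m iter_seq F t m"
    by (auto simp: map_comp_def split: option.splits)
  finally show ?case .
qed

lemma iter_seq_add_iff:
  "iter_seq F t (m + n) x = Some y \<longleftrightarrow> (\<exists>z. iter_seq F t m x = Some z \<and> iter_seq F (t + m) n z = Some y)"
  unfolding iter_seq_add by (auto simp: map_comp_def split: option.splits)

lemma iter_seq_Suc_iff:
  "iter_seq F t (Suc n) x = Some y \<longleftrightarrow> (\<exists>z. iter_seq F t n x = Some z \<and> F (t + Suc n) z = Some y)"
  by (auto simp: map_comp_def split: option.splits)

abbreviation orb :: "(nat \<Rightarrow> 'a \<rightharpoonup> 'a) \<Rightarrow> nat \<Rightarrow> nat \<Rightarrow> 'a \<Rightarrow> 'a" where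
  "orb F t n x \<equiv> the (iter_seq F t n x)"

lemma iter_seq_dom_add:
  "x \<in> dom (iter_seq F t (m + n)) \<longleftrightarrow> x \<in> dom (iter_seq F t m) \<and> orb F t m x \<in> dom (iter_seq F (t + m) n)"
  unfolding iter_seq_add dom_map_comp_iff ..

lemma orb_add:
  "x \<in> dom (iter_seq F t m) \<Longrightarrow> orb F t (m + n) x = orb F (t + m) n (orb F t m x)"
  unfolding iter_seq_add by (simp add: the_map_comp)

lemma iter_seq_dom_Suc:
  "x \<in> dom (iter_seq F t (Suc n)) \<longleftrightarrow> x \<in> dom (iter_seq F t n) \<and> orb F t n x \<in> dom (F (t + Suc n))"
  unfolding iter_seq.simps dom_map_comp_iff ..

lemma orb_Suc:
  "x \<in> dom (iter_seq F t n) \<Longrightarrow> orb F t (Suc n) x = the (F (t + Suc n) (orb F t n x))"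
  by (simp add: the_map_comp)

lemma iter_seq_dom_mono:
  assumes "x \<in> dom (iter_seq F t n)" "m \<le> n" shows "x \<in> dom (iter_seq F t m)"
  using assms(1) iter_seq_dom_add[of x F t m "n - m"] assms(2) by simp

lemma iter_seq_step_dom:
  assumes "x \<in> dom (iter_seq F t n)" "j < n"
  shows "orb F t j x \<in> dom (F (t + Suc j))"
  using iter_seq_dom_mono[OF assms(1), of "Suc j"] assms(2) unfolding iter_seq_dom_Suc by simp

text \<open>
  The derivative of an iterate, defined by the chain rule. It makes algebra along orbits a
  matter of finite products; \<open>conf_deriv_iter_seq\<close> identifies it with the
  derivative as a limit.
\<close>

definition iter_deriv :: "(nat \<Rightarrow> 'a::metric_space \<rightharpoonup> 'a) \<Rightarrow> nat \<Rightarrow> nat \<Rightarrow> 'a \<Rightarrow> real" where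
  "iter_deriv F t n x = (\<Prod>j<n. conf_deriv (F (t + Suc j)) (orb F t j x))"

lemma iter_deriv_0 [simp]: "iter_deriv F t 0 x = 1"
  by (simp add: iter_deriv_def)

lemma iter_deriv_Suc: "iter_deriv F t (Suc n) x = conf_deriv (F (t + Suc n)) (orb F t n x) * iter_deriv F t n x"
  by (simp add: iter_deriv_def)

lemma iter_deriv_add:
  assumes "x \<in> dom (iter_seq F t m)"
  shows "iter_deriv F t (m + n) x = iter_deriv F t m x * iter_deriv F (t + m) n (orb F t m x)"
proof (induction n)
  case (Suc n)
  have "iter_deriv F t (m + Suc n) x = conf_deriv (F (t + m + Suc n)) (orb F t (m + n) x) * iter_deriv F t (m + n) x"
    by (simp add: iter_deriv_Suc add.assoc)
  also have "\<dots> = iter_deriv F t m x * iter_deriv F (t + m) (Suc n) (orb F t m x)"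
    using Suc assms by (simp add: orb_add iter_deriv_Suc)
  finally show ?case .
qed simp

context conf_params
begin

definition conf_seq :: "(nat \<Rightarrow> 'a::metric_space \<rightharpoonup> 'a) \<Rightarrow> bool" where
  "conf_seq F \<longleftrightarrow> (\<forall>k\<ge>1. F k \<in> conf)"

lemma conf_seqD: "conf_seq F \<Longrightarrow> F (t + Suc n) \<in> conf"
  by (simp add: conf_seq_def)

lemma conf_open_at:
  assumes f: "f \<in> conf" and x: "x \<in> dom f" shows "open_at f x"
  unfolding open_at_def
proof (intro allI impI)
  fix e :: real assume "e > 0"
  show "\<exists>d>0. \<forall>w. dist w (the (f x)) < d \<longrightarrow> (\<exists>u. f u = Some w \<and> dist u x < e)"
  proof (intro exI[of _ "min \<Delta> e"] conjI allI impI)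
    fix w assume w: "dist w (the (f x)) < min \<Delta> e"
    then obtain u where u: "f u = Some w" "dist u x < rad f x" using rad_onto[OF f x, of w] by auto
    then have "dist u x \<le> dist w (the (f x)) / \<beta>" using branch_dist_le[OF f, of u x] x by auto
    also have "\<dots> \<le> dist w (the (f x)) / 1" using \<beta>_gt_1 by (intro divide_left_mono) auto
    finally show "\<exists>u. f u = Some w \<and> dist u x < e" using u w by auto
  qed (use \<Delta>_pos \<open>e > 0\<close> in auto)
qed

lemma conf_conformal_at:
  fixes f :: "'a::{complete_space, perfect_space} \<rightharpoonup> 'a"
  assumes f: "f \<in> conf" and x: "x \<in> dom f" shows "conformal_at f x (conf_deriv f x)"
proof -
  obtain L where "conformal_at f x L"
    using bspec[OF conf_C1[OF f, unfolded C1_conformal_def] x] unfolding conformal_at_def by blast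
  then show ?thesis using conformal_at_deriv[OF conf_open_at[OF f x] x] by metis
qed

context
  fixes F :: "nat \<Rightarrow> 'a::{complete_space, perfect_space} \<rightharpoonup> 'a"
  assumes F: "conf_seq F"
begin

lemma iter_seq_continuous: "continuous_on (dom (iter_seq F t n)) (\<lambda>x. orb F t n x)"
proof (induction n)
  case (Suc n)
  then show ?case
    unfolding iter_seq.simps by (rule continuous_on_map_comp[OF _ conf_continuous[OF conf_seqD[OF F]]])
qed (simp add: continuous_on_id)

lemma iter_seq_closed: "closed (dom (iter_seq F t n))"
proof (induction n)
  case (Suc n)
  have "closed (dom (iter_seq F t n) \<inter> (\<lambda>x. orb F t n x) -` dom (F (t + Suc n)))"
    using continuous_on_closed_vimage[OF Suc, THEN iffD1, OF iter_seq_continuous]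
      conf_dom_closed[OF conf_seqD[OF F, of t n]] by (simp add: Int_commute)
  moreover have "dom (iter_seq F t n) \<inter> (\<lambda>x. orb F t n x) -` dom (F (t + Suc n)) = dom (iter_seq F t (Suc n))"
    by (rule set_eqI) (simp only: Int_iff vimage_eq iter_seq_dom_Suc)
  ultimately show ?case by simp
qed simp

lemma iter_deriv_ge: "x \<in> dom (iter_seq F t n) \<Longrightarrow> \<beta> ^ n \<le> iter_deriv F t n x"
proof (induction n)
  case (Suc n)
  note x = Suc.prems[unfolded iter_seq_dom_Suc]
  have "\<beta> * \<beta> ^ n \<le> conf_deriv (F (t + Suc n)) (orb F t n x) * iter_deriv F t n x"
    by (rule mult_mono[OF conf_deriv_ge[OF conf_seqD[OF F] conjunct2[OF x]] Suc.IH[OF conjunct1[OF x]]])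
       (use \<beta>_gt_1 conf_deriv_pos[OF conf_seqD[OF F] conjunct2[OF x]] in auto)
  then show ?case by (simp add: iter_deriv_Suc)
qed simp

lemma iter_deriv_pos: "x \<in> dom (iter_seq F t n) \<Longrightarrow> 0 < iter_deriv F t n x"
  using iter_deriv_ge[of x t n] \<beta>_gt_1 by (smt (verit) zero_less_power)

lemma iter_seq_conformal:
  "x \<in> dom (iter_seq F t n) \<Longrightarrow> open_at (iter_seq F t n) x \<and> conformal_at (iter_seq F t n) x (iter_deriv F t n x)"
proof (induction n)
  case 0
  have "eventually (\<lambda>p. diff_quot Some p = 1) (offdiag_at Some x)"
    unfolding offdiag_at_def eventually_at_filter by (rule always_eventually) (auto simp: diff_quot_def)
  then have "conformal_at Some x 1" unfolding conformal_at_def by (rule tendsto_eventually)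
  moreover have "open_at Some x" unfolding open_at_def by auto
  ultimately show ?case by simp
next
  case (Suc n)
  note x = Suc.prems[unfolded iter_seq_dom_Suc]
  note IH = Suc.IH[OF conjunct1[OF x]]
  note Fn = conf_seqD[OF F, of t n]
  have "open_at (F (t + Suc n) \<circ>\<^sub>m iter_seq F t n) x"
    by (rule open_at_comp[OF conjunct1[OF IH] conf_open_at[OF Fn conjunct2[OF x]] conjunct1[OF x]])
  moreover have "conformal_at (F (t + Suc n) \<circ>\<^sub>m iter_seq F t n) x
      (conf_deriv (F (t + Suc n)) (orb F t n x) * iter_deriv F t n x)"
    by (rule conformal_at_comp[OF conjunct2[OF IH] iter_deriv_pos iter_seq_continuous
          conf_conformal_at[OF Fn conjunct2[OF x]]]) (rule conjunct1[OF x])+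
  ultimately show ?case by (simp add: iter_deriv_Suc)
qed

lemma conf_deriv_iter_seq:
  "x \<in> dom (iter_seq F t n) \<Longrightarrow> conf_deriv (iter_seq F t n) x = iter_deriv F t n x"
  using iter_seq_conformal[of x t n] conformal_at_deriv by blast

lemma iter_fibre_Suc: "fibre (iter_seq F t (Suc n)) y = (\<Union>z\<in>fibre (F (t + Suc n)) y. fibre (iter_seq F t n) z)"
  by (auto simp: fibre_iff iter_seq_Suc_iff simp del: iter_seq.simps)

lemma iter_fibre_add: "fibre (iter_seq F t (m + n)) y = (\<Union>z\<in>fibre (iter_seq F (t + m) n) y. fibre (iter_seq F t m) z)"
  by (auto simp: fibre_iff iter_seq_add_iff)

lemma iter_fibre_finite: "finite (fibre (iter_seq F t n) y)"
proof (induction n arbitrary: y)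
  case 0
  have "fibre (iter_seq F t 0) y = {y}" by (auto simp: fibre_iff)
  then show ?case by simp
next
  case (Suc n)
  then show ?case unfolding iter_fibre_Suc using conf_fibre_finite[OF conf_seqD[OF F]] by blast
qed

lemma iter_fibre_nonempty: "fibre (iter_seq F t n) y \<noteq> {}"
proof (induction n arbitrary: y)
  case 0
  have "fibre (iter_seq F t 0) y = {y}" by (auto simp: fibre_iff)
  then show ?case by simp
next
  case (Suc n)
  then show ?case unfolding iter_fibre_Suc using conf_fibre_nonempty[OF conf_seqD[OF F], of t n y] by blast
qed

end

end

section \<open>Bounded distortion along parallel orbits\<close>

text \<open>
  Fibres of iterates are trees. If a relation \<open>C\<close> between base points can always be
  continued to a pairing of the one-step fibres that again satisfies \<open>C\<close>, the
  pairings of the levels combine to a bijection between the trees. It is used for two points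
  under the same maps and for the same point under two sequences of maps.
\<close>

lemma fibre_iter_pairing:
  assumes step: "\<And>k z z'. t \<le> k \<Longrightarrow> k < t + n \<Longrightarrow> C z z' \<Longrightarrow>
      \<exists>\<pi>. bij_betw \<pi> (fibre (F (Suc k)) z) (fibre (G (Suc k)) z') \<and>
          (\<forall>x\<in>fibre (F (Suc k)) z. C x (\<pi> x) \<and> R k x (\<pi> x))"
    and "C y w"
  shows "\<exists>\<psi>. bij_betw \<psi> (fibre (iter_seq F t n) y) (fibre (iter_seq G t n) w) \<and>
    (\<forall>x\<in>fibre (iter_seq F t n) y. \<forall>j\<le>n. C (orb F t j x) (orb G t j (\<psi> x)) \<and>
        (j < n \<longrightarrow> R (t + j) (orb F t j x) (orb G t j (\<psi> x))))"
  using assms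
proof (induction n arbitrary: y w)
  case 0
  have "fibre (iter_seq F t 0) y = {y}" "fibre (iter_seq G t 0) w = {w}" by (auto simp: fibre_iff)
  then show ?case using 0(2) by (intro exI[of _ "\<lambda>_. w"]) (auto simp: bij_betw_def)
next
  case (Suc n)
  have IH: "\<exists>\<psi>. bij_betw \<psi> (fibre (iter_seq F t n) y) (fibre (iter_seq G t n) w) \<and>
    (\<forall>x\<in>fibre (iter_seq F t n) y. \<forall>j\<le>n. C (orb F t j x) (orb G t j (\<psi> x)) \<and>
        (j < n \<longrightarrow> R (t + j) (orb F t j x) (orb G t j (\<psi> x))))" if "C y w" for y w
    by (rule Suc.IH[OF Suc.prems(1) that]) simp_all
  let ?f = "F (Suc (t + n))" and ?g = "G (Suc (t + n))"
  obtain \<pi> where \<pi>: "bij_betw \<pi> (fibre ?f y) (fibre ?g w)"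
    and \<pi>C: "\<forall>x\<in>fibre ?f y. C x (\<pi> x) \<and> R (t + n) x (\<pi> x)"
    using Suc.prems(1)[of "t + n" y w] Suc.prems(2) by auto
  have "\<forall>z\<in>fibre ?f y. \<exists>\<psi>. bij_betw \<psi> (fibre (iter_seq F t n) z) (fibre (iter_seq G t n) (\<pi> z)) \<and>
    (\<forall>x\<in>fibre (iter_seq F t n) z. \<forall>j\<le>n. C (orb F t j x) (orb G t j (\<psi> x)) \<and>
        (j < n \<longrightarrow> R (t + j) (orb F t j x) (orb G t j (\<psi> x))))"
    using IH \<pi>C by blast
  from bchoice[OF this] obtain \<psi> where \<psi>: "\<forall>z\<in>fibre ?f y.
      bij_betw (\<psi> z) (fibre (iter_seq F t n) z) (fibre (iter_seq G t n) (\<pi> z)) \<and>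
    (\<forall>x\<in>fibre (iter_seq F t n) z. \<forall>j\<le>n. C (orb F t j x) (orb G t j (\<psi> z x)) \<and>
        (j < n \<longrightarrow> R (t + j) (orb F t j x) (orb G t j (\<psi> z x))))" by blast
  define \<phi> where "\<phi> = (\<lambda>x. \<psi> (orb F t n x) x)"
  have fibF: "fibre (iter_seq F t (Suc n)) y = (\<Union>z\<in>fibre ?f y. fibre (iter_seq F t n) z)"
    by (auto simp: fibre_iff iter_seq_Suc_iff simp del: iter_seq.simps)
  have "fibre (iter_seq G t (Suc n)) w = (\<Union>z\<in>fibre ?g w. fibre (iter_seq G t n) z)"
    by (auto simp: fibre_iff iter_seq_Suc_iff simp del: iter_seq.simps)
  also have "\<dots> = (\<Union>z\<in>fibre ?f y. fibre (iter_seq G t n) (\<pi> z))"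
    using bij_betw_imp_surj_on[OF \<pi>] by (metis image_image)
  finally have fibG: "fibre (iter_seq G t (Suc n)) w = (\<Union>z\<in>fibre ?f y. fibre (iter_seq G t n) (\<pi> z))" .
  have on: "orb F t n x = z" if "x \<in> fibre (iter_seq F t n) z" for x z
    using that by (simp add: fibre_iff)
  have "bij_betw \<phi> (\<Union>z\<in>fibre ?f y. fibre (iter_seq F t n) z) (\<Union>z\<in>fibre ?f y. fibre (iter_seq G t n) (\<pi> z))"
  proof (rule bij_betw_UNION_disjoint)
    show "disjoint_family_on (\<lambda>z. fibre (iter_seq G t n) (\<pi> z)) (fibre ?f y)"
    proof (unfold disjoint_family_on_def, intro ballI impI)
      fix a b assume ab: "a \<in> fibre ?f y" "b \<in> fibre ?f y" "a \<noteq> b"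
      then have "\<pi> a \<noteq> \<pi> b" using \<pi> by (meson bij_betw_def inj_onD)
      then show "fibre (iter_seq G t n) (\<pi> a) \<inter> fibre (iter_seq G t n) (\<pi> b) = {}"
        by (auto simp: fibre_iff)
    qed
    fix z assume z: "z \<in> fibre ?f y"
    have "bij_betw (\<psi> z) (fibre (iter_seq F t n) z) (fibre (iter_seq G t n) (\<pi> z))" using \<psi> z by blast
    then show "bij_betw \<phi> (fibre (iter_seq F t n) z) (fibre (iter_seq G t n) (\<pi> z))"
      by (rule bij_betw_cong[THEN iffD1, rotated]) (simp add: \<phi>_def on)
  qed
  moreover have "C (orb F t j x) (orb G t j (\<phi> x)) \<and>
        (j < Suc n \<longrightarrow> R (t + j) (orb F t j x) (orb G t j (\<phi> x)))"
    if x: "x \<in> fibre (iter_seq F t (Suc n)) y" and j: "j \<le> Suc n" for x j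
  proof -
    from x obtain z where z: "z \<in> fibre ?f y" "x \<in> fibre (iter_seq F t n) z" unfolding fibF by blast
    have \<phi>x: "\<phi> x = \<psi> z x" by (simp add: \<phi>_def on[OF z(2)])
    have "\<psi> z x \<in> fibre (iter_seq G t n) (\<pi> z)" using \<psi> z by (meson bij_betwE)
    then have orbG: "orb G t n (\<phi> x) = \<pi> z" unfolding \<phi>x by (simp add: fibre_iff)
    have Gx: "\<phi> x \<in> fibre (iter_seq G t (Suc n)) w"
      unfolding fibG \<phi>x using \<open>\<psi> z x \<in> _\<close> z(1) by blast
    consider "j < n" | "j = n" | "j = Suc n" using j by linarith
    then show ?thesis
    proof cases
      case 1
      then show ?thesis using \<psi> z unfolding \<phi>x by auto
    next
      case 2
      then show ?thesis using \<pi>C z(1) by (simp add: orbG on[OF z(2)])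
    next
      case 3
      have "orb F t (Suc n) x = y" "orb G t (Suc n) (\<phi> x) = w"
        using x Gx unfolding fibre_iff by simp_all
      then show ?thesis using 3 Suc.prems(2) by (simp del: iter_seq.simps)
    qed
  qed
  ultimately show ?case unfolding fibF fibG by (intro exI[of _ \<phi>] conjI ballI allI impI) (blast+)
qed

context conf_params
begin

text \<open>
  The point \<open>u\<close> follows \<open>x\<close> for \<open>n\<close> steps along the same
  inverse branches. The image condition is stated after each step and not at time zero, so that
  orbit segments can be concatenated.
\<close>

definition close :: "(nat \<Rightarrow> 'a::metric_space \<rightharpoonup> 'a) \<Rightarrow> nat \<Rightarrow> nat \<Rightarrow> 'a \<Rightarrow> 'a \<Rightarrow> bool" where
  "close F t n x u \<longleftrightarrow> x \<in> dom (iter_seq F t n) \<and> u \<in> dom (iter_seq F t n) \<and>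
     (\<forall>j<n. dist (orb F t j u) (orb F t j x) < rad (F (t + Suc j)) (orb F t j x) \<and>
            dist (orb F t (Suc j) u) (orb F t (Suc j) x) < \<Delta>)"

text \<open>
  Orbits that end at distance less than \<open>\<Delta>\<close> were at distance less than
  \<open>\<Delta> / \<beta>\<^sup>i\<close> when \<open>i\<close> steps were left. Since
  \<open>\<epsilon>\<close> may fail to be summable along geometric sequences, these sums, which
  bound the distortion of an \<open>n\<close>-fold iterate, may be unbounded.
\<close>

definition distortion_sum :: "nat \<Rightarrow> real" where
  "distortion_sum n = (\<Sum>i<n. \<epsilon> (\<Delta> / \<beta> ^ i))"

lemma distortion_sum_nonneg: "0 \<le> distortion_sum n"
  unfolding distortion_sum_def using \<Delta>_pos \<beta>_gt_1 by (intro sum_nonneg \<epsilon>_nonneg) simp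

lemma distortion_sum_mono: "m \<le> n \<Longrightarrow> distortion_sum m \<le> distortion_sum n"
  unfolding distortion_sum_def using \<Delta>_pos \<beta>_gt_1 by (intro sum_mono2 \<epsilon>_nonneg) auto

text \<open>
  The terms tend to zero, hence so do their averages.
\<close>

lemma distortion_sum_sublinear: "(\<lambda>n. distortion_sum n / real n) \<longlonglongrightarrow> 0"
proof (rule tendstoI)
  fix e :: real assume e: "e > 0"
  obtain d where d: "0 < d" "\<epsilon> d < e / 2" using \<epsilon>_small[of "e / 2"] e by auto
  obtain N where N: "\<Delta> / d < \<beta> ^ N" using real_arch_pow[OF \<beta>_gt_1] by blast
  have small: "\<epsilon> (\<Delta> / \<beta> ^ i) \<le> e / 2" if "i \<ge> N" for i
  proof -
    have "\<Delta> / d < \<beta> ^ i" using N power_increasing[OF that, of \<beta>] \<beta>_gt_1 by linarith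
    then have "\<Delta> / \<beta> ^ i \<le> d" using d \<beta>_gt_1 by (simp add: field_simps)
    then have "\<epsilon> (\<Delta> / \<beta> ^ i) \<le> \<epsilon> d" using \<Delta>_pos \<beta>_gt_1 by (intro \<epsilon>_mono) auto
    then show ?thesis using d by linarith
  qed
  have le: "distortion_sum n \<le> distortion_sum N + e / 2 * real n" for n
  proof (induction n)
    case 0
    then show ?case using distortion_sum_nonneg[of N] by (simp add: distortion_sum_def)
  next
    case (Suc n)
    show ?case
    proof (cases "n < N")
      case True
      then have "distortion_sum (Suc n) \<le> distortion_sum N"
        unfolding distortion_sum_def using \<Delta>_pos \<beta>_gt_1 by (intro sum_mono2 \<epsilon>_nonneg) auto
      then show ?thesis using e by (simp add: add_increasing2)
    next
      case False
      then show ?thesis using small[of n] Suc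
        by (simp add: distortion_sum_def algebra_simps add_divide_distrib)
    qed
  qed
  have "eventually (\<lambda>n. distortion_sum N / real n < e / 2) sequentially"
    using e by (intro order_tendstoD(2)[OF lim_const_over_n]) auto
  then show "eventually (\<lambda>n. dist (distortion_sum n / real n) 0 < e) sequentially"
    using eventually_gt_at_top[of 0]
  proof eventually_elim
    case (elim n)
    have "distortion_sum n / real n \<le> (distortion_sum N + e / 2 * real n) / real n"
      by (rule divide_right_mono[OF le]) simp
    also have "\<dots> = distortion_sum N / real n + e / 2" using elim by (simp add: add_divide_distrib)
    also have "\<dots> < e" using elim(1) by linarith
    finally show ?case using distortion_sum_nonneg[of n] by (simp add: dist_real_def)
  qed
qed

context
  fixes F :: "nat \<Rightarrow> 'a::{complete_space, perfect_space} \<rightharpoonup> 'a"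
  assumes F: "conf_seq F"
begin

lemma closeD:
  assumes "close F t n x u"
  shows "x \<in> dom (iter_seq F t n)" "u \<in> dom (iter_seq F t n)"
    and "j < n \<Longrightarrow> dist (orb F t j u) (orb F t j x) < rad (F (t + Suc j)) (orb F t j x)"
    and "j < n \<Longrightarrow> dist (orb F t (Suc j) u) (orb F t (Suc j) x) < \<Delta>"
  using assms unfolding close_def by (simp_all del: iter_seq.simps)

lemma close_step:
  assumes c: "close F t n x u" and j: "j < n"
  defines "e \<equiv> \<epsilon> (dist (orb F t (Suc j) u) (orb F t (Suc j) x))"
  shows "\<beta> * dist (orb F t j u) (orb F t j x) \<le> dist (orb F t (Suc j) u) (orb F t (Suc j) x)"
    and "dist (orb F t j u) (orb F t j x) * conf_deriv (F (t + Suc j)) (orb F t j x)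
           \<le> exp e * dist (orb F t (Suc j) u) (orb F t (Suc j) x)"
    and "dist (orb F t (Suc j) u) (orb F t (Suc j) x)
           \<le> exp e * conf_deriv (F (t + Suc j)) (orb F t j x) * dist (orb F t j u) (orb F t j x)"
    and "\<bar>ln (conf_deriv (F (t + Suc j)) (orb F t j u)) - ln (conf_deriv (F (t + Suc j)) (orb F t j x))\<bar> \<le> e"
proof -
  have dx: "orb F t j x \<in> dom (F (t + Suc j))" and du: "orb F t j u \<in> dom (F (t + Suc j))"
    by (rule iter_seq_step_dom[OF closeD(1)[OF c] j], rule iter_seq_step_dom[OF closeD(2)[OF c] j])
  have x: "x \<in> dom (iter_seq F t j)" and u: "u \<in> dom (iter_seq F t j)"
    by (rule iter_seq_dom_mono[OF closeD(1)[OF c]], use j in simp,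
        rule iter_seq_dom_mono[OF closeD(2)[OF c]], use j in simp)
  note f = conf_seqD[OF F, of t j]
  note r = closeD(3)[OF c j] and d = closeD(4)[OF c j, unfolded orb_Suc[OF x] orb_Suc[OF u]]
  show "\<beta> * dist (orb F t j u) (orb F t j x) \<le> dist (orb F t (Suc j) u) (orb F t (Suc j) x)"
    unfolding orb_Suc[OF x] orb_Suc[OF u] by (rule branch_expands[OF f du dx r])
  show "dist (orb F t j u) (orb F t j x) * conf_deriv (F (t + Suc j)) (orb F t j x)
           \<le> exp e * dist (orb F t (Suc j) u) (orb F t (Suc j) x)"
    "dist (orb F t (Suc j) u) (orb F t (Suc j) x)
           \<le> exp e * conf_deriv (F (t + Suc j)) (orb F t j x) * dist (orb F t j u) (orb F t j x)"
    unfolding e_def orb_Suc[OF x] orb_Suc[OF u] by (rule branch_dist_bounds[OF f dx du r d])+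
  show "\<bar>ln (conf_deriv (F (t + Suc j)) (orb F t j u)) - ln (conf_deriv (F (t + Suc j)) (orb F t j x))\<bar> \<le> e"
    unfolding e_def orb_Suc[OF x] orb_Suc[OF u] by (rule branch_distortion[OF f dx du r d])
qed

lemma close_contract:
  assumes c: "close F t n x u" and "j \<le> n"
  shows "dist (orb F t j u) (orb F t j x) * \<beta> ^ (n - j) \<le> dist (orb F t n u) (orb F t n x)"
  using assms(2)
proof (induction rule: inc_induct)
  case (step j)
  have "\<beta> ^ (n - j) = \<beta> * \<beta> ^ (n - Suc j)" using step(2) by (metis Suc_diff_Suc power_Suc)
  then have "dist (orb F t j u) (orb F t j x) * \<beta> ^ (n - j)
      = (\<beta> * dist (orb F t j u) (orb F t j x)) * \<beta> ^ (n - Suc j)" by simp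
  also have "\<dots> \<le> dist (orb F t (Suc j) u) (orb F t (Suc j) x) * \<beta> ^ (n - Suc j)"
    using close_step(1)[OF c step(2)] \<beta>_gt_1 by (intro mult_right_mono) auto
  finally show ?case using step(3) by (rule order_trans)
qed simp

lemma close_eq:
  assumes c: "close F t n x u" and eq: "orb F t n u = orb F t n x" shows "u = x"
proof -
  have "dist u x * \<beta> ^ n \<le> 0" using close_contract[OF c, of 0] eq by simp
  moreover have "0 < \<beta> ^ n" using \<beta>_gt_1 by simp
  ultimately have "dist u x \<le> 0" by (simp add: mult_le_0_iff)
  then show ?thesis by simp
qed

lemma close_dist_le:
  assumes c: "close F t n x u" and "j < n"
  shows "dist (orb F t (Suc j) u) (orb F t (Suc j) x) \<le> \<Delta> / \<beta> ^ (n - Suc j)"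
proof -
  have "n - 1 < n" using assms by simp
  then have "dist (orb F t n u) (orb F t n x) < \<Delta>"
    using closeD(4)[OF c, of "n - 1"] by (simp del: iter_seq.simps)
  then show ?thesis
    using close_contract[OF c, of "Suc j"] assms(2) \<beta>_gt_1 by (simp add: field_simps del: iter_seq.simps)
qed

lemma close_error_sum:
  assumes c: "close F t n x u"
  shows "(\<Sum>j<n. \<epsilon> (dist (orb F t (Suc j) u) (orb F t (Suc j) x))) \<le> distortion_sum n"
proof -
  have "(\<Sum>j<n. \<epsilon> (dist (orb F t (Suc j) u) (orb F t (Suc j) x))) \<le> (\<Sum>j<n. \<epsilon> (\<Delta> / \<beta> ^ (n - Suc j)))"
    by (intro sum_mono \<epsilon>_mono close_dist_le[OF c]) auto
  also have "\<dots> = distortion_sum n"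
    using sum.nat_diff_reindex[of "\<lambda>i. \<epsilon> (\<Delta> / \<beta> ^ i)" n] by (simp add: distortion_sum_def)
  finally show ?thesis .
qed

lemma ln_iter_deriv:
  assumes "x \<in> dom (iter_seq F t n)"
  shows "ln (iter_deriv F t n x) = (\<Sum>j<n. ln (conf_deriv (F (t + Suc j)) (orb F t j x)))"
  unfolding iter_deriv_def
proof (rule ln_prod)
  fix j assume "j \<in> {..<n}"
  then show "conf_deriv (F (t + Suc j)) (orb F t j x) \<noteq> 0"
    by (intro less_imp_neq[symmetric] conf_deriv_pos[OF conf_seqD[OF F]] iter_seq_step_dom[OF assms]) simp
qed simp

lemma close_iter_deriv:
  assumes c: "close F t n x u"
  shows "\<bar>ln (iter_deriv F t n u) - ln (iter_deriv F t n x)\<bar> \<le> distortion_sum n"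
proof -
  have "\<bar>ln (iter_deriv F t n u) - ln (iter_deriv F t n x)\<bar> =
    \<bar>\<Sum>j<n. ln (conf_deriv (F (t + Suc j)) (orb F t j u)) - ln (conf_deriv (F (t + Suc j)) (orb F t j x))\<bar>"
    by (simp add: ln_iter_deriv closeD(1,2)[OF c] sum_subtractf del: iter_seq.simps)
  also have "\<dots> \<le> (\<Sum>j<n. \<epsilon> (dist (orb F t (Suc j) u) (orb F t (Suc j) x)))"
    by (rule order_trans[OF sum_abs]) (intro sum_mono close_step(4)[OF c], simp)
  also note close_error_sum[OF c]
  finally show ?thesis .
qed

lemma close_iter_deriv_le:
  assumes c: "close F t n x u"
  shows "iter_deriv F t n u \<le> exp (distortion_sum n) * iter_deriv F t n x"
    and "iter_deriv F t n x \<le> exp (distortion_sum n) * iter_deriv F t n u"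
proof -
  note pos = iter_deriv_pos[OF F closeD(1)[OF c]] iter_deriv_pos[OF F closeD(2)[OF c]]
  have *: "p \<le> exp e * q" if "ln p - ln q \<le> e" "p > 0" "q > 0" for p q e :: real
  proof -
    have "ln p \<le> ln (exp e * q)" using that by (simp add: ln_mult)
    then show ?thesis using that by simp
  qed
  show "iter_deriv F t n u \<le> exp (distortion_sum n) * iter_deriv F t n x"
    "iter_deriv F t n x \<le> exp (distortion_sum n) * iter_deriv F t n u"
    by (rule *; use close_iter_deriv[OF c] pos in linarith)+
qed

text \<open>
  Multiplying the one-step estimates: along parallel orbits the iterate expands distances by its
  derivative, up to the distortion.
\<close>

lemma close_dist_bounds:
  assumes c: "close F t n x u"
  shows "dist u x * iter_deriv F t n x \<le> exp (distortion_sum n) * dist (orb F t n u) (orb F t n x)"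
    and "dist (orb F t n u) (orb F t n x) \<le> exp (distortion_sum n) * iter_deriv F t n x * dist u x"
proof -
  define e where "e = (\<lambda>j. \<epsilon> (dist (orb F t (Suc j) u) (orb F t (Suc j) x)))"
  have "dist u x * iter_deriv F t m x \<le> exp (\<Sum>j<m. e j) * dist (orb F t m u) (orb F t m x) \<and>
     dist (orb F t m u) (orb F t m x) \<le> exp (\<Sum>j<m. e j) * iter_deriv F t m x * dist u x" if "m \<le> n" for m
    using that
  proof (induction m)
    case (Suc m)
    then have m: "m < n" and IH: "dist u x * iter_deriv F t m x \<le> exp (\<Sum>j<m. e j) * dist (orb F t m u) (orb F t m x)"
     "dist (orb F t m u) (orb F t m x) \<le> exp (\<Sum>j<m. e j) * iter_deriv F t m x * dist u x" by auto
    let ?c = "conf_deriv (F (t + Suc m)) (orb F t m x)"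
    have c0: "0 \<le> ?c"
      using conf_deriv_pos[OF conf_seqD[OF F] iter_seq_step_dom[OF closeD(1)[OF c] m]] by simp
    have "dist u x * iter_deriv F t (Suc m) x = ?c * (dist u x * iter_deriv F t m x)"
      by (simp add: iter_deriv_Suc)
    also have "\<dots> \<le> ?c * (exp (\<Sum>j<m. e j) * dist (orb F t m u) (orb F t m x))"
      by (rule mult_left_mono[OF IH(1) c0])
    also have "\<dots> = exp (\<Sum>j<m. e j) * (dist (orb F t m u) (orb F t m x) * ?c)" by simp
    also have "\<dots> \<le> exp (\<Sum>j<m. e j) * (exp (e m) * dist (orb F t (Suc m) u) (orb F t (Suc m) x))"
      unfolding e_def by (rule mult_left_mono[OF close_step(2)[OF c m]]) simp
    finally have 1: "dist u x * iter_deriv F t (Suc m) x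
        \<le> exp (\<Sum>j<Suc m. e j) * dist (orb F t (Suc m) u) (orb F t (Suc m) x)"
      by (simp add: exp_add mult_ac del: iter_seq.simps)
    have "dist (orb F t (Suc m) u) (orb F t (Suc m) x) \<le> exp (e m) * ?c * dist (orb F t m u) (orb F t m x)"
      unfolding e_def by (rule close_step(3)[OF c m])
    also have "\<dots> \<le> exp (e m) * ?c * (exp (\<Sum>j<m. e j) * iter_deriv F t m x * dist u x)"
      by (rule mult_left_mono[OF IH(2)]) (rule mult_nonneg_nonneg[OF exp_ge_zero c0])
    finally have "dist (orb F t (Suc m) u) (orb F t (Suc m) x)
        \<le> exp (\<Sum>j<Suc m. e j) * iter_deriv F t (Suc m) x * dist u x"
      by (simp add: exp_add iter_deriv_Suc mult_ac del: iter_seq.simps)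
    with 1 show ?case ..
  qed simp
  from this[OF order_refl] have
    b: "dist u x * iter_deriv F t n x \<le> exp (\<Sum>j<n. e j) * dist (orb F t n u) (orb F t n x)"
     "dist (orb F t n u) (orb F t n x) \<le> exp (\<Sum>j<n. e j) * (iter_deriv F t n x * dist u x)" by auto
  have e: "exp (\<Sum>j<n. e j) \<le> exp (distortion_sum n)"
    using close_error_sum[OF c] by (simp add: e_def del: iter_seq.simps)
  show "dist u x * iter_deriv F t n x \<le> exp (distortion_sum n) * dist (orb F t n u) (orb F t n x)"
    by (rule order_trans[OF b(1) mult_right_mono[OF e]]) simp
  show "dist (orb F t n u) (orb F t n x) \<le> exp (distortion_sum n) * iter_deriv F t n x * dist u x"
    unfolding mult.assoc
    by (rule order_trans[OF b(2) mult_right_mono[OF e]])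
       (use iter_deriv_pos[OF F closeD(1)[OF c]] in simp)
qed

lemma close_add:
  assumes a: "close F t m x u" and b: "close F (t + m) n (orb F t m x) (orb F t m u)"
  shows "close F t (m + n) x u"
proof -
  note xm = closeD(1)[OF a] and um = closeD(2)[OF a]
  have "dist (orb F t j u) (orb F t j x) < rad (F (t + Suc j)) (orb F t j x) \<and>
            dist (orb F t (Suc j) u) (orb F t (Suc j) x) < \<Delta>" if j: "j < m + n" for j
  proof (cases "j < m")
    case True
    then show ?thesis using closeD(3,4)[OF a] by blast
  next
    case False
    then obtain i where i: "j = m + i" "i < n" using j by (metis add_less_cancel_left le_add_diff_inverse not_less)
    have "Suc j = m + Suc i" using i by simp
    then show ?thesis
      using closeD(3,4)[OF b i(2)] unfolding i(1) orb_add[OF xm, symmetric] orb_add[OF um, symmetric]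
      by (simp add: add.assoc del: iter_seq.simps)
  qed
  then show ?thesis
    unfolding close_def iter_seq_dom_add using xm um closeD(1,2)[OF b] by blast
qed

lemma fibre_pairing_iter:
  assumes "dist w y < \<Delta>"
  obtains \<psi> where "bij_betw \<psi> (fibre (iter_seq F t n) y) (fibre (iter_seq F t n) w)"
    "\<And>x. x \<in> fibre (iter_seq F t n) y \<Longrightarrow> close F t n x (\<psi> x)"
proof -
  have "\<exists>\<psi>. bij_betw \<psi> (fibre (iter_seq F t n) y) (fibre (iter_seq F t n) w) \<and>
    (\<forall>x\<in>fibre (iter_seq F t n) y. \<forall>j\<le>n. dist (orb F t j (\<psi> x)) (orb F t j x) < \<Delta> \<and>
        (j < n \<longrightarrow> dist (orb F t j (\<psi> x)) (orb F t j x) < rad (F (Suc (t + j))) (orb F t j x)))"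
  proof (rule fibre_iter_pairing[where C = "\<lambda>x u. dist u x < \<Delta>" and R = "\<lambda>k x u. dist u x < rad (F (Suc k)) x"])
    fix k and z z' :: 'a assume "t \<le> k" "k < t + n" and d: "dist z' z < \<Delta>"
    have f: "F (Suc k) \<in> conf" using conf_seqD[OF F, of 0 k] by simp
    obtain \<pi> where \<pi>: "bij_betw \<pi> (fibre (F (Suc k)) z) (fibre (F (Suc k)) z')"
      "\<And>x. x \<in> fibre (F (Suc k)) z \<Longrightarrow> dist (\<pi> x) x < rad (F (Suc k)) x"
      using fibre_pairing[OF f, of z z'] d by (auto simp: dist_commute)
    have "dist (\<pi> x) x < \<Delta>" if "x \<in> fibre (F (Suc k)) z" for x
      using \<pi>(2)[OF that] rad_le[OF f, of x] that by (force simp: fibre_iff)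
    then show "\<exists>\<pi>. bij_betw \<pi> (fibre (F (Suc k)) z) (fibre (F (Suc k)) z') \<and>
          (\<forall>x\<in>fibre (F (Suc k)) z. dist (\<pi> x) x < \<Delta> \<and> dist (\<pi> x) x < rad (F (Suc k)) x)"
      using \<pi> by blast
  qed (use assms in simp)
  then obtain \<psi> where \<psi>: "bij_betw \<psi> (fibre (iter_seq F t n) y) (fibre (iter_seq F t n) w)"
    and c: "\<forall>x\<in>fibre (iter_seq F t n) y. \<forall>j\<le>n. dist (orb F t j (\<psi> x)) (orb F t j x) < \<Delta> \<and>
        (j < n \<longrightarrow> dist (orb F t j (\<psi> x)) (orb F t j x) < rad (F (Suc (t + j))) (orb F t j x))"
    by (elim exE conjE)
  have "close F t n x (\<psi> x)" if x: "x \<in> fibre (iter_seq F t n) y" for x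
  proof -
    have "\<psi> x \<in> fibre (iter_seq F t n) w" using bij_betwE[OF \<psi>] x by blast
    then have "x \<in> dom (iter_seq F t n)" "\<psi> x \<in> dom (iter_seq F t n)"
      using x by (auto simp: fibre_iff)
    moreover have "dist (orb F t j (\<psi> x)) (orb F t j x) < rad (F (t + Suc j)) (orb F t j x) \<and>
            dist (orb F t (Suc j) (\<psi> x)) (orb F t (Suc j) x) < \<Delta>" if j: "j < n" for j
      using bspec[OF c x, THEN spec, of j] bspec[OF c x, THEN spec, of "Suc j"] j
      by (simp del: iter_seq.simps)
    ultimately show ?thesis unfolding close_def by blast
  qed
  with \<psi> show ?thesis by (rule that)
qed

end

end

section \<open>Partition sums\<close>

definition psum :: "real \<Rightarrow> (nat \<Rightarrow> 'a::metric_space \<rightharpoonup> 'a) \<Rightarrow> nat \<Rightarrow> nat \<Rightarrow> 'a \<Rightarrow> real" where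
  "psum s F t n y = (\<Sum>x\<in>fibre (iter_seq F t n) y. iter_deriv F t n x powr (- s))"

definition pinf :: "real \<Rightarrow> (nat \<Rightarrow> 'a::metric_space \<rightharpoonup> 'a) \<Rightarrow> nat \<Rightarrow> nat \<Rightarrow> real" where
  "pinf s F t n = (INF y. psum s F t n y)"

definition log_norm_sum :: "(nat \<Rightarrow> 'a::metric_space \<rightharpoonup> 'a) \<Rightarrow> nat \<Rightarrow> nat \<Rightarrow> real" where
  "log_norm_sum F t n = (\<Sum>j<n. ln (norm_D (F (t + Suc j))))"

lemma psum_nonneg: "0 \<le> psum s F t n y"
  unfolding psum_def by (intro sum_nonneg) simp

lemma psum_bdd_below: "bdd_below (range (psum s F t n))"
  by (rule bdd_belowI2[where m = 0]) (rule psum_nonneg)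

lemma pinf_le: "pinf s F t n \<le> psum s F t n y"
  unfolding pinf_def by (rule cINF_lower[OF psum_bdd_below]) simp

lemma pinf_greatest: "(\<And>y. c \<le> psum s F t n y) \<Longrightarrow> c \<le> pinf s F t n"
  unfolding pinf_def by (rule cINF_greatest) auto

lemma pinf_near: 
  assumes "pinf s F t n < c"
  obtains y where "psum s F t n y < c"
  using assms unfolding pinf_def by (subst (asm) cINF_less_iff) (auto intro: psum_bdd_below)

lemma log_norm_sum_add: "log_norm_sum F t (m + n) = log_norm_sum F t m + log_norm_sum F (t + m) n"
  by (induction n) (auto simp: log_norm_sum_def add.assoc)

lemma powr_neg_mono: "0 < a \<Longrightarrow> a \<le> b \<Longrightarrow> 0 \<le> s \<Longrightarrow> b powr (- s) \<le> a powr (- s)" for a b s :: real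
  by (rule powr_mono2') auto

lemma exp_powr_mult: "exp c powr (- s) = exp (- (s * c))" for c s :: real
  by (simp add: powr_def)

context conf_params
begin

lemma norm_D_ge: "f \<in> conf \<Longrightarrow> x \<in> dom f \<Longrightarrow> conf_deriv f x \<le> norm_D f"
  unfolding norm_D_def by (rule cSUP_upper[OF _ conf_deriv_bounded])

lemma norm_D_ge_\<beta>: "f \<in> conf \<Longrightarrow> \<beta> \<le> norm_D f"
proof -
  assume f: "f \<in> conf"
  then obtain x where x: "x \<in> dom f" using conf_dom_nonempty[OF f] by (meson ex_in_conv)
  show ?thesis using conf_deriv_ge[OF f x] norm_D_ge[OF f x] by linarith
qed

lemma norm_inv_D_bdd: "f \<in> conf \<Longrightarrow> bdd_above ((\<lambda>x. 1 / conf_deriv f x) ` dom f)"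
proof (rule bdd_aboveI2)
  fix x assume "f \<in> conf" "x \<in> dom f"
  then have "\<beta> \<le> conf_deriv f x" by (rule conf_deriv_ge)
  then show "1 / conf_deriv f x \<le> 1 / \<beta>" using \<beta>_gt_1 by (intro divide_left_mono) auto
qed

lemma norm_inv_D_ge: "f \<in> conf \<Longrightarrow> x \<in> dom f \<Longrightarrow> 1 / conf_deriv f x \<le> norm_inv_D f"
  unfolding norm_inv_D_def by (rule cSUP_upper[OF _ norm_inv_D_bdd])

lemma norm_inv_D_pos: "f \<in> conf \<Longrightarrow> 0 < norm_inv_D f"
proof -
  assume f: "f \<in> conf"
  then obtain x where x: "x \<in> dom f" using conf_dom_nonempty[OF f] by (meson ex_in_conv)
  have "0 < 1 / conf_deriv f x" using conf_deriv_pos[OF f x] by simp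
  then show ?thesis using norm_inv_D_ge[OF f x] by linarith
qed

lemma norm_inv_D_le: "f \<in> conf \<Longrightarrow> norm_inv_D f \<le> 1 / \<beta>"
  unfolding norm_inv_D_def
proof (rule cSUP_least)
  fix x assume "f \<in> conf" "x \<in> dom f"
  then have "\<beta> \<le> conf_deriv f x" by (rule conf_deriv_ge)
  then show "1 / conf_deriv f x \<le> 1 / \<beta>" using \<beta>_gt_1 by (intro divide_left_mono) auto
qed (rule conf_dom_nonempty)

lemma norm_D_norm_inv_D: "f \<in> conf \<Longrightarrow> - ln (norm_inv_D f) \<le> ln (norm_D f)"
proof -
  assume f: "f \<in> conf"
  then obtain x where x: "x \<in> dom f" using conf_dom_nonempty[OF f] by (meson ex_in_conv)
  note p = conf_deriv_pos[OF f x]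
  have "ln (1 / conf_deriv f x) \<le> ln (norm_inv_D f)"
    using norm_inv_D_ge[OF f x] p by (simp add: norm_inv_D_pos[OF f])
  moreover have "ln (conf_deriv f x) \<le> ln (norm_D f)"
    using norm_D_ge[OF f x] p by simp
  ultimately show ?thesis using p by (simp add: ln_div)
qed

lemma card_fibre_range_finite: "f \<in> conf \<Longrightarrow> finite (range (\<lambda>y. card (fibre f y)))"
proof -
  assume "f \<in> conf"
  then obtain N where "\<forall>y. card (fibre f y) \<le> N" using conf_card_bounded by blast
  then have "range (\<lambda>y. card (fibre f y)) \<subseteq> {..N}" by auto
  then show ?thesis using finite_subset by blast
qed

lemma card_fibre_le_dmax: "f \<in> conf \<Longrightarrow> card (fibre f y) \<le> dmax f"
  unfolding dmax_def by (rule Max_ge[OF card_fibre_range_finite]) auto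

lemma dmin_le_card_fibre: "f \<in> conf \<Longrightarrow> dmin f \<le> card (fibre f y)"
  unfolding dmin_def by (rule Min_le[OF card_fibre_range_finite]) auto

lemma dmin_pos: "f \<in> conf \<Longrightarrow> 1 \<le> dmin f"
proof -
  assume f: "f \<in> conf"
  have "dmin f \<in> range (\<lambda>y. card (fibre f y))"
    unfolding dmin_def by (rule Min_in[OF card_fibre_range_finite[OF f]]) auto
  then obtain y where "dmin f = card (fibre f y)" by auto
  moreover have "card (fibre f y) > 0"
    using conf_fibre_finite[OF f] conf_fibre_nonempty[OF f] by (simp add: card_gt_0_iff)
  ultimately show ?thesis by linarith
qed

lemma dmax_pos: "f \<in> conf \<Longrightarrow> 1 \<le> dmax f"
  using dmin_pos dmin_le_card_fibre card_fibre_le_dmax by (meson order_trans)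

context
  fixes F :: "nat \<Rightarrow> 'a::{complete_space, perfect_space} \<rightharpoonup> 'a"
  assumes F: "conf_seq F"
begin

lemma iter_deriv_le_norm: "x \<in> dom (iter_seq F t n) \<Longrightarrow> iter_deriv F t n x \<le> exp (log_norm_sum F t n)"
proof -
  assume x: "x \<in> dom (iter_seq F t n)"
  have "ln (iter_deriv F t n x) \<le> log_norm_sum F t n"
    unfolding ln_iter_deriv[OF F x] log_norm_sum_def
  proof (rule sum_mono)
    fix j assume "j \<in> {..<n}"
    then have d: "orb F t j x \<in> dom (F (t + Suc j))" by (intro iter_seq_step_dom[OF x]) simp
    note f = conf_seqD[OF F, of t j]
    show "ln (conf_deriv (F (t + Suc j)) (orb F t j x)) \<le> ln (norm_D (F (t + Suc j)))"
      using conf_deriv_pos[OF f d] norm_D_ge[OF f d] by simp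
  qed
  then show ?thesis using iter_deriv_pos[OF F x] by (metis exp_le_cancel_iff exp_ln)
qed

lemma log_norm_sum_nonneg: "0 \<le> log_norm_sum F t n"
  unfolding log_norm_sum_def
proof (intro sum_nonneg)
  fix j show "0 \<le> ln (norm_D (F (t + Suc j)))"
    using norm_D_ge_\<beta>[OF conf_seqD[OF F, of t j]] \<beta>_gt_1 by simp
qed

lemma psum_0: "psum s F t 0 y = 1"
proof -
  have "fibre (iter_seq F t 0) y = {y}" by (auto simp: fibre_iff)
  then show ?thesis by (simp add: psum_def)
qed

lemma sum_fibre_add:
  fixes h :: "'a \<Rightarrow> real"
  shows "(\<Sum>x\<in>fibre (iter_seq F t (m + n)) y. h x)
    = (\<Sum>z\<in>fibre (iter_seq F (t + m) n) y. \<Sum>x\<in>fibre (iter_seq F t m) z. h x)"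
  unfolding iter_fibre_add[OF F]
  by (rule sum.UNION_disjoint) (auto simp: iter_fibre_finite[OF F] fibre_iff)

lemma fibre_dom: "x \<in> fibre (iter_seq F t n) y \<Longrightarrow> x \<in> dom (iter_seq F t n)"
  by (auto simp: fibre_iff)

lemma fibre_orb: "x \<in> fibre (iter_seq F t n) y \<Longrightarrow> orb F t n x = y"
  by (simp add: fibre_iff)

lemma psum_add:
  "psum s F t (m + n) y = (\<Sum>z\<in>fibre (iter_seq F (t + m) n) y. iter_deriv F (t + m) n z powr (- s) * psum s F t m z)"
  unfolding psum_def sum_fibre_add sum_distrib_left
proof (intro sum.cong refl)
  fix z x assume z: "z \<in> fibre (iter_seq F (t + m) n) y" and x: "x \<in> fibre (iter_seq F t m) z"
  have "iter_deriv F t (m + n) x = iter_deriv F t m x * iter_deriv F (t + m) n z"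
    using iter_deriv_add[OF fibre_dom[OF x]] fibre_orb[OF x] by simp
  then show "iter_deriv F t (m + n) x powr (- s) = iter_deriv F (t + m) n z powr (- s) * iter_deriv F t m x powr (- s)"
    using iter_deriv_pos[OF F fibre_dom[OF x]] iter_deriv_pos[OF F fibre_dom[OF z]] by (simp add: powr_mult)
qed

lemma psum_ge_exp:
  assumes "0 \<le> s"
  shows "exp (- (s * log_norm_sum F t n)) \<le> psum s F t n y"
proof -
  obtain x where x: "x \<in> fibre (iter_seq F t n) y" using iter_fibre_nonempty[OF F, of t n y] by blast
  have "exp (- (s * log_norm_sum F t n)) \<le> iter_deriv F t n x powr (- s)"
    unfolding exp_powr_mult[symmetric]
    by (rule powr_neg_mono[OF iter_deriv_pos[OF F fibre_dom[OF x]] iter_deriv_le_norm[OF fibre_dom[OF x]] assms])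
  also have "\<dots> \<le> psum s F t n y"
    unfolding psum_def by (rule member_le_sum[OF x _ iter_fibre_finite[OF F]]) simp
  finally show ?thesis .
qed

lemma pinf_ge_exp: "0 \<le> s \<Longrightarrow> exp (- (s * log_norm_sum F t n)) \<le> pinf s F t n"
  by (rule pinf_greatest) (rule psum_ge_exp)

lemma pinf_pos: "0 \<le> s \<Longrightarrow> 0 < pinf s F t n"
  using pinf_ge_exp[of s t n] exp_gt_zero less_le_trans by blast

lemma ln_pinf_ge: "0 \<le> s \<Longrightarrow> - (s * log_norm_sum F t n) \<le> ln (pinf s F t n)"
  using pinf_ge_exp[of s t n] pinf_pos[of s t n] by (metis ln_exp ln_le_cancel_iff exp_gt_zero)

lemma psum_add_ge:
  "pinf s F t m * psum s F (t + m) n y \<le> psum s F t (m + n) y"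
  unfolding psum_add unfolding psum_def[of s F "t + m"] sum_distrib_left
proof (rule sum_mono)
  fix z
  show "pinf s F t m * iter_deriv F (t + m) n z powr - s \<le> iter_deriv F (t + m) n z powr - s * psum s F t m z"
    using mult_right_mono[OF pinf_le[of s F t m z], of "iter_deriv F (t + m) n z powr - s"] by (simp add: mult.commute)
qed

lemma pinf_supermult:
  assumes "0 \<le> s"
  shows "pinf s F t m * pinf s F (t + m) n \<le> pinf s F t (m + n)"
proof (rule pinf_greatest)
  fix y
  have "pinf s F t m * pinf s F (t + m) n \<le> pinf s F t m * psum s F (t + m) n y"
    using pinf_pos[OF assms] by (intro mult_left_mono pinf_le) (simp add: less_imp_le)
  also note psum_add_ge
  finally show "pinf s F t m * pinf s F (t + m) n \<le> psum s F t (m + n) y" .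
qed

text \<open>
  The fibre of the composition is a disjoint union of fibres of the first piece; each of these
  carries at least the infimum.
\<close>

lemma ln_pinf_superadd:
  assumes "0 \<le> s"
  shows "ln (pinf s F t m) + ln (pinf s F (t + m) n) \<le> ln (pinf s F t (m + n))"
proof -
  note p = pinf_pos[OF assms]
  have "ln (pinf s F t m * pinf s F (t + m) n) \<le> ln (pinf s F t (m + n))"
    using pinf_supermult[OF assms, of t m n] p by (simp add: mult_pos_pos)
  then show ?thesis using p[of t m] p[of "t + m" n] by (simp add: ln_mult)
qed

lemma psum_compare:
  assumes bij: "bij_betw \<psi> (fibre (iter_seq F t n) y) (fibre (iter_seq G t' n') w)" and s: "0 \<le> s"
    and le: "\<And>x. x \<in> fibre (iter_seq F t n) y \<Longrightarrow> iter_deriv G t' n' (\<psi> x) \<le> exp c * iter_deriv F t n x"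
    and pos: "\<And>x. x \<in> fibre (iter_seq F t n) y \<Longrightarrow> 0 < iter_deriv G t' n' (\<psi> x)"
  shows "exp (- (s * c)) * psum s F t n y \<le> psum s G t' n' w"
proof -
  have "psum s G t' n' w = (\<Sum>x\<in>fibre (iter_seq F t n) y. iter_deriv G t' n' (\<psi> x) powr (- s))"
    unfolding psum_def by (rule sum.reindex_bij_betw[OF bij, symmetric])
  moreover have "exp (- (s * c)) * psum s F t n y \<le> \<dots>"
    unfolding psum_def sum_distrib_left
  proof (rule sum_mono)
    fix x assume x: "x \<in> fibre (iter_seq F t n) y"
    have "exp (- (s * c)) * iter_deriv F t n x powr (- s) = (exp c * iter_deriv F t n x) powr (- s)"
      using iter_deriv_pos[OF F fibre_dom[OF x]] by (simp add: powr_mult exp_powr_mult)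
    also have "\<dots> \<le> iter_deriv G t' n' (\<psi> x) powr (- s)"
      by (rule powr_neg_mono[OF pos[OF x] le[OF x] s])
    finally show "exp (- (s * c)) * iter_deriv F t n x powr (- s) \<le> iter_deriv G t' n' (\<psi> x) powr (- s)" .
  qed
  ultimately show ?thesis by simp
qed

lemma psum_pairing:
  assumes d: "dist w y < \<Delta>" and s: "0 \<le> s"
  shows "exp (- (s * distortion_sum n)) * psum s F t n y \<le> psum s F t n w"
proof -
  obtain \<psi> where \<psi>: "bij_betw \<psi> (fibre (iter_seq F t n) y) (fibre (iter_seq F t n) w)"
    "\<And>x. x \<in> fibre (iter_seq F t n) y \<Longrightarrow> close F t n x (\<psi> x)"
    by (rule fibre_pairing_iter[OF F d]) blast
  show ?thesis
    by (rule psum_compare[OF \<psi>(1) s])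
       (rule close_iter_deriv_le(1)[OF F \<psi>(2)], assumption, rule iter_deriv_pos[OF F closeD(2)[OF F \<psi>(2)]])
qed

text \<open>
  Within \<open>n0\<close> further steps the fibre of any \<open>y\<close> comes
  \<open>\<Delta>\<close>-close to \<open>z\<close>, so the sum over the fibre of
  \<open>z\<close> appears, up to distortion, as a part of the sum over the fibre of
  \<open>y\<close>. The price for the \<open>n0\<close> steps is the norm of their derivative.
\<close>

lemma psum_mixing:
  assumes mix: "mixing n0 \<Delta> F" and s: "0 \<le> s" and z: "z \<in> dom (iter_seq F (t + a) n0)"
  shows "psum s F t a z \<le> exp (s * log_norm_sum F (t + a) n0 + s * distortion_sum a) * pinf s F t (a + n0)"
proof -
  let ?N = "log_norm_sum F (t + a) n0" and ?c = "distortion_sum a"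
  have "exp (- (s * ?N) - s * ?c) * psum s F t a z \<le> pinf s F t (a + n0)"
  proof (rule pinf_greatest)
    fix y
    obtain z' where z': "z' \<in> fibre (iter_seq F (t + a) n0) y" "dist z z' < \<Delta>"
      using mix z unfolding mixing_def mpreim_UNIV by blast
    have "exp (- (s * ?N) - s * ?c) * psum s F t a z
        = exp (- (s * ?N)) * (exp (- (s * ?c)) * psum s F t a z)" by (simp add: exp_diff exp_minus field_simps)
    also have "\<dots> \<le> exp (- (s * ?N)) * psum s F t a z'"
      using psum_pairing[of z' z s a t] z'(2) s by (simp add: dist_commute)
    also have "\<dots> \<le> iter_deriv F (t + a) n0 z' powr (- s) * psum s F t a z'"
      unfolding exp_powr_mult[symmetric]
      by (intro mult_right_mono psum_nonneg powr_neg_mono[OF iter_deriv_pos[OF F] iter_deriv_le_norm s] fibre_dom[OF z'(1)])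
    also have "\<dots> \<le> psum s F t (a + n0) y"
      unfolding psum_add
      by (rule member_le_sum[OF z'(1) _ iter_fibre_finite[OF F]]) (simp add: psum_nonneg)
    finally show "exp (- (s * ?N) - s * ?c) * psum s F t a z \<le> psum s F t (a + n0) y" .
  qed
  then have "exp (s * ?N + s * ?c) * (exp (- (s * ?N) - s * ?c) * psum s F t a z)
      \<le> exp (s * ?N + s * ?c) * pinf s F t (a + n0)" by (rule mult_left_mono) simp
  then show ?thesis by (simp add: mult.assoc[symmetric] exp_add[symmetric])
qed

text \<open>
  The counterpart of superadditivity: every inner sum is replaced by the infimum at the later
  time \<open>a + n0\<close>. The base points of the inner fibres must have \<open>n0\<close>
  further images, which is why \<open>b\<close> is at least \<open>n0\<close>.
\<close>

lemma ln_pinf_mixing: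
  assumes mix: "mixing n0 \<Delta> F" and s: "0 \<le> s" and b: "n0 \<le> b"
  shows "ln (pinf s F t (a + b)) \<le> ln (pinf s F t (a + n0))
     + s * log_norm_sum F (t + a) n0 + s * distortion_sum a + ln (pinf s F (t + a) b)"
proof -
  let ?K = "exp (s * log_norm_sum F (t + a) n0 + s * distortion_sum a) * pinf s F t (a + n0)"
  have K: "0 < ?K" using pinf_pos[OF s] by simp
  have le: "pinf s F t (a + b) \<le> ?K * psum s F (t + a) b y" for y
  proof -
    have "pinf s F t (a + b) \<le> psum s F t (a + b) y" by (rule pinf_le)
    also have "\<dots> \<le> (\<Sum>z\<in>fibre (iter_seq F (t + a) b) y. iter_deriv F (t + a) b z powr (- s) * ?K)"
      unfolding psum_add
      by (intro sum_mono mult_left_mono psum_mixing[OF mix s])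
         (rule iter_seq_dom_mono[OF fibre_dom b], assumption, simp)
    also have "\<dots> = ?K * psum s F (t + a) b y" by (simp add: psum_def sum_distrib_right mult.commute)
    finally show ?thesis .
  qed
  have "pinf s F t (a + b) / ?K \<le> pinf s F (t + a) b"
  proof (rule pinf_greatest)
    fix y show "pinf s F t (a + b) / ?K \<le> psum s F (t + a) b y"
      using le[of y] K by (simp add: pos_divide_le_eq mult.commute)
  qed
  then have "pinf s F t (a + b) \<le> ?K * pinf s F (t + a) b"
    using K by (simp add: pos_divide_le_eq mult.commute)
  then have "ln (pinf s F t (a + b)) \<le> ln (?K * pinf s F (t + a) b)"
    using pinf_pos[OF s, of t "a + b"] by (intro ln_mono) auto
  also have "\<dots> = ln (exp (s * log_norm_sum F (t + a) n0 + s * distortion_sum a)) + ln (pinf s F t (a + n0))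
      + ln (pinf s F (t + a) b)"
    using pinf_pos[OF s, of t "a + n0"] pinf_pos[OF s, of "t + a" b] K by (simp only: ln_mult_pos exp_gt_zero)
  finally show ?thesis by simp
qed

lemma pinf_step_ge:
  assumes s: "0 \<le> s"
  shows "ln (real (dmin (F (Suc t)))) - s * ln (norm_D (F (Suc t))) \<le> ln (pinf s F t 1)"
proof -
  note f = conf_seqD[OF F, of t 0, simplified]
  let ?d = "real (dmin (F (Suc t)))" and ?L = "ln (norm_D (F (Suc t)))"
  have fib: "fibre (iter_seq F t 1) y = fibre (F (Suc t)) y" for y by (auto simp: fibre_iff)
  have N: "log_norm_sum F t 1 = ?L" by (simp add: log_norm_sum_def)
  have "?d * exp (- (s * ?L)) \<le> pinf s F t 1"
  proof (rule pinf_greatest)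
    fix y
    have "?d * exp (- (s * ?L)) \<le> real (card (fibre (F (Suc t)) y)) * exp (- (s * ?L))"
      using dmin_le_card_fibre[OF f, of y] by (intro mult_right_mono) auto
    also have "\<dots> \<le> psum s F t 1 y"
      unfolding psum_def fib
    proof (rule sum_bounded_below)
      fix x assume "x \<in> fibre (F (Suc t)) y"
      then have "x \<in> dom (iter_seq F t 1)" unfolding fib[symmetric] by (rule fibre_dom)
      then show "exp (- (s * ?L)) \<le> iter_deriv F t 1 x powr (- s)"
        unfolding exp_powr_mult[symmetric] N[symmetric]
        by (intro powr_neg_mono[OF iter_deriv_pos[OF F] iter_deriv_le_norm s])
    qed
    finally show "?d * exp (- (s * ?L)) \<le> psum s F t 1 y" .
  qed
  moreover have "0 < ?d" using dmin_pos[OF f] by simp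
  ultimately have "ln (?d * exp (- (s * ?L))) \<le> ln (pinf s F t 1)" by (intro ln_mono) auto
  then show ?thesis using \<open>0 < ?d\<close> by (simp add: ln_mult)
qed

lemma ln_pinf_ge_dmin:
  assumes s: "0 \<le> s"
  shows "(\<Sum>j<n. ln (real (dmin (F (t + Suc j)))) - s * ln (norm_D (F (t + Suc j)))) \<le> ln (pinf s F t n)"
proof (induction n)
  case 0
  then show ?case by (simp add: pinf_def psum_0)
next
  case (Suc n)
  then show ?case using ln_pinf_superadd[OF s, of t n 1] pinf_step_ge[OF s, of "t + n"] by simp
qed

lemma psum_le_dmax:
  assumes s: "0 \<le> s"
  shows "psum s F t n y \<le> exp (\<Sum>j<n. ln (real (dmax (F (t + Suc j)))) + s * ln (norm_inv_D (F (t + Suc j))))"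
proof (induction n arbitrary: y)
  case 0
  then show ?case by (simp add: psum_0)
next
  case (Suc n)
  let ?f = "F (t + Suc n)" and ?E = "exp (\<Sum>j<n. ln (real (dmax (F (t + Suc j)))) + s * ln (norm_inv_D (F (t + Suc j))))"
  note f = conf_seqD[OF F, of t n]
  have fib: "fibre (iter_seq F (t + n) 1) y = fibre ?f y" for y by (auto simp: fibre_iff)
  have der: "iter_deriv F (t + n) 1 z = conf_deriv ?f z" for z by (simp add: iter_deriv_def)
  have "psum s F t (n + 1) y = (\<Sum>z\<in>fibre ?f y. conf_deriv ?f z powr (- s) * psum s F t n z)"
    unfolding psum_add fib der ..
  also have "\<dots> \<le> (\<Sum>z\<in>fibre ?f y. exp (s * ln (norm_inv_D ?f)) * ?E)"
  proof (intro sum_mono mult_mono Suc.IH psum_nonneg)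
    fix z assume "z \<in> fibre ?f y"
    then have z: "z \<in> dom ?f" by (auto simp: fibre_iff)
    have p: "0 < conf_deriv ?f z" by (rule conf_deriv_pos[OF f z])
    have "conf_deriv ?f z powr (- s) = (1 / conf_deriv ?f z) powr s"
      using p by (simp add: powr_minus_divide powr_divide)
    also have "\<dots> \<le> norm_inv_D ?f powr s"
      using norm_inv_D_ge[OF f z] p s by (intro powr_mono2) auto
    also have "\<dots> = exp (s * ln (norm_inv_D ?f))" using norm_inv_D_pos[OF f] by (simp add: powr_def)
    finally show "conf_deriv ?f z powr (- s) \<le> exp (s * ln (norm_inv_D ?f))" .
  qed auto
  also have "\<dots> = real (card (fibre ?f y)) * (exp (s * ln (norm_inv_D ?f)) * ?E)" by simp
  also have "\<dots> \<le> real (dmax ?f) * (exp (s * ln (norm_inv_D ?f)) * ?E)"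
    using card_fibre_le_dmax[OF f, of y] by (intro mult_right_mono) auto
  also have "\<dots> = exp (ln (real (dmax ?f))) * (exp (s * ln (norm_inv_D ?f)) * ?E)"
    using dmax_pos[OF f] by simp
  finally show ?case by (simp add: exp_add mult_ac)
qed

lemma ln_pinf_le_dmax:
  assumes s: "0 \<le> s"
  shows "ln (pinf s F t n) \<le> (\<Sum>j<n. ln (real (dmax (F (t + Suc j)))) + s * ln (norm_inv_D (F (t + Suc j))))"
proof -
  obtain y :: 'a where True by blast
  have "pinf s F t n \<le> exp (\<Sum>j<n. ln (real (dmax (F (t + Suc j)))) + s * ln (norm_inv_D (F (t + Suc j))))"
    by (rule order_trans[OF pinf_le[of s F t n y] psum_le_dmax[OF s]])
  then show ?thesis using pinf_pos[OF s, of t n] by (metis exp_gt_zero ln_exp ln_le_cancel_iff)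
qed

lemma psum_exponent_shift:
  assumes h: "0 \<le> h"
  shows "psum (s + h) F t n y \<le> exp (- (h * (real n * ln \<beta>))) * psum s F t n y"
    and "exp (- (h * log_norm_sum F t n)) * psum s F t n y \<le> psum (s + h) F t n y"
proof -
  have b: "exp (real n * ln \<beta>) = \<beta> ^ n" using \<beta>_gt_1 by (simp add: exp_of_nat_mult)
  have split: "iter_deriv F t n x powr (- (s + h)) = iter_deriv F t n x powr (- h) * iter_deriv F t n x powr (- s)" for x
    by (simp add: powr_add[symmetric] add.commute)
  show "psum (s + h) F t n y \<le> exp (- (h * (real n * ln \<beta>))) * psum s F t n y"
    unfolding psum_def sum_distrib_left split
  proof (intro sum_mono mult_right_mono)
    fix x assume "x \<in> fibre (iter_seq F t n) y"
    then have "\<beta> ^ n \<le> iter_deriv F t n x" by (intro iter_deriv_ge[OF F] fibre_dom)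
    then show "iter_deriv F t n x powr (- h) \<le> exp (- (h * (real n * ln \<beta>)))"
      unfolding exp_powr_mult[symmetric] b using \<beta>_gt_1 by (intro powr_neg_mono[OF _ _ h]) auto
  qed simp
  show "exp (- (h * log_norm_sum F t n)) * psum s F t n y \<le> psum (s + h) F t n y"
    unfolding psum_def sum_distrib_left split
  proof (intro sum_mono mult_right_mono)
    fix x assume "x \<in> fibre (iter_seq F t n) y"
    then have x: "x \<in> dom (iter_seq F t n)" by (rule fibre_dom)
    show "exp (- (h * log_norm_sum F t n)) \<le> iter_deriv F t n x powr (- h)"
      unfolding exp_powr_mult[symmetric]
      by (rule powr_neg_mono[OF iter_deriv_pos[OF F x] iter_deriv_le_norm[OF x] h])
  qed simp
qed

text \<open>
  These two bounds on the slope in the exponent locate the zero of the pressure: the first makes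
  it strictly decreasing, the second finite and continuous as soon as it is finite at zero.
\<close>

lemma ln_pinf_exponent_shift:
  assumes s: "0 \<le> s" and h: "0 \<le> h"
  shows "ln (pinf (s + h) F t n) \<le> ln (pinf s F t n) - h * (real n * ln \<beta>)"
    and "ln (pinf s F t n) - h * log_norm_sum F t n \<le> ln (pinf (s + h) F t n)"
proof -
  have sh: "0 \<le> s + h" using s h by simp
  have *: "ln p \<le> ln q + c" if "exp (- c) * p \<le> q" "0 < p" for p q c :: real
  proof -
    have "0 < exp (- c) * p" using that by simp
    then have "ln (exp (- c) * p) \<le> ln q" by (intro ln_mono) (use that in auto)
    then show ?thesis using that by (simp add: ln_mult)
  qed
  have "exp (- (- (h * (real n * ln \<beta>)))) * pinf (s + h) F t n \<le> pinf s F t n"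
  proof (rule pinf_greatest)
    fix y
    have "exp (h * (real n * ln \<beta>)) * pinf (s + h) F t n \<le> exp (h * (real n * ln \<beta>)) * psum (s + h) F t n y"
      by (intro mult_left_mono pinf_le) simp
    also have "\<dots> \<le> exp (h * (real n * ln \<beta>)) * (exp (- (h * (real n * ln \<beta>))) * psum s F t n y)"
      by (intro mult_left_mono psum_exponent_shift h) simp
    also have "\<dots> = psum s F t n y" by (simp add: mult.assoc[symmetric] exp_add[symmetric])
    finally show "exp (- (- (h * (real n * ln \<beta>)))) * pinf (s + h) F t n \<le> psum s F t n y" by simp
  qed
  from *[OF this pinf_pos[OF sh]]
  show "ln (pinf (s + h) F t n) \<le> ln (pinf s F t n) - h * (real n * ln \<beta>)" by simp
  have "exp (- (h * log_norm_sum F t n)) * pinf s F t n \<le> pinf (s + h) F t n"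
  proof (rule pinf_greatest)
    fix y
    have "exp (- (h * log_norm_sum F t n)) * pinf s F t n \<le> exp (- (h * log_norm_sum F t n)) * psum s F t n y"
      by (intro mult_left_mono pinf_le) simp
    also note psum_exponent_shift(2)[OF h]
    finally show "exp (- (h * log_norm_sum F t n)) * pinf s F t n \<le> psum (s + h) F t n y" .
  qed
  from *[OF this pinf_pos[OF s]]
  show "ln (pinf s F t n) - h * log_norm_sum F t n \<le> ln (pinf (s + h) F t n)" by simp
qed

lemma lower_pressure_eq:
  "lower_pressure s F = liminf (\<lambda>n. ereal (1 / real n * ln (pinf s F 0 n)))"
proof -
  have "(\<Sum>x\<in>fibre (iter_seq F 0 n) y. conf_deriv (iter_seq F 0 n) x powr (- s)) = psum s F 0 n y" for n y
    unfolding psum_def by (intro sum.cong refl) (simp add: conf_deriv_iter_seq[OF F fibre_dom])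
  then show ?thesis unfolding lower_pressure_def pinf_def by simp
qed

end

end

section \<open>The metric on maps\<close>

context conf_params
begin

text \<open>
  The distance \<open>d\<^sub>\<E>\<close> as a relation: the infimum over pairings is attained
  because fibres are finite, so a bound on the distance is the same as the existence of pairings
  (\<open>dE_imp_matched\<close>, \<open>matched_imp_dE\<close>).
\<close>

definition matched :: "('a::metric_space \<rightharpoonup> 'a) \<Rightarrow> ('a \<rightharpoonup> 'a) \<Rightarrow> real \<Rightarrow> bool" where
  "matched f g r \<longleftrightarrow> (\<forall>y. \<exists>\<pi>. bij_betw \<pi> (fibre f y) (fibre g y) \<and>
     (\<forall>x\<in>fibre f y. \<epsilon> (\<beta> / (\<beta> - 1) * dist x (\<pi> x)) + \<bar>ln (conf_deriv g (\<pi> x) / conf_deriv f x)\<bar> \<le> r))"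

lemma dE_imp_matched:
  assumes f: "f \<in> conf" and g: "g \<in> conf" and r: "0 \<le> r" and le: "dE \<beta> \<epsilon> f g \<le> ennreal r"
  shows "matched f g r"
  unfolding matched_def
proof
  fix y
  let ?e = "\<lambda>\<pi> x. \<epsilon> (\<beta> / (\<beta> - 1) * dist x (\<pi> x)) + \<bar>ln (conf_deriv g (\<pi> x) / conf_deriv f x)\<bar>"
  let ?B = "{\<pi>. bij_betw \<pi> (fibre f y) (fibre g y)}"
  define c where "c = (\<lambda>\<pi>. SUP x\<in>fibre f y. ennreal (?e \<pi> x))"
  have card: "card (fibre f y) = card (fibre g y)" for y
    using le unfolding dE_def by (auto split: if_splits simp: top_unique)
  then have "(SUP y. INF \<pi>\<in>{\<pi>. bij_betw \<pi> (fibre f y) (fibre g y)}. SUP x\<in>fibre f y. ennreal (?e \<pi> x)) \<le> ennreal r"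
    using le unfolding dE_def by simp
  then have INF: "(INF \<pi>\<in>?B. c \<pi>) \<le> ennreal r"
    unfolding c_def by (rule SUP_le_iff[THEN iffD1, THEN bspec]) simp
  have ne: "?B \<noteq> {}"
    using finite_same_card_bij[OF conf_fibre_finite[OF f] conf_fibre_finite[OF g] card] by blast
  have "c ` ?B \<subseteq> c ` (fibre f y \<rightarrow>\<^sub>E fibre g y)"
  proof (rule image_subsetI)
    fix \<pi> assume "\<pi> \<in> ?B"
    then have 1: "restrict \<pi> (fibre f y) \<in> fibre f y \<rightarrow>\<^sub>E fibre g y"
      by (auto simp: bij_betw_def)
    have 2: "c \<pi> = c (restrict \<pi> (fibre f y))" unfolding c_def by (intro SUP_cong refl) simp
    show "c \<pi> \<in> c ` (fibre f y \<rightarrow>\<^sub>E fibre g y)" by (subst 2) (rule imageI[OF 1])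
  qed
  then have fin: "finite (c ` ?B)"
    by (rule finite_subset) (intro finite_imageI finite_PiE conf_fibre_finite f g)
  have "Inf (c ` ?B) = Min (c ` ?B)" using fin ne by (intro cInf_eq_Min) auto
  also have "\<dots> \<in> c ` ?B" using fin ne by (intro Min_in) auto
  finally obtain \<pi> where \<pi>: "\<pi> \<in> ?B" "c \<pi> \<le> ennreal r" using INF by auto
  have "?e \<pi> x \<le> r" if "x \<in> fibre f y" for x
  proof -
    have "ennreal (?e \<pi> x) \<le> c \<pi>" unfolding c_def using that by (rule SUP_upper)
    also note \<pi>(2)
    finally show ?thesis using r by simp
  qed
  then show "\<exists>\<pi>. bij_betw \<pi> (fibre f y) (fibre g y) \<and> (\<forall>x\<in>fibre f y. ?e \<pi> x \<le> r)"
    using \<pi>(1) by blast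
qed

lemma matched_imp_dE:
  assumes m: "matched f g r"
  shows "dE \<beta> \<epsilon> f g \<le> ennreal r"
proof -
  let ?e = "\<lambda>\<pi> x. \<epsilon> (\<beta> / (\<beta> - 1) * dist x (\<pi> x)) + \<bar>ln (conf_deriv g (\<pi> x) / conf_deriv f x)\<bar>"
  have card: "card (fibre f y) = card (fibre g y)" for y
    using m unfolding matched_def by (meson bij_betw_same_card)
  have "(INF \<pi>\<in>{\<pi>. bij_betw \<pi> (fibre f y) (fibre g y)}. SUP x\<in>fibre f y. ennreal (?e \<pi> x)) \<le> ennreal r" for y
  proof -
    obtain \<pi> where "bij_betw \<pi> (fibre f y) (fibre g y)" "\<forall>x\<in>fibre f y. ?e \<pi> x \<le> r"
      using m unfolding matched_def by blast
    then show ?thesis by (intro INF_lower2[of \<pi>]) (auto intro!: SUP_least ennreal_leI)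
  qed
  then show ?thesis using card unfolding dE_def by (simp add: SUP_le_iff)
qed

text \<open>
  The triangle inequality, in the form with a common first argument that symmetric pairings make
  convenient; the distance term uses subadditivity of \<open>\<epsilon>\<close>.
\<close>

lemma matched_trans:
  assumes f: "f \<in> conf" and g: "g \<in> conf" and h: "h \<in> conf"
    and fg: "matched f g a" and fh: "matched f h b"
  shows "matched g h (a + b)"
  unfolding matched_def
proof
  fix y
  obtain p where p: "bij_betw p (fibre f y) (fibre g y)"
    "\<forall>x\<in>fibre f y. \<epsilon> (\<beta> / (\<beta> - 1) * dist x (p x)) + \<bar>ln (conf_deriv g (p x) / conf_deriv f x)\<bar> \<le> a"
    using fg unfolding matched_def by blast
  obtain q where q: "bij_betw q (fibre f y) (fibre h y)"
    "\<forall>x\<in>fibre f y. \<epsilon> (\<beta> / (\<beta> - 1) * dist x (q x)) + \<bar>ln (conf_deriv h (q x) / conf_deriv f x)\<bar> \<le> b"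
    using fh unfolding matched_def by blast
  let ?p' = "inv_into (fibre f y) p"
  have p': "bij_betw ?p' (fibre g y) (fibre f y)" using p(1) by (rule bij_betw_inv_into)
  have "\<epsilon> (\<beta> / (\<beta> - 1) * dist z ((q \<circ> ?p') z)) + \<bar>ln (conf_deriv h ((q \<circ> ?p') z) / conf_deriv g z)\<bar> \<le> a + b"
    if z: "z \<in> fibre g y" for z
  proof -
    define x where "x = ?p' z"
    have x: "x \<in> fibre f y" "p x = z"
      using bij_betwE[OF p'] z bij_betw_inv_into_right[OF p(1) z] by (auto simp: x_def)
    have qx: "q x \<in> fibre h y" using bij_betwE[OF q(1)] x by blast
    have pos: "0 < conf_deriv f x" "0 < conf_deriv g z" "0 < conf_deriv h (q x)"
      using conf_deriv_pos[OF f, of x] conf_deriv_pos[OF g, of z] conf_deriv_pos[OF h, of "q x"] x z qx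
      by (auto simp: fibre_iff)
    let ?k = "\<beta> / (\<beta> - 1)"
    have k: "0 \<le> ?k" using \<beta>_gt_1 by simp
    have "dist z (q x) \<le> dist x (p x) + dist x (q x)" using dist_triangle3[of z "q x" x] x(2) by simp
    then have "?k * dist z (q x) \<le> ?k * (dist x (p x) + dist x (q x))" using k by (rule mult_left_mono)
    then have "?k * dist z (q x) \<le> ?k * dist x (p x) + ?k * dist x (q x)" by (simp only: distrib_left)
    then have "\<epsilon> (?k * dist z (q x)) \<le> \<epsilon> (?k * dist x (p x) + ?k * dist x (q x))"
      by (intro \<epsilon>_mono mult_nonneg_nonneg k zero_le_dist)
    also have "\<dots> \<le> \<epsilon> (?k * dist x (p x)) + \<epsilon> (?k * dist x (q x))"
      by (intro \<epsilon>_subadd mult_nonneg_nonneg k zero_le_dist)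
    finally have "\<epsilon> (?k * dist z (q x)) \<le> \<epsilon> (?k * dist x (p x)) + \<epsilon> (?k * dist x (q x))" .
    moreover have "\<bar>ln (conf_deriv h (q x) / conf_deriv g z)\<bar>
        \<le> \<bar>ln (conf_deriv g (p x) / conf_deriv f x)\<bar> + \<bar>ln (conf_deriv h (q x) / conf_deriv f x)\<bar>"
      using pos x(2) by (simp add: ln_div)
    ultimately show ?thesis using bspec[OF p(2) x(1)] bspec[OF q(2) x(1)] unfolding comp_def x_def[symmetric]
      by linarith
  qed
  then show "\<exists>\<pi>. bij_betw \<pi> (fibre g y) (fibre h y) \<and>
     (\<forall>x\<in>fibre g y. \<epsilon> (\<beta> / (\<beta> - 1) * dist x (\<pi> x)) + \<bar>ln (conf_deriv h (\<pi> x) / conf_deriv g x)\<bar> \<le> a + b)"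
    using bij_betw_trans[OF p' q(1)] by blast
qed

lemma matched_refl: "f \<in> conf \<Longrightarrow> matched f f 0"
  unfolding matched_def
proof
  fix y assume f: "f \<in> conf"
  have "ln (conf_deriv f x / conf_deriv f x) = 0" if "x \<in> fibre f y" for x
    using conf_deriv_pos[OF f, of x] that by (auto simp: fibre_iff)
  then show "\<exists>\<pi>. bij_betw \<pi> (fibre f y) (fibre f y) \<and>
     (\<forall>x\<in>fibre f y. \<epsilon> (\<beta> / (\<beta> - 1) * dist x (\<pi> x)) + \<bar>ln (conf_deriv f (\<pi> x) / conf_deriv f x)\<bar> \<le> 0)"
    by (intro exI[of _ id]) (auto simp: \<epsilon>_0)
qed

lemma matched_sym: "f \<in> conf \<Longrightarrow> g \<in> conf \<Longrightarrow> matched f g r \<Longrightarrow> matched g f r"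
  using matched_trans[OF _ _ _ _ matched_refl, of f g r] by simp

lemma matchedE:
  assumes f: "f \<in> conf" and g: "g \<in> conf" and m: "matched f g r"
  obtains \<pi> where "bij_betw \<pi> (fibre f y) (fibre g y)"
    "\<And>x. x \<in> fibre f y \<Longrightarrow> \<epsilon> (\<beta> / (\<beta> - 1) * dist x (\<pi> x)) + \<bar>ln (conf_deriv g (\<pi> x)) - ln (conf_deriv f x)\<bar> \<le> r"
proof -
  obtain \<pi> where \<pi>: "bij_betw \<pi> (fibre f y) (fibre g y)"
    "\<forall>x\<in>fibre f y. \<epsilon> (\<beta> / (\<beta> - 1) * dist x (\<pi> x)) + \<bar>ln (conf_deriv g (\<pi> x) / conf_deriv f x)\<bar> \<le> r"
    using m unfolding matched_def by blast
  have "ln (conf_deriv g (\<pi> x) / conf_deriv f x) = ln (conf_deriv g (\<pi> x)) - ln (conf_deriv f x)"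
    if x: "x \<in> fibre f y" for x
  proof -
    have "\<pi> x \<in> fibre g y" using bij_betwE[OF \<pi>(1)] x by blast
    then have "0 < conf_deriv f x" "0 < conf_deriv g (\<pi> x)"
      using conf_deriv_pos[OF f, of x] conf_deriv_pos[OF g, of "\<pi> x"] x by (auto simp: fibre_iff)
    then show ?thesis by (simp add: ln_div)
  qed
  then show ?thesis using \<pi> by (intro that[of \<pi>]) auto
qed

lemma matched_point:
  assumes f: "f \<in> conf" and g: "g \<in> conf" and m: "matched f g r" and x: "x \<in> dom f"
  obtains x' where "x' \<in> dom g" "g x' = f x" "\<epsilon> (\<beta> / (\<beta> - 1) * dist x x') \<le> r"
    "\<bar>ln (conf_deriv g x') - ln (conf_deriv f x)\<bar> \<le> r"
proof -
  obtain y where y: "f x = Some y" using x by blast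
  obtain \<pi> where \<pi>: "bij_betw \<pi> (fibre f y) (fibre g y)"
    "\<And>x. x \<in> fibre f y \<Longrightarrow> \<epsilon> (\<beta> / (\<beta> - 1) * dist x (\<pi> x)) + \<bar>ln (conf_deriv g (\<pi> x)) - ln (conf_deriv f x)\<bar> \<le> r"
    by (rule matchedE[OF f g m]) blast
  have xf: "x \<in> fibre f y" using y by (simp add: fibre_iff)
  then have "\<pi> x \<in> fibre g y" using bij_betwE[OF \<pi>(1)] by blast
  then have gx: "g (\<pi> x) = Some y" by (simp add: fibre_iff)
  have "0 \<le> \<epsilon> (\<beta> / (\<beta> - 1) * dist x (\<pi> x))" using \<beta>_gt_1 by (intro \<epsilon>_nonneg) simp
  then show ?thesis using \<pi>(2)[OF xf] gx y by (intro that[of "\<pi> x"]) auto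
qed

lemma matched_norm_D:
  assumes f: "f \<in> conf" and g: "g \<in> conf" and m: "matched f g r"
  shows "ln (norm_D f) \<le> ln (norm_D g) + r"
proof -
  have "norm_D f \<le> exp r * norm_D g"
    unfolding norm_D_def[of f]
  proof (rule cSUP_least[OF conf_dom_nonempty[OF f]])
    fix x assume x: "x \<in> dom f"
    obtain x' where x': "x' \<in> dom g" "\<bar>ln (conf_deriv g x') - ln (conf_deriv f x)\<bar> \<le> r"
      by (rule matched_point[OF f g m x]) blast
    have "ln (conf_deriv f x) \<le> ln (exp r * conf_deriv g x')"
      using x' conf_deriv_pos[OF g x'(1)] by (simp add: ln_mult)
    then have "conf_deriv f x \<le> exp r * conf_deriv g x'"
      using conf_deriv_pos[OF f x] conf_deriv_pos[OF g x'(1)] by simp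
    also have "\<dots> \<le> exp r * norm_D g" using norm_D_ge[OF g x'(1)] by simp
    finally show "conf_deriv f x \<le> exp r * norm_D g" .
  qed
  then have "ln (norm_D f) \<le> ln (exp r * norm_D g)"
    using norm_D_ge_\<beta>[OF f] \<beta>_gt_1 by (intro ln_mono) auto
  then show ?thesis using norm_D_ge_\<beta>[OF g] \<beta>_gt_1 by (simp add: ln_mult)
qed

lemma matched_norm_inv_D:
  assumes f: "f \<in> conf" and g: "g \<in> conf" and m: "matched f g r"
  shows "ln (norm_inv_D f) \<le> ln (norm_inv_D g) + r"
proof -
  have "norm_inv_D f \<le> exp r * norm_inv_D g"
    unfolding norm_inv_D_def[of f]
  proof (rule cSUP_least[OF conf_dom_nonempty[OF f]])
    fix x assume x: "x \<in> dom f"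
    obtain x' where x': "x' \<in> dom g" "\<bar>ln (conf_deriv g x') - ln (conf_deriv f x)\<bar> \<le> r"
      by (rule matched_point[OF f g m x]) blast
    note p = conf_deriv_pos[OF f x] conf_deriv_pos[OF g x'(1)]
    have "ln (conf_deriv g x') \<le> ln (exp r * conf_deriv f x)"
      using x' p by (simp add: ln_mult)
    then have "conf_deriv g x' \<le> exp r * conf_deriv f x" using p by simp
    then have "1 / conf_deriv f x \<le> exp r * (1 / conf_deriv g x')" using p by (simp add: field_simps)
    also have "\<dots> \<le> exp r * norm_inv_D g" using norm_inv_D_ge[OF g x'(1)] by (intro mult_left_mono) auto
    finally show "1 / conf_deriv f x \<le> exp r * norm_inv_D g" .
  qed
  then have "ln (norm_inv_D f) \<le> ln (exp r * norm_inv_D g)"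
    using norm_inv_D_pos[OF f] by (intro ln_mono) auto
  then show ?thesis using norm_inv_D_pos[OF g] by (simp add: ln_mult)
qed

lemma matched_card: "matched f g r \<Longrightarrow> card (fibre f y) = card (fibre g y)"
  unfolding matched_def by (meson bij_betw_same_card)

lemma matched_dmin: "matched f g r \<Longrightarrow> dmin f = dmin g"
  unfolding dmin_def by (simp add: matched_card)

lemma matched_dmax: "matched f g r \<Longrightarrow> dmax f = dmax g"
  unfolding dmax_def by (simp add: matched_card)

section \<open>Separation scale of a map\<close>

text \<open>
  Points of the domain with distant images are at least \<open>c\<close> apart. For points on
  the same inverse branch that is a Lipschitz bound; for points on different branches it is a
  separation property. It is the only quantitative trace of the constants
  \<open>\<delta>(f)\<close> and \<open>\<lambda>\<^sub>1(f)\<close> in the lower bound for the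
  dimension.
\<close>

definition has_gap :: "('a::metric_space \<rightharpoonup> 'a) \<Rightarrow> real \<Rightarrow> bool" where
  "has_gap f c \<longleftrightarrow> (\<forall>u\<in>dom f. \<forall>v\<in>dom f. dist u v < c \<longrightarrow> dist (the (f u)) (the (f v)) < \<Delta>)"

text \<open>
  The optimal constant, truncated at one so that the supremum is finite. Unlike
  \<open>\<lambda>\<^sub>1(f)\<close>, which is a choice, it depends on the map continuously.
\<close>

definition gap :: "('a::metric_space \<rightharpoonup> 'a) \<Rightarrow> real" where
  "gap f = (SUP c\<in>{c. 0 \<le> c \<and> c \<le> 1 \<and> has_gap f c}. c)"

lemma has_gap_0: "has_gap f 0"
  by (simp add: has_gap_def not_less)

lemma gap_bdd: "bdd_above {c. 0 \<le> c \<and> c \<le> 1 \<and> has_gap f c}"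
  by (rule bdd_aboveI[of _ 1]) simp

lemma gap_nonneg: "0 \<le> gap f"
  unfolding gap_def using cSUP_upper[of 0 "{c. 0 \<le> c \<and> c \<le> 1 \<and> has_gap f c}" "\<lambda>c. c"] gap_bdd[of f] has_gap_0[of f]
  by simp

lemma gap_upper: "0 \<le> c \<Longrightarrow> c \<le> 1 \<Longrightarrow> has_gap f c \<Longrightarrow> c \<le> gap f"
  unfolding gap_def using cSUP_upper[of c "{c. 0 \<le> c \<and> c \<le> 1 \<and> has_gap f c}" "\<lambda>c. c"] gap_bdd[of f]
  by simp

lemma has_gap_gap: "has_gap f (gap f)"
  unfolding has_gap_def
proof (intro ballI impI)
  fix u v assume uv: "u \<in> dom f" "v \<in> dom f" and d: "dist u v < gap f"
  have "{c. 0 \<le> c \<and> c \<le> 1 \<and> has_gap f c} \<noteq> {}" using has_gap_0[of f] by (auto intro!: exI[of _ 0])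
  then obtain c where "has_gap f c" "dist u v < c"
    using d less_cSUP_iff[of "{c. 0 \<le> c \<and> c \<le> 1 \<and> has_gap f c}" "\<lambda>c. c"] gap_bdd[of f] unfolding gap_def by auto
  then show "dist (the (f u)) (the (f v)) < \<Delta>" using uv unfolding has_gap_def by simp
qed

lemma gap_pos:
  assumes f: "f \<in> conf" shows "0 < gap f"
proof -
  obtain \<delta>0 where \<delta>0: "\<delta>0 > 0" "\<forall>x\<in>dom f. \<delta>0 \<le> rad f x"
    using rad_uniform[OF f] by (elim exE conjE)
  obtain L1 where L1: "\<forall>u\<in>dom f. \<forall>x\<in>dom f. dist u x < rad f x \<longrightarrow> div_diff f u x \<le> L1"
    using div_diff_bounded[OF f] by (elim exE)
  define c where "c = min 1 (min \<delta>0 (\<Delta> / (\<bar>L1\<bar> + 1)))"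
  have c: "0 < c" "c \<le> 1" "c \<le> \<delta>0" "c \<le> \<Delta> / (\<bar>L1\<bar> + 1)" using \<delta>0 \<Delta>_pos by (auto simp: c_def)
  have "has_gap f c"
    unfolding has_gap_def
  proof (intro ballI impI)
    fix u v assume uv: "u \<in> dom f" "v \<in> dom f" and d: "dist u v < c"
    have "div_diff f u v \<le> L1" using bspec[OF bspec[OF L1 uv(1)] uv(2)] bspec[OF \<delta>0(2) uv(2)] d c by simp
    then have "div_diff f u v * dist u v \<le> (\<bar>L1\<bar> + 1) * dist u v" by (intro mult_right_mono) auto
    then have "dist (the (f u)) (the (f v)) \<le> (\<bar>L1\<bar> + 1) * dist u v" by (simp add: div_diff_dist[OF f])
    also have "\<dots> < (\<bar>L1\<bar> + 1) * (\<Delta> / (\<bar>L1\<bar> + 1))" using d c(4) by (intro mult_strict_left_mono) auto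
    finally show "dist (the (f u)) (the (f v)) < \<Delta>" by simp
  qed
  then have "c \<le> gap f" using c by (intro gap_upper) auto
  then show ?thesis using c by simp
qed

text \<open>
  Moving both points to the other map's domain costs \<open>2 d\<close> in distance and keeps
  their images.
\<close>

lemma matched_gap:
  assumes f: "f \<in> conf" and g: "g \<in> conf" and m: "matched f g (\<epsilon> (\<beta> / (\<beta> - 1) * d))" and d: "0 \<le> d"
  shows "gap f - 2 * d \<le> gap g"
proof (cases "gap f - 2 * d \<le> 0")
  case True
  then show ?thesis using gap_nonneg[of g] by linarith
next
  case False
  have "gap f \<le> 1" unfolding gap_def
    by (rule cSUP_least) (use has_gap_0[of f] in \<open>auto intro!: exI[of _ 0]\<close>)
  have "has_gap g (gap f - 2 * d)"
    unfolding has_gap_def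
  proof (intro ballI impI)
    fix u v assume uv: "u \<in> dom g" "v \<in> dom g" and l: "dist u v < gap f - 2 * d"
    note m' = matched_sym[OF f g m]
    have close: "dist p p' \<le> d" if "\<epsilon> (\<beta> / (\<beta> - 1) * dist p p') \<le> \<epsilon> (\<beta> / (\<beta> - 1) * d)" for p p' :: 'a
    proof (rule ccontr)
      assume "\<not> dist p p' \<le> d"
      then have "\<beta> / (\<beta> - 1) * d < \<beta> / (\<beta> - 1) * dist p p'"
        using \<beta>_gt_1 by (intro mult_strict_left_mono) auto
      then have "\<epsilon> (\<beta> / (\<beta> - 1) * d) < \<epsilon> (\<beta> / (\<beta> - 1) * dist p p')"
        using \<beta>_gt_1 d by (subst \<epsilon>_less_iff) auto
      with that show False by simp
    qed
    obtain u' where u': "u' \<in> dom f" "f u' = g u" "dist u u' \<le> d"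
      by (rule matched_point[OF g f m' uv(1)]) (use close in blast)
    obtain v' where v': "v' \<in> dom f" "f v' = g v" "dist v v' \<le> d"
      by (rule matched_point[OF g f m' uv(2)]) (use close in blast)
    have "dist u' v' \<le> dist u' u + dist u v + dist v v'"
      using dist_triangle[of u' v' u] dist_triangle[of u v' v] by linarith
    then have "dist u' v' < gap f" using l u'(3) v'(3) by (simp add: dist_commute)
    then have "dist (the (f u')) (the (f v')) < \<Delta>"
      using has_gap_gap[of f] u'(1) v'(1) unfolding has_gap_def by simp
    then show "dist (the (g u)) (the (g v)) < \<Delta>" using u' v' by simp
  qed
  then show ?thesis using False \<open>gap f \<le> 1\<close> d by (intro gap_upper) auto
qed

section \<open>Shadowing\<close>

lemma \<epsilon>_inverse:
  assumes "0 \<le> r" "r \<le> \<epsilon> \<Delta>"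
  obtains \<rho> where "0 \<le> \<rho>" "\<rho> \<le> \<Delta>" "\<epsilon> \<rho> = r"
proof -
  have "continuous_on {0..\<Delta>} \<epsilon>" by (rule continuous_on_subset[OF \<epsilon>_cont]) auto
  then show ?thesis using IVT'[of \<epsilon> 0 r \<Delta>] assms \<epsilon>_0 \<Delta>_pos that by auto
qed

text \<open>
  The weight \<open>\<beta> / (\<beta> - 1)\<close> in the metric is made for this step. Passing
  to the paired point of \<open>g\<close> moves by at most \<open>(\<beta> - 1) \<rho> /
  \<beta>\<close>, and following the inverse branch of \<open>g\<close> from \<open>z\<close> to
  \<open>z'\<close> moves by at most \<open>\<rho> / \<beta>\<close>; together this is again at
  most \<open>\<rho>\<close>. Each of the two moves changes the logarithm of the derivative by
  at most \<open>\<epsilon> \<rho>\<close>. The strict bound by \<open>\<Delta>\<close> is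
  carried along because \<open>\<rho> = \<Delta>\<close> is allowed.
\<close>

lemma shadow_step:
  fixes f g :: "'a::metric_space \<rightharpoonup> 'a"
  assumes f: "f \<in> conf" and g: "g \<in> conf" and m: "matched f g (\<epsilon> \<rho>)"
    and \<rho>: "0 \<le> \<rho>" "\<rho> \<le> \<Delta>" and z: "dist z' z \<le> \<rho>" "dist z' z < \<Delta>"
  shows "\<exists>\<pi>. bij_betw \<pi> (fibre f z) (fibre g z') \<and>
    (\<forall>x\<in>fibre f z. (dist (\<pi> x) x \<le> \<rho> \<and> dist (\<pi> x) x < \<Delta>) \<and>
        \<bar>ln (conf_deriv g (\<pi> x)) - ln (conf_deriv f x)\<bar> \<le> 2 * \<epsilon> \<rho>)"
proof -
  obtain p where p: "bij_betw p (fibre f z) (fibre g z)"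
    "\<And>x. x \<in> fibre f z \<Longrightarrow> \<epsilon> (\<beta> / (\<beta> - 1) * dist x (p x)) + \<bar>ln (conf_deriv g (p x)) - ln (conf_deriv f x)\<bar> \<le> \<epsilon> \<rho>"
    by (rule matchedE[OF f g m]) blast
  obtain q where q: "bij_betw q (fibre g z) (fibre g z')"
    "\<And>x. x \<in> fibre g z \<Longrightarrow> dist (q x) x < rad g x"
    by (rule fibre_pairing[OF g, of z z']) (use z in \<open>simp_all add: dist_commute\<close>)
  have "(dist (q (p x)) x \<le> \<rho> \<and> dist (q (p x)) x < \<Delta>) \<and>
        \<bar>ln (conf_deriv g (q (p x))) - ln (conf_deriv f x)\<bar> \<le> 2 * \<epsilon> \<rho>" if x: "x \<in> fibre f z" for x
  proof -
    have px: "p x \<in> fibre g z" using bij_betwE[OF p(1)] x by blast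
    then have qx: "q (p x) \<in> fibre g z'" using bij_betwE[OF q(1)] by blast
    have gp: "g (p x) = Some z" "g (q (p x)) = Some z'" using px qx by (simp_all add: fibre_iff)
    then have d: "p x \<in> dom g" "q (p x) \<in> dom g" by auto
    have e0: "0 \<le> \<epsilon> (\<beta> / (\<beta> - 1) * dist x (p x))" using \<beta>_gt_1 by (intro \<epsilon>_nonneg) simp
    have 1: "\<epsilon> (\<beta> / (\<beta> - 1) * dist x (p x)) \<le> \<epsilon> \<rho>" "\<bar>ln (conf_deriv g (p x)) - ln (conf_deriv f x)\<bar> \<le> \<epsilon> \<rho>"
      using p(2)[OF x] e0 by linarith+
    have "\<beta> / (\<beta> - 1) * dist x (p x) \<le> \<rho>"
    proof (rule ccontr)
      assume "\<not> \<beta> / (\<beta> - 1) * dist x (p x) \<le> \<rho>"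
      then have "\<epsilon> \<rho> < \<epsilon> (\<beta> / (\<beta> - 1) * dist x (p x))" using \<rho> \<beta>_gt_1 by (subst \<epsilon>_less_iff) auto
      with 1 show False by simp
    qed
    then have "\<beta> * dist x (p x) \<le> (\<beta> - 1) * \<rho>" using \<beta>_gt_1 by (simp add: field_simps)
    moreover have "\<beta> * dist (q (p x)) (p x) \<le> dist z' z"
      using branch_expands[OF g d(2,1) q(2)[OF px]] gp by simp
    moreover have "\<beta> * dist (q (p x)) x \<le> \<beta> * dist (q (p x)) (p x) + \<beta> * dist x (p x)"
      unfolding distrib_left[symmetric] using dist_triangle2[of "q (p x)" x "p x"] \<beta>_gt_1
      by (intro mult_left_mono) auto
    ultimately have le: "\<beta> * dist (q (p x)) x \<le> dist z' z + (\<beta> - 1) * \<rho>" by linarith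
    have "\<beta> * dist (q (p x)) x \<le> \<beta> * \<rho>" using le z(1) by (simp add: left_diff_distrib)
    then have A: "dist (q (p x)) x \<le> \<rho>" using \<beta>_gt_1 by simp
    have "(\<beta> - 1) * \<rho> \<le> (\<beta> - 1) * \<Delta>" using \<rho> \<beta>_gt_1 by (intro mult_left_mono) auto
    then have "\<beta> * dist (q (p x)) x < \<beta> * \<Delta>" using le z(2) by (simp add: left_diff_distrib)
    then have B: "dist (q (p x)) x < \<Delta>" using \<beta>_gt_1 by simp
    have "\<bar>ln (conf_deriv g (q (p x))) - ln (conf_deriv g (p x))\<bar> \<le> \<epsilon> (dist z' z)"
      using branch_distortion(2)[OF g d(1,2) q(2)[OF px]] gp z(2) by simp
    also have "\<dots> \<le> \<epsilon> \<rho>" using z(1) by (intro \<epsilon>_mono) auto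
    finally show ?thesis using A B 1(2) by linarith
  qed
  then show ?thesis using bij_betw_trans[OF p(1) q(1)] by (intro exI[of _ "q \<circ> p"]) simp
qed

text \<open>
  The fibres of the same point under the two sequences start at distance zero, so the pairing of
  \<open>shadow_step\<close> can be iterated, with an error of \<open>2 r\<close> in the
  logarithm of the derivative per step.
\<close>

lemma ln_pinf_shadow:
  fixes F G :: "nat \<Rightarrow> 'a::{complete_space, perfect_space} \<rightharpoonup> 'a"
  assumes F: "conf_seq F" and G: "conf_seq G" and r: "0 \<le> r" "r \<le> \<epsilon> \<Delta>" and s: "0 \<le> s"
    and m: "\<And>k. t \<le> k \<Longrightarrow> k < t + n \<Longrightarrow> matched (F (Suc k)) (G (Suc k)) r"
  shows "ln (pinf s F t n) - 2 * r * real n * s \<le> ln (pinf s G t n)"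
proof -
  obtain \<rho> where \<rho>: "0 \<le> \<rho>" "\<rho> \<le> \<Delta>" "\<epsilon> \<rho> = r" by (rule \<epsilon>_inverse[OF r])
  have sum_le: "exp (- (s * (2 * r * real n))) * psum s F t n y \<le> psum s G t n y" for y
  proof -
    have "\<exists>\<psi>. bij_betw \<psi> (fibre (iter_seq F t n) y) (fibre (iter_seq G t n) y) \<and>
      (\<forall>x\<in>fibre (iter_seq F t n) y. \<forall>j\<le>n. (dist (orb G t j (\<psi> x)) (orb F t j x) \<le> \<rho> \<and>
            dist (orb G t j (\<psi> x)) (orb F t j x) < \<Delta>) \<and>
        (j < n \<longrightarrow> \<bar>ln (conf_deriv (G (Suc (t + j))) (orb G t j (\<psi> x))) - ln (conf_deriv (F (Suc (t + j))) (orb F t j x))\<bar> \<le> 2 * r))"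
    proof (rule fibre_iter_pairing[where C = "\<lambda>x u. dist u x \<le> \<rho> \<and> dist u x < \<Delta>"
          and R = "\<lambda>k x u. \<bar>ln (conf_deriv (G (Suc k)) u) - ln (conf_deriv (F (Suc k)) x)\<bar> \<le> 2 * r"])
      fix k and z z' :: 'a assume k: "t \<le> k" "k < t + n" and d: "dist z' z \<le> \<rho> \<and> dist z' z < \<Delta>"
      have fg: "F (Suc k) \<in> conf" "G (Suc k) \<in> conf" using conf_seqD[OF F, of 0 k] conf_seqD[OF G, of 0 k] by simp_all
      show "\<exists>\<pi>. bij_betw \<pi> (fibre (F (Suc k)) z) (fibre (G (Suc k)) z') \<and>
          (\<forall>x\<in>fibre (F (Suc k)) z. (dist (\<pi> x) x \<le> \<rho> \<and> dist (\<pi> x) x < \<Delta>) \<and>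
            \<bar>ln (conf_deriv (G (Suc k)) (\<pi> x)) - ln (conf_deriv (F (Suc k)) x)\<bar> \<le> 2 * r)"
        using shadow_step[OF fg _ \<rho>(1,2) conjunct1[OF d] conjunct2[OF d]] m[OF k] by (simp add: \<rho>(3))
    qed (use \<rho> \<Delta>_pos in simp)
    then obtain \<psi> where \<psi>: "bij_betw \<psi> (fibre (iter_seq F t n) y) (fibre (iter_seq G t n) y)"
      and c: "\<forall>x\<in>fibre (iter_seq F t n) y. \<forall>j\<le>n. (dist (orb G t j (\<psi> x)) (orb F t j x) \<le> \<rho> \<and>
            dist (orb G t j (\<psi> x)) (orb F t j x) < \<Delta>) \<and>
        (j < n \<longrightarrow> \<bar>ln (conf_deriv (G (Suc (t + j))) (orb G t j (\<psi> x))) - ln (conf_deriv (F (Suc (t + j))) (orb F t j x))\<bar> \<le> 2 * r)"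
      by (elim exE conjE)
    show ?thesis
    proof (rule psum_compare[OF F \<psi> s])
      fix x assume x: "x \<in> fibre (iter_seq F t n) y"
      then have "\<psi> x \<in> fibre (iter_seq G t n) y" using bij_betwE[OF \<psi>] by blast
      then have d: "\<psi> x \<in> dom (iter_seq G t n)" "x \<in> dom (iter_seq F t n)"
        using fibre_dom[OF G] fibre_dom[OF F] x by blast+
      show pos: "0 < iter_deriv G t n (\<psi> x)" by (rule iter_deriv_pos[OF G d(1)])
      have "ln (iter_deriv G t n (\<psi> x)) \<le> (\<Sum>j<n. ln (conf_deriv (F (t + Suc j)) (orb F t j x)) + 2 * r)"
        unfolding ln_iter_deriv[OF G d(1)]
      proof (rule sum_mono)
        fix j assume "j \<in> {..<n}"
        then have "\<bar>ln (conf_deriv (G (t + Suc j)) (orb G t j (\<psi> x))) - ln (conf_deriv (F (t + Suc j)) (orb F t j x))\<bar> \<le> 2 * r"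
          using bspec[OF c x, THEN spec, of j] by simp
        then show "ln (conf_deriv (G (t + Suc j)) (orb G t j (\<psi> x))) \<le> ln (conf_deriv (F (t + Suc j)) (orb F t j x)) + 2 * r"
          by linarith
      qed
      also have "\<dots> = ln (iter_deriv F t n x) + 2 * r * real n"
        unfolding ln_iter_deriv[OF F d(2)] by (simp add: sum.distrib)
      also have "\<dots> = ln (exp (2 * r * real n) * iter_deriv F t n x)"
        using iter_deriv_pos[OF F d(2)] by (simp add: ln_mult)
      finally show "iter_deriv G t n (\<psi> x) \<le> exp (2 * r * real n) * iter_deriv F t n x"
        using pos iter_deriv_pos[OF F d(2)] by simp
    qed
  qed
  have "exp (- (s * (2 * r * real n))) * pinf s F t n \<le> pinf s G t n"
  proof (rule pinf_greatest)
    fix y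
    have "exp (- (s * (2 * r * real n))) * pinf s F t n \<le> exp (- (s * (2 * r * real n))) * psum s F t n y"
      by (intro mult_left_mono pinf_le) simp
    also note sum_le
    finally show "exp (- (s * (2 * r * real n))) * pinf s F t n \<le> psum s G t n y" .
  qed
  then have "ln (exp (- (s * (2 * r * real n))) * pinf s F t n) \<le> ln (pinf s G t n)"
    by (intro ln_mono) (use pinf_pos[OF F s] in auto)
  then show ?thesis using pinf_pos[OF F s, of t n] by (simp add: ln_mult mult_ac)
qed

section \<open>Measurability by countable approximation\<close>

text \<open>
  This is where the triangle inequality is needed: open balls belong to the Borel sets of the
  metric.
\<close>

lemma dE_ball_open:
  assumes c: "c \<in> conf" and a: "0 < a"
  shows "dE_open \<Delta> \<beta> \<epsilon> {h \<in> conf. dE \<beta> \<epsilon> h c < ennreal a}"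
  unfolding dE_open_def
proof (intro conjI ballI)
  fix h assume "h \<in> {h \<in> conf. dE \<beta> \<epsilon> h c < ennreal a}"
  then have h: "h \<in> conf" and lt: "dE \<beta> \<epsilon> h c < ennreal a" by auto
  define b where "b = enn2real (dE \<beta> \<epsilon> h c)"
  have b: "dE \<beta> \<epsilon> h c = ennreal b" "0 \<le> b"
    using lt by (auto simp: b_def ennreal_enn2real_if top.not_eq_extremum[symmetric])
  then have "b < a" using lt by (simp add: ennreal_less_iff)
  have hc: "matched h c b" using dE_imp_matched[OF h c b(2)] b(1) by simp
  have "0 < a - b" using \<open>b < a\<close> by simp
  then obtain d where d: "0 < d" "d < a - b" using dense[of 0 "a - b"] by blast
  show "\<exists>e>0. \<forall>g\<in>conf. dE \<beta> \<epsilon> h g < e \<longrightarrow> g \<in> {h \<in> conf. dE \<beta> \<epsilon> h c < ennreal a}"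
  proof (intro exI[of _ "ennreal d"] conjI ballI impI)
    show "0 < ennreal d" using d by simp
    fix g assume g: "g \<in> conf" and l: "dE \<beta> \<epsilon> h g < ennreal d"
    have "matched h g d" using dE_imp_matched[OF h g less_imp_le[OF d(1)]] l by simp
    then have "matched g c (d + b)" by (rule matched_trans[OF h g c _ hc])
    then have le: "dE \<beta> \<epsilon> g c \<le> ennreal (d + b)" by (rule matched_imp_dE)
    have "d + b < a" using d(2) by simp
    then have "ennreal (d + b) < ennreal a" by (rule ennreal_lessI[OF a])
    with le have "dE \<beta> \<epsilon> g c < ennreal a" by (rule le_less_trans)
    with g show "g \<in> {h \<in> conf. dE \<beta> \<epsilon> h c < ennreal a}" by (intro CollectI conjI)
  qed
qed (rule subsetI, erule CollectE, erule conjunct1)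

end

lemma (in prob_space) measurable_finite_coding:
  fixes idx :: "nat \<Rightarrow> 'a \<Rightarrow> nat" and H :: "nat list \<Rightarrow> real"
  assumes [measurable]: "\<And>i. idx i \<in> measurable M (count_space UNIV)"
  shows "(\<lambda>x. H (map (\<lambda>i. idx i x) [0..<n])) \<in> borel_measurable M"
proof (induction n arbitrary: H)
  case (Suc n)
  have "(\<lambda>x. (\<lambda>a x. H (map (\<lambda>i. idx i x) [0..<n] @ [a])) (idx n x) x) \<in> borel_measurable M"
    by (rule measurable_compose_countable) (auto intro: Suc[of "\<lambda>l. H (l @ [_])"])
  then show ?case by simp
qed simp

locale random_conf = ergodic_system M T + conf_params \<Delta> \<beta> \<epsilon>
  for M :: "'w measure" and T \<Delta> \<beta> \<epsilon>
begin

context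
  fixes f :: "'w \<Rightarrow> 'a::{complete_space, perfect_space} \<rightharpoonup> 'a"
  assumes f: "f \<in> random_maps M \<Delta> \<beta> \<epsilon>"
begin

lemma random_map_conf: "x \<in> space M \<Longrightarrow> f x \<in> conf"
proof -
  assume x: "x \<in> space M"
  have "f \<in> measurable M (borel_E \<Delta> \<beta> \<epsilon>)" using f unfolding random_maps_def by simp
  then have "f x \<in> space (borel_E \<Delta> \<beta> \<epsilon>)" using x by (rule measurable_space)
  also have "space (borel_E \<Delta> \<beta> \<epsilon>) = conf"
    unfolding borel_E_def by (rule space_measure_of) (auto simp: dE_open_def)
  finally show ?thesis .
qed

lemma orbit_conf_seq: "x \<in> space M \<Longrightarrow> conf_seq (orbit_seq T f x)"
  unfolding conf_seq_def orbit_seq_def using random_map_conf funpow_T_space by blast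

lemma orbit_seq_shift: "1 \<le> k \<Longrightarrow> orbit_seq T f ((T ^^ t) x) k = orbit_seq T f x (t + k)"
  unfolding orbit_seq_def by (cases k) (auto simp: funpow_add[symmetric, THEN fun_cong, unfolded comp_def] add.commute)

text \<open>
  Choosing the first element of the countable dense set that is close enough is a measurable
  choice, since balls are Borel sets.
\<close>

lemma approximation:
  assumes e: "0 < e"
  shows "\<exists>c idx. (\<forall>k::nat. (c k :: 'a \<rightharpoonup> 'a) \<in> conf) \<and> idx \<in> measurable M (count_space UNIV) \<and>
    (AE x in M. dE \<beta> \<epsilon> (f x) (c (idx x)) < ennreal e)"
proof -
  obtain A C where A: "A \<in> sets M" "measure M A = 1" and C: "countable C" "C \<subseteq> f ` A"
    "\<forall>x\<in>A. \<forall>e>0. \<exists>c\<in>C. dE \<beta> \<epsilon> (f x) c < e"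
    using f unfolding random_maps_def by blast
  have fm: "f \<in> measurable M (borel_E \<Delta> \<beta> \<epsilon>)" using f unfolding random_maps_def by simp
  have "A \<noteq> {}" using A by auto
  then obtain x0 where "x0 \<in> A" by blast
  then have "\<exists>c\<in>C. dE \<beta> \<epsilon> (f x0) c < 1" by (rule C(3)[rule_format]) simp
  then have "C \<noteq> {}" by blast
  define c where "c = from_nat_into C"
  have cC: "c k \<in> C" for k unfolding c_def by (rule from_nat_into[OF \<open>C \<noteq> {}\<close>])
  have c: "c k \<in> conf" for k
  proof -
    obtain x where "x \<in> A" "c k = f x" using cC[of k] C(2) by blast
    then show ?thesis using random_map_conf[of x] sets.sets_into_space[OF A(1)] by auto
  qed
  let ?P = "\<lambda>k x. dE \<beta> \<epsilon> (f x) (c k) < ennreal e"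
  have pred: "Measurable.pred M (?P k)" for k
  proof -
    have "{h \<in> conf. dE \<beta> \<epsilon> h (c k) < ennreal e} \<in> sets (borel_E \<Delta> \<beta> \<epsilon>)"
    proof -
      have sub: "{U :: ('a \<rightharpoonup> 'a) set. dE_open \<Delta> \<beta> \<epsilon> U} \<subseteq> Pow conf" by (auto simp: dE_open_def)
      show ?thesis unfolding borel_E_def sets_measure_of[OF sub]
        by (rule sigma_sets.Basic) (rule CollectI, rule dE_ball_open[OF c e])
    qed
    then have "f -` {h \<in> conf. dE \<beta> \<epsilon> h (c k) < ennreal e} \<inter> space M \<in> sets M"
      by (rule measurable_sets[OF fm])
    also have "f -` {h \<in> conf. dE \<beta> \<epsilon> h (c k) < ennreal e} \<inter> space M = {x \<in> space M. ?P k x}"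
      using random_map_conf by auto
    finally show ?thesis by (simp add: pred_def)
  qed
  define idx where "idx = (\<lambda>x. LEAST k. ?P k x)"
  have idxm: "idx \<in> measurable M (count_space UNIV)"
    unfolding idx_def by (rule measurable_Least[OF pred])
  have near: "AE x in M. dE \<beta> \<epsilon> (f x) (c (idx x)) < ennreal e"
  proof -
    have "AE x in M. x \<in> A" using A by (subst AE_in_set_eq_1) auto
    then show ?thesis
    proof (rule AE_mp, intro AE_I2 impI)
      fix x assume "x \<in> A"
      then have "\<exists>b\<in>C. dE \<beta> \<epsilon> (f x) b < ennreal e" by (rule C(3)[rule_format]) (simp add: e)
      then obtain b where "b \<in> C" "dE \<beta> \<epsilon> (f x) b < ennreal e" by blast
      moreover obtain k where "c k = b"
        using from_nat_into_surj[OF C(1) \<open>b \<in> C\<close>] unfolding c_def by blast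
      ultimately have "?P k x" by simp
      then show "?P (idx x) x" unfolding idx_def by (rule LeastI)
    qed
  qed
  show ?thesis
    by (rule exI[of _ c], rule exI[of _ idx]) (intro conjI allI c idxm near)
qed

text \<open>
  A continuous function of finitely many maps is, almost surely, a limit of functions that
  depend only on the indices of approximating maps; each of these has countably many values.
  Only equality almost everywhere is obtained, because the approximation holds only on a set of
  full measure.
\<close>

lemma measurable_version:
  fixes \<Phi> :: "(nat \<Rightarrow> 'a \<rightharpoonup> 'a) \<Rightarrow> real"
  assumes cont: "\<And>F \<eta>. conf_seq F \<Longrightarrow> 0 < \<eta> \<Longrightarrow> \<exists>r>0. \<forall>G. conf_seq G \<longrightarrow>
      (\<forall>k\<in>{1..n}. matched (F k) (G k) r) \<longrightarrow> \<bar>\<Phi> G - \<Phi> F\<bar> < \<eta>"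
  shows "\<exists>X\<in>borel_measurable M. AE x in M. \<Phi> (orbit_seq T f x) = X x"
proof -
  have "\<forall>j. \<exists>c idx. (\<forall>k. (c k :: 'a \<rightharpoonup> 'a) \<in> conf) \<and> idx \<in> measurable M (count_space UNIV) \<and>
     (AE x in M. dE \<beta> \<epsilon> (f x) (c (idx x :: nat)) < ennreal (1 / real (Suc j)))"
    by (intro allI approximation) simp
  from choice[OF this] obtain c :: "nat \<Rightarrow> nat \<Rightarrow> 'a \<rightharpoonup> 'a" where
    "\<forall>j. \<exists>idx. (\<forall>k. (c j k :: 'a \<rightharpoonup> 'a) \<in> conf) \<and> idx \<in> measurable M (count_space UNIV) \<and>
     (AE x in M. dE \<beta> \<epsilon> (f x) (c j (idx x :: nat)) < ennreal (1 / real (Suc j)))" by (elim exE)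
  from choice[OF this] obtain idx :: "nat \<Rightarrow> 'w \<Rightarrow> nat" where
    ci: "\<forall>j. (\<forall>k. (c j k :: 'a \<rightharpoonup> 'a) \<in> conf) \<and> idx j \<in> measurable M (count_space UNIV) \<and>
     (AE x in M. dE \<beta> \<epsilon> (f x) (c j (idx j x :: nat)) < ennreal (1 / real (Suc j)))" by (elim exE)
  from ci have c: "\<And>j k. c j k \<in> conf" and idx: "\<And>j. idx j \<in> measurable M (count_space UNIV)"
    and near: "\<And>j. AE x in M. dE \<beta> \<epsilon> (f x) (c j (idx j x)) < ennreal (1 / real (Suc j))"
    by simp_all
  define H where "H = (\<lambda>j xs. \<Phi> (\<lambda>k. if 1 \<le> k \<and> k \<le> n then c j (xs ! (k - 1)) else c j 0))"
  define Y where "Y = (\<lambda>j x. H j (map (\<lambda>i. idx j ((T ^^ i) x)) [0..<n]))"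
  have Ym[measurable]: "Y j \<in> borel_measurable M" for j
    unfolding Y_def by (rule measurable_finite_coding) (rule measurable_compose[OF funpow_T_measurable idx])
  define X where "X = (\<lambda>x. lim (\<lambda>j. Y j x))"
  have "X \<in> borel_measurable M" unfolding X_def by measurable
  moreover have "AE x in M. \<Phi> (orbit_seq T f x) = X x"
  proof -
    have "AE x in M. \<forall>j i. dE \<beta> \<epsilon> (f ((T ^^ i) x)) (c j (idx j ((T ^^ i) x))) < ennreal (1 / real (Suc j))"
      unfolding AE_all_countable using AE_shift[OF near] by blast
    then show ?thesis
    proof (rule AE_mp, intro AE_I2 impI)
      fix x assume x: "\<forall>j i. dE \<beta> \<epsilon> (f ((T ^^ i) x)) (c j (idx j ((T ^^ i) x))) < ennreal (1 / real (Suc j))"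
        and xs: "x \<in> space M"
      let ?F = "orbit_seq T f x"
      let ?G = "\<lambda>j k. if 1 \<le> k \<and> k \<le> n then c j (map (\<lambda>i. idx j ((T ^^ i) x)) [0..<n] ! (k - 1)) else c j 0"
      have G: "conf_seq (?G j)" for j unfolding conf_seq_def using c by simp
      have "(\<lambda>j. Y j x) \<longlonglongrightarrow> \<Phi> ?F"
      proof (rule tendstoI)
        fix \<eta> :: real assume "\<eta> > 0"
        then obtain r where r: "r > 0" "\<And>G. conf_seq G \<Longrightarrow> (\<forall>k\<in>{1..n}. matched (?F k) (G k) r) \<Longrightarrow> \<bar>\<Phi> G - \<Phi> ?F\<bar> < \<eta>"
          using cont[OF orbit_conf_seq[OF xs] \<open>\<eta> > 0\<close>] by blast
        obtain N :: nat where N: "1 / real (Suc N) < r" using nat_approx_posE[OF r(1)] by blast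
        have "dist (Y j x) (\<Phi> ?F) < \<eta>" if "j \<ge> N" for j
        proof -
          have "1 / real (Suc j) \<le> 1 / real (Suc N)" using that by (simp add: frac_le)
          then have jr: "1 / real (Suc j) < r" using N by linarith
          have "\<forall>k\<in>{1..n}. matched (?F k) (?G j k) r"
          proof
            fix k assume k: "k \<in> {1..n}"
            then have eq: "?G j k = c j (idx j ((T ^^ (k - 1)) x))" "?F k = f ((T ^^ (k - 1)) x)"
              by (auto simp: orbit_seq_def)
            have "dE \<beta> \<epsilon> (?F k) (?G j k) < ennreal (1 / real (Suc j))"
              unfolding eq using x by blast
            also have "\<dots> \<le> ennreal r" using jr by (intro ennreal_leI) simp
            finally show "matched (?F k) (?G j k) r"
              using dE_imp_matched[of "?F k" "?G j k" r] r(1) c random_map_conf[OF funpow_T_space[OF xs]]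
              unfolding eq by (simp add: less_imp_le)
          qed
          then have "\<bar>\<Phi> (?G j) - \<Phi> ?F\<bar> < \<eta>" by (rule r(2)[OF G])
          then show ?thesis unfolding Y_def H_def dist_real_def .
        qed
        then show "eventually (\<lambda>j. dist (Y j x) (\<Phi> ?F) < \<eta>) sequentially"
          by (rule eventually_sequentiallyI)
      qed
      then show "\<Phi> ?F = X x" unfolding X_def by (rule limI[symmetric])
    qed
  qed
  ultimately show ?thesis by blast
qed

end

end

section \<open>Compactness of repellers and the upper box dimension\<close>

lemma diameter_le_metric:
  fixes S :: "'a::metric_space set"
  assumes "0 \<le> d" "\<And>x y. x \<in> S \<Longrightarrow> y \<in> S \<Longrightarrow> dist x y \<le> d"
  shows "diameter S \<le> d"
  unfolding diameter_def using assms by (auto intro!: cSUP_least)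

text \<open>
  A cover by \<open>N\<close> balls of radius \<open>r\<close> has Hausdorff sum at most
  \<open>N (2 r)\<^sup>t\<close>; along radii that realise the lower box dimension this tends to
  zero for every larger \<open>t\<close>.
\<close>

lemma hausdorff_le_lower_box: "hausdorff_dim A \<le> lower_box_dim A"
proof (rule ccontr)
  assume "\<not> hausdorff_dim A \<le> lower_box_dim A"
  then have "lower_box_dim A < hausdorff_dim A" by simp
  then obtain a where a: "lower_box_dim A < a" "a < hausdorff_dim A" using dense by blast
  then obtain b where b: "a < b" "b < hausdorff_dim A" using dense by blast
  have "a < top" "b < top" using a b by (auto simp: less_top[symmetric] intro: less_le_trans[OF _ top_greatest])
  define t' where "t' = enn2real a"
  define t where "t = enn2real b"
  have at: "a = ennreal t'" "b = ennreal t" "0 \<le> t'" "0 \<le> t"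
    using \<open>a < top\<close> \<open>b < top\<close> by (simp_all add: t'_def t_def)
  have tt: "t' < t" using b(1) at by (simp add: ennreal_less_iff)
  have "hausdorff_premeasure t \<rho> A \<le> ennreal e" if \<rho>: "0 < \<rho>" and e: "0 < e" for \<rho> e
  proof -
    have "\<not> eventually (\<lambda>r. a \<le> box_quotient A r) (at_right 0)"
      using a(1) Liminf_bounded[of a "box_quotient A" "at_right 0"] unfolding lower_box_dim_def by auto
    then have freq: "frequently (\<lambda>r. box_quotient A r < a) (at_right 0)"
      unfolding frequently_def by (simp add: not_less)
    have "((\<lambda>r. 2 powr t * r powr (t - t')) \<longlongrightarrow> 2 powr t * 0) (at_right 0)"
      using tt by (intro tendsto_mult tendsto_const) real_asymp
    then have "eventually (\<lambda>r. 2 powr t * r powr (t - t') < e) (at_right 0)"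
      using e by (intro order_tendstoD(2)[where y = "2 powr t * 0"]) auto
    moreover have "eventually (\<lambda>r::real. 0 < r \<and> r < 1 \<and> 2 * r \<le> \<rho>) (at_right 0)"
      unfolding eventually_at_right_field using \<rho> by (intro exI[of _ "min 1 (\<rho> / 2)"]) auto
    ultimately have "eventually (\<lambda>r. 2 powr t * r powr (t - t') < e \<and> 0 < r \<and> r < 1 \<and> 2 * r \<le> \<rho>) (at_right 0)"
      by eventually_elim simp
    then have "eventually (\<lambda>r. box_quotient A r < a \<longrightarrow> box_quotient A r < a \<and> (2 powr t * r powr (t - t') < e \<and> 0 < r \<and> r < 1 \<and> 2 * r \<le> \<rho>)) (at_right 0)"
      by (rule eventually_mono) simp
    then have "frequently (\<lambda>r. box_quotient A r < a \<and> (2 powr t * r powr (t - t') < e \<and> 0 < r \<and> r < 1 \<and> 2 * r \<le> \<rho>)) (at_right 0)"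
      by (rule frequently_rev_mp[OF freq])
    then obtain r where r: "box_quotient A r < a" "2 powr t * r powr (t - t') < e" "0 < r" "r < 1" "2 * r \<le> \<rho>"
      by (auto dest: frequently_ex)
    have ex: "\<exists>C. ball_cover A r C"
      using r(1) \<open>a < top\<close> unfolding box_quotient_def by (auto split: if_splits)
    then have "covering_number A r \<in> {card C | C. ball_cover A r C}"
      unfolding covering_number_def by (intro Inf_nat_def1) auto
    then obtain C where C: "ball_cover A r C" "card C = covering_number A r" by auto
    let ?N = "covering_number A r"
    have q: "ennreal (ln (real ?N) / - ln r) < ennreal t'"
      using r(1) ex unfolding box_quotient_def at(1) by simp
    have lr: "- ln r > 0" using r by simp
    have lnN: "ln (real ?N) / - ln r < t'" if "?N > 0"
    proof -
      have "0 \<le> ln (real ?N)" using that by simp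
      then have "0 \<le> ln (real ?N) / - ln r" using lr by (rule divide_nonneg_pos)
      then show ?thesis using q ennreal_less_iff by blast
    qed
    have N: "real ?N \<le> r powr (- t')"
    proof (cases "?N = 0")
      case False
      then have "ln (real ?N) < t' * - ln r" using lnN[unfolded pos_divide_less_eq[OF lr]] by blast
      then have "real ?N < exp (t' * - ln r)" using False by (metis exp_less_mono exp_ln of_nat_0_less_iff neq0_conv)
      then show ?thesis using r by (simp add: powr_def)
    qed simp
    obtain h where h: "bij_betw h {0..<card C} C" using ex_bij_betw_nat_finite C(1) unfolding ball_cover_def by blast
    define U where "U = (\<lambda>i. if i < card C then ball (h i) r else {})"
    have "A \<subseteq> (\<Union>i. U i)"
    proof
      fix x assume "x \<in> A"
      then obtain c where "c \<in> C" "x \<in> ball c r" using C(1) unfolding ball_cover_def by blast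
      moreover have "c \<in> h ` {0..<card C}" using bij_betw_imp_surj_on[OF h] \<open>c \<in> C\<close> by simp
      then obtain i where "i < card C" "h i = c" by auto
      ultimately show "x \<in> (\<Union>i. U i)" by (auto simp: U_def intro!: exI[of _ i])
    qed
    moreover have diam: "diameter (ball (h i) r) \<le> 2 * r" for i
    proof (rule diameter_le_metric)
      fix x y assume "x \<in> ball (h i) r" "y \<in> ball (h i) r"
      then show "dist x y \<le> 2 * r" using dist_triangle3[of x y "h i"] by simp
    qed (use r in simp)
    have "bounded (U i) \<and> diameter (U i) \<le> \<rho>" for i
      using diam[of i] r by (auto simp: U_def)
    ultimately have "hausdorff_premeasure t \<rho> A \<le> (\<Sum>i. diam_pow t (U i))"
      unfolding hausdorff_premeasure_def by (intro Inf_lower) blast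
    also have "(\<Sum>i. diam_pow t (U i)) = (\<Sum>i<card C. diam_pow t (U i))"
      by (rule suminf_finite) (auto simp: U_def diam_pow_def)
    also have "\<dots> \<le> (\<Sum>i<card C. ennreal ((2 * r) powr t))"
    proof (rule sum_mono)
      fix i assume "i \<in> {..<card C}"
      then have U: "U i = ball (h i) r" "U i \<noteq> {}" using r by (auto simp: U_def)
      have "diameter (U i) powr t \<le> (2 * r) powr t"
        using diam[of i] at unfolding U(1) by (intro powr_mono2) (auto simp: diameter_ge_0)
      then show "diam_pow t (U i) \<le> ennreal ((2 * r) powr t)"
        using U at tt by (auto simp: diam_pow_def intro!: ennreal_leI)
    qed
    also have "\<dots> = ennreal (real ?N * (2 * r) powr t)"
      using C(2) by (simp add: ennreal_of_nat_eq_real_of_nat ennreal_mult'')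
    also have "real ?N * (2 * r) powr t \<le> r powr (- t') * (2 * r) powr t"
      using N by (intro mult_right_mono) auto
    also have "\<dots> = 2 powr t * r powr (t - t')"
      using r by (simp add: powr_mult powr_diff powr_minus field_simps)
    finally show ?thesis using r(2) by (metis (no_types, lifting) ennreal_leI less_imp_le order_trans)
  qed
  then have "hausdorff_premeasure t \<rho> A = 0" if "0 < \<rho>" for \<rho>
    using that by (metis ennreal_le_epsilon add_0 le_zero_eq)
  then have "hausdorff_measure t A = 0" unfolding hausdorff_measure_def by simp
  then have "hausdorff_dim A \<le> ennreal t" unfolding hausdorff_dim_def using at by (intro Inf_lower) auto
  then show False using b(2) at by simp
qed

lemma lower_box_le_upper_box: "lower_box_dim A \<le> upper_box_dim A"
  unfolding lower_box_dim_def upper_box_dim_def by (rule Liminf_le_Limsup) simp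

context conf_params
begin

text \<open>
  The repeller seen from time \<open>t\<close>: the points that can be iterated forever,
  starting with the map number \<open>t + 1\<close>. Time zero contributes no condition, since
  the empty iterate is defined everywhere.
\<close>

definition shift_repeller :: "(nat \<Rightarrow> 'a \<rightharpoonup> 'a) \<Rightarrow> nat \<Rightarrow> 'a set" where
  "shift_repeller F t = (\<Inter>n. dom (iter_seq F t n))"

lemma repeller_eq: "repeller F = shift_repeller F 0"
proof -
  have "dom (iter_seq F 0 0) = UNIV" by simp
  then have "(\<Inter>n. dom (iter_seq F 0 n)) = (\<Inter>n\<in>{1..}. dom (iter_seq F 0 n))"
  proof (intro set_eqI iffI)
    fix x assume d: "dom (iter_seq F 0 0) = UNIV" and x: "x \<in> (\<Inter>n\<in>{1..}. dom (iter_seq F 0 n))"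
    have "x \<in> dom (iter_seq F 0 n)" for n
    proof (cases n)
      case 0
      then show ?thesis using d by simp
    next
      case (Suc k)
      then have "n \<in> {1..}" by simp
      then show ?thesis by (rule INT_D[OF x])
    qed
    then show "x \<in> (\<Inter>n. dom (iter_seq F 0 n))" by (rule INT_I)
  qed (rule INT_I, erule INT_D, simp)
  then show ?thesis unfolding repeller_def shift_repeller_def mpreim_UNIV ..
qed

lemma shift_repellerD: "x \<in> shift_repeller F t \<Longrightarrow> x \<in> dom (iter_seq F t n)"
  unfolding shift_repeller_def by (erule INT_D) simp

lemma shift_repellerI: "(\<And>n. x \<in> dom (iter_seq F t n)) \<Longrightarrow> x \<in> shift_repeller F t"
  unfolding shift_repeller_def by (rule INT_I)

lemma orb_shift_repeller:
  assumes "x \<in> shift_repeller F t" shows "orb F t n x \<in> shift_repeller F (t + n)"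
proof (rule shift_repellerI)
  fix k show "orb F t n x \<in> dom (iter_seq F (t + n) k)"
    using shift_repellerD[OF assms, of "n + k"] unfolding iter_seq_dom_add by (rule conjunct2)
qed

lemma shift_repeller_iff:
  "x \<in> shift_repeller F t \<longleftrightarrow> x \<in> dom (iter_seq F t n) \<and> orb F t n x \<in> shift_repeller F (t + n)"
proof (intro iffI conjI)
  assume a: "x \<in> dom (iter_seq F t n) \<and> orb F t n x \<in> shift_repeller F (t + n)"
  have "x \<in> dom (iter_seq F t (n + k))" for k
    unfolding iter_seq_dom_add by (rule conjI[OF conjunct1[OF a] shift_repellerD[OF conjunct2[OF a]]])
  then have "x \<in> dom (iter_seq F t k)" for k
    by (rule iter_seq_dom_mono[of _ _ _ "n + k"]) simp
  then show "x \<in> shift_repeller F t" by (rule shift_repellerI)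
qed (simp_all only: shift_repellerD orb_shift_repeller)

context
  fixes F :: "nat \<Rightarrow> 'a::{complete_space, perfect_space} \<rightharpoonup> 'a" and n0 :: nat
  assumes F: "conf_seq F" and mix: "mixing n0 \<Delta> F"
begin

text \<open>
  After \<open>n\<close> steps the point is \<open>\<Delta>\<close>-close to the fibre of
  \<open>y\<close> under the next \<open>n0\<close> maps, and this closeness is pulled back
  along the orbit.
\<close>

lemma mixing_cover:
  assumes x: "x \<in> dom (iter_seq F t (n + n0))"
  obtains x' where "x' \<in> fibre (iter_seq F t (n + n0)) y" "close F t n x' x" "dist (orb F t n x) (orb F t n x') < \<Delta>"
proof -
  note x' = x[unfolded iter_seq_dom_add]
  obtain z where z: "z \<in> fibre (iter_seq F (t + n) n0) y" "dist (orb F t n x) z < \<Delta>"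
    using mix conjunct2[OF x'] unfolding mixing_def mpreim_UNIV by blast
  obtain \<psi> where \<psi>: "bij_betw \<psi> (fibre (iter_seq F t n) z) (fibre (iter_seq F t n) (orb F t n x))"
    "\<And>x. x \<in> fibre (iter_seq F t n) z \<Longrightarrow> close F t n x (\<psi> x)"
    by (rule fibre_pairing_iter[OF F z(2)]) blast
  have "x \<in> fibre (iter_seq F t n) (orb F t n x)" using conjunct1[OF x'] by (auto simp: fibre_iff)
  then obtain w where w: "w \<in> fibre (iter_seq F t n) z" "\<psi> w = x"
    using bij_betw_imp_surj_on[OF \<psi>(1)] by (metis imageE)
  have "w \<in> fibre (iter_seq F t (n + n0)) y" using w(1) z(1) unfolding fibre_iff iter_seq_add_iff by blast
  moreover have "close F t n w x" using \<psi>(2)[OF w(1)] w(2) by simp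
  moreover have "dist (orb F t n x) (orb F t n w) < \<Delta>" using z(2) fibre_orb[OF F w(1)] by simp
  ultimately show ?thesis by (rule that)
qed

lemma domain_finite_cover:
  "dom (iter_seq F t (n + n0)) \<subseteq> (\<Union>c\<in>fibre (iter_seq F t (n + n0)) y. ball c (\<Delta> / \<beta> ^ n))"
proof
  fix x assume "x \<in> dom (iter_seq F t (n + n0))"
  then obtain x' where x': "x' \<in> fibre (iter_seq F t (n + n0)) y" "close F t n x' x" "dist (orb F t n x) (orb F t n x') < \<Delta>"
    by (rule mixing_cover)
  have "dist x x' * \<beta> ^ n < \<Delta>" using close_contract[OF F x'(2), of 0] x'(3) by simp
  then have "dist x' x < \<Delta> / \<beta> ^ n" using \<beta>_gt_1 by (simp add: pos_less_divide_eq dist_commute)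
  then show "x \<in> (\<Union>c\<in>fibre (iter_seq F t (n + n0)) y. ball c (\<Delta> / \<beta> ^ n))" using x'(1) by auto
qed

text \<open>
  The space \<open>K\<close> need not be compact, but the domain of a long iterate is covered by
  finitely many small balls, centred at the fibre of one point
  (\<open>domain_finite_cover\<close>). So a sequence whose members lie in longer and longer
  domains has a totally bounded range, and its limit points lie in all domains, since these are
  closed.
\<close>

lemma domains_compactness:
  assumes x: "\<And>n. x n \<in> dom (iter_seq F t n)"
  shows "\<exists>l r. l \<in> shift_repeller F t \<and> strict_mono (r :: nat \<Rightarrow> nat) \<and> (x \<circ> r) \<longlonglongrightarrow> l"
proof -
  have "compact (closure (range x))"
    unfolding compact_eq_totally_bounded complete_eq_closed
  proof (intro conjI allI impI)
    show "closed (closure (range x))" by simp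
    fix e :: real assume "e > 0"
    obtain n where n: "\<Delta> / (e / 2) < \<beta> ^ n" using real_arch_pow[OF \<beta>_gt_1] by blast
    then have small: "\<Delta> / \<beta> ^ n \<le> e / 2" using \<open>e > 0\<close> \<beta>_gt_1 by (simp add: field_simps)
    obtain y :: 'a where True by blast
    define k where "k = fibre (iter_seq F t (n + n0)) y \<union> x ` {..<n + n0}"
    have "finite k" unfolding k_def using iter_fibre_finite[OF F] by simp
    have "range x \<subseteq> (\<Union>c\<in>k. cball c (e / 2))"
    proof (rule image_subsetI)
      fix i
      show "x i \<in> (\<Union>c\<in>k. cball c (e / 2))"
      proof (cases "i < n + n0")
        case True
        then have "x i \<in> k" by (simp add: k_def)
        moreover have "x i \<in> cball (x i) (e / 2)" using \<open>e > 0\<close> by simp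
        ultimately show ?thesis by (rule UN_I)
      next
        case False
        then have "x i \<in> dom (iter_seq F t (n + n0))" by (intro iter_seq_dom_mono[OF x]) simp
        then obtain c where "c \<in> fibre (iter_seq F t (n + n0)) y" "x i \<in> ball c (\<Delta> / \<beta> ^ n)"
          using subsetD[OF domain_finite_cover] by (metis UN_E)
        then have "c \<in> k" "dist c (x i) < \<Delta> / \<beta> ^ n" by (simp_all add: k_def)
        moreover from this small have "x i \<in> cball c (e / 2)" unfolding mem_cball by linarith
        ultimately show ?thesis by (intro UN_I[of c])
      qed
    qed
    moreover have "closed (\<Union>c\<in>k. cball c (e / 2))" using \<open>finite k\<close> by (intro closed_UN) auto
    ultimately have "closure (range x) \<subseteq> (\<Union>c\<in>k. cball c (e / 2))" by (rule closure_minimal)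
    moreover have "cball c (e / 2) \<subseteq> ball c e" for c :: 'a using \<open>e > 0\<close> by auto
    then have "(\<Union>c\<in>k. cball c (e / 2)) \<subseteq> (\<Union>c\<in>k. ball c e)" by (rule UN_mono[OF order_refl])
    ultimately have "closure (range x) \<subseteq> (\<Union>c\<in>k. ball c e)" by (rule order_trans)
    with \<open>finite k\<close> show "\<exists>k. finite k \<and> closure (range x) \<subseteq> (\<Union>c\<in>k. ball c e)"
      by (intro exI[of _ k] conjI)
  qed
  then have "seq_compact (closure (range x))" by (rule compact_imp_seq_compact)
  moreover have "\<forall>n. x n \<in> closure (range x)" by (intro allI subsetD[OF closure_subset] rangeI)
  ultimately obtain l r where r: "strict_mono (r :: nat \<Rightarrow> nat)" "(x \<circ> r) \<longlonglongrightarrow> l"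
    unfolding seq_compact_def by meson
  have "l \<in> dom (iter_seq F t n)" for n
  proof (rule Lim_in_closed_set[OF iter_seq_closed[OF F] _ _ r(2)])
    show "eventually (\<lambda>i. (x \<circ> r) i \<in> dom (iter_seq F t n)) sequentially"
    proof (rule eventually_sequentiallyI)
      fix i assume "n \<le> i"
      then have "n \<le> r i" using seq_suble[OF r(1), of i] by simp
      then show "(x \<circ> r) i \<in> dom (iter_seq F t n)" unfolding comp_def by (rule iter_seq_dom_mono[OF x])
    qed
  qed simp
  then have "l \<in> shift_repeller F t" by (rule shift_repellerI)
  with r show ?thesis by (intro exI[of _ l] exI[of _ r] conjI)
qed

lemma shift_repeller_nonempty: "shift_repeller F t \<noteq> {}"
proof -
  obtain y :: 'a where True by blast
  have "\<exists>x. x \<in> dom (iter_seq F t n)" for n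
    using iter_fibre_nonempty[OF F, of t n y] fibre_dom[OF F] by (meson ex_in_conv)
  then obtain x where "\<And>n. x n \<in> dom (iter_seq F t n)" by metis
  from domains_compactness[OF this] show ?thesis by (metis empty_iff)
qed

lemma shift_repeller_compact: "compact (shift_repeller F t)"
  unfolding compact_eq_seq_compact_metric seq_compact_def
proof (intro allI impI)
  fix x :: "nat \<Rightarrow> 'a" assume "\<forall>n. x n \<in> shift_repeller F t"
  then have "x n \<in> dom (iter_seq F t n)" for n by (intro shift_repellerD) (rule spec)
  from domains_compactness[OF this]
  show "\<exists>l\<in>shift_repeller F t. \<exists>r. strict_mono r \<and> (x \<circ> r) \<longlonglongrightarrow> l" by (elim exE conjE) (rule bexI, rule exI, rule conjI)
qed

text \<open>
  The stopping time is the first \<open>n\<close> at which the derivative along the orbit of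
  \<open>x\<close> makes up for the scale \<open>r\<close>, including a factor for the
  distortion. Then the centre found by mixing is closer than \<open>r\<close>. Minimality bounds
  the derivative one step earlier, hence the derivative at the centre up to the norms of the
  last map and of the \<open>n0\<close> maps after it. The fibre may belong to a different base
  point \<open>y n\<close> for each \<open>n\<close>.
\<close>

lemma stopping_cover:
  assumes r: "0 < r" "r \<le> \<Delta>" and x: "x \<in> shift_repeller F 0"
    and N: "\<Delta> * exp (2 * distortion_sum N) < r * \<beta> ^ N"
  shows "\<exists>n\<in>{1..N}. \<exists>x'\<in>fibre (iter_seq F 0 (n + n0)) (y n). dist x' x < r \<and>
    iter_deriv F 0 (n + n0) x' \<le> \<Delta> * exp (3 * distortion_sum n + log_norm_sum F (n - 1) (Suc n0)) / r"
proof -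
  note xd = shift_repellerD[OF x]
  let ?c = distortion_sum
  define P where "P = (\<lambda>n. \<Delta> * exp (2 * ?c n) < r * iter_deriv F 0 n x)"
  have "r * \<beta> ^ N \<le> r * iter_deriv F 0 N x" using iter_deriv_ge[OF F xd] r by (intro mult_left_mono) auto
  then have PN: "P N" using N unfolding P_def by linarith
  have P0: "\<not> P 0" using r unfolding P_def by (simp add: distortion_sum_def)
  define n where "n = (LEAST n. P n)"
  have Pn: "P n" unfolding n_def using PN by (rule LeastI)
  have nN: "n \<le> N" unfolding n_def using PN by (rule Least_le)
  have n1: "1 \<le> n" using Pn P0 by (cases n) auto
  then have "n - 1 < n" by simp
  then have nP: "\<not> P (n - 1)" unfolding n_def by (rule not_less_Least)
  obtain m where m: "n = Suc m" using n1 by (cases n) auto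
  have D1: "r * iter_deriv F 0 m x \<le> \<Delta> * exp (2 * ?c n)"
  proof -
    have "r * iter_deriv F 0 m x \<le> \<Delta> * exp (2 * ?c m)" using nP m by (simp add: P_def)
    also have "\<dots> \<le> \<Delta> * exp (2 * ?c n)" using distortion_sum_mono[of m n] m \<Delta>_pos by (intro mult_left_mono) auto
    finally show ?thesis .
  qed
  obtain x' where x': "x' \<in> fibre (iter_seq F 0 (n + n0)) (y n)" "close F 0 n x' x"
    "dist (orb F 0 n x) (orb F 0 n x') < \<Delta>" by (rule mixing_cover[OF xd])
  note D' = iter_deriv_pos[OF F closeD(1)[OF F x'(2)]] and D = iter_deriv_pos[OF F xd]
  have "dist x x' * iter_deriv F 0 n x' \<le> exp (?c n) * dist (orb F 0 n x) (orb F 0 n x')"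
    by (rule close_dist_bounds(1)[OF F x'(2)])
  also have "\<dots> \<le> exp (?c n) * \<Delta>" using x'(3) by simp
  finally have "dist x x' * iter_deriv F 0 n x' \<le> exp (?c n) * \<Delta>" .
  then have "exp (?c n) * (dist x x' * iter_deriv F 0 n x') \<le> exp (?c n) * (exp (?c n) * \<Delta>)"
    by (rule mult_left_mono) simp
  also have "exp (?c n) * (exp (?c n) * \<Delta>) = \<Delta> * exp (2 * ?c n)"
    unfolding mult_2 exp_add by (simp only: mult_ac)
  also have "\<dots> < r * iter_deriv F 0 n x" using Pn unfolding P_def .
  also have "\<dots> \<le> r * (exp (?c n) * iter_deriv F 0 n x')"
    using close_iter_deriv_le(1)[OF F x'(2)] r by (intro mult_left_mono) auto
  finally have "(exp (?c n) * iter_deriv F 0 n x') * dist x x' < (exp (?c n) * iter_deriv F 0 n x') * r"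
    by (simp only: mult_ac)
  moreover have "0 < exp (?c n) * iter_deriv F 0 n x'" using D' by simp
  ultimately have dist: "dist x x' < r" by (rule mult_less_cancel_left_pos[THEN iffD1, rotated])
  have orbn: "orb F 0 m x \<in> dom (F (Suc m))" using iter_seq_step_dom[OF xd[of n], of m] m by simp
  have fm: "F (Suc m) \<in> conf" using conf_seqD[OF F, of 0 m] by simp
  have "iter_deriv F 0 (n + n0) x' = iter_deriv F 0 n x' * iter_deriv F n n0 (orb F 0 n x')"
    using iter_deriv_add[OF closeD(1)[OF F x'(2)], of n0] by simp
  also have "\<dots> \<le> (exp (?c n) * iter_deriv F 0 n x) * exp (log_norm_sum F n n0)"
  proof (rule mult_mono)
    show "iter_deriv F 0 n x' \<le> exp (?c n) * iter_deriv F 0 n x" by (rule close_iter_deriv_le(2)[OF F x'(2)])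
    have "orb F 0 n x' \<in> dom (iter_seq F (0 + n) n0)"
      using fibre_dom[OF F x'(1)] unfolding iter_seq_dom_add by (rule conjunct2)
    then have o: "orb F 0 n x' \<in> dom (iter_seq F n n0)" by simp
    show "iter_deriv F n n0 (orb F 0 n x') \<le> exp (log_norm_sum F n n0)" by (rule iter_deriv_le_norm[OF F o])
    show "0 \<le> iter_deriv F n n0 (orb F 0 n x')" using iter_deriv_pos[OF F o] by simp
  qed (use D[of n] in simp)
  also have "iter_deriv F 0 n x = conf_deriv (F (Suc m)) (orb F 0 m x) * iter_deriv F 0 m x"
    using iter_deriv_Suc[of F 0 m x] unfolding m by simp
  also have "exp (?c n) * (conf_deriv (F (Suc m)) (orb F 0 m x) * iter_deriv F 0 m x) * exp (log_norm_sum F n n0)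
    \<le> exp (?c n) * (exp (ln (norm_D (F (Suc m)))) * (\<Delta> * exp (2 * ?c n) / r)) * exp (log_norm_sum F n n0)"
  proof (intro mult_right_mono mult_left_mono mult_mono)
    show "conf_deriv (F (Suc m)) (orb F 0 m x) \<le> exp (ln (norm_D (F (Suc m))))"
      using norm_D_ge[OF fm orbn] norm_D_ge_\<beta>[OF fm] \<beta>_gt_1 by simp
    show "iter_deriv F 0 m x \<le> \<Delta> * exp (2 * ?c n) / r" using D1 r by (simp add: pos_le_divide_eq mult.commute)
  qed (use D[of m] in auto)
  also have "\<dots> = \<Delta> * (exp (?c n) * exp (2 * ?c n) * (exp (ln (norm_D (F (Suc m)))) * exp (log_norm_sum F n n0))) / r"
    by (simp add: mult_ac)
  also have "exp (?c n) * exp (2 * ?c n) * (exp (ln (norm_D (F (Suc m)))) * exp (log_norm_sum F n n0))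
     = exp (3 * ?c n + log_norm_sum F (n - 1) (Suc n0))"
    using log_norm_sum_add[of F m 1 n0] unfolding m by (simp add: mult_exp_exp log_norm_sum_def)
  finally have "iter_deriv F 0 (n + n0) x' \<le> \<Delta> * exp (3 * ?c n + log_norm_sum F (n - 1) (Suc n0)) / r" .
  then show ?thesis using n1 nN x'(1) dist
    by (intro bexI[of _ n] bexI[of _ x'] conjI) (simp_all add: dist_commute)
qed

text \<open>
  The base point of each fibre is chosen so that its sum is within a factor two of the infimum.
  Counting the centres whose derivative is at most \<open>Q n / r\<close> by their weights shows
  that there are at most \<open>a n * r\<^sup>-\<^sup>s\<close> of them, and \<open>a n\<close>
  decays exponentially: the infimum does by hypothesis, and \<open>Q n\<close> is
  subexponential. The sum of \<open>a\<close> is a constant that does not depend on the radius.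
\<close>

lemma upper_box_le:
  assumes s: "0 \<le> s" and \<gamma>: "0 < \<gamma>"
    and neg: "eventually (\<lambda>n. ln (pinf s F 0 n) \<le> - \<gamma> * real n) sequentially"
    and norm: "(\<lambda>n. ln (norm_D (F n)) / real n) \<longlonglongrightarrow> 0"
  shows "upper_box_dim (repeller F) \<le> ennreal s"
proof -
  define Q where "Q = (\<lambda>n. \<Delta> * exp (3 * distortion_sum n + log_norm_sum F (n - 1) (Suc n0)))"
  have Qpos: "0 < Q n" for n unfolding Q_def using \<Delta>_pos by simp
  define a where "a = (\<lambda>n. 2 * pinf s F 0 (n + n0) * Q n powr s)"
  have a0: "0 \<le> a n" for n unfolding a_def using pinf_pos[OF F s, of 0 "n + n0"] by simp
  have "summable a"
  proof (rule summable_comparison_test_ev)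
    have "(\<lambda>n. ln (norm_D (F (Suc (n - 1 + j)))) / real n) \<longlonglongrightarrow> 0" for j
    proof -
      have "(\<lambda>n. ln (norm_D (F (n + j))) / real (n + j)) \<longlonglongrightarrow> 0"
        using LIMSEQ_ignore_initial_segment[OF norm, of j] by simp
      moreover have "(\<lambda>n. real (n + j) / real n) \<longlonglongrightarrow> 1" by real_asymp
      ultimately have "(\<lambda>n. ln (norm_D (F (n + j))) / real (n + j) * (real (n + j) / real n)) \<longlonglongrightarrow> 0 * 1"
        by (rule tendsto_mult)
      moreover have "eventually (\<lambda>n. ln (norm_D (F (n + j))) / real (n + j) * (real (n + j) / real n)
          = ln (norm_D (F (Suc (n - 1 + j)))) / real n) sequentially"
        using eventually_gt_at_top[of 0] by eventually_elim simp
      ultimately show ?thesis using Lim_transform_eventually by fastforce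
    qed
    then have "(\<lambda>n. \<Sum>j<Suc n0. ln (norm_D (F (Suc (n - 1 + j)))) / real n) \<longlonglongrightarrow> (\<Sum>j<Suc n0. 0)"
      by (intro tendsto_sum)
    then have L: "(\<lambda>n. log_norm_sum F (n - 1) (Suc n0) / real n) \<longlonglongrightarrow> 0"
      by (simp add: log_norm_sum_def sum_divide_distrib del: sum.lessThan_Suc)
    have "(\<lambda>n. s * (ln \<Delta> / real n + 3 * (distortion_sum n / real n) + log_norm_sum F (n - 1) (Suc n0) / real n))
        \<longlonglongrightarrow> s * (0 + 3 * 0 + 0)"
      by (intro tendsto_intros L distortion_sum_sublinear lim_const_over_n)
    then have "eventually (\<lambda>n. s * (ln \<Delta> / real n + 3 * (distortion_sum n / real n) + log_norm_sum F (n - 1) (Suc n0) / real n) < \<gamma> / 2) sequentially"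
      using \<gamma> by (intro order_tendstoD(2)) auto
    moreover have "eventually (\<lambda>n. ln (pinf s F 0 (n + n0)) \<le> - \<gamma> * real (n + n0)) sequentially"
      using neg eventually_sequentially_seg[of "\<lambda>n. ln (pinf s F 0 n) \<le> - \<gamma> * real n" n0] by simp
    ultimately show "eventually (\<lambda>n. norm (a n) \<le> 2 * exp (- \<gamma> / 2) ^ n) sequentially"
      using eventually_gt_at_top[of 0]
    proof eventually_elim
      case (elim n)
      let ?q = "ln \<Delta> + 3 * distortion_sum n + log_norm_sum F (n - 1) (Suc n0)"
      have "s * ?q = s * (ln \<Delta> / real n + 3 * (distortion_sum n / real n) + log_norm_sum F (n - 1) (Suc n0) / real n) * real n"
        using elim(3) by (simp add: field_simps)
      also have "\<dots> \<le> \<gamma> / 2 * real n" using elim(1) by (intro mult_right_mono) auto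
      finally have q: "s * ?q \<le> \<gamma> / 2 * real n" .
      have "- \<gamma> * real (n + n0) \<le> - \<gamma> * real n" using \<gamma> by simp
      then have p: "ln (pinf s F 0 (n + n0)) + s * ?q \<le> - \<gamma> / 2 * real n" using elim(2) q by linarith
      have "Q n = exp ?q" unfolding Q_def using \<Delta>_pos by (simp add: exp_add)
      then have "Q n powr s = exp (s * ?q)" by (simp add: powr_def)
      then have "a n = 2 * exp (ln (pinf s F 0 (n + n0)) + s * ?q)"
        unfolding a_def using pinf_pos[OF F s, of 0 "n + n0"] by (simp add: exp_add)
      also have "\<dots> \<le> 2 * exp (- \<gamma> / 2 * real n)" using p by simp
      also have "exp (- \<gamma> / 2 * real n) = exp (- \<gamma> / 2) ^ n" by (simp add: exp_of_nat_mult[symmetric] mult.commute)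
      finally show ?case using a0[of n] by simp
    qed
    show "summable (\<lambda>n. 2 * exp (- \<gamma> / 2) ^ n)"
      using \<gamma> by (intro summable_mult summable_geometric) auto
  qed
  define S where "S = suminf a + 1"
  have S: "1 \<le> S" unfolding S_def using suminf_nonneg[OF \<open>summable a\<close> a0] by simp
  have "\<exists>y. psum s F 0 (n + n0) y < 2 * pinf s F 0 (n + n0)" for n
    using pinf_near[of s F 0 "n + n0" "2 * pinf s F 0 (n + n0)"] pinf_pos[OF F s, of 0 "n + n0"] by force
  then obtain y where y: "\<And>n. psum s F 0 (n + n0) (y n) < 2 * pinf s F 0 (n + n0)" by metis
  have cover: "\<exists>C. ball_cover (repeller F) r C \<and> real (card C) \<le> S * r powr (- s)" if r: "0 < r" "r \<le> \<Delta>" for r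
  proof -
    have "(\<lambda>n. 2 * (distortion_sum n / real n) + ln (\<Delta> / r) / real n) \<longlonglongrightarrow> 2 * 0 + 0"
      by (intro tendsto_intros distortion_sum_sublinear lim_const_over_n)
    then have "eventually (\<lambda>n. 2 * (distortion_sum n / real n) + ln (\<Delta> / r) / real n < ln \<beta>) sequentially"
      using \<beta>_gt_1 by (intro order_tendstoD(2)) auto
    then have "eventually (\<lambda>n. 2 * (distortion_sum n / real n) + ln (\<Delta> / r) / real n < ln \<beta> \<and> 0 < n) sequentially"
      using eventually_gt_at_top[of 0] by (rule eventually_conj)
    then obtain N where N: "2 * (distortion_sum N / real N) + ln (\<Delta> / r) / real N < ln \<beta>" "0 < N"
      unfolding eventually_sequentially by blast
    then have "(2 * (distortion_sum N / real N) + ln (\<Delta> / r) / real N) * real N < ln \<beta> * real N" by simp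
    moreover have "(2 * (distortion_sum N / real N) + ln (\<Delta> / r) / real N) * real N = 2 * distortion_sum N + ln (\<Delta> / r)"
      using N(2) by (simp add: distrib_right)
    ultimately have "2 * distortion_sum N + ln (\<Delta> / r) < real N * ln \<beta>" by (simp add: mult.commute)
    then have "exp (2 * distortion_sum N + ln (\<Delta> / r)) < exp (real N * ln \<beta>)" by simp
    then have "exp (2 * distortion_sum N) * (\<Delta> / r) < \<beta> ^ N"
      using \<beta>_gt_1 \<Delta>_pos r by (simp add: exp_add exp_of_nat_mult)
    then have N': "\<Delta> * exp (2 * distortion_sum N) < r * \<beta> ^ N" using r by (simp add: field_simps)
    define A where "A = (\<lambda>n. {x' \<in> fibre (iter_seq F 0 (n + n0)) (y n). iter_deriv F 0 (n + n0) x' \<le> Q n / r})"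
    have finA: "finite (A n)" for n unfolding A_def using iter_fibre_finite[OF F] by simp
    have cardA: "real (card (A n)) \<le> a n * r powr (- s)" for n
    proof -
      have Qr: "0 < Q n / r" using Qpos r by simp
      have "real (card (A n)) * (Q n / r) powr (- s) \<le> (\<Sum>x'\<in>A n. iter_deriv F 0 (n + n0) x' powr (- s))"
      proof (rule sum_bounded_below)
        fix x' assume "x' \<in> A n"
        then have "x' \<in> fibre (iter_seq F 0 (n + n0)) (y n)" "iter_deriv F 0 (n + n0) x' \<le> Q n / r"
          unfolding A_def by simp_all
        then show "(Q n / r) powr (- s) \<le> iter_deriv F 0 (n + n0) x' powr (- s)"
          by (intro powr_neg_mono[OF iter_deriv_pos[OF F fibre_dom[OF F]] _ s])
      qed
      also have "\<dots> \<le> psum s F 0 (n + n0) (y n)"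
        unfolding psum_def by (rule sum_mono2[OF iter_fibre_finite[OF F]]) (auto simp: A_def)
      also have "\<dots> \<le> 2 * pinf s F 0 (n + n0)" using y[of n] by simp
      finally have "real (card (A n)) * (Q n / r) powr (- s) * (Q n / r) powr s \<le> 2 * pinf s F 0 (n + n0) * (Q n / r) powr s"
        by (intro mult_right_mono) auto
      moreover have "(Q n / r) powr (- s) * (Q n / r) powr s = 1"
        using Qpos[of n] r by (simp add: powr_add[symmetric])
      moreover have "(Q n / r) powr s = Q n powr s * r powr (- s)"
        using Qpos[of n] r by (simp add: powr_divide powr_minus_divide)
      ultimately show ?thesis unfolding a_def by (simp add: mult.assoc)
    qed
    define C where "C = (\<Union>n\<in>{1..N}. A n)"
    have "repeller F \<subseteq> (\<Union>x\<in>C. ball x r)"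
    proof
      fix x assume "x \<in> repeller F"
      then have "x \<in> shift_repeller F 0" by (simp add: repeller_eq)
      from stopping_cover[OF r this N', of y] obtain n x' where "n \<in> {1..N}" "x' \<in> fibre (iter_seq F 0 (n + n0)) (y n)"
        "dist x' x < r" "iter_deriv F 0 (n + n0) x' \<le> Q n / r" unfolding Q_def by blast
      then show "x \<in> (\<Union>x\<in>C. ball x r)" unfolding C_def A_def by auto
    qed
    then have bc: "ball_cover (repeller F) r C" unfolding ball_cover_def C_def using finA by auto
    have "real (card C) \<le> (\<Sum>n=1..N. real (card (A n)))"
      unfolding C_def using card_UN_le[of "{1..N}" A] by (simp flip: of_nat_sum)
    also have "\<dots> \<le> (\<Sum>n=1..N. a n * r powr (- s))" by (rule sum_mono[OF cardA])
    also have "\<dots> = (\<Sum>n=1..N. a n) * r powr (- s)" by (simp add: sum_distrib_right)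
    also have "\<dots> \<le> S * r powr (- s)"
      using sum_le_suminf[OF \<open>summable a\<close>, of "{1..N}"] a0 unfolding S_def by (intro mult_right_mono) auto
    finally show ?thesis using bc by blast
  qed
  have "upper_box_dim (repeller F) \<le> ennreal s + ennreal e" if e: "0 < e" for e
    unfolding upper_box_dim_def
  proof (rule Limsup_bounded)
    have "((\<lambda>r. ln S / - ln r) \<longlongrightarrow> 0) (at_right 0)" by real_asymp
    then have "eventually (\<lambda>r. ln S / - ln r < e) (at_right 0)" using e by (rule order_tendstoD)
    moreover have "eventually (\<lambda>r. 0 < r \<and> r < 1 \<and> r \<le> \<Delta>) (at_right 0)"
      unfolding eventually_at_right_field using \<Delta>_pos by (intro exI[of _ "min 1 \<Delta>"]) auto
    ultimately show "eventually (\<lambda>r. box_quotient (repeller F) r \<le> ennreal s + ennreal e) (at_right 0)"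
    proof eventually_elim
      case (elim r)
      then have r: "0 < r" "r < 1" "r \<le> \<Delta>" by auto
      obtain C where C: "ball_cover (repeller F) r C" "real (card C) \<le> S * r powr (- s)" using cover[OF r(1,3)] by blast
      have "covering_number (repeller F) r \<le> card C"
        unfolding covering_number_def using C(1) by (intro cInf_lower) auto
      then have N: "real (covering_number (repeller F) r) \<le> S * r powr (- s)" using C(2) by simp
      have lr: "0 < - ln r" using r by simp
      have "ln (real (covering_number (repeller F) r)) \<le> ln S + s * - ln r"
      proof (cases "covering_number (repeller F) r = 0")
        case True
        moreover have "0 \<le> s * - ln r" using s lr by (intro mult_nonneg_nonneg) simp_all
        moreover have "0 \<le> ln S" using S by simp
        ultimately show ?thesis by simp
      next
        case False
        then have "ln (real (covering_number (repeller F) r)) \<le> ln (S * r powr (- s))"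
          using N by (intro ln_mono) auto
        also have "\<dots> = ln S + s * - ln r" using S r by (simp add: ln_mult ln_powr)
        finally show ?thesis .
      qed
      then have "ln (real (covering_number (repeller F) r)) / - ln r \<le> (ln S + s * - ln r) / - ln r"
        using lr by (intro divide_right_mono) auto
      also have "\<dots> = ln S / - ln r + s"
        unfolding add_divide_distrib using lr by (subst nonzero_mult_div_cancel_right) simp_all
      also have "\<dots> \<le> s + e" using elim(1) by simp
      finally have "box_quotient (repeller F) r \<le> ennreal (s + e)"
        unfolding box_quotient_def using C(1) by (auto intro!: ennreal_leI)
      then show ?case using s e by (simp add: ennreal_plus)
    qed
  qed
  then show ?thesis by (rule ennreal_le_epsilon)
qed

end

end

section \<open>Hausdorff measure of selected sub-repellers\<close>

text \<open>
  Enlarging the members of a countable cover slightly makes them open, and by compactness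
  finitely many suffice. The enlargements cost at most 1/4 in total, which is why a lower bound
  1/2 for finite covers leaves 1/4 for countable ones.
\<close>

lemma hausdorff_measure_pos_of_finite_covers:
  fixes A :: "'a::metric_space set"
  assumes "compact A" and s: "0 < s" and \<rho>: "0 < \<rho>"
    and fin: "\<And>I (U :: nat \<Rightarrow> 'a set). finite I \<Longrightarrow> A \<subseteq> (\<Union>i\<in>I. U i) \<Longrightarrow>
      (\<And>i. i \<in> I \<Longrightarrow> bounded (U i) \<and> diameter (U i) < \<rho>) \<Longrightarrow> 1 / 2 \<le> (\<Sum>i\<in>I. diameter (U i) powr s)"
  shows "hausdorff_measure s A \<noteq> 0"
proof -
  have "ennreal (1 / 4) \<le> (\<Sum>i. diam_pow s (U i))"
    if cov: "A \<subseteq> (\<Union>i. U i)" and small: "\<And>i. bounded (U i) \<and> diameter (U i) \<le> \<rho> / 2" for U :: "nat \<Rightarrow> 'a set"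
  proof -
    have "\<exists>\<eta>>0. (diameter (U i) + 2 * \<eta>) powr s < diameter (U i) powr s + (1 / 2) ^ i / 8 \<and> diameter (U i) + 2 * \<eta> < \<rho>" for i
    proof -
      have "((\<lambda>\<eta>. (diameter (U i) + 2 * \<eta>) powr s) \<longlongrightarrow> (diameter (U i) + 2 * 0) powr s) (at_right 0)"
        using s small[of i] by (intro tendsto_powr' tendsto_intros)
          (auto simp: eventually_at_right_field diameter_ge_0 intro!: exI[of _ 1] add_nonneg_nonneg)
      then have "eventually (\<lambda>\<eta>. (diameter (U i) + 2 * \<eta>) powr s < diameter (U i) powr s + (1 / 2) ^ i / 8) (at_right 0)"
        by (intro order_tendstoD(2)[where y = "(diameter (U i) + 2 * 0) powr s"]) auto
      moreover have "eventually (\<lambda>\<eta>. 0 < \<eta> \<and> diameter (U i) + 2 * \<eta> < \<rho>) (at_right 0)"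
        unfolding eventually_at_right_field using small[of i] \<rho> by (intro exI[of _ "\<rho> / 4"]) auto
      ultimately have "eventually (\<lambda>\<eta>. 0 < \<eta> \<and> (diameter (U i) + 2 * \<eta>) powr s < diameter (U i) powr s + (1 / 2) ^ i / 8 \<and> diameter (U i) + 2 * \<eta> < \<rho>) (at_right 0)"
        by eventually_elim simp
      then have "\<exists>\<eta>. 0 < \<eta> \<and> (diameter (U i) + 2 * \<eta>) powr s < diameter (U i) powr s + (1 / 2) ^ i / 8 \<and> diameter (U i) + 2 * \<eta> < \<rho>"
        by (rule eventually_happens'[OF trivial_limit_at_right_real])
      then show ?thesis by blast
    qed
    then obtain \<eta> where \<eta>: "\<And>i. \<eta> i > 0" 
      "\<And>i. (diameter (U i) + 2 * \<eta> i) powr s < diameter (U i) powr s + (1 / 2) ^ i / 8"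
      "\<And>i. diameter (U i) + 2 * \<eta> i < \<rho>" by metis
    define V where "V = (\<lambda>i. \<Union>a\<in>U i. ball a (\<eta> i))"
    have dV: "dist x y \<le> diameter (U i) + 2 * \<eta> i" if xy: "x \<in> V i" "y \<in> V i" for i x y
    proof -
      obtain a b where ab: "a \<in> U i" "b \<in> U i" "dist a x < \<eta> i" "dist b y < \<eta> i" using xy unfolding V_def by auto
      have "dist a b \<le> diameter (U i)" using small[of i] ab by (intro diameter_bounded_bound) auto
      moreover have "dist x y \<le> dist a x + dist a b + dist b y"
        using dist_triangle[of x y a] dist_triangle[of a y b] by (simp add: dist_commute)
      ultimately show ?thesis using ab by linarith
    qed
    have d0: "0 \<le> diameter (U i)" for i using small[of i] by (simp add: diameter_ge_0)
    have diamV: "diameter (V i) \<le> diameter (U i) + 2 * \<eta> i" for i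
    proof (rule diameter_le_metric)
      show "0 \<le> diameter (U i) + 2 * \<eta> i" using d0[of i] \<eta>(1)[of i] by linarith
    qed (rule dV)
    have bV: "bounded (V i)" for i
    proof (cases "V i = {}")
      case False
      then obtain a where "a \<in> V i" by blast
      then have "\<forall>y\<in>V i. dist a y \<le> diameter (U i) + 2 * \<eta> i" using dV by (intro ballI)
      then show ?thesis unfolding bounded_def by (intro exI)
    qed simp
    have "U i \<subseteq> V i" for i unfolding V_def using \<eta>(1)[of i] by auto
    then have "(\<Union>i. U i) \<subseteq> (\<Union>i. V i)" by (rule UN_mono[OF order_refl])
    with cov have covV: "A \<subseteq> (\<Union>i. V i)" by (rule order_trans)
    have opV: "open (V i)" for i unfolding V_def by (intro open_UN ballI open_ball)
    obtain I where I: "I \<subseteq> UNIV" "finite I" "A \<subseteq> (\<Union>i\<in>I. V i)"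
      by (rule compactE_image[OF \<open>compact A\<close> opV covV])
    define J where "J = {i\<in>I. V i \<noteq> {}}"
    have "(\<Union>i\<in>I. V i) \<subseteq> (\<Union>i\<in>J. V i)" unfolding J_def by auto
    with I have J: "finite J" "A \<subseteq> (\<Union>i\<in>J. V i)" by (simp_all add: J_def)
    have "bounded (V i) \<and> diameter (V i) < \<rho>" for i using bV diamV[of i] \<eta>(3)[of i] by simp
    then have half: "1 / 2 \<le> (\<Sum>i\<in>J. diameter (V i) powr s)" by (intro fin[OF J])
    also have "\<dots> \<le> (\<Sum>i\<in>J. diameter (U i) powr s + (1 / 2) ^ i / 8)"
    proof (rule sum_mono)
      fix i
      have "diameter (V i) powr s \<le> (diameter (U i) + 2 * \<eta> i) powr s"
        using diamV[of i] s bV[of i] by (intro powr_mono2) (auto simp: diameter_ge_0)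
      then show "diameter (V i) powr s \<le> diameter (U i) powr s + (1 / 2) ^ i / 8" using \<eta>(2)[of i] by linarith
    qed
    also have "\<dots> = (\<Sum>i\<in>J. diameter (U i) powr s) + (\<Sum>i\<in>J. (1 / 2) ^ i / 8)" by (rule sum.distrib)
    also have "(\<Sum>i\<in>J. (1 / 2 :: real) ^ i / 8) \<le> (\<Sum>i. (1 / 2) ^ i / 8)"
      using J(1) by (intro sum_le_suminf) (auto intro!: summable_divide summable_geometric)
    also have "(\<Sum>i. (1 / 2 :: real) ^ i / 8) = 1 / 4"
      using suminf_geometric[of "1 / 2 :: real"] by (subst suminf_divide) (auto intro!: summable_geometric)
    finally have q: "1 / 4 \<le> (\<Sum>i\<in>J. diameter (U i) powr s)" by simp
    have eq: "diam_pow s (U i) = ennreal (diameter (U i) powr s)" if "i \<in> J" for i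
    proof -
      have "U i \<noteq> {}" using that unfolding J_def V_def by auto
      then show ?thesis using s by (simp add: diam_pow_def)
    qed
    have "ennreal (1 / 4) \<le> ennreal (\<Sum>i\<in>J. diameter (U i) powr s)" using q by (rule ennreal_leI)
    also have "\<dots> = (\<Sum>i\<in>J. diam_pow s (U i))" by (simp add: eq sum_ennreal)
    also have "\<dots> \<le> (\<Sum>i. diam_pow s (U i))" by (rule sum_le_suminf[OF summableI J(1)]) auto
    finally show ?thesis .
  qed
  then have "ennreal (1 / 4) \<le> hausdorff_premeasure s (\<rho> / 2) A"
    unfolding hausdorff_premeasure_def by (intro Inf_greatest) blast
  also have "\<dots> \<le> hausdorff_measure s A"
    unfolding hausdorff_measure_def using \<rho> by (intro SUP_upper) auto
  finally show ?thesis by (auto simp: ennreal_le_iff2)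
qed

context conf_params
begin

context
  fixes F :: "nat \<Rightarrow> 'a::{complete_space, perfect_space} \<rightharpoonup> 'a" and n0 :: nat
  assumes F: "conf_seq F" and mix: "mixing n0 \<Delta> F"
begin

text \<open>
  Time is cut at \<open>T 0 < T 1 < \<dots>\<close>, and \<open>p i\<close> is the position of
  one orbit of the repeller at time \<open>T i\<close>. In the block from \<open>T i\<close> to
  \<open>T (i+1)\<close> some preimages \<open>Sel i y\<close> of each point \<open>y\<close>
  near \<open>p (i+1)\<close> are selected, all of them near \<open>p i\<close>, so that
  selections can be composed. Their weight is at least \<open>exp (V i)\<close>. Selected points
  that are closer than \<open>sep\<close>, even when they come from different \<open>y\<close>,
  follow the same inverse branches through the block.
\<close>

context
  fixes T :: "nat \<Rightarrow> nat" and p :: "nat \<Rightarrow> 'a" and r0 s sep :: real and Sel :: "nat \<Rightarrow> 'a \<Rightarrow> 'a set" and V :: "nat \<Rightarrow> real"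
  assumes T0: "T 0 = 0" and T_less: "\<And>i. T i < T (Suc i)" and s: "0 < s" and r0: "0 < r0" and sep: "0 < sep"
    and p: "\<And>i. p i \<in> shift_repeller F (T i)"
    and Sel: "\<And>i y. y \<in> ball (p (Suc i)) r0 \<Longrightarrow> Sel i y \<subseteq> fibre (iter_seq F (T i) (T (Suc i) - T i)) y \<inter> ball (p i) r0"
    and Sel_sum: "\<And>i y. y \<in> ball (p (Suc i)) r0 \<Longrightarrow>
       exp (V i) \<le> (\<Sum>v\<in>Sel i y. iter_deriv F (T i) (T (Suc i) - T i) v powr (- s))"
    and Sel_close: "\<And>i y y' u v. y \<in> ball (p (Suc i)) r0 \<Longrightarrow> y' \<in> ball (p (Suc i)) r0 \<Longrightarrow> u \<in> Sel i y \<Longrightarrow> v \<in> Sel i y' \<Longrightarrow>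
       dist u v < sep \<Longrightarrow> close F (T i) (T (Suc i) - T i) u v"
begin

lemma T_mono: "i \<le> j \<Longrightarrow> T i \<le> T j"
  by (rule lift_Suc_mono_le[of T]) (simp_all add: less_imp_le[OF T_less])

lemma T_ge: "k \<le> T k"
proof (induction k)
  case (Suc k)
  then show ?case using T_less[of k] by simp
qed simp

text \<open>
  Indexed by the number of blocks below the root \<open>p n\<close>, so that the recursion is
  structural.
\<close>

primrec sel_tree_aux :: "nat \<Rightarrow> nat \<Rightarrow> 'a set" where
  "sel_tree_aux n 0 = {p n}"
| "sel_tree_aux n (Suc d) = (\<Union>y\<in>sel_tree_aux n d. Sel (n - Suc d) y)"

definition sel_tree :: "nat \<Rightarrow> nat \<Rightarrow> 'a set" where
  "sel_tree n i = sel_tree_aux n (n - i)"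

lemma sel_tree_top: "sel_tree n n = {p n}"
  by (simp add: sel_tree_def)

lemma sel_tree_step: "i < n \<Longrightarrow> sel_tree n i = (\<Union>y\<in>sel_tree n (Suc i). Sel i y)"
proof -
  assume i: "i < n"
  then have "n - i = Suc (n - Suc i)" by simp
  then have "sel_tree n i = (\<Union>y\<in>sel_tree_aux n (n - Suc i). Sel (n - Suc (n - Suc i)) y)"
    unfolding sel_tree_def by (simp only: sel_tree_aux.simps)
  also have "n - Suc (n - Suc i) = i" using i by simp
  finally show ?thesis unfolding sel_tree_def .
qed

lemma sel_tree_ball: "i \<le> n \<Longrightarrow> sel_tree n i \<subseteq> ball (p i) r0"
proof (induction rule: inc_induct)
  case base
  show ?case using r0 by (simp add: sel_tree_top)
next
  case (step i)
  show ?case unfolding sel_tree_step[OF step(2)] using Sel step(3) by blast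
qed

lemma sel_tree_finite: "i \<le> n \<Longrightarrow> finite (sel_tree n i)"
proof (induction rule: inc_induct)
  case base
  show ?case by (simp add: sel_tree_top)
next
  case (step i)
  have "finite (Sel i y)" if "y \<in> sel_tree n (Suc i)" for y
  proof (rule finite_subset[OF _ iter_fibre_finite[OF F]])
    have "Suc i \<le> n" using step(2) by simp
    then have "y \<in> ball (p (Suc i)) r0" using that by (rule subsetD[OF sel_tree_ball])
    from Sel[OF this] show "Sel i y \<subseteq> fibre (iter_seq F (T i) (T (Suc i) - T i)) y" by simp
  qed
  then show ?case unfolding sel_tree_step[OF step(2)] using step(3) by blast
qed

definition transport :: "nat \<Rightarrow> nat \<Rightarrow> 'a \<Rightarrow> 'a" where
  "transport i j u = orb F (T i) (T j - T i) u"

lemma transport_refl: "transport i i u = u"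
  by (simp add: transport_def)

lemma T_split: "i \<le> j \<Longrightarrow> T (Suc j) - T i = (T j - T i) + (T (Suc j) - T j)"
  using T_mono[of i j] T_less[of j] by simp

lemma sel_tree_transport:
  assumes "i \<le> j" "j \<le> n" "u \<in> sel_tree n i"
  shows "u \<in> dom (iter_seq F (T i) (T j - T i)) \<and> transport i j u \<in> sel_tree n j"
  using assms(1,2)
proof (induction rule: dec_induct)
  case base
  then show ?case using assms(3) by (simp add: transport_refl)
next
  case (step j)
  then have j: "j < n" and IH: "u \<in> dom (iter_seq F (T i) (T j - T i))" "transport i j u \<in> sel_tree n j" by simp_all
  obtain y where y: "y \<in> sel_tree n (Suc j)" "transport i j u \<in> Sel j y" using IH(2) unfolding sel_tree_step[OF j] by blast
  have "y \<in> ball (p (Suc j)) r0" using sel_tree_ball[of "Suc j" n] y(1) j by auto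
  then have "transport i j u \<in> fibre (iter_seq F (T j) (T (Suc j) - T j)) y" using Sel y(2) by blast
  then have f: "iter_seq F (T j) (T (Suc j) - T j) (orb F (T i) (T j - T i) u) = Some y"
    by (simp add: fibre_iff transport_def)
  have Tj: "T i + (T j - T i) = T j" using T_mono[OF step(1)] by simp
  have iu: "iter_seq F (T i) (T j - T i) u = Some (orb F (T i) (T j - T i) u)" using IH(1) by auto
  have "iter_seq F (T i) (T (Suc j) - T i) u = Some y"
    unfolding T_split[OF step(1)] iter_seq_add_iff Tj using f iu by blast
  then show ?case using y(1) by (auto simp: transport_def)
qed

lemma transport_Suc_Sel:
  assumes "i \<le> j" "j < n" "u \<in> sel_tree n i"
  shows "\<exists>y\<in>ball (p (Suc j)) r0. transport i j u \<in> Sel j y"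
proof -
  have "transport i j u \<in> sel_tree n j" using sel_tree_transport[of i j n u] assms by simp
  then obtain y where y: "y \<in> sel_tree n (Suc j)" "transport i j u \<in> Sel j y" unfolding sel_tree_step[OF assms(2)] by blast
  then show ?thesis using sel_tree_ball[of "Suc j" n] assms(2) by auto
qed

lemma sel_tree_repeller:
  assumes "u \<in> sel_tree n 0" shows "u \<in> shift_repeller F 0"
proof -
  have "u \<in> dom (iter_seq F (T 0) (T n - T 0))" "transport 0 n u \<in> sel_tree n n"
    using sel_tree_transport[of 0 n n u] assms by simp_all
  then have "u \<in> dom (iter_seq F 0 (T n)) \<and> orb F 0 (T n) u \<in> shift_repeller F (0 + T n)"
    using p[of n] by (simp add: sel_tree_top transport_def T0)
  then show ?thesis by (subst shift_repeller_iff[of _ _ _ "T n"])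
qed

text \<open>
  Weight of the part of the tree with root \<open>p n\<close> that has grown back to block
  \<open>i\<close>.
\<close>

definition sel_sum :: "nat \<Rightarrow> nat \<Rightarrow> real" where
  "sel_sum n i = (\<Sum>u\<in>sel_tree n i. iter_deriv F (T i) (T n - T i) u powr (- s))"

lemma sel_sum_top: "sel_sum n n = 1"
  by (simp add: sel_sum_def sel_tree_top)

lemma sel_sum_nonneg: "0 \<le> sel_sum n i"
  unfolding sel_sum_def by (intro sum_nonneg) simp

lemma sel_sum_step:
  assumes i: "i < n"
  shows "exp (V i) * sel_sum n (Suc i) \<le> sel_sum n i"
proof -
  let ?l = "T (Suc i) - T i"
  have ball: "y \<in> ball (p (Suc i)) r0" if "y \<in> sel_tree n (Suc i)" for y
    using sel_tree_ball[of "Suc i" n] i that by auto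
  have fib: "Sel i y \<subseteq> fibre (iter_seq F (T i) ?l) y" if "y \<in> sel_tree n (Suc i)" for y
    using Sel[OF ball[OF that]] by blast
  have TT: "T i + ?l = T (Suc i)" using T_less[of i] by simp
  have Tn: "T n - T i = ?l + (T n - T (Suc i))" using T_less[of i] T_mono[of "Suc i" n] i by simp
  have "sel_sum n i = (\<Sum>y\<in>sel_tree n (Suc i). \<Sum>u\<in>Sel i y. iter_deriv F (T i) (T n - T i) u powr (- s))"
    unfolding sel_sum_def sel_tree_step[OF i]
  proof (rule sum.UNION_disjoint)
    show "finite (sel_tree n (Suc i))" using sel_tree_finite i by simp
    show "\<forall>y\<in>sel_tree n (Suc i). finite (Sel i y)"
      using finite_subset[OF fib iter_fibre_finite[OF F]] by blast
    show "\<forall>a\<in>sel_tree n (Suc i). \<forall>b\<in>sel_tree n (Suc i). a \<noteq> b \<longrightarrow> Sel i a \<inter> Sel i b = {}"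
    proof (intro ballI impI)
      fix a b assume ab: "a \<in> sel_tree n (Suc i)" "b \<in> sel_tree n (Suc i)" "a \<noteq> b"
      have "fibre (iter_seq F (T i) ?l) a \<inter> fibre (iter_seq F (T i) ?l) b = {}" using ab(3) by (auto simp: fibre_iff)
      then show "Sel i a \<inter> Sel i b = {}" using fib[OF ab(1)] fib[OF ab(2)] by blast
    qed
  qed
  also have "\<dots> = (\<Sum>y\<in>sel_tree n (Suc i). (\<Sum>u\<in>Sel i y. iter_deriv F (T i) ?l u powr (- s)) *
      iter_deriv F (T (Suc i)) (T n - T (Suc i)) y powr (- s))"
    unfolding sum_distrib_right
  proof (intro sum.cong refl)
    fix y u assume y: "y \<in> sel_tree n (Suc i)" and "u \<in> Sel i y"
    then have u: "u \<in> fibre (iter_seq F (T i) ?l) y" using fib by blast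
    have yd: "y \<in> dom (iter_seq F (T (Suc i)) (T n - T (Suc i)))"
      using sel_tree_transport[of "Suc i" n n y] y i by simp
    have "iter_deriv F (T i) (T n - T i) u = iter_deriv F (T i) ?l u * iter_deriv F (T (Suc i)) (T n - T (Suc i)) y"
      unfolding Tn using iter_deriv_add[OF fibre_dom[OF F u], of "T n - T (Suc i)"] by (simp only: TT fibre_orb[OF F u])
    then show "iter_deriv F (T i) (T n - T i) u powr (- s) = iter_deriv F (T i) ?l u powr (- s) *
       iter_deriv F (T (Suc i)) (T n - T (Suc i)) y powr (- s)"
      using iter_deriv_pos[OF F fibre_dom[OF F u]] iter_deriv_pos[OF F yd] by (simp add: powr_mult)
  qed
  also have "\<dots> \<ge> (\<Sum>y\<in>sel_tree n (Suc i). exp (V i) * iter_deriv F (T (Suc i)) (T n - T (Suc i)) y powr (- s))"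
    by (intro sum_mono mult_right_mono Sel_sum ball) auto
  finally show ?thesis unfolding sel_sum_def[of n "Suc i"] sum_distrib_left .
qed

lemma sel_sum_ge: "k \<le> n \<Longrightarrow> exp (\<Sum>i<k. V i) * sel_sum n k \<le> sel_sum n 0"
proof (induction k)
  case (Suc k)
  have "exp (\<Sum>i<Suc k. V i) * sel_sum n (Suc k) = exp (\<Sum>i<k. V i) * (exp (V k) * sel_sum n (Suc k))"
    by (simp add: exp_add)
  also have "\<dots> \<le> exp (\<Sum>i<k. V i) * sel_sum n k" using sel_sum_step[of k n] Suc by (intro mult_left_mono) auto
  also have "\<dots> \<le> sel_sum n 0" using Suc by simp
  finally show ?case .
qed simp

lemma sel_close_upto:
  assumes u: "u \<in> sel_tree n 0" and v: "v \<in> sel_tree n 0" and k: "k \<le> n"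
    and near: "\<And>i. i < k \<Longrightarrow> dist (transport 0 i u) (transport 0 i v) < sep"
  shows "close F 0 (T k) u v"
  using k near
proof (induction k)
  case 0
  then show ?case by (simp add: T0 close_def)
next
  case (Suc k)
  then have c: "close F 0 (T k) u v" by simp
  obtain y where y: "y \<in> ball (p (Suc k)) r0" "transport 0 k u \<in> Sel k y"
    using transport_Suc_Sel[of 0 k n u] Suc u by auto
  obtain y' where y': "y' \<in> ball (p (Suc k)) r0" "transport 0 k v \<in> Sel k y'"
    using transport_Suc_Sel[of 0 k n v] Suc v by auto
  have "close F (T k) (T (Suc k) - T k) (transport 0 k u) (transport 0 k v)"
    by (rule Sel_close[OF y(1) y'(1) y(2) y'(2)]) (use Suc in simp)
  then have "close F (0 + T k) (T (Suc k) - T k) (orb F 0 (T k) u) (orb F 0 (T k) v)"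
    by (simp add: transport_def T0)
  from close_add[OF F c this] show ?case using T_less[of k] by simp
qed

lemma log_norm_sum_mono: "m \<le> n \<Longrightarrow> log_norm_sum F t m \<le> log_norm_sum F t n"
  using log_norm_sum_add[of F t m "n - m"] log_norm_sum_nonneg[OF F, of "t + m" "n - m"] by simp

text \<open>
  Let \<open>k\<close> be the first block at whose beginning two points of \<open>U\<close> are
  \<open>sep\<close> apart. Until then they are shadowed by a single inverse branch, so the
  derivative at that time is comparable to \<open>sep / diameter U\<close>; this gives the
  factor \<open>diameter U powr s\<close>. From then on the images of the points of
  \<open>U\<close> are distinct members of the tree at block \<open>k\<close>, whose weight is
  at most \<open>exp (- (\<Sum>i<k. V i))\<close> times the total. This gain absorbs the
  distortion once \<open>k\<close> is at least \<open>K\<close>, which smallness of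
  \<open>U\<close> guarantees. If the points never separate, \<open>U\<close> contains a single
  one, of weight at most one.
\<close>

lemma small_set_contribution:
  fixes U :: "'a set"
  assumes bdd: "bounded U"
    and K: "\<And>k. K \<le> k \<Longrightarrow> s * (2 * distortion_sum (T k) - ln sep) \<le> (\<Sum>i<k. V i)"
    and diam: "diameter U < sep * exp (- distortion_sum (T K) - log_norm_sum F 0 (T K))"
  shows "(\<Sum>u\<in>U \<inter> sel_tree n 0. iter_deriv F 0 (T n) u powr (- s)) \<le> diameter U powr s * sel_sum n 0 + 1"
proof (cases "\<exists>k<n. \<exists>u\<in>U \<inter> sel_tree n 0. \<exists>v\<in>U \<inter> sel_tree n 0. sep \<le> dist (transport 0 k u) (transport 0 k v)")
  case False
  have eq: "u = v" if u: "u \<in> U \<inter> sel_tree n 0" and v: "v \<in> U \<inter> sel_tree n 0" for u v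
  proof -
    have "close F 0 (T n) u v"
      by (rule sel_close_upto[of u n v n]) (use False u v in \<open>auto simp: not_le\<close>)
    moreover have "transport 0 n u = p n" "transport 0 n v = p n"
      using sel_tree_transport[of 0 n n u] sel_tree_transport[of 0 n n v] u v by (auto simp: sel_tree_top)
    then have "orb F 0 (T n) v = orb F 0 (T n) u" by (simp add: transport_def T0)
    ultimately show ?thesis by (rule close_eq[OF F, symmetric])
  qed
  have "(\<Sum>u\<in>U \<inter> sel_tree n 0. iter_deriv F 0 (T n) u powr (- s)) \<le> 1"
  proof (cases "U \<inter> sel_tree n 0 = {}")
    case False
    then obtain u where u: "u \<in> U \<inter> sel_tree n 0" by blast
    have "U \<inter> sel_tree n 0 \<subseteq> {u}" using eq[OF u] by auto
    then have "U \<inter> sel_tree n 0 = {u}" using u by auto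
    moreover have "u \<in> dom (iter_seq F 0 (T n))" using sel_tree_transport[of 0 n n u] u by (simp add: T0)
    then have "1 \<le> iter_deriv F 0 (T n) u"
      using iter_deriv_ge[OF F, of u 0 "T n"] one_le_power[of \<beta> "T n"] \<beta>_gt_1 by linarith
    then have "iter_deriv F 0 (T n) u powr (- s) \<le> 1 powr (- s)" using s by (intro powr_neg_mono) auto
    ultimately show ?thesis by simp
  qed simp
  moreover have "0 \<le> diameter U powr s * sel_sum n 0"
    by (rule mult_nonneg_nonneg[OF powr_ge_zero sel_sum_nonneg])
  ultimately show ?thesis by linarith
next
  case True
  define P where "P = (\<lambda>k. k < n \<and> (\<exists>u\<in>U \<inter> sel_tree n 0. \<exists>v\<in>U \<inter> sel_tree n 0. sep \<le> dist (transport 0 k u) (transport 0 k v)))"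
  define k where "k = (LEAST k. P k)"
  have "\<exists>k. P k" using True unfolding P_def .
  then have "P k" unfolding k_def by (rule LeastI_ex)
  then have kn: "k < n" and ex: "\<exists>u\<in>U \<inter> sel_tree n 0. \<exists>v\<in>U \<inter> sel_tree n 0. sep \<le> dist (transport 0 k u) (transport 0 k v)"
    unfolding P_def by simp_all
  from ex obtain u v where u: "u \<in> U \<inter> sel_tree n 0" and v: "v \<in> U \<inter> sel_tree n 0"
    and far: "sep \<le> dist (transport 0 k u) (transport 0 k v)" by (elim bexE)
  have near: "dist (transport 0 i a) (transport 0 i b) < sep"
    if "i < k" "a \<in> U \<inter> sel_tree n 0" "b \<in> U \<inter> sel_tree n 0" for i a b
  proof -
    have "\<not> P i" using that(1) unfolding k_def by (rule not_less_Least)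
    moreover have "i < n" using that(1) kn by simp
    ultimately show ?thesis using that(2,3) unfolding P_def by (meson not_le)
  qed
  have cl: "close F 0 (T k) a b" if "a \<in> U \<inter> sel_tree n 0" "b \<in> U \<inter> sel_tree n 0" for a b
    by (rule sel_close_upto[of a n b k]) (use that kn near in auto)
  let ?c = "distortion_sum (T k)"
  have dom: "a \<in> dom (iter_seq F 0 (T k))" if "a \<in> sel_tree n 0" for a
    using sel_tree_transport[of 0 k n a] that kn by (simp add: T0)
  note ud = dom[OF IntD2[OF u]]
  have "dist v u \<le> diameter U" using u v bdd by (intro diameter_bounded_bound) auto
  have "sep \<le> dist (orb F 0 (T k) v) (orb F 0 (T k) u)" using far by (simp add: transport_def T0 dist_commute)
  also have "\<dots> \<le> exp ?c * iter_deriv F 0 (T k) u * dist v u"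
    by (rule close_dist_bounds(2)[OF F cl[OF u v]])
  also have "\<dots> \<le> exp ?c * iter_deriv F 0 (T k) u * diameter U"
    using \<open>dist v u \<le> diameter U\<close> iter_deriv_pos[OF F ud] by (intro mult_left_mono) auto
  finally have sep_le: "sep \<le> exp ?c * iter_deriv F 0 (T k) u * diameter U" .
  have dpos: "0 < diameter U"
  proof (rule ccontr)
    assume "\<not> 0 < diameter U"
    then have "diameter U = 0" using diameter_ge_0[OF bdd] by simp
    then show False using sep_le sep by simp
  qed
  have "K \<le> k"
  proof (rule ccontr)
    assume "\<not> K \<le> k"
    then have Tk: "T k \<le> T K" by (intro T_mono) simp
    have "iter_deriv F 0 (T k) u \<le> exp (log_norm_sum F 0 (T K))"
      using iter_deriv_le_norm[OF F ud] log_norm_sum_mono[OF Tk, of 0] by (meson exp_le_cancel_iff order_trans)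
    moreover have "exp ?c \<le> exp (distortion_sum (T K))" using distortion_sum_mono[OF Tk] by simp
    ultimately have "exp ?c * iter_deriv F 0 (T k) u \<le> exp (distortion_sum (T K)) * exp (log_norm_sum F 0 (T K))"
      using iter_deriv_pos[OF F ud] by (intro mult_mono) auto
    then have "sep \<le> exp (distortion_sum (T K)) * exp (log_norm_sum F 0 (T K)) * diameter U"
      using sep_le dpos mult_right_mono[of _ _ "diameter U"] by (meson less_imp_le order_trans)
    also have "\<dots> < exp (distortion_sum (T K)) * exp (log_norm_sum F 0 (T K)) *
        (sep * exp (- distortion_sum (T K) - log_norm_sum F 0 (T K)))"
      using diam by (intro mult_strict_left_mono) auto
    also have "\<dots> = sep" by (simp add: exp_diff exp_minus)
    finally show False by simp
  qed
  have Dw: "iter_deriv F 0 (T k) w powr (- s) \<le> diameter U powr s * exp (s * (2 * ?c - ln sep))"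
    if w: "w \<in> U \<inter> sel_tree n 0" for w
  proof -
    note wd = dom[OF IntD2[OF w]]
    have "iter_deriv F 0 (T k) u \<le> exp ?c * iter_deriv F 0 (T k) w"
      by (rule close_iter_deriv_le(1)[OF F cl[OF w u]])
    then have "exp ?c * iter_deriv F 0 (T k) u * diameter U \<le> exp ?c * (exp ?c * iter_deriv F 0 (T k) w) * diameter U"
      using dpos by (intro mult_right_mono mult_left_mono) auto
    then have "sep \<le> exp (2 * ?c) * iter_deriv F 0 (T k) w * diameter U"
      using sep_le by (simp add: mult.assoc[symmetric] exp_add[symmetric])
    then have "sep * exp (- 2 * ?c) / diameter U \<le> iter_deriv F 0 (T k) w"
      using dpos by (simp add: pos_divide_le_eq exp_minus field_simps)
    then have "iter_deriv F 0 (T k) w powr (- s) \<le> (sep * exp (- 2 * ?c) / diameter U) powr (- s)"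
      using sep dpos s by (intro powr_neg_mono) auto
    also have "\<dots> = exp (s * (2 * ?c - ln sep)) * diameter U powr s"
      using sep dpos by (simp add: powr_def ln_div ln_mult exp_add[symmetric] algebra_simps)
    finally show ?thesis by (simp add: mult.commute)
  qed
  have Tn: "T n = T k + (T n - T k)" using T_mono[of k n] kn by simp
  have "(\<Sum>w\<in>U \<inter> sel_tree n 0. iter_deriv F 0 (T n) w powr (- s))
      = (\<Sum>w\<in>U \<inter> sel_tree n 0. iter_deriv F 0 (T k) w powr (- s) * iter_deriv F (T k) (T n - T k) (transport 0 k w) powr (- s))"
  proof (intro sum.cong refl)
    fix w assume w: "w \<in> U \<inter> sel_tree n 0"
    note wd = dom[OF IntD2[OF w]]
    have "transport 0 k w \<in> sel_tree n k" using sel_tree_transport[of 0 k n w] w kn by simp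
    then have wk: "transport 0 k w \<in> dom (iter_seq F (T k) (T n - T k))"
      using sel_tree_transport[of k n n "transport 0 k w"] kn by simp
    have "iter_deriv F 0 (T k + (T n - T k)) w = iter_deriv F 0 (T k) w * iter_deriv F (0 + T k) (T n - T k) (orb F 0 (T k) w)"
      by (rule iter_deriv_add[OF wd])
    then have "iter_deriv F 0 (T n) w = iter_deriv F 0 (T k) w * iter_deriv F (T k) (T n - T k) (transport 0 k w)"
      using Tn by (simp add: transport_def T0)
    then show "iter_deriv F 0 (T n) w powr (- s) = iter_deriv F 0 (T k) w powr (- s) * iter_deriv F (T k) (T n - T k) (transport 0 k w) powr (- s)"
      using iter_deriv_pos[OF F wd] iter_deriv_pos[OF F wk] by (simp add: powr_mult)
  qed
  also have "\<dots> \<le> (\<Sum>w\<in>U \<inter> sel_tree n 0. (diameter U powr s * exp (s * (2 * ?c - ln sep))) * iter_deriv F (T k) (T n - T k) (transport 0 k w) powr (- s))"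
    by (intro sum_mono mult_right_mono Dw) auto
  also have "\<dots> = (diameter U powr s * exp (s * (2 * ?c - ln sep))) * (\<Sum>w\<in>U \<inter> sel_tree n 0. iter_deriv F (T k) (T n - T k) (transport 0 k w) powr (- s))"
    by (rule sum_distrib_left[symmetric])
  also have "(\<Sum>w\<in>U \<inter> sel_tree n 0. iter_deriv F (T k) (T n - T k) (transport 0 k w) powr (- s))
     = (\<Sum>z\<in>transport 0 k ` (U \<inter> sel_tree n 0). iter_deriv F (T k) (T n - T k) z powr (- s))"
  proof (rule sum.reindex_cong[symmetric])
    show "inj_on (transport 0 k) (U \<inter> sel_tree n 0)"
    proof (rule inj_onI)
      fix a b assume "a \<in> U \<inter> sel_tree n 0" "b \<in> U \<inter> sel_tree n 0" "transport 0 k a = transport 0 k b"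
      then show "a = b" using close_eq[OF F cl[of b a]] by (simp add: transport_def T0)
    qed
  qed simp_all
  also have "\<dots> \<le> sel_sum n k"
    unfolding sel_sum_def
  proof (rule sum_mono2)
    show "finite (sel_tree n k)" using sel_tree_finite kn by simp
    show "transport 0 k ` (U \<inter> sel_tree n 0) \<subseteq> sel_tree n k"
    proof (rule image_subsetI)
      fix a assume "a \<in> U \<inter> sel_tree n 0"
      then show "transport 0 k a \<in> sel_tree n k" using sel_tree_transport[of 0 k n a] kn by simp
    qed
  qed simp
  finally have "(\<Sum>w\<in>U \<inter> sel_tree n 0. iter_deriv F 0 (T n) w powr (- s))
     \<le> diameter U powr s * exp (s * (2 * ?c - ln sep)) * sel_sum n k" by (simp add: mult_left_mono)
  also have "\<dots> \<le> diameter U powr s * exp (\<Sum>i<k. V i) * sel_sum n k"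
    using K[OF \<open>K \<le> k\<close>] sel_sum_nonneg[of n k] by (intro mult_right_mono mult_left_mono) auto
  also have "\<dots> = diameter U powr s * (exp (\<Sum>i<k. V i) * sel_sum n k)" by simp
  also have "\<dots> \<le> diameter U powr s * sel_sum n 0"
    using sel_sum_ge[of k n] kn by (intro mult_left_mono) auto
  finally show ?thesis by simp
qed

text \<open>
  The weight of the tree tends to infinity with its depth. Deep enough, the summands one from
  the sets that are never separated amount to less than half of it, for any given finite cover,
  and the rest of the weight is distributed proportionally to \<open>diameter U powr s\<close>.
\<close>

lemma hausdorff_measure_pos_of_selection:
  assumes \<gamma>: "0 < \<gamma>" and V: "eventually (\<lambda>k. \<gamma> * real (T k) \<le> (\<Sum>i<k. V i)) sequentially"
  shows "hausdorff_measure s (repeller F) \<noteq> 0"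
proof -
  have Tinf: "filterlim T at_top sequentially"
    by (rule filterlim_at_top_mono[OF filterlim_ident]) (simp add: T_ge)
  have "(\<lambda>n. s * (2 * (distortion_sum n / real n) - ln sep / real n)) \<longlonglongrightarrow> s * (2 * 0 - 0)"
    by (intro tendsto_intros distortion_sum_sublinear lim_const_over_n)
  then have "eventually (\<lambda>n. s * (2 * (distortion_sum n / real n) - ln sep / real n) < \<gamma>) sequentially"
    using \<gamma> by (intro order_tendstoD(2)) auto
  then have "eventually (\<lambda>n. s * (2 * distortion_sum n - ln sep) \<le> \<gamma> * real n) sequentially"
    using eventually_gt_at_top[of 0]
  proof eventually_elim
    case (elim n)
    have "s * (2 * distortion_sum n - ln sep) = s * (2 * (distortion_sum n / real n) - ln sep / real n) * real n"
      using elim(2) by (simp add: field_simps)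
    also have "\<dots> \<le> \<gamma> * real n" using elim(1) by (intro mult_right_mono) auto
    finally show ?case .
  qed
  then have "eventually (\<lambda>k. s * (2 * distortion_sum (T k) - ln sep) \<le> \<gamma> * real (T k)) sequentially"
    using Tinf by (rule eventually_compose_filterlim)
  then have "eventually (\<lambda>k. s * (2 * distortion_sum (T k) - ln sep) \<le> (\<Sum>i<k. V i)) sequentially"
    using V by eventually_elim linarith
  then obtain K where K: "\<And>k. K \<le> k \<Longrightarrow> s * (2 * distortion_sum (T k) - ln sep) \<le> (\<Sum>i<k. V i)"
    unfolding eventually_sequentially by blast
  show ?thesis
    unfolding repeller_eq
  proof (rule hausdorff_measure_pos_of_finite_covers[OF shift_repeller_compact[OF F mix] s])
    show "0 < sep * exp (- distortion_sum (T K) - log_norm_sum F 0 (T K))" using sep by simp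
    fix I and U :: "nat \<Rightarrow> 'a set"
    assume I: "finite I" and cov: "shift_repeller F 0 \<subseteq> (\<Union>i\<in>I. U i)"
      and U: "\<And>i. i \<in> I \<Longrightarrow> bounded (U i) \<and> diameter (U i) < sep * exp (- distortion_sum (T K) - log_norm_sum F 0 (T K))"
    have "filterlim (\<lambda>k. \<gamma> * real (T k)) at_top sequentially"
      by (rule filterlim_tendsto_pos_mult_at_top[OF tendsto_const \<gamma>])
         (rule filterlim_compose[OF filterlim_real_sequentially Tinf])
    then have "eventually (\<lambda>k. ln (2 * real (card I) + 1) \<le> \<gamma> * real (T k)) sequentially"
      unfolding filterlim_at_top by blast
    then have "eventually (\<lambda>k. ln (2 * real (card I) + 1) \<le> (\<Sum>i<k. V i)) sequentially"
      using V by eventually_elim linarith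
    then obtain n where "ln (2 * real (card I) + 1) \<le> (\<Sum>i<n. V i)"
      unfolding eventually_sequentially by blast
    then have "2 * real (card I) + 1 \<le> exp (\<Sum>i<n. V i)"
      by (metis add_nonneg_pos exp_le_cancel_iff exp_ln mult_nonneg_nonneg of_nat_0_le_iff zero_le_numeral zero_less_one)
    also have "\<dots> \<le> sel_sum n 0" using sel_sum_ge[of n n] by (simp add: sel_sum_top)
    finally have big: "2 * real (card I) + 1 \<le> sel_sum n 0" .
    have cov': "sel_tree n 0 \<subseteq> (\<Union>i\<in>I. U i \<inter> sel_tree n 0)" using cov sel_tree_repeller[of _ n] by blast
    have "sel_sum n 0 = (\<Sum>u\<in>sel_tree n 0. iter_deriv F 0 (T n) u powr (- s))" by (simp add: sel_sum_def T0)
    also have "\<dots> \<le> (\<Sum>u\<in>(\<Union>i\<in>I. U i \<inter> sel_tree n 0). iter_deriv F 0 (T n) u powr (- s))"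
      using I sel_tree_finite[of 0 n] by (intro sum_mono2[OF _ cov']) auto
    also have "\<dots> \<le> (\<Sum>i\<in>I. \<Sum>u\<in>U i \<inter> sel_tree n 0. iter_deriv F 0 (T n) u powr (- s))"
      using I
    proof (induction I rule: finite_induct)
      case (insert i I)
      let ?h = "\<lambda>u. iter_deriv F 0 (T n) u powr (- s)"
      have fin: "finite (U i \<inter> sel_tree n 0)" "finite (\<Union>i\<in>I. U i \<inter> sel_tree n 0)"
        using sel_tree_finite[of 0 n] insert(1) by auto
      have "sum ?h (\<Union>i\<in>insert i I. U i \<inter> sel_tree n 0) = sum ?h ((U i \<inter> sel_tree n 0) \<union> (\<Union>i\<in>I. U i \<inter> sel_tree n 0))"
        by simp
      also have "\<dots> \<le> sum ?h (U i \<inter> sel_tree n 0) + sum ?h (\<Union>i\<in>I. U i \<inter> sel_tree n 0)"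
        using sum_Un[OF fin, of ?h] sum_nonneg[of "(U i \<inter> sel_tree n 0) \<inter> (\<Union>i\<in>I. U i \<inter> sel_tree n 0)" ?h] by simp
      finally show ?case using insert by simp
    qed simp
    also have "\<dots> \<le> (\<Sum>i\<in>I. diameter (U i) powr s * sel_sum n 0 + 1)"
      by (intro sum_mono small_set_contribution[OF _ K]) (use U in auto)
    also have "\<dots> = (\<Sum>i\<in>I. diameter (U i) powr s) * sel_sum n 0 + real (card I)"
      by (simp add: sum.distrib sum_distrib_right)
    finally have le: "sel_sum n 0 \<le> (\<Sum>i\<in>I. diameter (U i) powr s) * sel_sum n 0 + real (card I)" .
    have "(1 / 2) * sel_sum n 0 \<le> (\<Sum>i\<in>I. diameter (U i) powr s) * sel_sum n 0" using le big by linarith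
    moreover have "0 < sel_sum n 0" using big by linarith
    ultimately show "1 / 2 \<le> (\<Sum>i\<in>I. diameter (U i) powr s)" by (rule mult_right_le_imp_le)
  qed
qed

end

end

end

section \<open>Good blocks and single branches\<close>

lemma iter_seq_1: "iter_seq F t 1 = F (Suc t)"
  by (auto simp: map_comp_def split: option.splits)

context conf_params
begin

context
  fixes \<delta> :: real and dummy :: "'a::{complete_space, perfect_space} itself"
  assumes \<delta>: "0 < \<delta>" "\<delta> < \<Delta>" and homog: "\<And>y::'a. ball y \<Delta> - ball y \<delta> \<noteq> {}"
begin

text \<open>
  The only use of homogeneity. There is a point at distance at least \<open>\<delta>\<close>
  from \<open>f u\<close> within the reach of the inverse branch at \<open>u\<close>; its
  preimage lies in the ball of radius \<open>rad f u\<close>, and it is at distance at least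
  \<open>\<delta> / Df u\<close> from \<open>u\<close> up to distortion.
\<close>

lemma rad_lower_bound:
  fixes f :: "'a \<rightharpoonup> 'a"
  assumes f: "f \<in> conf" and u: "u \<in> dom f"
  shows "\<delta> * exp (- \<epsilon> \<Delta>) < rad f u * conf_deriv f u"
proof -
  obtain w where "w \<in> ball (the (f u)) \<Delta> - ball (the (f u)) \<delta>" using homog by blast
  then have w: "dist (the (f u)) w < \<Delta>" "\<delta> \<le> dist (the (f u)) w" by simp_all
  have "dist w (the (f u)) < \<Delta>" using w by (simp add: dist_commute)
  then obtain a where a: "f a = Some w" "dist a u < rad f u" using rad_onto[OF f u] by blast
  have ad: "a \<in> dom f" and fa: "the (f a) = w" using a(1) by auto
  have d: "dist (the (f a)) (the (f u)) < \<Delta>" using w fa by (simp add: dist_commute)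
  note D = conf_deriv_pos[OF f u]
  have e: "exp (\<epsilon> (dist (the (f a)) (the (f u)))) \<le> exp (\<epsilon> \<Delta>)" using d by (simp add: \<epsilon>_mono)
  have "\<delta> \<le> dist (the (f a)) (the (f u))" using w fa by (simp add: dist_commute)
  also have "\<dots> \<le> exp (\<epsilon> (dist (the (f a)) (the (f u)))) * conf_deriv f u * dist a u"
    by (rule branch_dist_bounds(2)[OF f u ad a(2) d])
  also have "\<dots> \<le> exp (\<epsilon> \<Delta>) * conf_deriv f u * dist a u"
    using e D by (intro mult_right_mono) auto
  also have "\<dots> < exp (\<epsilon> \<Delta>) * conf_deriv f u * rad f u"
    using a(2) D by (intro mult_strict_left_mono) auto
  finally have "exp (- \<epsilon> \<Delta>) * \<delta> < exp (- \<epsilon> \<Delta>) * (exp (\<epsilon> \<Delta>) * conf_deriv f u * rad f u)" by simp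
  also have "\<dots> = rad f u * conf_deriv f u" by (simp add: exp_minus)
  finally show ?thesis by (simp add: mult.commute)
qed

text \<open>
  Half of the radius from \<open>rad_lower_bound\<close> (in the image), reduced by two more
  distortion factors: one for comparing the derivatives at two points and one for the distances
  from the centre.
\<close>

definition branch_scale :: real where
  "branch_scale = \<delta> * exp (- 3 * \<epsilon> \<Delta>) / 2"

lemma branch_scale: "0 < branch_scale" "2 * branch_scale < \<Delta>"
proof -
  show "0 < branch_scale" using \<delta> by (simp add: branch_scale_def)
  have "exp (- 3 * \<epsilon> \<Delta>) \<le> 1" using \<epsilon>_nonneg[of \<Delta>] \<Delta>_pos by simp
  then have "\<delta> * exp (- 3 * \<epsilon> \<Delta>) \<le> \<delta> * 1" using \<delta> by (intro mult_left_mono) auto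
  then show "2 * branch_scale < \<Delta>" using \<delta> unfolding branch_scale_def by linarith
qed

text \<open>
  Being on the same inverse branch is defined relative to a centre, with a radius that depends
  on the centre. At the scale \<open>branch_scale\<close> the centre can be exchanged for any
  other point of the branch.
\<close>

lemma branch_transitive:
  fixes f :: "'a \<rightharpoonup> 'a"
  assumes f: "f \<in> conf" and x: "x \<in> dom f" and u: "u \<in> dom f" "dist u x < rad f x" and v: "v \<in> dom f" "dist v x < rad f x"
    and du: "dist (the (f u)) (the (f x)) < branch_scale" and dv: "dist (the (f v)) (the (f x)) < branch_scale"
  shows "dist v u < rad f u"
proof -
  let ?e = "\<epsilon> \<Delta>"
  have r: "branch_scale < \<Delta>" using branch_scale by simp
  note D = conf_deriv_pos[OF f x] conf_deriv_pos[OF f u(1)]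
  have le: "exp (\<epsilon> d) \<le> exp ?e" if "d < branch_scale" "0 \<le> d" for d using that r by (simp add: \<epsilon>_mono)
  have near: "dist w x * conf_deriv f x \<le> exp ?e * branch_scale"
    if w: "w \<in> dom f" "dist w x < rad f x" and dw: "dist (the (f w)) (the (f x)) < branch_scale" for w
  proof -
    have "dist w x * conf_deriv f x \<le> exp (\<epsilon> (dist (the (f w)) (the (f x)))) * dist (the (f w)) (the (f x))"
      by (rule branch_dist_bounds(1)[OF f x w]) (use dw r in simp)
    also have "\<dots> \<le> exp ?e * branch_scale" using le[OF dw] dw by (intro mult_mono) auto
    finally show ?thesis .
  qed
  have "conf_deriv f u \<le> exp (\<epsilon> (dist (the (f u)) (the (f x)))) * conf_deriv f x"
    by (rule branch_dist_bounds(3)[OF f x u]) (use du r in simp)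
  also have "\<dots> \<le> exp ?e * conf_deriv f x" using le[OF du] D by (intro mult_right_mono) auto
  finally have Du: "conf_deriv f u \<le> exp ?e * conf_deriv f x" .
  have "dist v u * conf_deriv f u \<le> (dist v x + dist u x) * (exp ?e * conf_deriv f x)"
    using Du D dist_triangle2[of v u x] by (intro mult_mono) auto
  also have "\<dots> = exp ?e * (dist v x * conf_deriv f x + dist u x * conf_deriv f x)" by (simp add: algebra_simps)
  also have "\<dots> \<le> exp ?e * (exp ?e * branch_scale + exp ?e * branch_scale)"
    using near[OF u du] near[OF v dv] by (intro mult_left_mono add_mono) auto
  also have "\<dots> = (exp ?e * exp ?e * exp (- 3 * ?e)) * \<delta>" by (simp add: branch_scale_def)
  also have "exp ?e * exp ?e * exp (- 3 * ?e) = exp (- ?e)" by (simp only: exp_add[symmetric]) simp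
  also have "exp (- ?e) * \<delta> < rad f u * conf_deriv f u" using rad_lower_bound[OF f u(1)] by (simp add: mult.commute)
  finally show ?thesis using D(2) by simp
qed

context
  fixes F :: "nat \<Rightarrow> 'a \<rightharpoonup> 'a" and n0 :: nat
  assumes F: "conf_seq F" and mix: "mixing n0 \<Delta> F"
begin

text \<open>
  Contrapositive of separation: when norms are at most \<open>exp B\<close> and separation
  scales at least \<open>\<eta>\<close> throughout a block, points that start close enough stay
  closer than \<open>\<eta>\<close> and within the branch radius up to its end. The initial
  bound anticipates an expansion by at most \<open>exp (\<epsilon> \<Delta> + B)\<close> in each
  of the \<open>m\<close> steps.
\<close>

lemma block_separation:
  assumes B: "\<And>j. j < m \<Longrightarrow> ln (norm_D (F (t + Suc j))) \<le> B" and g: "\<And>j. j < m \<Longrightarrow> \<eta> \<le> gap (F (t + Suc j))"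
    and B0: "0 \<le> B"
    and u: "u \<in> dom (iter_seq F t m)" and v: "v \<in> dom (iter_seq F t m)"
    and near: "dist v u < min \<eta> (\<delta> * exp (- \<epsilon> \<Delta> - B)) * exp (- ((\<epsilon> \<Delta> + B) * real m))"
  shows "close F t m u v"
proof -
  let ?\<kappa> = "min \<eta> (\<delta> * exp (- \<epsilon> \<Delta> - B))" and ?E = "\<epsilon> \<Delta> + B"
  have E0: "0 \<le> ?E" using B0 \<epsilon>_nonneg[of \<Delta>] \<Delta>_pos by simp
  have \<kappa>0: "0 < ?\<kappa>"
  proof -
    have "0 < ?\<kappa> * exp (- (?E * real m))" using near zero_le_dist[of v u] by linarith
    then show ?thesis by (simp add: zero_less_mult_iff)
  qed
  have step: "dist (orb F t j v) (orb F t j u) < rad (F (t + Suc j)) (orb F t j u) \<and>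
     dist (orb F t (Suc j) v) (orb F t (Suc j) u) < \<Delta> \<and>
     dist (orb F t (Suc j) v) (orb F t (Suc j) u) < ?\<kappa> * exp (- (?E * real (m - Suc j)))"
    if j: "j < m" and d: "dist (orb F t j v) (orb F t j u) < ?\<kappa> * exp (- (?E * real (m - j)))" for j
  proof -
    note f = conf_seqD[OF F, of t j]
    note uj = iter_seq_step_dom[OF u j] and vj = iter_seq_step_dom[OF v j]
    have "j \<le> m" using j by simp
    note ou = orb_Suc[OF iter_seq_dom_mono[OF u this]] and ov = orb_Suc[OF iter_seq_dom_mono[OF v this]]
    have "?\<kappa> * exp (- (?E * real (m - j))) \<le> ?\<kappa> * 1" using E0 \<kappa>0 by (intro mult_left_mono) auto
    then have d\<kappa>: "dist (orb F t j v) (orb F t j u) < ?\<kappa>" using d by simp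
    then have dg: "dist (orb F t j v) (orb F t j u) < gap (F (t + Suc j))" using g[OF j] by simp
    have D: "dist (the (F (t + Suc j) (orb F t j v))) (the (F (t + Suc j) (orb F t j u))) < \<Delta>"
      using bspec[OF bspec[OF has_gap_gap[unfolded has_gap_def] vj] uj] dg by simp
    let ?c = "conf_deriv (F (t + Suc j)) (orb F t j u)"
    have c: "0 < ?c" by (rule conf_deriv_pos[OF f uj])
    have cB: "?c \<le> exp B"
    proof -
      have "?c \<le> norm_D (F (t + Suc j))" by (rule norm_D_ge[OF f uj])
      also have "\<dots> = exp (ln (norm_D (F (t + Suc j))))" using norm_D_ge_\<beta>[OF f] \<beta>_gt_1 by simp
      also have "\<dots> \<le> exp B" using B[OF j] by simp
      finally show ?thesis .
    qed
    have "dist (orb F t j v) (orb F t j u) * ?c \<le> (\<delta> * exp (- \<epsilon> \<Delta> - B)) * exp B"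
      using d\<kappa> cB c \<delta>(1) by (intro mult_mono) auto
    also have "\<dots> = \<delta> * exp (- \<epsilon> \<Delta>)" by (simp add: exp_diff)
    also have "\<dots> < rad (F (t + Suc j)) (orb F t j u) * ?c" by (rule rad_lower_bound[OF f uj])
    finally have R: "dist (orb F t j v) (orb F t j u) < rad (F (t + Suc j)) (orb F t j u)" using c by simp
    have "dist (the (F (t + Suc j) (orb F t j v))) (the (F (t + Suc j) (orb F t j u)))
      \<le> exp (\<epsilon> (dist (the (F (t + Suc j) (orb F t j v))) (the (F (t + Suc j) (orb F t j u))))) * ?c * dist (orb F t j v) (orb F t j u)"
      by (rule branch_dist_bounds(2)[OF f uj vj R D])
    also have "\<dots> \<le> exp (\<epsilon> \<Delta>) * exp B * dist (orb F t j v) (orb F t j u)"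
      using cB c D by (intro mult_right_mono mult_mono) (auto intro: \<epsilon>_mono)
    also have "\<dots> < exp (\<epsilon> \<Delta>) * exp B * (?\<kappa> * exp (- (?E * real (m - j))))"
      using d by (intro mult_strict_left_mono) auto
    also have "\<dots> = ?\<kappa> * (exp ?E * exp (- (?E * real (m - j))))" by (simp add: exp_add mult_ac)
    also have "exp ?E * exp (- (?E * real (m - j))) = exp (- (?E * real (m - Suc j)))"
    proof -
      have "real (m - j) = 1 + real (m - Suc j)" using j by simp
      then show ?thesis unfolding mult_exp_exp by (simp add: algebra_simps)
    qed
    finally show ?thesis using R D unfolding ou ov by simp
  qed
  have d: "dist (orb F t j v) (orb F t j u) < ?\<kappa> * exp (- (?E * real (m - j)))" if "j \<le> m" for j
    using that
  proof (induction j)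
    case 0
    then show ?case using near by simp
  next
    case (Suc j)
    then have "j < m" "dist (orb F t j v) (orb F t j u) < ?\<kappa> * exp (- (?E * real (m - j)))" by simp_all
    from step[OF this] show ?case by blast
  qed
  have "dist (orb F t j v) (orb F t j u) < rad (F (t + Suc j)) (orb F t j u) \<and>
     dist (orb F t (Suc j) v) (orb F t (Suc j) u) < \<Delta>" if "j < m" for j
    using step[OF that d] that by simp
  then show ?thesis unfolding close_def using u v by blast
qed

text \<open>
  Follow the orbit of \<open>P\<close> for \<open>q\<close> steps along one inverse branch,
  which contracts to below \<open>branch_scale\<close>, and use mixing to reach an arbitrary
  point in the next \<open>n0\<close> steps. So any \<open>x\<close> has a preimage near
  \<open>P\<close>, at the price of one preimage instead of many during \<open>q + n0\<close>
  steps.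
\<close>

lemma reset_branches:
  assumes P: "P \<in> shift_repeller F t" and q: "\<Delta> / \<beta> ^ q < branch_scale"
  shows "\<exists>\<sigma>. \<forall>x. iter_seq F t (q + n0) (\<sigma> x) = Some x \<and> dist (\<sigma> x) P < branch_scale"
proof -
  have "\<exists>w. iter_seq F t (q + n0) w = Some x \<and> dist w P < branch_scale" for x
  proof -
    have "orb F t q P \<in> dom (iter_seq F (t + q) n0)"
      by (rule shift_repellerD[OF orb_shift_repeller[OF P]])
    then obtain z where z: "z \<in> fibre (iter_seq F (t + q) n0) x" "dist (orb F t q P) z < \<Delta>"
      using mix unfolding mixing_def mpreim_UNIV by blast
    have d: "dist z (orb F t q P) < \<Delta>" using z(2) by (simp add: dist_commute)
    obtain \<psi> where \<psi>: "bij_betw \<psi> (fibre (iter_seq F t q) (orb F t q P)) (fibre (iter_seq F t q) z)"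
      "\<And>x. x \<in> fibre (iter_seq F t q) (orb F t q P) \<Longrightarrow> close F t q x (\<psi> x)"
      by (rule fibre_pairing_iter[OF F d]) blast
    have PP: "P \<in> fibre (iter_seq F t q) (orb F t q P)"
      using shift_repellerD[OF P, of q] by (auto simp: fibre_iff)
    have w: "\<psi> P \<in> fibre (iter_seq F t q) z" using bij_betwE[OF \<psi>(1)] PP by blast
    have "dist (\<psi> P) P * \<beta> ^ q \<le> dist (orb F t q (\<psi> P)) (orb F t q P)"
      using close_contract[OF F \<psi>(2)[OF PP], of 0] by simp
    also have "\<dots> < \<Delta>" using d fibre_orb[OF F w] by simp
    finally have "dist (\<psi> P) P < \<Delta> / \<beta> ^ q" using \<beta>_gt_1 by (simp add: pos_less_divide_eq)
    moreover have "iter_seq F t (q + n0) (\<psi> P) = Some x"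
      unfolding iter_seq_add_iff using w z(1) unfolding fibre_iff by blast
    ultimately show ?thesis using q by (intro exI[of _ "\<psi> P"]) simp
  qed
  then show ?thesis by (intro choice allI)
qed

text \<open>
  Blocks are found greedily along the time axis: length \<open>m\<close> at a good time, length
  one at a bad time. Good times that fall inside a block are skipped, and only the bad times at
  which a block starts cost anything, so bounds for the bad times of the whole orbit suffice. A
  good block has weight at least \<open>exp (v - s * M1)\<close>: one branch for the first
  \<open>q + n0\<close> steps, whose derivative is at most \<open>exp M1\<close>, followed by
  all branches.
\<close>

lemma hausdorff_measure_pos_of_good_times:
  fixes good :: "nat \<Rightarrow> bool"
  assumes s: "0 < s" and q: "\<Delta> / \<beta> ^ q < branch_scale" and Lm: "q + n0 \<le> m" "1 \<le> m"
    and B0: "0 \<le> B" and \<eta>: "0 < \<eta>"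
    and goodB: "\<And>t j. good t \<Longrightarrow> j < m \<Longrightarrow> ln (norm_D (F (t + Suc j))) \<le> B"
    and goodG: "\<And>t j. good t \<Longrightarrow> j < m \<Longrightarrow> \<eta> \<le> gap (F (t + Suc j))"
    and goodM: "\<And>t. good t \<Longrightarrow> log_norm_sum F t (q + n0) \<le> M1"
    and goodV: "\<And>t. good t \<Longrightarrow> v \<le> ln (pinf s F (t + (q + n0)) (m - (q + n0)))"
    and a: "0 < a" "a * real m \<le> v - s * M1"
    and bad1: "eventually (\<lambda>n. (\<Sum>t<n. if good t then 0 else 1) \<le> real n / 2) sequentially"
    and bad2: "eventually (\<lambda>n. s * (\<Sum>t<n. if good t then 0 else ln (norm_D (F (Suc t)))) \<le> a / 4 * real n) sequentially"
  shows "hausdorff_measure s (repeller F) \<noteq> 0"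
proof -
  obtain e where e: "e \<in> shift_repeller F 0" using shift_repeller_nonempty[OF F mix, of 0] by blast
  define T where "T = rec_nat 0 (\<lambda>_ t. t + (if good t then m else 1))"
  have T0: "T 0 = 0" and TS: "T (Suc i) = T i + (if good (T i) then m else 1)" for i by (simp_all add: T_def)
  define p where "p = (\<lambda>i. orb F 0 (T i) e)"
  have p: "p i \<in> shift_repeller F (T i)" for i
    using orb_shift_repeller[OF e, of "T i"] by (simp add: p_def)
  have T_less: "T i < T (Suc i)" for i using Lm(2) by (simp add: TS)
  have pS: "iter_seq F (T i) (T (Suc i) - T i) (p i) = Some (p (Suc i))" for i
  proof -
    have "iter_seq F 0 (T i + (T (Suc i) - T i)) e = Some (p (Suc i))"
      using shift_repellerD[OF e, of "T (Suc i)"] T_less[of i] by (auto simp: p_def)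
    then show ?thesis unfolding iter_seq_add_iff by (auto simp: p_def)
  qed
  define V where "V = (\<lambda>i. if good (T i) then v - s * M1 else - (s * ln (norm_D (F (Suc (T i))))))"
  define sep where "sep = min \<eta> (\<delta> * exp (- \<epsilon> \<Delta> - B)) * exp (- ((\<epsilon> \<Delta> + B) * real m))"
  have sep: "0 < sep" using \<eta> \<delta> by (simp add: sep_def)
  have "\<exists>S. \<forall>y\<in>ball (p (Suc i)) branch_scale. S y \<subseteq> fibre (iter_seq F (T i) (T (Suc i) - T i)) y \<inter> ball (p i) branch_scale \<and>
      exp (V i) \<le> (\<Sum>w\<in>S y. iter_deriv F (T i) (T (Suc i) - T i) w powr (- s)) \<and>
      (\<forall>y'\<in>ball (p (Suc i)) branch_scale. \<forall>u\<in>S y. \<forall>w\<in>S y'. dist u w < sep \<longrightarrow> close F (T i) (T (Suc i) - T i) u w)" for i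
  proof (cases "good (T i)")
    case True
    then have len: "T (Suc i) - T i = m" by (simp add: TS)
    obtain \<sigma> where \<sigma>: "\<And>x. iter_seq F (T i) (q + n0) (\<sigma> x) = Some x" "\<And>x. dist (\<sigma> x) (p i) < branch_scale"
      using reset_branches[OF p q] by blast
    let ?L = "q + n0"
    define S where "S = (\<lambda>y. \<sigma> ` fibre (iter_seq F (T i + ?L) (m - ?L)) y)"
    have mL: "m = ?L + (m - ?L)" using Lm(1) by simp
    have Sf: "S y \<subseteq> fibre (iter_seq F (T i) m) y" for y
    proof
      fix w assume "w \<in> S y"
      then obtain x where x: "x \<in> fibre (iter_seq F (T i + ?L) (m - ?L)) y" "w = \<sigma> x" unfolding S_def by blast
      have "iter_seq F (T i) (?L + (m - ?L)) w = Some y"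
        by (subst iter_seq_add_iff) (use x \<sigma>(1)[of x] in \<open>simp add: fibre_iff\<close>)
      then show "w \<in> fibre (iter_seq F (T i) m) y" unfolding fibre_iff using mL by simp
    qed
    have Sb: "S y \<subseteq> ball (p i) branch_scale" for y
      unfolding S_def using \<sigma>(2) by (auto simp: dist_commute)
    have Ss: "exp (V i) \<le> (\<Sum>w\<in>S y. iter_deriv F (T i) m w powr (- s))" for y
    proof -
      have inj: "inj_on \<sigma> X" for X
        by (rule inj_onI) (metis \<sigma>(1) option.inject)
      have "exp (V i) = exp (- (s * M1)) * exp v" using True by (simp add: V_def exp_diff exp_minus field_simps)
      also have "\<dots> \<le> exp (- (s * M1)) * psum s F (T i + ?L) (m - ?L) y"
      proof (intro mult_left_mono)
        have s0: "0 \<le> s" using s by simp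
        have "exp v \<le> exp (ln (pinf s F (T i + ?L) (m - ?L)))" using goodV[OF True] by simp
        also have "\<dots> = pinf s F (T i + ?L) (m - ?L)" using pinf_pos[OF F s0] by simp
        also have "\<dots> \<le> psum s F (T i + ?L) (m - ?L) y" by (rule pinf_le)
        finally show "exp v \<le> psum s F (T i + ?L) (m - ?L) y" .
      qed simp
      also have "\<dots> \<le> (\<Sum>x\<in>fibre (iter_seq F (T i + ?L) (m - ?L)) y. iter_deriv F (T i) m (\<sigma> x) powr (- s))"
        unfolding psum_def sum_distrib_left
      proof (rule sum_mono)
        fix x assume x: "x \<in> fibre (iter_seq F (T i + ?L) (m - ?L)) y"
        have sd: "\<sigma> x \<in> dom (iter_seq F (T i) ?L)" using \<sigma>(1)[of x] by auto
        have so: "orb F (T i) ?L (\<sigma> x) = x" using \<sigma>(1)[of x] by simp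
        have "iter_deriv F (T i) (?L + (m - ?L)) (\<sigma> x) = iter_deriv F (T i) ?L (\<sigma> x) * iter_deriv F (T i + ?L) (m - ?L) x"
          using iter_deriv_add[OF sd, of "m - ?L"] so by simp
        then have D: "iter_deriv F (T i) m (\<sigma> x) = iter_deriv F (T i) ?L (\<sigma> x) * iter_deriv F (T i + ?L) (m - ?L) x"
          using mL by simp
        have "iter_deriv F (T i) ?L (\<sigma> x) \<le> exp M1"
          using iter_deriv_le_norm[OF F sd] goodM[OF True] by (meson exp_le_cancel_iff order_trans)
        then have "exp (- (s * M1)) \<le> iter_deriv F (T i) ?L (\<sigma> x) powr (- s)"
          unfolding exp_powr_mult[symmetric] using iter_deriv_pos[OF F sd] s by (intro powr_neg_mono) auto
        then show "exp (- (s * M1)) * iter_deriv F (T i + ?L) (m - ?L) x powr (- s) \<le> iter_deriv F (T i) m (\<sigma> x) powr (- s)"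
          unfolding D using iter_deriv_pos[OF F sd] iter_deriv_pos[OF F fibre_dom[OF F x]]
          by (simp add: powr_mult mult_right_mono)
      qed
      also have "\<dots> = (\<Sum>w\<in>S y. iter_deriv F (T i) m w powr (- s))"
        unfolding S_def by (subst sum.reindex[OF inj]) (simp add: comp_def)
      finally show ?thesis .
    qed
    have Sc: "close F (T i) m u w" if "u \<in> S y" "w \<in> S y'" "dist u w < sep" for u w y y'
    proof (rule block_separation[where B = B and \<eta> = \<eta>, OF goodB[OF True] goodG[OF True] B0])
      show "u \<in> dom (iter_seq F (T i) m)" "w \<in> dom (iter_seq F (T i) m)"
        using subsetD[OF Sf that(1)] subsetD[OF Sf that(2)] fibre_dom[OF F] by blast+
      show "dist w u < min \<eta> (\<delta> * exp (- \<epsilon> \<Delta> - B)) * exp (- ((\<epsilon> \<Delta> + B) * real m))"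
        using that(3) by (simp add: sep_def dist_commute)
    qed
    show ?thesis unfolding len
      by (rule exI[of _ S]) (intro ballI conjI Int_greatest Sf Sb Ss impI, rule Sc, assumption+)
  next
    case False
    then have len: "T (Suc i) - T i = 1" by (simp add: TS)
    let ?f = "F (Suc (T i))"
    have f: "?f \<in> conf" using conf_seqD[OF F, of 0 "T i"] by simp
    have fp: "?f (p i) = Some (p (Suc i))" using pS[of i] unfolding len iter_seq_1 .
    have pd: "p i \<in> dom ?f" using fp by auto
    have "\<exists>u. ?f u = Some y \<and> dist u (p i) < rad ?f (p i)" if "y \<in> ball (p (Suc i)) branch_scale" for y
    proof -
      have "dist y (the (?f (p i))) < \<Delta>" using that branch_scale fp by (simp add: dist_commute)
      from rad_onto[OF f pd this] show ?thesis by blast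
    qed
    then obtain \<sigma> where \<sigma>: "\<And>y. y \<in> ball (p (Suc i)) branch_scale \<Longrightarrow> ?f (\<sigma> y) = Some y \<and> dist (\<sigma> y) (p i) < rad ?f (p i)"
      by metis
    have \<sigma>d: "\<sigma> y \<in> dom ?f" "the (?f (\<sigma> y)) = y" "dist (\<sigma> y) (p i) < rad ?f (p i)"
      "dist (the (?f (\<sigma> y))) (the (?f (p i))) < branch_scale"
      if "y \<in> ball (p (Suc i)) branch_scale" for y
      using \<sigma>[OF that] that fp by (auto simp: dist_commute)
    define S where "S = (\<lambda>y. {\<sigma> y})"
    have Sf: "S y \<subseteq> fibre (iter_seq F (T i) 1) y" if "y \<in> ball (p (Suc i)) branch_scale" for y
      unfolding S_def iter_seq_1 using \<sigma>[OF that] by (simp add: fibre_iff)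
    have Sb: "S y \<subseteq> ball (p i) branch_scale" if y: "y \<in> ball (p (Suc i)) branch_scale" for y
    proof -
      have "dist (\<sigma> y) (p i) \<le> dist (the (?f (\<sigma> y))) (the (?f (p i))) / \<beta>"
        by (rule branch_dist_le[OF f \<sigma>d(1)[OF y] pd \<sigma>d(3)[OF y]])
      also have "\<dots> \<le> dist (the (?f (\<sigma> y))) (the (?f (p i))) / 1" using \<beta>_gt_1 by (intro divide_left_mono) auto
      also have "\<dots> < branch_scale" using \<sigma>d(4)[OF y] by simp
      finally show ?thesis unfolding S_def by (simp add: dist_commute)
    qed
    have Ss: "exp (V i) \<le> (\<Sum>w\<in>S y. iter_deriv F (T i) 1 w powr (- s))" if y: "y \<in> ball (p (Suc i)) branch_scale" for y
    proof -
      have w: "\<sigma> y \<in> dom (iter_seq F (T i) 1)" unfolding iter_seq_1 by (rule \<sigma>d(1)[OF y])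
      have "V i = - (s * log_norm_sum F (T i) 1)" using False by (simp add: V_def log_norm_sum_def)
      then have "exp (V i) = exp (log_norm_sum F (T i) 1) powr (- s)" by (simp add: exp_powr_mult)
      also have "\<dots> \<le> iter_deriv F (T i) 1 (\<sigma> y) powr (- s)"
        using s by (intro powr_neg_mono[OF iter_deriv_pos[OF F w] iter_deriv_le_norm[OF F w]]) simp
      finally show ?thesis unfolding S_def by simp
    qed
    have Sc: "close F (T i) 1 u w"
      if y: "y \<in> ball (p (Suc i)) branch_scale" and y': "y' \<in> ball (p (Suc i)) branch_scale" and "u \<in> S y" "w \<in> S y'" for u w y y'
    proof -
      have uw: "u = \<sigma> y" "w = \<sigma> y'" using that(3,4) by (simp_all add: S_def)
      have "dist w u < rad ?f u"
        unfolding uw by (rule branch_transitive[OF f pd \<sigma>d(1)[OF y] \<sigma>d(3)[OF y] \<sigma>d(1)[OF y'] \<sigma>d(3)[OF y'] \<sigma>d(4)[OF y] \<sigma>d(4)[OF y']])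
      moreover have "dist y' y < \<Delta>" 
        using y y' branch_scale(2) dist_triangle3[of y' y "p (Suc i)"] by simp
      then have "dist (the (?f w)) (the (?f u)) < \<Delta>" unfolding uw using \<sigma>d(2)[OF y] \<sigma>d(2)[OF y'] by simp
      moreover have "iter_seq F (T i) (Suc 0) = ?f" using iter_seq_1[of F "T i"] by simp
      ultimately show ?thesis
        unfolding close_def using \<sigma>d(1)[OF y] \<sigma>d(1)[OF y'] uw by (simp add: iter_seq_1 del: iter_seq.simps(2))
    qed
    show ?thesis unfolding len
      by (rule exI[of _ S]) (intro ballI conjI Int_greatest Sf Sb Ss impI; (rule Sc)?; assumption)
  qed
  then obtain Sel where Sel: "\<And>i. \<forall>y\<in>ball (p (Suc i)) branch_scale. Sel i y \<subseteq> fibre (iter_seq F (T i) (T (Suc i) - T i)) y \<inter> ball (p i) branch_scale \<and>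
      exp (V i) \<le> (\<Sum>w\<in>Sel i y. iter_deriv F (T i) (T (Suc i) - T i) w powr (- s)) \<and>
      (\<forall>y'\<in>ball (p (Suc i)) branch_scale. \<forall>u\<in>Sel i y. \<forall>w\<in>Sel i y'. dist u w < sep \<longrightarrow> close F (T i) (T (Suc i) - T i) u w)"
    by metis
  define badc where "badc = (\<lambda>n. \<Sum>t<n. if good t then 0 else 1 :: real)"
  define bads where "bads = (\<lambda>n. \<Sum>t<n. if good t then 0 else ln (norm_D (F (Suc t))))"
  have lnorm: "0 \<le> ln (norm_D (F (Suc t)))" for t
    using norm_D_ge_\<beta>[OF conf_seqD[OF F, of 0 t]] \<beta>_gt_1 by simp
  \<comment> \<open>a good block of length \<open>m\<close> contributes at least \<open>a * m\<close>; in a bad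
    step the time and the number of bad times increase together, so that only the norm is lost\<close>
  have sumV: "a * (real (T k) - badc (T k)) - s * bads (T k) \<le> (\<Sum>i<k. V i)" for k
  proof (induction k)
    case 0
    then show ?case by (simp add: T0 badc_def bads_def)
  next
    case (Suc k)
    show ?case
    proof (cases "good (T k)")
      case True
      have T: "T (Suc k) = T k + m" using True by (simp add: TS)
      have "badc (T k) \<le> badc (T k + m)" unfolding badc_def by (intro sum_mono2) auto
      then have "a * badc (T k) \<le> a * badc (T k + m)" using a(1) by simp
      moreover have "bads (T k) \<le> bads (T k + m)" unfolding bads_def using lnorm by (intro sum_mono2) auto
      then have "s * bads (T k) \<le> s * bads (T k + m)" using s by simp
      moreover have "V k = v - s * M1" using True by (simp add: V_def)
      ultimately show ?thesis using Suc a(2) unfolding T by (simp add: algebra_simps)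
    next
      case False
      then have T: "T (Suc k) = Suc (T k)" by (simp add: TS)
      have "badc (Suc (T k)) = badc (T k) + 1" "bads (Suc (T k)) = bads (T k) + ln (norm_D (F (Suc (T k))))"
        using False by (simp_all add: badc_def bads_def)
      then show ?thesis using Suc False unfolding T by (simp add: V_def algebra_simps)
    qed
  qed
  have T_ge: "k \<le> T k" for k
  proof (induction k)
    case (Suc k)
    then show ?case using T_less[of k] by simp
  qed simp
  have Tinf: "filterlim T at_top sequentially"
    by (rule filterlim_at_top_mono[OF filterlim_ident]) (simp add: T_ge)
  have "eventually (\<lambda>n. a / 4 * real n \<le> a * (real n - badc n) - s * bads n) sequentially"
    using bad1 bad2
  proof eventually_elim
    case (elim n)
    have "a * badc n \<le> a * (real n / 2)" using elim(1) a(1) unfolding badc_def by (intro mult_left_mono) auto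
    then show ?case using elim(2) unfolding bads_def by (simp add: algebra_simps)
  qed
  then have "eventually (\<lambda>k. a / 4 * real (T k) \<le> a * (real (T k) - badc (T k)) - s * bads (T k)) sequentially"
    using Tinf by (rule eventually_compose_filterlim)
  then have "eventually (\<lambda>k. a / 4 * real (T k) \<le> (\<Sum>i<k. V i)) sequentially"
    by eventually_elim (rule order_trans[OF _ sumV])
  then show ?thesis
    using a(1)
    by (intro hausdorff_measure_pos_of_selection[OF F mix, where T = T and p = p and ?r0.0 = branch_scale and s = s
          and sep = sep and Sel = Sel and V = V and \<gamma> = "a / 4"])
       (use T0 T_less s branch_scale(1) sep p Sel in \<open>simp_all\<close>)
qed

end

end

end

section \<open>Averages, expectations and measurable versions\<close>

lemma hausdorff_measure_zero_mono:
  assumes s: "0 \<le> s" "s \<le> s'" and z: "hausdorff_measure s A = 0"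
  shows "hausdorff_measure s' A = 0"
proof -
  have pre0: "hausdorff_premeasure s (min 1 \<rho>) A = 0" if "0 < \<rho>" for \<rho> :: real
  proof -
    have "hausdorff_premeasure s (min 1 \<rho>) A \<le> hausdorff_measure s A"
      unfolding hausdorff_measure_def using that by (intro SUP_upper) auto
    then show ?thesis using z by simp
  qed
  have "hausdorff_premeasure s' \<rho> A \<le> hausdorff_premeasure s (min 1 \<rho>) A" for \<rho> :: real
    unfolding hausdorff_premeasure_def[of s]
  proof (rule Inf_greatest)
    fix c assume "c \<in> {\<Sum>i. diam_pow s (U i) |U. A \<subseteq> (\<Union>i. U i) \<and> (\<forall>i. bounded (U i) \<and> diameter (U i) \<le> min 1 \<rho>)}"
    then obtain U where U: "c = (\<Sum>i. diam_pow s (U i))" "A \<subseteq> (\<Union>i. U i)" "\<And>i. bounded (U i) \<and> diameter (U i) \<le> min 1 \<rho>" by blast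
    have le: "diam_pow s' (U i) \<le> diam_pow s (U i)" for i
    proof -
      have d: "0 \<le> diameter (U i)" "diameter (U i) \<le> 1" using U(3)[of i] by (auto simp: diameter_ge_0)
      have "diameter (U i) powr s' \<le> diameter (U i) powr s" if "s \<noteq> 0"
        using d s that by (intro powr_mono') auto
      moreover have "diameter (U i) powr s' \<le> 1" using d s by (intro powr_le1) auto
      ultimately show ?thesis using s by (auto simp: diam_pow_def intro!: ennreal_leI)
    qed
    have "\<forall>i. bounded (U i) \<and> diameter (U i) \<le> \<rho>" using U(3) by simp
    then have "hausdorff_premeasure s' \<rho> A \<le> (\<Sum>i. diam_pow s' (U i))"
      unfolding hausdorff_premeasure_def using U(2) by (intro Inf_lower) blast
    also have "\<dots> \<le> c" unfolding U(1) by (intro suminf_le le summableI)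
    finally show "hausdorff_premeasure s' \<rho> A \<le> c" .
  qed
  then have "hausdorff_premeasure s' \<rho> A = 0" if "0 < \<rho>" for \<rho> :: real
    using pre0[OF that] by (metis le_zero_eq)
  then show ?thesis unfolding hausdorff_measure_def by simp
qed

text \<open>
  Dropping the first map changes a sum by a bounded amount, which is invisible in averages.
\<close>

lemma liminf_average_le_shift:
  fixes a b :: "nat \<Rightarrow> real"
  assumes le: "\<And>n. c + b n \<le> a (Suc n)"
  shows "liminf (\<lambda>n. ereal (1 / real n * b n)) \<le> liminf (\<lambda>n. ereal (1 / real n * a n))"
  unfolding le_Liminf_iff
proof (intro allI impI)
  fix y assume y: "y < liminf (\<lambda>n. ereal (1 / real n * b n))"
  obtain z2 where z2: "y < ereal z2" "ereal z2 < liminf (\<lambda>n. ereal (1 / real n * b n))" using ereal_dense2[OF y] by blast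
  obtain z1 where z1: "y < ereal z1" "ereal z1 < ereal z2" using ereal_dense2[OF z2(1)] by blast
  have z12: "z1 < z2" using z1 by simp
  have "eventually (\<lambda>n. ereal z2 < ereal (1 / real n * b n)) sequentially"
    by (rule less_LiminfD[OF z2(2)])
  moreover have "eventually (\<lambda>n. (z1 - c) / (z2 - z1) < real n) sequentially"
    using filterlim_real_sequentially by (simp add: filterlim_at_top_dense)
  ultimately have "eventually (\<lambda>n. y < ereal (1 / real (Suc n) * a (Suc n))) sequentially"
    using eventually_gt_at_top[of 0]
  proof eventually_elim
    case (elim n)
    have "z2 * real n < b n" using elim(1,3) by (simp add: field_simps)
    moreover have "z1 - c < (z2 - z1) * real n" using elim(2) z12 by (simp add: field_simps)
    ultimately have "z1 * real (Suc n) < a (Suc n)" using le[of n] by (simp add: algebra_simps)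
    then have "z1 < 1 / real (Suc n) * a (Suc n)" by (simp add: field_simps)
    then show ?case using z1(1) less_trans by (metis less_ereal.simps(1))
  qed
  then show "eventually (\<lambda>n. y < ereal (1 / real n * a n)) sequentially"
    by (simp only: eventually_sequentially_Suc[of "\<lambda>n. y < ereal (1 / real n * a n)"])
qed

lemma liminf_average_ge:
  fixes X :: "nat \<Rightarrow> real"
  assumes "eventually (\<lambda>n. c * real n \<le> X n) sequentially"
  shows "ereal c \<le> liminf (\<lambda>n. ereal (1 / real n * X n))"
proof (rule Liminf_bounded)
  show "eventually (\<lambda>n. ereal c \<le> ereal (1 / real n * X n)) sequentially"
    using assms eventually_gt_at_top[of 0] by eventually_elim (simp add: field_simps)
qed

lemma liminf_average_gt:
  fixes X :: "nat \<Rightarrow> real"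
  assumes "ereal c < liminf (\<lambda>n. ereal (1 / real n * X n))"
  shows "eventually (\<lambda>n. c * real n \<le> X n) sequentially"
  using less_LiminfD[OF assms] eventually_gt_at_top[of 0]
  by eventually_elim (simp add: field_simps)

lemma liminf_average_less:
  fixes X :: "nat \<Rightarrow> real"
  assumes "liminf (\<lambda>n. ereal (1 / real n * X n)) < ereal c"
  shows "frequently (\<lambda>n. X n \<le> c * real n) sequentially"
proof -
  have "\<not> eventually (\<lambda>n. c * real n < X n) sequentially"
  proof
    assume "eventually (\<lambda>n. c * real n < X n) sequentially"
    then have "eventually (\<lambda>n. c * real n \<le> X n) sequentially" by eventually_elim simp
    from liminf_average_ge[OF this] show False using assms by simp
  qed
  then show ?thesis by (simp add: frequently_def not_le)
qed

lemma iter_seq_shift: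
  assumes "\<And>k. 1 \<le> k \<Longrightarrow> G k = F (t + k)"
  shows "iter_seq F (t + a) n = iter_seq G a n"
proof (induction n)
  case (Suc n)
  have "G (a + Suc n) = F (t + a + Suc n)" using assms[of "a + Suc n"] by (simp add: add.assoc)
  then show ?case using Suc by simp
qed simp

lemma pinf_shift:
  assumes G: "\<And>k. 1 \<le> k \<Longrightarrow> G k = F (t + k)"
  shows "pinf s F (t + a) n = pinf s G a n"
proof -
  have i: "iter_seq F (t + a) n = iter_seq G a n" for a n
    by (rule iter_seq_shift) (rule G)
  have "F (t + a + Suc j) = G (a + Suc j)" for j using G[of "a + Suc j"] by (simp add: add.assoc)
  then have "iter_deriv F (t + a) n x = iter_deriv G a n x" for x unfolding iter_deriv_def i by simp
  then show ?thesis unfolding pinf_def psum_def i by simp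
qed

lemma (in prob_space) prob_not_tendsto_0:
  assumes [measurable]: "\<And>n. Measurable.pred M (Q n)"
    and ev: "AE x in M. eventually (\<lambda>n. Q n x) sequentially"
  shows "(\<lambda>n. prob {x \<in> space M. \<not> Q n x}) \<longlonglongrightarrow> 0"
proof -
  have "(\<lambda>n. \<integral>x. indicator {x \<in> space M. \<not> Q n x} x \<partial>M :: real) \<longlonglongrightarrow> (\<integral>x. 0 \<partial>M)"
  proof (rule integral_dominated_convergence[where w = "\<lambda>_. 1"])
    show "AE x in M. (\<lambda>n. indicator {x \<in> space M. \<not> Q n x} x :: real) \<longlonglongrightarrow> 0"
      using ev
    proof (rule AE_mp, intro AE_I2 impI)
      fix x assume "eventually (\<lambda>n. Q n x) sequentially"
      then have "eventually (\<lambda>n. indicator {x \<in> space M. \<not> Q n x} x = (0::real)) sequentially"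
        by eventually_elim simp
      then show "(\<lambda>n. indicator {x \<in> space M. \<not> Q n x} x :: real) \<longlonglongrightarrow> 0" by (rule tendsto_eventually)
    qed
  qed (auto simp: indicator_def)
  then show ?thesis by simp
qed

text \<open>
  Any real random variable is bounded by a constant outside a set of small probability.
\<close>

lemma (in prob_space) prob_tail_small:
  fixes h :: "'a \<Rightarrow> real"
  assumes [measurable]: "h \<in> borel_measurable M" and "0 < \<theta>"
  obtains K where "0 < K" "prob {x \<in> space M. \<not> h x \<le> K} < \<theta>"
proof -
  have "(\<lambda>n. prob {x \<in> space M. \<not> h x \<le> real n}) \<longlonglongrightarrow> 0"
  proof (rule prob_not_tendsto_0)
    show "AE x in M. eventually (\<lambda>n. h x \<le> real n) sequentially"
    proof (rule AE_I2)
      fix x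
      obtain N :: nat where "h x \<le> real N" using real_arch_simple by blast
      then show "eventually (\<lambda>n. h x \<le> real n) sequentially"
        by (intro eventually_sequentiallyI[of N]) (auto intro: order_trans)
    qed
  qed measurable
  then have "eventually (\<lambda>n. prob {x \<in> space M. \<not> h x \<le> real n} < \<theta>) sequentially"
    using assms(2) by (rule order_tendstoD)
  then have "eventually (\<lambda>n. prob {x \<in> space M. \<not> h x \<le> real n} < \<theta> \<and> 0 < n) sequentially"
    using eventually_gt_at_top[of 0] by (rule eventually_conj)
  then obtain n where "prob {x \<in> space M. \<not> h x \<le> real n} < \<theta>" "0 < n" unfolding eventually_sequentially by blast
  then show ?thesis by (intro that[of "real n"]) auto
qed

lemma expect_cong_AE:
  assumes "AE x in M. h x = h' x" shows "expect M h = expect M h'"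
proof -
  have "(\<integral>\<^sup>+x. ennreal (h x) \<partial>M) = (\<integral>\<^sup>+x. ennreal (h' x) \<partial>M)"
    "(\<integral>\<^sup>+x. ennreal (- h x) \<partial>M) = (\<integral>\<^sup>+x. ennreal (- h' x) \<partial>M)"
    using assms by (auto intro!: nn_integral_cong_AE)
  then show ?thesis unfolding expect_def by simp
qed

lemma expect_nonneg:
  assumes "\<And>x. x \<in> space M \<Longrightarrow> 0 \<le> h x" shows "expect M h = enn2ereal (\<integral>\<^sup>+x. ennreal (h x) \<partial>M)"
proof -
  have "(\<integral>\<^sup>+x. ennreal (- h x) \<partial>M) = (\<integral>\<^sup>+x. 0 \<partial>M)"
    using assms by (intro nn_integral_cong) (simp add: ennreal_neg)
  then show ?thesis unfolding expect_def by (simp add: zero_ennreal.rep_eq)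
qed

lemma expect_nonpos:
  assumes "\<And>x. x \<in> space M \<Longrightarrow> h x \<le> 0" shows "expect M h = - enn2ereal (\<integral>\<^sup>+x. ennreal (- h x) \<partial>M)"
proof -
  have "(\<integral>\<^sup>+x. ennreal (h x) \<partial>M) = (\<integral>\<^sup>+x. 0 \<partial>M)"
    using assms by (intro nn_integral_cong) (simp add: ennreal_neg)
  then show ?thesis unfolding expect_def by (simp add: zero_ennreal.rep_eq)
qed

context random_conf
begin

context
  fixes f :: "'w \<Rightarrow> 'a::{complete_space, perfect_space} \<rightharpoonup> 'a"
  assumes f: "f \<in> random_maps M \<Delta> \<beta> \<epsilon>"
begin

lemma ln_pinf_version:
  assumes s: "0 \<le> s"
  shows "\<exists>Y\<in>borel_measurable M. AE x in M. ln (pinf s (orbit_seq T f x) 0 n) = Y x"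
proof (rule measurable_version[OF f, where n = n])
  fix F :: "nat \<Rightarrow> 'a \<rightharpoonup> 'a" and \<eta> :: real assume F: "conf_seq F" and \<eta>: "0 < \<eta>"
  define r where "r = min (\<epsilon> \<Delta>) (\<eta> / (2 * real n * s + 1))"
  have "0 < \<epsilon> \<Delta>" using \<epsilon>_less_iff[of 0 \<Delta>] \<Delta>_pos \<epsilon>_0 by simp
  moreover have d: "0 < 2 * real n * s + 1" using s by (intro add_nonneg_pos mult_nonneg_nonneg) auto
  ultimately have r: "0 < r" "r \<le> \<epsilon> \<Delta>" using \<eta> by (auto simp: r_def)
  have "r * (2 * real n * s + 1) \<le> \<eta>" using d by (simp add: r_def pos_le_divide_eq[symmetric])
  then have small: "2 * r * real n * s < \<eta>" using r by (simp add: algebra_simps)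
  have "\<bar>ln (pinf s G 0 n) - ln (pinf s F 0 n)\<bar> < \<eta>"
    if G: "conf_seq G" and m: "\<forall>k\<in>{1..n}. matched (F k) (G k) r" for G
  proof -
    have FG: "matched (F (Suc k)) (G (Suc k)) r" if "0 \<le> k" "k < 0 + n" for k using m that by simp
    have GF: "matched (G (Suc k)) (F (Suc k)) r" if k: "0 \<le> k" "k < 0 + n" for k
      using matched_sym[OF _ _ FG[OF k]] conf_seqD[OF F, of 0 k] conf_seqD[OF G, of 0 k] by simp
    have "ln (pinf s F 0 n) - 2 * r * real n * s \<le> ln (pinf s G 0 n)"
      by (rule ln_pinf_shadow[OF F G less_imp_le[OF r(1)] r(2) s]) (rule FG)
    moreover have "ln (pinf s G 0 n) - 2 * r * real n * s \<le> ln (pinf s F 0 n)"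
      by (rule ln_pinf_shadow[OF G F less_imp_le[OF r(1)] r(2) s]) (rule GF)
    ultimately show ?thesis using small by linarith
  qed
  then show "\<exists>r>0. \<forall>G. conf_seq G \<longrightarrow> (\<forall>k\<in>{1..n}. matched (F k) (G k) r) \<longrightarrow> \<bar>ln (pinf s G 0 n) - ln (pinf s F 0 n)\<bar> < \<eta>"
    using r by blast
qed

text \<open>
  A one-sided estimate is enough for continuity, because being matched is symmetric.
\<close>

lemma one_map_version:
  fixes \<phi> :: "('a \<rightharpoonup> 'a) \<Rightarrow> real"
  assumes cont: "\<And>\<eta>. 0 < \<eta> \<Longrightarrow> \<exists>r>0. \<forall>g h. g \<in> conf \<longrightarrow> h \<in> conf \<longrightarrow> matched g h r \<longrightarrow> \<phi> g \<le> \<phi> h + \<eta>"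
  shows "\<exists>Y\<in>borel_measurable M. AE x in M. \<phi> (f x) = Y x"
proof -
  have "\<exists>Y\<in>borel_measurable M. AE x in M. \<phi> (orbit_seq T f x 1) = Y x"
  proof (rule measurable_version[OF f, where n = 1])
    fix F :: "nat \<Rightarrow> 'a \<rightharpoonup> 'a" and \<eta> :: real assume F: "conf_seq F" and \<eta>: "0 < \<eta>"
    then obtain r where r: "0 < r" "\<And>g h. g \<in> conf \<Longrightarrow> h \<in> conf \<Longrightarrow> matched g h r \<Longrightarrow> \<phi> g \<le> \<phi> h + \<eta> / 2"
      using cont[of "\<eta> / 2"] by auto
    have "\<bar>\<phi> (G 1) - \<phi> (F 1)\<bar> < \<eta>" if G: "conf_seq G" and m: "\<forall>k\<in>{1..1}. matched (F k) (G k) r" for G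
    proof -
      have FG: "F 1 \<in> conf" "G 1 \<in> conf" using F G by (simp_all add: conf_seq_def)
      have m1: "matched (F 1) (G 1) r" using m by simp
      show ?thesis using r(2)[OF FG m1] r(2)[OF FG(2,1) matched_sym[OF FG m1]] \<eta> by linarith
    qed
    then show "\<exists>r>0. \<forall>G. conf_seq G \<longrightarrow> (\<forall>k\<in>{1..1}. matched (F k) (G k) r) \<longrightarrow> \<bar>\<phi> (G 1) - \<phi> (F 1)\<bar> < \<eta>"
      using r(1) by blast
  qed
  then show ?thesis by (simp add: orbit_seq_def)
qed

lemma norm_D_version: "\<exists>Y\<in>borel_measurable M. AE x in M. ln (norm_D (f x)) = Y x"
  by (rule one_map_version) (use matched_norm_D in blast)

lemma norm_inv_D_version: "\<exists>Y\<in>borel_measurable M. AE x in M. ln (norm_inv_D (f x)) = Y x"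
  by (rule one_map_version) (use matched_norm_inv_D in blast)

lemma dmin_version: "\<exists>Y\<in>borel_measurable M. AE x in M. ln (real (dmin (f x))) = Y x"
  by (rule one_map_version) (intro exI[of _ "1::real"], simp add: matched_dmin)

lemma dmax_version: "\<exists>Y\<in>borel_measurable M. AE x in M. ln (real (dmax (f x))) = Y x"
  by (rule one_map_version) (intro exI[of _ "1::real"], simp add: matched_dmax)

lemma gap_version: "\<exists>Y\<in>borel_measurable M. AE x in M. gap (f x) = Y x"
proof (rule one_map_version)
  fix \<eta> :: real assume \<eta>: "0 < \<eta>"
  have "0 < \<beta> / (\<beta> - 1) * (\<eta> / 2)" using \<eta> \<beta>_gt_1 by simp
  then have "0 < \<epsilon> (\<beta> / (\<beta> - 1) * (\<eta> / 2))" using \<epsilon>_less_iff[of 0 "\<beta> / (\<beta> - 1) * (\<eta> / 2)"] \<epsilon>_0 by simp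
  moreover have "gap g \<le> gap h + \<eta>" if "g \<in> conf" "h \<in> conf" "matched g h (\<epsilon> (\<beta> / (\<beta> - 1) * (\<eta> / 2)))" for g h :: "'a \<rightharpoonup> 'a"
    using matched_gap[OF that] \<eta> by simp
  ultimately show "\<exists>r>0. \<forall>g h :: 'a \<rightharpoonup> 'a. g \<in> conf \<longrightarrow> h \<in> conf \<longrightarrow> matched g h r \<longrightarrow> gap g \<le> gap h + \<eta>" by blast
qed

end

end

section \<open>The random repeller\<close>

text \<open>
  The homogeneity radius is a parameter of the locale, so that two random maps on the same space
  can be compared.
\<close>

locale random_repeller = random_conf M T \<Delta> \<beta> \<epsilon> for M :: "'w measure" and T \<Delta> \<beta> \<epsilon> +
  fixes f :: "'w \<Rightarrow> 'a::{complete_space, perfect_space} \<rightharpoonup> 'a" and n0 :: nat and \<delta> :: real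
  assumes f: "f \<in> random_maps M \<Delta> \<beta> \<epsilon>"
    and mix: "AE x in M. mixing n0 \<Delta> (orbit_seq T f x)"
    and norm_fin: "expect M (\<lambda>x. ln (norm_D (f x))) < \<infinity>"
    and \<delta>: "0 < \<delta>" "\<delta> < \<Delta>" and homog: "\<And>y::'a. ball y \<Delta> - ball y \<delta> \<noteq> {}"
begin

abbreviation orbit where "orbit x \<equiv> orbit_seq T f x"

definition X :: "real \<Rightarrow> nat \<Rightarrow> 'w \<Rightarrow> real" where "X s n x = ln (pinf s (orbit x) 0 n)"

definition L :: "'w \<Rightarrow> real" where "L x = ln (norm_D (f x))"

text \<open>
  The quantities of the proof are defined pointwise and need not be measurable; a measurable
  function that agrees with one almost surely is chosen once and for all.
\<close>

definition version :: "('w \<Rightarrow> real) \<Rightarrow> 'w \<Rightarrow> real" where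
  "version h = (SOME Y. Y \<in> borel_measurable M \<and> (AE x in M. h x = Y x))"

lemma version:
  assumes "\<exists>Y\<in>borel_measurable M. AE x in M. h x = Y x"
  shows "version h \<in> borel_measurable M" "AE x in M. h x = version h x"
proof -
  have "\<exists>Y. Y \<in> borel_measurable M \<and> (AE x in M. h x = Y x)" using assms by blast
  from someI_ex[OF this] show "version h \<in> borel_measurable M" "AE x in M. h x = version h x"
    unfolding version_def by simp_all
qed

lemma conf_f: "x \<in> space M \<Longrightarrow> f x \<in> conf"
  by (rule random_map_conf[OF f])

lemma conf_seq_orbit: "x \<in> space M \<Longrightarrow> conf_seq (orbit x)"
  by (rule orbit_conf_seq[OF f])

lemma orbit_Suc: "orbit x (t + Suc j) = f ((T ^^ (t + j)) x)"
  by (simp add: orbit_seq_def)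

lemma X_version: "0 \<le> s \<Longrightarrow> version (X s n) \<in> borel_measurable M \<and> (AE x in M. X s n x = version (X s n) x)"
  using version[OF ln_pinf_version[OF f, of s n, folded X_def]] by simp

lemma L_version: "version L \<in> borel_measurable M" "AE x in M. L x = version L x"
  using version[OF norm_D_version[OF f, folded L_def]] by simp_all

lemma L_ge: "x \<in> space M \<Longrightarrow> ln \<beta> \<le> L x"
  unfolding L_def using norm_D_ge_\<beta>[OF conf_f, of x] \<beta>_gt_1 by simp

lemma L_nonneg: "x \<in> space M \<Longrightarrow> 0 \<le> L x"
  using L_ge[of x] \<beta>_gt_1 ln_gt_zero[of \<beta>] by linarith

text \<open>
  The truncation makes the version nonnegative everywhere and not only almost everywhere.
\<close>

definition Lm :: "'w \<Rightarrow> real" where "Lm x = max 0 (version L x)"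

lemma Lm_measurable [measurable]: "Lm \<in> borel_measurable M"
  unfolding Lm_def using L_version(1) by measurable

lemma Lm_nonneg: "0 \<le> Lm x"
  by (simp add: Lm_def)

lemma L_eq_Lm: "AE x in M. L x = Lm x"
  using L_version(2) AE_space
proof eventually_elim
  case (elim x)
  then show ?case using L_nonneg[of x] by (simp add: Lm_def)
qed

lemma Lm_integrable: "integrable M Lm"
proof (rule integrableI_nonneg)
  have "enn2ereal (\<integral>\<^sup>+x. ennreal (L x) \<partial>M) < \<infinity>"
    using norm_fin expect_nonneg[of M L] L_nonneg unfolding L_def by simp
  then have "(\<integral>\<^sup>+x. ennreal (L x) \<partial>M) < \<infinity>"
    by (metis enn2ereal_top infinity_ennreal_def less_ennreal.rep_eq)
  also have "(\<integral>\<^sup>+x. ennreal (L x) \<partial>M) = (\<integral>\<^sup>+x. ennreal (Lm x) \<partial>M)"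
    using L_eq_Lm by (intro nn_integral_cong_AE) auto
  finally show "(\<integral>\<^sup>+x. ennreal (Lm x) \<partial>M) < \<infinity>" .
qed (auto simp: Lm_nonneg)

lemma expect_L: "expect M L = ereal (\<integral>x. Lm x \<partial>M)"
proof -
  have "expect M L = expect M Lm" by (rule expect_cong_AE[OF L_eq_Lm])
  also have "\<dots> = enn2ereal (\<integral>\<^sup>+x. ennreal (Lm x) \<partial>M)" by (rule expect_nonneg) (rule Lm_nonneg)
  also have "(\<integral>\<^sup>+x. ennreal (Lm x) \<partial>M) = ennreal (\<integral>x. Lm x \<partial>M)"
    by (rule nn_integral_eq_integral[OF Lm_integrable]) (simp add: Lm_nonneg)
  finally show ?thesis by (simp add: integral_nonneg_AE Lm_nonneg)
qed

lemma integral_L_pos: "0 < (\<integral>x. Lm x \<partial>M)"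
proof -
  have "AE x in M. ln \<beta> \<le> Lm x"
    using L_eq_Lm AE_space by eventually_elim (use L_ge in fastforce)
  then have "(\<integral>x. ln \<beta> \<partial>M) \<le> (\<integral>x. Lm x \<partial>M)"
    by (intro integral_mono_AE Lm_integrable) auto
  then show ?thesis using \<beta>_gt_1 by (simp add: prob_space less_le_trans[OF ln_gt_zero])
qed

lemma log_norm_sum_orbit: "log_norm_sum (orbit x) t n = (\<Sum>j<n. L ((T ^^ (t + j)) x))"
  unfolding log_norm_sum_def L_def orbit_Suc ..

lemma pinf_orbit_shift: "pinf s (orbit x) t n = pinf s (orbit ((T ^^ t) x)) 0 n"
  using pinf_shift[of "orbit ((T ^^ t) x)" "orbit x" t s 0 n] orbit_seq_shift[OF f] by simp

lemma X_superadd: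
  assumes "x \<in> space M" "0 \<le> s"
  shows "X s m x + X s n ((T ^^ m) x) \<le> X s (m + n) x"
  using ln_pinf_superadd[OF conf_seq_orbit[OF assms(1)] assms(2), of 0 m n] pinf_orbit_shift[of s x m n] by (simp add: X_def)

lemma X_mixing:
  assumes x: "x \<in> space M" "mixing n0 \<Delta> (orbit x)" and s: "0 \<le> s" and b: "n0 \<le> b"
  shows "X s (a + b) x \<le> X s (a + n0) x + s * (\<Sum>j<n0. L ((T ^^ (a + j)) x)) + s * distortion_sum a + X s b ((T ^^ a) x)"
  using ln_pinf_mixing[OF conf_seq_orbit[OF x(1)] x(2) s b, of 0 a] pinf_orbit_shift[of s x a b]
  by (simp add: X_def log_norm_sum_orbit)

lemma X_ge: "x \<in> space M \<Longrightarrow> 0 \<le> s \<Longrightarrow> - (s * (\<Sum>j<n. L ((T ^^ j) x))) \<le> X s n x"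
  using ln_pinf_ge[OF conf_seq_orbit, of x s 0 n] by (simp add: X_def log_norm_sum_orbit)

lemma X_shift_exponent:
  assumes "x \<in> space M" "0 \<le> s" "0 \<le> h"
  shows "X (s + h) n x \<le> X s n x - h * (real n * ln \<beta>)"
    and "X s n x - h * (\<Sum>j<n. L ((T ^^ j) x)) \<le> X (s + h) n x"
  using ln_pinf_exponent_shift[OF conf_seq_orbit[OF assms(1)] assms(2,3), of 0 n] by (simp_all add: X_def log_norm_sum_orbit)

lemma L_sum_eq: "AE x in M. \<forall>n. (\<Sum>j<n. L ((T ^^ j) x)) = birkhoff_sum Lm n x"
  using AE_all_shifts[OF L_eq_Lm] by (rule AE_mp) (auto simp: birkhoff_sum_def)

lemma pressure_exists:
  assumes s: "0 \<le> s" shows "\<exists>c. AE x in M. lower_pressure s (orbit x) = c"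
proof -
  define h where "h = (\<lambda>x. liminf (\<lambda>n. ereal (1 / real n * version (X s n) x)))"
  have [measurable]: "version (X s n) \<in> borel_measurable M" for n using X_version[OF s] by blast
  have hm: "h \<in> borel_measurable M" unfolding h_def by measurable
  have "AE x in M. \<forall>n. X s n x = version (X s n) x"
    unfolding AE_all_countable using X_version[OF s] by blast
  then have eq: "AE x in M. lower_pressure s (orbit x) = h x" using AE_space
  proof eventually_elim
    case (elim x)
    then show ?case unfolding lower_pressure_eq[OF conf_seq_orbit[OF elim(2)]] h_def X_def[symmetric] by simp
  qed
  have "AE x in M. lower_pressure s (orbit ((T ^^ 1) x)) = h ((T ^^ 1) x)" by (rule AE_shift[OF eq])
  then have "AE x in M. h (T x) \<le> h x" using eq AE_space
  proof eventually_elim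
    case (elim x)
    have Tx: "T x \<in> space M" using funpow_T_space[OF elim(3), of 1] by simp
    have "lower_pressure s (orbit (T x)) \<le> lower_pressure s (orbit x)"
      unfolding lower_pressure_eq[OF conf_seq_orbit[OF elim(3)]] lower_pressure_eq[OF conf_seq_orbit[OF Tx]] X_def[symmetric]
      by (rule liminf_average_le_shift[where c = "X s 1 x"]) (use X_superadd[OF elim(3) s, of 1] in simp)
    then show ?case using elim by simp
  qed
  then obtain c where "AE x in M. h x = c" by (rule subinvariant_AE_const[OF hm])
  with eq have "AE x in M. lower_pressure s (orbit x) = c" by eventually_elim simp
  then show ?thesis by blast
qed

definition P :: "real \<Rightarrow> ereal" where "P s = (SOME c. AE x in M. lower_pressure s (orbit x) = c)"

lemma P_AE: "0 \<le> s \<Longrightarrow> AE x in M. lower_pressure s (orbit x) = P s"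
  unfolding P_def by (rule someI_ex[OF pressure_exists])

lemma P_AE_X: "0 \<le> s \<Longrightarrow> AE x in M. liminf (\<lambda>n. ereal (1 / real n * X s n x)) = P s"
  using P_AE[of s] AE_space by (auto simp: X_def lower_pressure_eq[OF conf_seq_orbit] elim!: eventually_elim2)

lemma P_ge:
  assumes s: "0 \<le> s" and "AE x in M. eventually (\<lambda>n. c * real n \<le> X s n x) sequentially"
  shows "ereal c \<le> P s"
proof -
  have "AE x in M. ereal c \<le> P s"
    using P_AE_X[OF s] assms(2) by eventually_elim (use liminf_average_ge in metis)
  then show ?thesis by simp
qed

lemma P_gt:
  assumes s: "0 \<le> s" and "ereal c < P s"
  shows "AE x in M. eventually (\<lambda>n. c * real n \<le> X s n x) sequentially"
  using P_AE_X[OF s] by eventually_elim (use assms(2) liminf_average_gt in metis)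

text \<open>
  The slope of the pressure is at most \<open>- ln \<beta>\<close>, stated with a real lower
  bound \<open>c\<close> because \<open>P\<close> may be infinite.
\<close>

lemma P_exponent_upper:
  assumes s: "0 \<le> s" and h: "0 \<le> h" and c: "ereal c < P (s + h)"
  shows "ereal (c + h * ln \<beta>) \<le> P s"
proof (rule P_ge[OF s])
  have "0 \<le> s + h" using s h by simp
  from P_gt[OF this c] show "AE x in M. eventually (\<lambda>n. (c + h * ln \<beta>) * real n \<le> X s n x) sequentially"
    using AE_space
  proof eventually_elim
    case (elim x)
    from elim(1) show ?case
    proof (rule eventually_mono)
      fix n assume "c * real n \<le> X (s + h) n x"
      then show "(c + h * ln \<beta>) * real n \<le> X s n x"
        using X_shift_exponent(1)[OF elim(2) s h, of n] by (simp add: algebra_simps)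
    qed
  qed
qed

lemma L_sum_upper:
  assumes "(\<integral>x. Lm x \<partial>M) < c"
  shows "AE x in M. eventually (\<lambda>n. (\<Sum>j<n. L ((T ^^ j) x)) \<le> c * real n) sequentially"
  using birkhoff_sum_upper[OF Lm_integrable assms] L_sum_eq by eventually_elim simp

lemma P_exponent_lower:
  assumes s: "0 \<le> s" and h: "0 \<le> h" and c: "ereal c < P s" and l: "(\<integral>x. Lm x \<partial>M) < l"
  shows "ereal (c - h * l) \<le> P (s + h)"
proof (rule P_ge)
  show "AE x in M. eventually (\<lambda>n. (c - h * l) * real n \<le> X (s + h) n x) sequentially"
    using P_gt[OF s c] L_sum_upper[OF l] AE_space
  proof eventually_elim
    case (elim x)
    from elim(1,2) show ?case
    proof eventually_elim
      case (elim n)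
      have "h * (\<Sum>j<n. L ((T ^^ j) x)) \<le> h * (l * real n)" using elim(2) h by (rule mult_left_mono)
      then show ?case using X_shift_exponent(2)[OF \<open>x \<in> space M\<close> s h, of n] elim(1) by (simp add: algebra_simps)
    qed
  qed
qed (use s h in simp)

lemma P_antimono:
  assumes "0 \<le> s" "s \<le> s'" shows "P s' \<le> P s"
proof (rule ccontr)
  assume "\<not> P s' \<le> P s"
  then have "P s < P s'" by simp
  then obtain c where c: "P s < ereal c" "ereal c < P s'" using ereal_dense2 by blast
  have "ereal (c + (s' - s) * ln \<beta>) \<le> P s"
    by (rule P_exponent_upper[OF assms(1)]) (use assms c(2) in simp_all)
  moreover have "ereal c \<le> ereal (c + (s' - s) * ln \<beta>)" using assms \<beta>_gt_1 by simp
  ultimately show False using c(1) by (meson leD order_trans)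
qed

lemma P_le:
  assumes s: "0 \<le> s" and up: "AE x in M. eventually (\<lambda>n. X s n x \<le> c * real n) sequentially"
  shows "P s \<le> ereal c"
proof (rule ccontr)
  assume "\<not> P s \<le> ereal c"
  then obtain c' where c': "ereal c < ereal c'" "ereal c' < P s" using ereal_dense2 not_le by meson
  have "AE x in M. False"
    using up P_gt[OF s c'(2)]
  proof eventually_elim
    case (elim x)
    then have "eventually (\<lambda>n. c' * real n \<le> c * real n \<and> 0 < n) sequentially"
      using eventually_gt_at_top[of 0] by eventually_elim (intro conjI; linarith)
    then obtain n where "c' * real n \<le> c * real n" "0 < n" unfolding eventually_sequentially by blast
    then show ?case using c'(1) by simp
  qed
  then show False by simp
qed

lemma X_0_nonneg: "x \<in> space M \<Longrightarrow> 0 \<le> X 0 n x"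
  using X_ge[of x 0 n] by simp

lemma P_0_nonneg: "0 \<le> P 0"
proof -
  have "ereal 0 \<le> P 0"
    by (rule P_ge) (use X_0_nonneg in \<open>auto intro!: AE_I2\<close>)
  then show ?thesis by (simp add: zero_ereal_def)
qed

lemma X_le_X_0: "x \<in> space M \<Longrightarrow> 0 \<le> s \<Longrightarrow> X s n x \<le> X 0 n x"
proof -
  assume x: "x \<in> space M" and s: "0 \<le> s"
  have "0 \<le> s * (real n * ln \<beta>)" using s \<beta>_gt_1 by (intro mult_nonneg_nonneg) auto
  then show ?thesis using X_shift_exponent(1)[OF x order_refl s, of n] by simp
qed

lemma X_0_mono: "x \<in> space M \<Longrightarrow> X 0 n x \<le> X 0 (n + m) x"
  using X_superadd[of x 0 n m] X_0_nonneg[OF funpow_T_space[of x n], of m] by simp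

text \<open>
  By superadditivity the term at time \<open>n\<close> is at most \<open>X 0 (n + m) - X 0
  n\<close>. The sum telescopes to at most \<open>m\<close> terms \<open>X 0 (n + j)\<close>
  with \<open>j < m\<close>, and monotonicity replaces each of them by the largest one.
\<close>

lemma X_0_telescope: "x \<in> space M \<Longrightarrow> (\<Sum>t<n. X 0 m ((T ^^ t) x)) \<le> real m * X 0 (n + m) x"
proof -
  assume x: "x \<in> space M"
  have "(\<Sum>t<n. X 0 m ((T ^^ t) x)) \<le> (\<Sum>j<m. X 0 (n + j) x)"
  proof (induction n)
    case 0
    then show ?case using X_0_nonneg[OF x] by (simp add: sum_nonneg)
  next
    case (Suc n)
    have "X 0 n x + X 0 m ((T ^^ n) x) \<le> X 0 (n + m) x" by (rule X_superadd[OF x order_refl])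
    moreover have "(\<Sum>j<m. X 0 (Suc n + j) x) = (\<Sum>j<m. X 0 (n + j) x) + X 0 (n + m) x - X 0 n x"
      by (induction m) auto
    ultimately show ?case using Suc by simp
  qed
  also have "\<dots> \<le> (\<Sum>j<m. X 0 (n + m) x)"
  proof (rule sum_mono)
    fix j assume "j \<in> {..<m}"
    then show "X 0 (n + j) x \<le> X 0 (n + m) x" using X_0_mono[OF x, of "n + j" "m - j"] by simp
  qed
  finally show ?thesis by simp
qed

text \<open>
  If some \<open>X 0 m\<close> had infinite mean, its Birkhoff averages would tend to infinity,
  and by \<open>X_0_telescope\<close> so would \<open>X 0 n / n\<close>.
\<close>

lemma X_0_integrable:
  assumes fin: "P 0 < \<infinity>"
  shows "integrable M (version (X 0 m))"
proof -
  have meas[measurable]: "version (X 0 k) \<in> borel_measurable M" for k using X_version[of 0] by simp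
  have eq: "AE x in M. X 0 k x = version (X 0 k) x" for k using X_version[of 0] by simp
  \<comment> \<open>a positive length, so that one may divide by it\<close>
  let ?m = "Suc m"
  define \<phi> where "\<phi> = (\<lambda>x. max 0 (version (X 0 ?m) x))"
  have [measurable]: "\<phi> \<in> borel_measurable M" unfolding \<phi>_def by measurable
  have \<phi>: "AE x in M. X 0 ?m x = \<phi> x"
    using eq[of ?m] AE_space
  proof eventually_elim
    case (elim x)
    then show ?case using X_0_nonneg[OF elim(2), of ?m] by (simp add: \<phi>_def)
  qed
  have "(\<integral>\<^sup>+x. ennreal (\<phi> x) \<partial>M) < \<infinity>"
  proof (rule ccontr)
    assume "\<not> (\<integral>\<^sup>+x. ennreal (\<phi> x) \<partial>M) < \<infinity>"
    then have inf: "enn2ereal (\<integral>\<^sup>+x. ennreal (\<phi> x) \<partial>M) = \<infinity>" by (simp add: not_less top_unique)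
    obtain z where z: "P 0 < ereal z" using ereal_dense2[OF fin] by blast
    have "0 < z" using z P_0_nonneg by (metis ereal_less(2) le_less_trans)
    let ?c = "real ?m * (z + 1)"
    have "AE x in M. eventually (\<lambda>n. ?c * real n \<le> birkhoff_sum \<phi> n x) sequentially"
    proof (rule birkhoff_sum_lower_nonneg)
      show "ereal ?c < enn2ereal (\<integral>\<^sup>+x. ennreal (\<phi> x) \<partial>M)" unfolding inf by simp
    qed (simp_all add: \<phi>_def)
    moreover have "AE x in M. \<forall>t. X 0 ?m ((T ^^ t) x) = \<phi> ((T ^^ t) x)" by (rule AE_all_shifts[OF \<phi>])
    ultimately have "AE x in M. eventually (\<lambda>n. z * real n \<le> X 0 n x) sequentially"
      using AE_space
    proof eventually_elim
      case (elim x)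
      note x = elim(3)
      obtain K :: nat where K: "(z + 1) * real ?m \<le> real K" using real_arch_simple by blast
      have "eventually (\<lambda>n. z * real (n + ?m) \<le> X 0 (n + ?m) x) sequentially"
        using elim(1) eventually_ge_at_top[of K]
      proof eventually_elim
        case (elim n)
        have "?c * real n \<le> (\<Sum>t<n. X 0 ?m ((T ^^ t) x))"
          using elim(1) \<open>\<forall>t. X 0 ?m ((T ^^ t) x) = \<phi> ((T ^^ t) x)\<close> by (simp add: birkhoff_sum_def)
        also have "\<dots> \<le> real ?m * X 0 (n + ?m) x" by (rule X_0_telescope[OF x])
        finally have "real ?m * ((z + 1) * real n) \<le> real ?m * X 0 (n + ?m) x" by (simp only: mult.assoc)
        then have "(z + 1) * real n \<le> X 0 (n + ?m) x" by (rule mult_left_le_imp_le) simp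
        moreover have "(z + 1) * real ?m \<le> real n" using K elim(2) by linarith
        then have "z * real (n + ?m) \<le> (z + 1) * real n" by (simp add: algebra_simps)
        ultimately show ?case by linarith
      qed
      then show ?case by (rule eventually_sequentially_seg[THEN iffD1])
    qed
    then have "ereal z \<le> P 0" by (rule P_ge[OF order_refl])
    with z show False by simp
  qed
  then have int: "integrable M \<phi>" by (intro integrableI_nonneg) (auto simp: \<phi>_def)
  show ?thesis
  proof (rule Bochner_Integration.integrable_bound[OF int meas])
    show "AE x in M. norm (version (X 0 m) x) \<le> norm (\<phi> x)"
      using eq[of m] \<phi> AE_space
    proof eventually_elim
      case (elim x)
      then show ?case using X_0_mono[of x m 1] X_0_nonneg[of x m] by simp
    qed
  qed
qed

lemma Lm_over_n: "AE x in M. \<forall>j. (\<lambda>n. Lm ((T ^^ (n + j)) x) / real n) \<longlonglongrightarrow> 0"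
  using shift_over_n_tendsto_0[OF Lm_integrable]
proof (rule AE_mp, intro AE_I2 impI allI)
  fix x j assume lim: "(\<lambda>n. Lm ((T ^^ n) x) / real n) \<longlonglongrightarrow> 0"
  have "(\<lambda>n. real (n + j) / real n) \<longlonglongrightarrow> 1" by real_asymp
  with LIMSEQ_ignore_initial_segment[OF lim, of j]
  have "(\<lambda>n. Lm ((T ^^ (n + j)) x) / real (n + j) * (real (n + j) / real n)) \<longlonglongrightarrow> 0 * 1" by (rule tendsto_mult)
  moreover have "eventually (\<lambda>n. Lm ((T ^^ (n + j)) x) / real (n + j) * (real (n + j) / real n) = Lm ((T ^^ (n + j)) x) / real n) sequentially"
    using eventually_gt_at_top[of 0] by eventually_elim simp
  ultimately show "(\<lambda>n. Lm ((T ^^ (n + j)) x) / real n) \<longlonglongrightarrow> 0" using Lim_transform_eventually by fastforce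
qed

text \<open>
  The lower limit is a limit: if it is below \<open>c\<close>, the sums are below \<open>c *
  n\<close> for all large \<open>n\<close> and not only for infinitely many. The correction in
  \<open>subadditive_upper\<close> is the cost of mixing, \<open>s\<close> times a norm sum over
  \<open>n0\<close> maps plus distortion. It is \<open>o(a)\<close>, so at the infinitely many
  times when \<open>X\<close> is small it is compensated by the margin between the intermediate
  rates \<open>c1 < c2 < c\<close>.
\<close>

lemma P_lt:
  assumes s: "0 \<le> s" and fin: "P 0 < \<infinity>" and c: "P s < ereal c"
  shows "AE x in M. eventually (\<lambda>n. X s n x \<le> c * real n) sequentially"
proof -
  obtain c2 where c2: "P s < ereal c2" "ereal c2 < ereal c" using ereal_dense2[OF c] by blast
  obtain c1 where c1: "P s < ereal c1" "ereal c1 < ereal c2" using ereal_dense2[OF c2(1)] by blast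
  have c12: "c1 < c2" "c2 < c" using c1 c2 by auto
  have meas[measurable]: "version (X s n) \<in> borel_measurable M" for n using X_version[OF s] by blast
  have eq: "AE x in M. \<forall>n. X s n x = version (X s n) x"
    unfolding AE_all_countable using X_version[OF s] by blast
  have eq0: "AE x in M. \<forall>n. X 0 n x = version (X 0 n) x"
    unfolding AE_all_countable using X_version[of 0] by simp
  define Y where "Y = (\<lambda>n x. version (X s n) x - c2 * real n)"
  define Z where "Z = (\<lambda>a x. version (X s (a + n0)) x + s * (\<Sum>j<n0. Lm ((T ^^ (a + j)) x)) + s * distortion_sum a - c2 * real a)"
  have [measurable]: "(\<lambda>x. Lm ((T ^^ k) x)) \<in> borel_measurable M" for k
    by (rule measurable_compose[OF funpow_T_measurable Lm_measurable])
  have "AE x in M. eventually (\<lambda>n. Y n x \<le> (c - c2) * real n) sequentially"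
  proof (rule subadditive_upper[where Z = Z and ?n0.0 = n0])
    show "Y n \<in> borel_measurable M" for n unfolding Y_def by measurable
    show "Z n \<in> borel_measurable M" for n unfolding Z_def by measurable
    show "integrable M (\<lambda>x. max 0 (Y n x))" for n
    proof (rule Bochner_Integration.integrable_bound)
      show "integrable M (\<lambda>x. \<bar>version (X 0 n) x\<bar> + \<bar>c2\<bar> * real n)" using X_0_integrable[OF fin] by simp
      show "AE x in M. norm (max 0 (Y n x)) \<le> norm (\<bar>version (X 0 n) x\<bar> + \<bar>c2\<bar> * real n)"
        using eq eq0 AE_space
      proof eventually_elim
        case (elim x)
        have "X s n x \<le> X 0 n x" by (rule X_le_X_0[OF elim(3) s])
        moreover have "- (c2 * real n) \<le> \<bar>c2\<bar> * real n" by (metis abs_ge_minus_self abs_mult abs_of_nat)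
        ultimately show ?case using elim(1,2) by (simp add: Y_def)
      qed
    qed (simp add: Y_def)
    show "integrable M (\<lambda>x. max 0 (Z 1 x))"
    proof (rule Bochner_Integration.integrable_bound)
      show "integrable M (\<lambda>x. \<bar>version (X 0 (1 + n0)) x\<bar> + s * (\<Sum>j<n0. Lm ((T ^^ (1 + j)) x)) + (s * distortion_sum 1 + \<bar>c2\<bar>))"
        by (intro Bochner_Integration.integrable_add integrable_abs Bochner_Integration.integrable_mult_right
            Bochner_Integration.integrable_sum X_0_integrable[OF fin] integrable_shift[OF Lm_integrable] integrable_const)
      show "AE x in M. norm (max 0 (Z 1 x)) \<le> norm (\<bar>version (X 0 (1 + n0)) x\<bar> + s * (\<Sum>j<n0. Lm ((T ^^ (1 + j)) x)) + (s * distortion_sum 1 + \<bar>c2\<bar>))"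
        using eq eq0 AE_space
      proof eventually_elim
        case (elim x)
        have "X s (1 + n0) x \<le> X 0 (1 + n0) x" by (rule X_le_X_0[OF elim(3) s])
        moreover have "0 \<le> s * (\<Sum>j<n0. Lm ((T ^^ (1 + j)) x))" using s Lm_nonneg by (intro mult_nonneg_nonneg sum_nonneg) auto
        moreover have "0 \<le> s * distortion_sum 1" using s distortion_sum_nonneg by (intro mult_nonneg_nonneg)
        moreover have "version (X s (1 + n0)) x = X s (1 + n0) x" by (rule sym) (rule elim(1)[THEN spec])
        moreover have "version (X 0 (1 + n0)) x = X 0 (1 + n0) x" by (rule sym) (rule elim(2)[THEN spec])
        ultimately show ?case unfolding Z_def real_norm_def by (simp only: of_nat_1 mult_1_right)
      qed
    qed (simp add: Z_def)
    have Ls: "AE x in M. \<forall>k. L ((T ^^ k) x) = Lm ((T ^^ k) x)" by (rule AE_all_shifts[OF L_eq_Lm])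
    have eqs: "AE x in M. \<forall>k. \<forall>n. X s n ((T ^^ k) x) = version (X s n) ((T ^^ k) x)" by (rule AE_all_shifts[OF eq])
    show "AE x in M. \<forall>a b. 1 \<le> a \<longrightarrow> n0 \<le> b \<longrightarrow> Y (a + b) x \<le> Z a x + Y b ((T ^^ a) x)"
      using mix Ls eqs eq AE_space
    proof eventually_elim
      case (elim x)
      show ?case
      proof (intro allI impI)
        fix a b :: nat assume "1 \<le> a" and b: "n0 \<le> b"
        have v: "version (X s (a + b)) x = X s (a + b) x" "version (X s (a + n0)) x = X s (a + n0) x"
          "version (X s b) ((T ^^ a) x) = X s b ((T ^^ a) x)" using elim(3,4) by simp_all
        have l: "(\<Sum>j<n0. Lm ((T ^^ (a + j)) x)) = (\<Sum>j<n0. L ((T ^^ (a + j)) x))" using elim(2) by simp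
        show "Y (a + b) x \<le> Z a x + Y b ((T ^^ a) x)"
          using X_mixing[OF elim(5,1) s b, of a] unfolding Y_def Z_def v l by (simp add: algebra_simps)
      qed
    qed
    show "AE x in M. \<exists>a\<ge>1. Z a x \<le> 0"
      using P_AE_X[OF s] Lm_over_n eq
    proof eventually_elim
      case (elim x)
      have "liminf (\<lambda>n. ereal (1 / real n * X s n x)) < ereal c1" using elim(1) c1(1) by simp
      then have "frequently (\<lambda>n. X s n x \<le> c1 * real n) sequentially" by (rule liminf_average_less)
      then have "frequently (\<lambda>a. X s (a + n0) x \<le> c1 * real (a + n0)) sequentially"
        unfolding frequently_def by (simp only: eventually_sequentially_seg[of "\<lambda>n. \<not> X s n x \<le> c1 * real n" n0] not_False_eq_True)
      moreover have "(\<lambda>a. s * (\<Sum>j<n0. Lm ((T ^^ (a + j)) x) / real a) + s * (distortion_sum a / real a) + c1 * real n0 / real a) \<longlonglongrightarrow> s * (\<Sum>j<n0. 0) + s * 0 + 0"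
        using elim(2) by (intro tendsto_intros distortion_sum_sublinear lim_const_over_n) auto
      then have "eventually (\<lambda>a. s * (\<Sum>j<n0. Lm ((T ^^ (a + j)) x) / real a) + s * (distortion_sum a / real a) + c1 * real n0 / real a < c2 - c1) sequentially"
        using c12 by (intro order_tendstoD(2)) auto
      then have "eventually (\<lambda>a. (X s (a + n0) x \<le> c1 * real (a + n0)) \<longrightarrow> (1 \<le> a \<and> Z a x \<le> 0)) sequentially"
        using eventually_ge_at_top[of 1]
      proof eventually_elim
        case (elim a)
        show ?case
        proof (intro impI conjI)
          assume le: "X s (a + n0) x \<le> c1 * real (a + n0)"
          have "(s * (\<Sum>j<n0. Lm ((T ^^ (a + j)) x) / real a) + s * (distortion_sum a / real a) + c1 * real n0 / real a) * real a \<le> (c2 - c1) * real a"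
            using elim(1) by (intro mult_right_mono) auto
          moreover have "(s * (\<Sum>j<n0. Lm ((T ^^ (a + j)) x) / real a) + s * (distortion_sum a / real a) + c1 * real n0 / real a) * real a
             = s * (\<Sum>j<n0. Lm ((T ^^ (a + j)) x)) + s * distortion_sum a + c1 * real n0"
            using elim(2) by (simp add: distrib_right sum_divide_distrib[symmetric])
          moreover have "version (X s (a + n0)) x = X s (a + n0) x" using \<open>\<forall>n. X s n x = version (X s n) x\<close> by simp
          ultimately show "Z a x \<le> 0" using le unfolding Z_def by (simp add: algebra_simps)
        qed (rule elim(2))
      qed
      ultimately have "frequently (\<lambda>a. 1 \<le> a \<and> Z a x \<le> 0) sequentially" by (rule frequently_rev_mp)
      then show ?case by (auto dest: frequently_ex)
    qed
  qed (use c12 in simp)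
  then show ?thesis using eq
  proof eventually_elim
    case (elim x)
    from elim(1) show ?case
    proof (rule eventually_mono)
      fix n assume "Y n x \<le> (c - c2) * real n"
      then show "X s n x \<le> c * real n" using elim(2) by (simp add: Y_def algebra_simps)
    qed
  qed
qed

definition dim :: ennreal where "dim = (SUP s\<in>{s. 0 \<le> s \<and> P s > 0}. ennreal s)"

lemma le_dim: "0 \<le> s \<Longrightarrow> 0 < P s \<Longrightarrow> ennreal s \<le> dim"
  unfolding dim_def by (intro SUP_upper) simp

text \<open>
  Since \<open>log \<parallel>D\<parallel>\<close> is integrable, the exponent \<open>s\<close>
  reduces the rate of growth by a finite amount only.
\<close>

lemma P_infinite:
  assumes "P 0 = \<infinity>" "0 \<le> s" shows "P s = \<infinity>"
proof (rule ereal_top)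
  fix B
  let ?l = "(\<integral>x. Lm x \<partial>M) + 1"
  have "ereal (B + s * ?l - s * ?l) \<le> P (0 + s)"
    by (rule P_exponent_lower[OF order_refl assms(2)]) (simp_all add: assms(1))
  then show "ereal B \<le> P s" by simp
qed

lemma dim_finite_iff: "dim < \<infinity> \<longleftrightarrow> P 0 < \<infinity>"
proof
  assume d: "dim < \<infinity>"
  show "P 0 < \<infinity>"
  proof (rule ccontr)
    assume "\<not> P 0 < \<infinity>"
    then have "P s = \<infinity>" if "0 \<le> s" for s using P_infinite[OF _ that] by simp
    then have "of_nat n \<le> dim" for n using le_dim[of "real n"] by (simp add: ennreal_of_nat_eq_real_of_nat)
    then have "dim = \<infinity>" by (metis ennreal_Ex_less_of_nat infinity_ennreal_def leD less_top)
    with d show False by simp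
  qed
next
  assume "P 0 < \<infinity>"
  then obtain z where z: "P 0 < ereal z" using ereal_dense2 by blast
  have "dim \<le> ennreal (z / ln \<beta>)"
    unfolding dim_def
  proof (rule SUP_least)
    fix s assume "s \<in> {s. 0 \<le> s \<and> P s > 0}"
    then have s: "0 \<le> s" "ereal 0 < P (0 + s)" by (auto simp: zero_ereal_def)
    have "ereal (0 + s * ln \<beta>) \<le> P 0" by (rule P_exponent_upper[OF order_refl s])
    from le_less_trans[OF this z] have "s * ln \<beta> < z" by simp
    then show "ennreal s \<le> ennreal (z / ln \<beta>)" using \<beta>_gt_1 by (intro ennreal_leI) (simp add: field_simps)
  qed
  then show "dim < \<infinity>" by (simp add: le_less_trans)
qed

text \<open>
  The constants are chosen in this order. The truncation level \<open>C\<close> makes the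
  integral of \<open>L\<close> over \<open>{L > C}\<close> small, and then the admissible
  probability \<open>\<theta>\<close> of bad times makes \<open>C * \<theta>\<close> small;
  together they bound the norm sum over the bad times by \<open>p' / (16 s)\<close> per unit of
  time. Then \<open>M1\<close> bounds the cost of a reset, a block length \<open>k\<close> large
  compared to \<open>M1\<close> makes the partition sum of the block beat this cost, and
  \<open>B\<close> bounds all norms and inverse separation scales in the block. Each of these
  three choices excludes less than \<open>\<theta> / 4\<close>.
\<close>

lemma hausdorff_pos:
  assumes s: "0 < s" and Ps: "0 < P s"
  shows "AE x in M. hausdorff_measure s (repeller (orbit x)) \<noteq> 0"
proof -
  have s0: "0 \<le> s" using s by simp
  obtain p' where p': "0 < p'" "ereal p' < P s" using ereal_dense2[OF Ps] by auto
  note bs = branch_scale[OF \<delta> homog]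
  obtain q where "\<Delta> / branch_scale \<delta> < \<beta> ^ q" using real_arch_pow[OF \<beta>_gt_1] by blast
  then have q: "\<Delta> / \<beta> ^ q < branch_scale \<delta>" using bs(1) \<beta>_gt_1 by (simp add: field_simps)
  define l where "l = q + n0"
  have Xm[measurable]: "version (X s n) \<in> borel_measurable M" for n using X_version[OF s0] by blast
  have [measurable]: "(\<lambda>x. Lm ((T ^^ k) x)) \<in> borel_measurable M" for k
    by (rule measurable_compose[OF funpow_T_measurable Lm_measurable])
  have gapm: "version (\<lambda>x. gap (f x)) \<in> borel_measurable M" "AE x in M. gap (f x) = version (\<lambda>x. gap (f x)) x"
    using version[OF gap_version[OF f]] by simp_all
  define g where "g = (\<lambda>x. max 0 (1 / version (\<lambda>x. gap (f x)) x))"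
  have [measurable]: "g \<in> borel_measurable M" unfolding g_def using gapm(1) by measurable
  have [measurable]: "(\<lambda>x. g ((T ^^ k) x)) \<in> borel_measurable M" for k
    by (rule measurable_compose[OF funpow_T_measurable]) measurable
  have g0: "0 \<le> g x" for x by (simp add: g_def)
  define tail where "tail = (\<lambda>(C::nat) x. Lm x * indicator {x \<in> space M. real C < Lm x} x)"
  have tail_int: "integrable M (tail C)" for C
    by (rule Bochner_Integration.integrable_bound[OF Lm_integrable]) (auto simp: tail_def indicator_def)
  have "(\<lambda>C. \<integral>x. tail C x \<partial>M) \<longlonglongrightarrow> (\<integral>x. 0 \<partial>M)"
  proof (rule integral_dominated_convergence[OF _ _ Lm_integrable])
    show "AE x in M. (\<lambda>C. tail C x) \<longlonglongrightarrow> 0"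
    proof (rule AE_I2)
      fix x
      obtain N :: nat where N: "Lm x \<le> real N" using real_arch_simple by blast
      have "tail C x = 0" if "C \<ge> N" for C
      proof -
        have "\<not> real C < Lm x" using N that by simp
        then show ?thesis by (simp add: tail_def)
      qed
      then show "(\<lambda>C. tail C x) \<longlonglongrightarrow> 0" by (intro tendsto_eventually eventually_sequentiallyI[of N])
    qed
    show "AE x in M. norm (tail C x) \<le> Lm x" for C using Lm_nonneg by (auto simp: tail_def indicator_def)
  qed (auto simp: tail_def)
  then have "eventually (\<lambda>C. (\<integral>x. tail C x \<partial>M) < p' / (32 * s)) sequentially"
    using order_tendstoD(2)[of "\<lambda>C. \<integral>x. tail C x \<partial>M" 0 sequentially "p' / (32 * s)"] p' s by simp
  then obtain C where C: "(\<integral>x. tail C x \<partial>M) < p' / (32 * s)" unfolding eventually_sequentially by blast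
  define \<theta> where "\<theta> = min (1 / 4) (p' / (32 * s * (real C + 1)))"
  have \<theta>: "0 < \<theta>" "\<theta> \<le> 1 / 4" "s * real C * \<theta> \<le> p' / 32"
  proof -
    show "0 < \<theta>" using p' s by (simp add: \<theta>_def)
    show "\<theta> \<le> 1 / 4" by (simp add: \<theta>_def)
    have "s * real C * \<theta> \<le> s * (real C + 1) * (p' / (32 * s * (real C + 1)))"
      using s \<open>0 < \<theta>\<close> by (intro mult_mono) (auto simp: \<theta>_def)
    also have "\<dots> = p' / 32" using s by (simp add: divide_simps)
    finally show "s * real C * \<theta> \<le> p' / 32" .
  qed
  define h1 where "h1 = (\<lambda>x. \<Sum>j<l. Lm ((T ^^ j) x))"
  have [measurable]: "h1 \<in> borel_measurable M" unfolding h1_def by measurable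
  obtain M1 where M1: "0 < M1" "prob {x \<in> space M. \<not> h1 x \<le> M1} < \<theta> / 4"
    by (rule prob_tail_small[of h1 "\<theta> / 4"]) (use \<theta> in auto)
  have "(\<lambda>n. prob {x \<in> space M. \<not> p' * real n \<le> version (X s n) x}) \<longlonglongrightarrow> 0"
  proof (rule prob_not_tendsto_0)
    have "AE x in M. \<forall>n. X s n x = version (X s n) x"
      unfolding AE_all_countable using X_version[OF s0] by blast
    then show "AE x in M. eventually (\<lambda>n. p' * real n \<le> version (X s n) x) sequentially"
      using P_gt[OF s0 p'(2)] by eventually_elim simp
  qed measurable
  then have "eventually (\<lambda>n. prob {x \<in> space M. \<not> p' * real n \<le> version (X s n) x} < \<theta> / 4) sequentially"
    using order_tendstoD(2)[of _ 0 sequentially "\<theta> / 4"] \<theta>(1) by simp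
  moreover have "eventually (\<lambda>n. real l + 2 * s * M1 / p' \<le> real n) sequentially"
    using filterlim_real_sequentially unfolding filterlim_at_top by blast
  ultimately have "eventually (\<lambda>n. prob {x \<in> space M. \<not> p' * real n \<le> version (X s n) x} < \<theta> / 4 \<and> real l + 2 * s * M1 / p' \<le> real n \<and> 1 \<le> n) sequentially"
    using eventually_ge_at_top[of 1] by eventually_elim simp
  then obtain k where k: "prob {x \<in> space M. \<not> p' * real k \<le> version (X s k) x} < \<theta> / 4"
    "real l + 2 * s * M1 / p' \<le> real k" "1 \<le> k" unfolding eventually_sequentially by blast
  define m where "m = l + k"
  \<comment> \<open>net gain of a good block per unit of time, after the reset\<close>
  have am: "p' / 2 * real m \<le> p' * real k - s * M1"
  proof -
    have "p' * (real l + 2 * s * M1 / p') \<le> p' * real k" using k(2) p' by (intro mult_left_mono) auto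
    moreover have "p' * (2 * s * M1 / p') = 2 * (s * M1)" using p'(1) by simp
    ultimately have "p' * real l + 2 * (s * M1) \<le> p' * real k" by (simp only: distrib_left)
    moreover have "p' * real m = p' * real l + p' * real k" by (simp add: m_def distrib_left)
    ultimately show ?thesis by linarith
  qed
  define h2 where "h2 = (\<lambda>x. \<Sum>j<m. Lm ((T ^^ j) x) + g ((T ^^ j) x))"
  have [measurable]: "h2 \<in> borel_measurable M" unfolding h2_def by measurable
  obtain B where B: "0 < B" "prob {x \<in> space M. \<not> h2 x \<le> B} < \<theta> / 4"
    by (rule prob_tail_small[of h2 "\<theta> / 4"]) (use \<theta> in auto)
  have [measurable]: "(\<lambda>x. version (X s k) ((T ^^ l) x)) \<in> borel_measurable M"
    by (rule measurable_compose[OF funpow_T_measurable Xm])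
  define Good where "Good = (\<lambda>x. h1 x \<le> M1 \<and> p' * real k \<le> version (X s k) ((T ^^ l) x) \<and> h2 x \<le> B)"
  have Good_meas[measurable]: "Measurable.pred M Good" unfolding Good_def by measurable
  have bad_prob: "prob {x \<in> space M. \<not> Good x} < \<theta>"
  proof -
    let ?A = "{x \<in> space M. \<not> h1 x \<le> M1}" and ?B = "{x \<in> space M. \<not> p' * real k \<le> version (X s k) ((T ^^ l) x)}"
      and ?C = "{x \<in> space M. \<not> h2 x \<le> B}"
    have "prob ?B = prob {x \<in> space M. \<not> p' * real k \<le> version (X s k) x}"
      by (rule prob_shift[of "\<lambda>x. \<not> p' * real k \<le> version (X s k) x" l]) measurable
    then have PB: "prob ?B < \<theta> / 4" using k(1) by simp
    have "{x \<in> space M. \<not> Good x} = (?A \<union> ?B) \<union> ?C" by (auto simp: Good_def)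
    then have "prob {x \<in> space M. \<not> Good x} \<le> prob (?A \<union> ?B) + prob ?C"
      by (simp add: measure_Un_le)
    also have "prob (?A \<union> ?B) \<le> prob ?A + prob ?B" by (rule measure_Un_le) measurable
    finally show ?thesis using M1(2) PB B(2) \<theta>(1) by linarith
  qed
  define \<phi> where "\<phi> = (\<lambda>x. if Good x then 0 else 1 :: real)"
  have [measurable]: "\<phi> \<in> borel_measurable M" unfolding \<phi>_def by measurable
  have \<phi>_int: "integrable M \<phi>" by (rule integrable_const_bound[of _ 1]) (auto simp: \<phi>_def)
  have "(\<integral>x. \<phi> x \<partial>M) = (\<integral>x. indicator {x \<in> space M. \<not> Good x} x \<partial>M)"
    by (rule Bochner_Integration.integral_cong) (auto simp: \<phi>_def indicator_def)
  then have \<phi>_lt: "(\<integral>x. \<phi> x \<partial>M) < \<theta>" using bad_prob by simp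
  have "AE x in M. \<forall>t. L ((T ^^ t) x) = Lm ((T ^^ t) x)" by (rule AE_all_shifts[OF L_eq_Lm])
  moreover have "AE x in M. \<forall>t. gap (f ((T ^^ t) x)) = version (\<lambda>x. gap (f x)) ((T ^^ t) x)" by (rule AE_all_shifts[OF gapm(2)])
  moreover have "AE x in M. \<forall>t. X s k ((T ^^ t) x) = version (X s k) ((T ^^ t) x)"
    by (rule AE_all_shifts) (use X_version[OF s0] in blast)
  moreover have "AE x in M. eventually (\<lambda>n. birkhoff_sum \<phi> n x \<le> \<theta> * real n) sequentially"
    by (rule birkhoff_sum_upper[OF \<phi>_int \<phi>_lt])
  moreover have "AE x in M. eventually (\<lambda>n. birkhoff_sum (tail C) n x \<le> p' / (32 * s) * real n) sequentially"
    by (rule birkhoff_sum_upper[OF tail_int C])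
  ultimately show ?thesis using mix AE_space
  proof eventually_elim
    fix x
    assume Lx: "\<forall>t. L ((T ^^ t) x) = Lm ((T ^^ t) x)"
      and gx: "\<forall>t. gap (f ((T ^^ t) x)) = version (\<lambda>x. gap (f x)) ((T ^^ t) x)"
      and Xx: "\<forall>t. X s k ((T ^^ t) x) = version (X s k) ((T ^^ t) x)"
      and b1: "eventually (\<lambda>n. birkhoff_sum \<phi> n x \<le> \<theta> * real n) sequentially"
      and b2: "eventually (\<lambda>n. birkhoff_sum (tail C) n x \<le> p' / (32 * s) * real n) sequentially"
      and mx: "mixing n0 \<Delta> (orbit x)" and xs: "x \<in> space M"
    note F = conf_seq_orbit[OF xs]
    define good where "good = (\<lambda>t. Good ((T ^^ t) x))"
    have TT: "(T ^^ (t + j)) x = (T ^^ j) ((T ^^ t) x)" for t j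
      by (simp add: funpow_add add.commute[of t j])
    have elem: "Lm ((T ^^ j) y) \<le> h2 y \<and> g ((T ^^ j) y) \<le> h2 y" if "j < m" for j y
    proof -
      have "Lm ((T ^^ j) y) + g ((T ^^ j) y) \<le> h2 y"
        unfolding h2_def using that by (intro member_le_sum) (auto simp: Lm_nonneg g0)
      then show ?thesis using Lm_nonneg[of "(T ^^ j) y"] g0[of "(T ^^ j) y"] by linarith
    qed
    show "hausdorff_measure s (repeller (orbit x)) \<noteq> 0"
    proof (rule hausdorff_measure_pos_of_good_times[OF \<delta> homog F mx s q, where m = m and B = B and \<eta> = "1 / B"
          and good = good and ?M1.0 = M1 and v = "p' * real k" and a = "p' / 2"])
      show "q + n0 \<le> m" "1 \<le> m" using k(3) by (simp_all add: m_def l_def)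
      show "0 \<le> B" "0 < 1 / B" using B by simp_all
      show "ln (norm_D (orbit x (t + Suc j))) \<le> B" if "good t" "j < m" for t j
      proof -
        have "ln (norm_D (orbit x (t + Suc j))) = Lm ((T ^^ j) ((T ^^ t) x))"
          unfolding orbit_Suc L_def[symmetric] TT[symmetric] using Lx by simp
        then show ?thesis using elem[OF that(2), of "(T ^^ t) x"] that(1) by (simp add: good_def Good_def)
      qed
      show "1 / B \<le> gap (orbit x (t + Suc j))" if "good t" "j < m" for t j
      proof -
        have "0 < gap (f ((T ^^ (t + j)) x))" by (rule gap_pos[OF conf_f[OF funpow_T_space[OF xs]]])
        moreover have "1 / gap (f ((T ^^ (t + j)) x)) \<le> g ((T ^^ (t + j)) x)" using gx by (simp add: g_def)
        then have "1 / gap (f ((T ^^ (t + j)) x)) \<le> B"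
          using elem[OF that(2), of "(T ^^ t) x"] that(1) unfolding TT[symmetric] by (simp add: good_def Good_def)
        ultimately have "1 \<le> B * gap (f ((T ^^ (t + j)) x))" by (simp only: pos_divide_le_eq)
        then show ?thesis unfolding orbit_Suc using B(1) by (simp only: pos_divide_le_eq mult.commute)
      qed
      show "log_norm_sum (orbit x) t (q + n0) \<le> M1" if "good t" for t
      proof -
        have "log_norm_sum (orbit x) t (q + n0) = h1 ((T ^^ t) x)"
          unfolding log_norm_sum_orbit h1_def l_def TT[symmetric] by (rule sum.cong[OF refl]) (rule Lx[THEN spec])
        then show ?thesis using that by (simp add: good_def Good_def)
      qed
      show "p' * real k \<le> ln (pinf s (orbit x) (t + (q + n0)) (m - (q + n0)))" if "good t" for t
      proof -
        have "ln (pinf s (orbit x) (t + (q + n0)) (m - (q + n0))) = X s k ((T ^^ (t + l)) x)"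
          unfolding pinf_orbit_shift[of s x "t + (q + n0)"] X_def by (simp add: m_def l_def)
        also have "\<dots> = version (X s k) ((T ^^ l) ((T ^^ t) x))" unfolding TT[symmetric] by (rule Xx[THEN spec])
        finally show ?thesis using that by (simp add: good_def Good_def)
      qed
      show "0 < p' / 2" using p' by simp
      show "p' / 2 * real m \<le> p' * real k - s * M1" by (rule am)
      have eq1: "(\<Sum>t<n. if good t then 0 else 1) = birkhoff_sum \<phi> n x" for n
        by (simp add: birkhoff_sum_def \<phi>_def good_def)
      from b1 show "eventually (\<lambda>n. (\<Sum>t<n. if good t then 0 else 1) \<le> real n / 2) sequentially"
        unfolding eq1
      proof (rule eventually_mono)
        fix n assume "birkhoff_sum \<phi> n x \<le> \<theta> * real n"
        also have "\<dots> \<le> 1 / 4 * real n" using \<theta>(2) by (intro mult_right_mono) auto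
        finally show "birkhoff_sum \<phi> n x \<le> real n / 2" by simp
      qed
      from b1 b2 show "eventually (\<lambda>n. s * (\<Sum>t<n. if good t then 0 else ln (norm_D (orbit x (Suc t)))) \<le> p' / 2 / 4 * real n) sequentially"
      proof eventually_elim
        case (elim n)
        have "(\<Sum>t<n. if good t then 0 else ln (norm_D (orbit x (Suc t)))) \<le> (\<Sum>t<n. real C * \<phi> ((T ^^ t) x) + tail C ((T ^^ t) x))"
        proof (rule sum_mono)
          fix t
          have y: "(T ^^ t) x \<in> space M" by (rule funpow_T_space[OF xs])
          have n: "ln (norm_D (orbit x (Suc t))) = Lm ((T ^^ t) x)"
            using orbit_Suc[of x 0 t] Lx by (simp add: L_def)
          show "(if good t then 0 else ln (norm_D (orbit x (Suc t)))) \<le> real C * \<phi> ((T ^^ t) x) + tail C ((T ^^ t) x)"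
            unfolding n using y Lm_nonneg[of "(T ^^ t) x"] by (auto simp: good_def \<phi>_def tail_def indicator_def)
        qed
        also have "\<dots> = real C * birkhoff_sum \<phi> n x + birkhoff_sum (tail C) n x"
          by (simp add: birkhoff_sum_def sum.distrib sum_distrib_left)
        also have "\<dots> \<le> real C * (\<theta> * real n) + p' / (32 * s) * real n"
          using elim by (intro add_mono mult_left_mono) auto
        finally have "s * (\<Sum>t<n. if good t then 0 else ln (norm_D (orbit x (Suc t)))) \<le> s * (real C * (\<theta> * real n) + p' / (32 * s) * real n)"
          using s by (intro mult_left_mono) auto
        also have "\<dots> = (s * real C * \<theta>) * real n + p' / 32 * real n" using s by (simp add: field_simps)
        also have "\<dots> \<le> p' / 32 * real n + p' / 32 * real n" using \<theta>(3) by (intro add_mono mult_right_mono) auto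
        also have "\<dots> \<le> p' / 2 / 4 * real n" using p' by (simp add: field_simps)
        finally show ?case .
      qed
    qed
  qed
qed

text \<open>
  Between \<open>dim\<close> and \<open>s\<close> there is an exponent with nonpositive
  pressure, and the slope makes the pressure at \<open>s\<close> strictly negative.
\<close>

lemma upper_box_le_of_dim_less:
  assumes s: "0 \<le> s" and d: "dim < ennreal s"
  shows "AE x in M. upper_box_dim (repeller (orbit x)) \<le> ennreal s"
proof -
  have "dim < \<infinity>" using d by (rule less_le_trans) simp
  then have fin: "P 0 < \<infinity>" using dim_finite_iff by blast
  obtain y where y: "dim < y" "y < ennreal s" using dense[OF d] by blast
  define s1 where "s1 = enn2real y"
  have "y < top" using y(2) less_le_trans top_greatest by blast
  then have y1: "y = ennreal s1" "0 \<le> s1" by (simp_all add: s1_def)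
  have s1: "s1 < s" using y(2) y1 by (simp add: ennreal_less_iff)
  have P1: "P s1 \<le> 0" using le_dim[OF y1(2)] y(1) y1(1) by (meson leD not_le)
  define \<gamma> where "\<gamma> = (s - s1) * ln \<beta> / 2"
  have \<gamma>: "0 < \<gamma>" using s1 \<beta>_gt_1 by (simp add: \<gamma>_def)
  have "P s < ereal (- \<gamma>)"
  proof (rule ccontr)
    assume "\<not> P s < ereal (- \<gamma>)"
    then have "ereal (- \<gamma>) \<le> P s" by simp
    moreover have "ereal (- 2 * \<gamma>) < ereal (- \<gamma>)" using \<gamma> by simp
    ultimately have "ereal (- 2 * \<gamma>) < P s" by (rule less_le_trans[rotated])
    then obtain c where c: "ereal (- 2 * \<gamma>) < ereal c" "ereal c < P s" using ereal_dense2 by blast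
    have "ereal (c + (s - s1) * ln \<beta>) \<le> P s1"
      by (rule P_exponent_upper[OF y1(2)]) (use s1 c(2) in simp_all)
    also note P1
    finally have "c + (s - s1) * ln \<beta> \<le> 0" by (simp add: zero_ereal_def)
    then show False using c(1) by (simp add: \<gamma>_def)
  qed
  from P_lt[OF s fin this] have "AE x in M. eventually (\<lambda>n. X s n x \<le> - \<gamma> * real n) sequentially" .
  moreover have "AE x in M. \<forall>t. L ((T ^^ t) x) = Lm ((T ^^ t) x)" by (rule AE_all_shifts[OF L_eq_Lm])
  ultimately show ?thesis using Lm_over_n mix AE_space
  proof eventually_elim
    case (elim x)
    have "(\<lambda>n. ln (norm_D (orbit x n)) / real n) \<longlonglongrightarrow> 0"
    proof (rule LIMSEQ_imp_Suc)
      have "(\<lambda>n. real n / real (Suc n)) \<longlonglongrightarrow> 1" by real_asymp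
      with elim(3)[THEN spec, of 0]
      have "(\<lambda>n. Lm ((T ^^ (n + 0)) x) / real n * (real n / real (Suc n))) \<longlonglongrightarrow> 0 * 1" by (rule tendsto_mult)
      moreover have "eventually (\<lambda>n. Lm ((T ^^ (n + 0)) x) / real n * (real n / real (Suc n)) = ln (norm_D (orbit x (Suc n))) / real (Suc n)) sequentially"
        using eventually_gt_at_top[of 0]
      proof eventually_elim
        case (elim n)
        have "ln (norm_D (orbit x (Suc n))) = Lm ((T ^^ n) x)"
          using orbit_Suc[of x 0 n] \<open>\<forall>t. L ((T ^^ t) x) = Lm ((T ^^ t) x)\<close> by (simp add: L_def)
        then show ?case using elim by simp
      qed
      ultimately show "(\<lambda>n. ln (norm_D (orbit x (Suc n))) / real (Suc n)) \<longlonglongrightarrow> 0"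
        using Lim_transform_eventually by fastforce
    qed
    then show ?case
      by (rule upper_box_le[OF conf_seq_orbit[OF elim(5)] elim(4) s \<gamma> elim(1)[unfolded X_def]])
  qed
qed

text \<open>
  The two bounds hold almost surely for each exponent; rational exponents suffice, by
  monotonicity of the pressure and of the vanishing of Hausdorff measures.
\<close>

theorem all_dims_AE: "AE x in M. all_dims_eq (repeller (orbit x)) dim"
proof -
  have "AE x in M. 0 < (of_rat q :: real) \<longrightarrow> 0 < P (of_rat q) \<longrightarrow> hausdorff_measure (of_rat q) (repeller (orbit x)) \<noteq> 0" for q :: rat
    using hausdorff_pos[of "of_rat q"] by (cases "0 < (of_rat q :: real) \<and> 0 < P (of_rat q)") auto
  then have "AE x in M. \<forall>q::rat. 0 < (of_rat q :: real) \<longrightarrow> 0 < P (of_rat q) \<longrightarrow> hausdorff_measure (of_rat q) (repeller (orbit x)) \<noteq> 0"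
    by (simp only: AE_all_countable) simp
  moreover have "AE x in M. 0 \<le> (of_rat q :: real) \<longrightarrow> dim < ennreal (of_rat q) \<longrightarrow> upper_box_dim (repeller (orbit x)) \<le> ennreal (of_rat q)" for q :: rat
    using upper_box_le_of_dim_less[of "of_rat q"] by (cases "0 \<le> (of_rat q :: real) \<and> dim < ennreal (of_rat q)") auto
  then have "AE x in M. \<forall>q::rat. 0 \<le> (of_rat q :: real) \<longrightarrow> dim < ennreal (of_rat q) \<longrightarrow> upper_box_dim (repeller (orbit x)) \<le> ennreal (of_rat q)"
    by (simp only: AE_all_countable) simp
  ultimately show ?thesis
  proof eventually_elim
    fix x
    assume lo: "\<forall>q::rat. 0 < (of_rat q :: real) \<longrightarrow> 0 < P (of_rat q) \<longrightarrow> hausdorff_measure (of_rat q) (repeller (orbit x)) \<noteq> 0"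
      and up: "\<forall>q::rat. 0 \<le> (of_rat q :: real) \<longrightarrow> dim < ennreal (of_rat q) \<longrightarrow> upper_box_dim (repeller (orbit x)) \<le> ennreal (of_rat q)"
    let ?A = "repeller (orbit x)"
    have "dim \<le> hausdorff_dim ?A"
      unfolding hausdorff_dim_def
    proof (rule Inf_greatest)
      fix c assume "c \<in> {ennreal s |s. 0 \<le> s \<and> hausdorff_measure s ?A = 0}"
      then obtain s where s: "c = ennreal s" "0 \<le> s" "hausdorff_measure s ?A = 0" by blast
      show "dim \<le> c" unfolding s(1) dim_def
      proof (rule SUP_least, rule ccontr)
        fix s' assume "s' \<in> {s. 0 \<le> s \<and> P s > 0}" and n: "\<not> ennreal s' \<le> ennreal s"
        then have s': "0 \<le> s'" "0 < P s'" by simp_all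
        have "s < s'" using n ennreal_leI[of s' s] by (cases "s < s'") auto
        then obtain q where q: "s < of_rat q" "of_rat q < s'" using of_rat_dense by blast
        have q0: "0 < (of_rat q :: real)" using q s(2) by linarith
        have "P s' \<le> P (of_rat q)" by (rule P_antimono) (use q q0 in simp_all)
        then have "hausdorff_measure (of_rat q) ?A \<noteq> 0" using lo q0 s'(2) by (meson less_le_trans)
        moreover have "hausdorff_measure (of_rat q) ?A = 0"
          by (rule hausdorff_measure_zero_mono[OF s(2) _ s(3)]) (use q in simp)
        ultimately show False by simp
      qed
    qed
    moreover have "upper_box_dim ?A \<le> dim"
    proof (rule ccontr)
      assume "\<not> upper_box_dim ?A \<le> dim"
      then have "dim < upper_box_dim ?A" by simp
      then obtain y where y: "dim < y" "y < upper_box_dim ?A" using dense by blast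
      have ytop: "y < top" using y(2) less_le_trans top_greatest by blast
      then have dtop: "dim < top" using y(1) by (rule less_trans[rotated])
      have "dim = ennreal (enn2real dim)" "y = ennreal (enn2real y)" using dtop ytop by simp_all
      then have "enn2real dim < enn2real y" using y(1) by (metis enn2real_nonneg ennreal_less_iff)
      then obtain q where q: "enn2real dim < of_rat q" "of_rat q < enn2real y" using of_rat_dense by blast
      have q0: "0 \<le> (of_rat q :: real)" using q(1) enn2real_nonneg[of dim] by linarith
      have "dim < ennreal (of_rat q)"
        using q(1) \<open>dim = ennreal (enn2real dim)\<close> by (metis enn2real_nonneg ennreal_less_iff)
      then have "upper_box_dim ?A \<le> ennreal (of_rat q)" using up q0 by blast
      also have "\<dots> \<le> y" using q(2) \<open>y = ennreal (enn2real y)\<close> by (metis ennreal_leI less_imp_le)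
      finally show False using y(2) by simp
    qed
    ultimately show "all_dims_eq ?A dim"
      unfolding all_dims_eq_def
      using hausdorff_le_lower_box[of ?A] lower_box_le_upper_box[of ?A] by (meson antisym order_trans)
  qed
qed

lemma dmin_nonneg: "\<forall>x\<in>space M. 0 \<le> ln (real (dmin (f x)))"
  using dmin_pos[OF conf_f] by simp

lemma dmax_nonneg: "\<forall>x\<in>space M. 0 \<le> ln (real (dmax (f x)))"
  using dmax_pos[OF conf_f] by simp

lemma nonneg_version:
  assumes v: "\<exists>Y\<in>borel_measurable M. AE x in M. h x = Y x" and nn: "\<forall>x\<in>space M. 0 \<le> h x"
  shows "\<exists>Y. Y \<in> borel_measurable M \<and> (\<forall>x. 0 \<le> Y x) \<and> (AE x in M. h x = Y x) \<and>
    expect M h = enn2ereal (\<integral>\<^sup>+x. ennreal (Y x) \<partial>M)"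
proof -
  obtain Y where Y: "Y \<in> borel_measurable M" "AE x in M. h x = Y x" using v by blast
  define Z where "Z = (\<lambda>x. max 0 (Y x))"
  have 1: "AE x in M. h x = Z x"
    using Y(2) AE_space
  proof eventually_elim
    case (elim x)
    then show ?case using bspec[OF nn elim(2)] by (simp add: Z_def)
  qed
  have "expect M h = expect M Z" by (rule expect_cong_AE[OF 1])
  also have "\<dots> = enn2ereal (\<integral>\<^sup>+x. ennreal (Z x) \<partial>M)" by (rule expect_nonneg) (simp add: Z_def)
  finally show ?thesis using 1 Y(1) by (intro exI[of _ Z]) (auto simp: Z_def)
qed

text \<open>
  If the quotient exceeded the dimension, so would some real \<open>s\<close>, for which
  \<open>s * E log \<parallel>D\<parallel> < E log d\<^sub>m\<^sub>i\<^sub>n\<close>. Bounding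
  every map by its smallest degree and its largest derivative shows that the pressure at
  \<open>s\<close> is positive. The numerator may be infinite.
\<close>

theorem dim_lower_bound:
  "expect M (\<lambda>x. ln (real (dmin (f x)))) / expect M (\<lambda>x. ln (norm_D (f x))) \<le> enn2ereal dim"
proof (rule ccontr)
  let ?l = "\<integral>x. Lm x \<partial>M"
  have El: "expect M (\<lambda>x. ln (norm_D (f x))) = ereal ?l" using expect_L unfolding L_def .
  note l0 = integral_L_pos
  obtain Y where Y: "Y \<in> borel_measurable M" "\<And>x. 0 \<le> Y x" "AE x in M. ln (real (dmin (f x))) = Y x"
    "expect M (\<lambda>x. ln (real (dmin (f x)))) = enn2ereal (\<integral>\<^sup>+x. ennreal (Y x) \<partial>M)"
    using nonneg_version[OF dmin_version[OF f] dmin_nonneg] by (elim exE conjE) simp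
  assume "\<not> expect M (\<lambda>x. ln (real (dmin (f x)))) / expect M (\<lambda>x. ln (norm_D (f x))) \<le> enn2ereal dim"
  then have "enn2ereal dim < enn2ereal (\<integral>\<^sup>+x. ennreal (Y x) \<partial>M) / ereal ?l" unfolding El Y(4) by simp
  then obtain s where s: "enn2ereal dim < ereal s" "ereal s < enn2ereal (\<integral>\<^sup>+x. ennreal (Y x) \<partial>M) / ereal ?l"
    using ereal_dense2 by blast
  have s0: "0 \<le> s" using s(1) enn2ereal_nonneg[of dim] by (metis ereal_less_eq(5) less_imp_le order_trans)
  have "ereal ?l * ereal s < enn2ereal (\<integral>\<^sup>+x. ennreal (Y x) \<partial>M)"
    using s(2) l0 by (subst (asm) ereal_less_divide_pos) auto
  then obtain c where c: "ereal (?l * s) < ereal c" "ereal c < enn2ereal (\<integral>\<^sup>+x. ennreal (Y x) \<partial>M)"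
    using ereal_dense2 by (metis times_ereal.simps(1))
  \<comment> \<open>slightly above the mean of \<open>L\<close>, so that \<open>s * l' < c\<close> still holds\<close>
  define l' where "l' = ?l + (c - ?l * s) / (2 * (s + 1))"
  have l': "?l < l'" using c(1) s0 by (simp add: l'_def)
  have "s * ((c - ?l * s) / (2 * (s + 1))) < c - ?l * s"
  proof -
    have "s / (2 * (s + 1)) < 1" using s0 by simp
    then have "(c - ?l * s) * (s / (2 * (s + 1))) < (c - ?l * s) * 1" using c(1) by (intro mult_strict_left_mono) auto
    then show ?thesis by (simp add: mult.commute)
  qed
  then have pos: "0 < c - s * l'" by (simp add: l'_def algebra_simps)
  have "AE x in M. eventually (\<lambda>n. c * real n \<le> birkhoff_sum Y n x) sequentially"
    by (rule birkhoff_sum_lower_nonneg[OF Y(1,2) c(2)])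
  moreover have "AE x in M. \<forall>t. ln (real (dmin (f ((T ^^ t) x)))) = Y ((T ^^ t) x)" by (rule AE_all_shifts[OF Y(3)])
  ultimately have "AE x in M. eventually (\<lambda>n. (c - s * l') * real n \<le> X s n x) sequentially"
    using L_sum_upper[OF l'] AE_space
  proof eventually_elim
    case (elim x)
    note xs = elim(4) and Yx = elim(2)
    from elim(1,3) show ?case
    proof eventually_elim
      case (elim n)
      have "(\<Sum>j<n. ln (real (dmin (orbit x (0 + Suc j)))) - s * ln (norm_D (orbit x (0 + Suc j)))) \<le> X s n x"
        unfolding X_def by (rule ln_pinf_ge_dmin[OF conf_seq_orbit[OF xs] s0])
      also have "(\<Sum>j<n. ln (real (dmin (orbit x (0 + Suc j)))) - s * ln (norm_D (orbit x (0 + Suc j))))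
          = birkhoff_sum Y n x - s * (\<Sum>j<n. L ((T ^^ j) x))"
        unfolding orbit_Suc using Yx by (simp add: sum_subtractf sum_distrib_left birkhoff_sum_def L_def)
      finally have "birkhoff_sum Y n x - s * (\<Sum>j<n. L ((T ^^ j) x)) \<le> X s n x" .
      moreover have "s * (\<Sum>j<n. L ((T ^^ j) x)) \<le> s * (l' * real n)" using elim(2) s0 by (rule mult_left_mono)
      ultimately show ?case using elim(1) by (simp add: algebra_simps)
    qed
  qed
  then have "ereal (c - s * l') \<le> P s" by (rule P_ge[OF s0])
  moreover have "0 < ereal (c - s * l')" using pos by simp
  ultimately have "0 < P s" by (rule less_le_trans[rotated])
  then have "ennreal s \<le> dim" by (rule le_dim[OF s0])
  then have "ereal s \<le> enn2ereal dim" using s0 by (metis enn2ereal_ennreal less_eq_ennreal.rep_eq)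
  with s(1) show False by simp
qed

lemma dmax_integrable_version:
  assumes "expect M (\<lambda>x. ln (real (dmax (f x)))) < \<infinity>"
  obtains Y where "integrable M Y" "AE x in M. \<forall>t. ln (real (dmax (f ((T ^^ t) x)))) = Y ((T ^^ t) x)"
    "expect M (\<lambda>x. ln (real (dmax (f x)))) = ereal (\<integral>x. Y x \<partial>M)"
proof -
  obtain Y where Y: "Y \<in> borel_measurable M" "\<And>x. 0 \<le> Y x" "AE x in M. ln (real (dmax (f x))) = Y x"
    "expect M (\<lambda>x. ln (real (dmax (f x)))) = enn2ereal (\<integral>\<^sup>+x. ennreal (Y x) \<partial>M)"
    using nonneg_version[OF dmax_version[OF f] dmax_nonneg] by (elim exE conjE) simp
  have "(\<integral>\<^sup>+x. ennreal (Y x) \<partial>M) < \<infinity>"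
    using assms Y(4) by (metis enn2ereal_top infinity_ennreal_def less_ennreal.rep_eq)
  then have int: "integrable M Y" using Y(1,2) by (intro integrableI_nonneg) auto
  have "(\<integral>\<^sup>+x. ennreal (Y x) \<partial>M) = ennreal (\<integral>x. Y x \<partial>M)"
    by (rule nn_integral_eq_integral[OF int]) (simp add: Y(2))
  then have "expect M (\<lambda>x. ln (real (dmax (f x)))) = ereal (\<integral>x. Y x \<partial>M)"
    using Y(4) by (simp add: integral_nonneg_AE Y(2))
  then show ?thesis using int AE_all_shifts[OF Y(3)] by (intro that)
qed

lemma X_le_dmax:
  assumes "x \<in> space M" "0 \<le> s"
  shows "X s n x \<le> (\<Sum>j<n. ln (real (dmax (f ((T ^^ j) x)))) + s * ln (norm_inv_D (f ((T ^^ j) x))))"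
  using ln_pinf_le_dmax[OF conf_seq_orbit[OF assms(1)] assms(2), of 0 n] unfolding orbit_Suc X_def by simp

lemma P_0_finite_of_dmax:
  assumes "expect M (\<lambda>x. ln (real (dmax (f x)))) < \<infinity>" shows "P 0 < \<infinity>"
proof -
  obtain Y where Y: "integrable M Y" "AE x in M. \<forall>t. ln (real (dmax (f ((T ^^ t) x)))) = Y ((T ^^ t) x)"
    by (rule dmax_integrable_version[OF assms]) blast
  let ?c = "(\<integral>x. Y x \<partial>M) + 1"
  have "AE x in M. eventually (\<lambda>n. birkhoff_sum Y n x \<le> ?c * real n) sequentially"
    by (rule birkhoff_sum_upper[OF Y(1)]) simp
  then have "AE x in M. eventually (\<lambda>n. X 0 n x \<le> ?c * real n) sequentially"
    using Y(2) AE_space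
  proof eventually_elim
    case (elim x)
    from elim(1) show ?case
    proof (rule eventually_mono)
      fix n assume "birkhoff_sum Y n x \<le> ?c * real n"
      then show "X 0 n x \<le> ?c * real n"
        using X_le_dmax[OF elim(3) order_refl, of n] elim(2) by (simp add: birkhoff_sum_def)
    qed
  qed
  then have "P 0 \<le> ereal ?c" by (rule P_le[OF order_refl])
  then show ?thesis by (rule le_less_trans) simp
qed

text \<open>
  The denominator is finite and at least \<open>ln \<beta>\<close>, since \<open>\<beta> \<le> 1
  / \<parallel>1/D\<parallel> \<le> \<parallel>D\<parallel>\<close>. If the numerator is
  infinite there is nothing to show; otherwise the pressure at any \<open>s\<close> larger than
  the quotient is at most zero.
\<close>

theorem dim_upper_bound:
  "enn2ereal dim \<le> expect M (\<lambda>x. ln (real (dmax (f x)))) / (- expect M (\<lambda>x. ln (norm_inv_D (f x))))"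
proof -
  let ?K = "\<lambda>x. - ln (norm_inv_D (f x))"
  have Kge: "ln \<beta> \<le> ?K x" if x: "x \<in> space M" for x
  proof -
    have "ln (norm_inv_D (f x)) \<le> ln (1 / \<beta>)"
      using norm_inv_D_le[OF conf_f[OF x]] norm_inv_D_pos[OF conf_f[OF x]] by (intro ln_mono) auto
    then show ?thesis using \<beta>_gt_1 by (simp add: ln_div)
  qed
  have lb: "0 < ln \<beta>" using \<beta>_gt_1 by simp
  have K0: "\<forall>x\<in>space M. 0 \<le> ?K x" using Kge lb by fastforce
  have Kle: "?K x \<le> L x" if "x \<in> space M" for x unfolding L_def by (rule norm_D_norm_inv_D[OF conf_f[OF that]])
  have "\<exists>Y\<in>borel_measurable M. AE x in M. ?K x = Y x"
  proof -
    obtain Y where "Y \<in> borel_measurable M" "AE x in M. ln (norm_inv_D (f x)) = Y x" using norm_inv_D_version[OF f] by blast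
    then show ?thesis by (intro bexI[of _ "\<lambda>x. - Y x"]) auto
  qed
  from nonneg_version[OF this K0]
  obtain Z where Z: "Z \<in> borel_measurable M" "\<And>x. 0 \<le> Z x" "AE x in M. ?K x = Z x"
    "expect M ?K = enn2ereal (\<integral>\<^sup>+x. ennreal (Z x) \<partial>M)" by blast
  have Zint: "integrable M Z"
  proof (rule Bochner_Integration.integrable_bound[OF Lm_integrable Z(1)])
    show "AE x in M. norm (Z x) \<le> norm (Lm x)"
      using Z(3) L_eq_Lm AE_space
    proof eventually_elim
      case (elim x)
      then show ?case using Kle[OF elim(3)] Z(2)[of x] by simp
    qed
  qed
  define k where "k = (\<integral>x. Z x \<partial>M)"
  have "(\<integral>x. ln \<beta> \<partial>M) \<le> k"
    unfolding k_def
  proof (rule integral_mono_AE)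
    show "AE x in M. ln \<beta> \<le> Z x" using Z(3) AE_space
    proof eventually_elim
      case (elim x)
      then show ?case using Kge[OF elim(2)] by simp
    qed
  qed (simp_all add: Zint)
  then have k: "0 < k" using lb by (simp add: prob_space)
  have "(\<integral>\<^sup>+x. ennreal (Z x) \<partial>M) = ennreal k"
    unfolding k_def by (rule nn_integral_eq_integral[OF Zint]) (simp add: Z(2))
  then have EK: "expect M ?K = ereal k" using Z(4) k by simp
  have "expect M (\<lambda>x. ln (norm_inv_D (f x))) = - enn2ereal (\<integral>\<^sup>+x. ennreal (?K x) \<partial>M)"
    by (rule expect_nonpos) (use K0 in simp)
  also have "enn2ereal (\<integral>\<^sup>+x. ennreal (?K x) \<partial>M) = expect M ?K" by (rule expect_nonneg[symmetric]) (use K0 in simp)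
  finally have den: "- expect M (\<lambda>x. ln (norm_inv_D (f x))) = ereal k" unfolding EK by simp
  show ?thesis
  proof (cases "expect M (\<lambda>x. ln (real (dmax (f x)))) < \<infinity>")
    case False
    then have "expect M (\<lambda>x. ln (real (dmax (f x)))) = \<infinity>" by simp
    then show ?thesis unfolding den using k by simp
  next
    case True
    obtain Y where Y: "integrable M Y" "AE x in M. \<forall>t. ln (real (dmax (f ((T ^^ t) x)))) = Y ((T ^^ t) x)"
      "expect M (\<lambda>x. ln (real (dmax (f x)))) = ereal (\<integral>x. Y x \<partial>M)"
      by (rule dmax_integrable_version[OF True])
    define d where "d = (\<integral>x. Y x \<partial>M)"
    have "0 \<le> expect M (\<lambda>x. ln (real (dmax (f x))))"
      using expect_nonneg[of M "\<lambda>x. ln (real (dmax (f x)))"] dmax_nonneg by simp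
    then have d0: "0 \<le> d" unfolding Y(3) d_def[symmetric] by simp
    have "dim \<le> ennreal (d / k)"
      unfolding dim_def
    proof (rule SUP_least, rule ccontr)
      fix s assume "s \<in> {s. 0 \<le> s \<and> P s > 0}" and n: "\<not> ennreal s \<le> ennreal (d / k)"
      then have s: "0 \<le> s" "0 < P s" by simp_all
      have "d / k < s" using n ennreal_leI[of s "d / k"] by (cases "d / k < s") auto
      then have "d < s * k" using k by (simp add: pos_divide_less_eq)
      define \<psi> where "\<psi> = (\<lambda>x. Y x - s * Z x)"
      have "AE x in M. eventually (\<lambda>n. birkhoff_sum \<psi> n x \<le> 0 * real n) sequentially"
      proof (rule birkhoff_sum_upper)
        show "integrable M \<psi>" unfolding \<psi>_def using Y(1) Zint by simp
        have "(\<integral>x. \<psi> x \<partial>M) = d - s * k" unfolding \<psi>_def d_def k_def using Y(1) Zint by simp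
        then show "(\<integral>x. \<psi> x \<partial>M) < 0" using \<open>d < s * k\<close> by simp
      qed
      moreover have "AE x in M. \<forall>t. ?K ((T ^^ t) x) = Z ((T ^^ t) x)" by (rule AE_all_shifts[OF Z(3)])
      ultimately have "AE x in M. eventually (\<lambda>n. X s n x \<le> 0 * real n) sequentially"
        using Y(2) AE_space
      proof eventually_elim
        case (elim x)
        from elim(1) show ?case
        proof (rule eventually_mono)
          fix n assume b: "birkhoff_sum \<psi> n x \<le> 0 * real n"
          have "X s n x \<le> (\<Sum>j<n. ln (real (dmax (f ((T ^^ j) x)))) + s * ln (norm_inv_D (f ((T ^^ j) x))))"
            by (rule X_le_dmax[OF elim(4) s(1)])
          also have "\<dots> = birkhoff_sum \<psi> n x"
            unfolding birkhoff_sum_def \<psi>_def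
          proof (rule sum.cong[OF refl])
            fix j
            show "ln (real (dmax (f ((T ^^ j) x)))) + s * ln (norm_inv_D (f ((T ^^ j) x))) = Y ((T ^^ j) x) - s * Z ((T ^^ j) x)"
              using elim(2)[THEN spec, of j, symmetric] elim(3)[THEN spec, of j] by simp
          qed
          finally show "X s n x \<le> 0 * real n" using b by simp
        qed
      qed
      then have "P s \<le> ereal 0" by (rule P_le[OF s(1)])
      with s(2) show False by (simp add: zero_ereal_def)
    qed
    then have "enn2ereal dim \<le> enn2ereal (ennreal (d / k))" by (simp add: less_eq_ennreal.rep_eq)
    also have "\<dots> = ereal (d / k)" using d0 k by simp
    also have "\<dots> = expect M (\<lambda>x. ln (real (dmax (f x)))) / (- expect M (\<lambda>x. ln (norm_inv_D (f x))))"
      unfolding den Y(3) d_def[symmetric] using k by simp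
    finally show ?thesis .
  qed
qed

end

section \<open>Dependence on the random map and the theorem\<close>

text \<open>
  Countably many constants approximate the essential supremum.
\<close>

lemma dE_random_attained:
  "AE x in M. dE \<beta> \<epsilon> (f x) (g x) \<le> dE_random M \<beta> \<epsilon> f g"
proof (cases "dE_random M \<beta> \<epsilon> f g = top")
  case False
  let ?d = "dE_random M \<beta> \<epsilon> f g"
  have "AE x in M. dE \<beta> \<epsilon> (f x) (g x) \<le> ?d + ennreal (1 / real (Suc n))" for n
  proof -
    obtain a where a: "?d = ennreal a" "0 \<le> a" using False by (cases ?d) auto
    have "ennreal a < ennreal (a + 1 / real (Suc n))" using a(2) by (intro ennreal_lessI) (simp_all add: add_nonneg_pos)
    also have "\<dots> = ?d + ennreal (1 / real (Suc n))" using a by (simp add: ennreal_plus)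
    finally have "?d < ?d + ennreal (1 / real (Suc n))" unfolding a(1) .
    then obtain c where "AE x in M. dE \<beta> \<epsilon> (f x) (g x) \<le> c" "c < ?d + ennreal (1 / real (Suc n))"
      unfolding dE_random_def Inf_less_iff by blast
    then show ?thesis by (auto elim!: eventually_mono intro: order_trans)
  qed
  then have "AE x in M. \<forall>n. dE \<beta> \<epsilon> (f x) (g x) \<le> ?d + ennreal (1 / real (Suc n))"
    by (simp only: AE_all_countable) simp
  then show ?thesis
  proof (rule AE_mp, intro AE_I2 impI)
    fix x assume x: "\<forall>n. dE \<beta> \<epsilon> (f x) (g x) \<le> ?d + ennreal (1 / real (Suc n))"
    show "dE \<beta> \<epsilon> (f x) (g x) \<le> ?d"
    proof (rule ennreal_le_epsilon)
      fix e :: real assume "e > 0"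
      then obtain n where "1 / real (Suc n) < e" using nat_approx_posE by blast
      then have "?d + ennreal (1 / real (Suc n)) \<le> ?d + ennreal e" by (intro add_left_mono ennreal_leI) simp
      with x show "dE \<beta> \<epsilon> (f x) (g x) \<le> ?d + ennreal e" by (meson order_trans)
    qed
  qed
qed simp

text \<open>
  If \<open>P s > 0\<close> for \<open>f\<close>, then the pressure of \<open>f\<close> at a
  smaller \<open>s'\<close> is above \<open>(s - s') ln \<beta>\<close>, and that of
  \<open>g\<close> is at most \<open>2 r s'\<close> lower. It is positive for \<open>s' = s ln
  \<beta> / (ln \<beta> + 2 r)\<close>, the exponent at which both amounts are equal; and this
  \<open>s'\<close> is at least \<open>exp (- 2 r / ln \<beta>) * s\<close> because \<open>1 + x
  \<le> exp x\<close>.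
\<close>

lemma (in random_conf) dim_lipschitz:
  fixes f g :: "'w \<Rightarrow> 'a::{complete_space, perfect_space} \<rightharpoonup> 'a"
  assumes F: "random_repeller M T \<Delta> \<beta> \<epsilon> f n0 \<delta>" and G: "random_repeller M T \<Delta> \<beta> \<epsilon> g n1 \<delta>"
    and r: "0 \<le> r" "r \<le> \<epsilon> \<Delta>" and d: "AE x in M. matched (f x) (g x) r"
  shows "ennreal (exp (- 2 * r / ln \<beta>)) * random_repeller.dim M T f \<le> random_repeller.dim M T g"
proof -
  interpret F: random_repeller M T \<Delta> \<beta> \<epsilon> f n0 \<delta> by (rule F)
  interpret G: random_repeller M T \<Delta> \<beta> \<epsilon> g n1 \<delta> by (rule G)
  have lb: "0 < ln \<beta>" using \<beta>_gt_1 by simp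
  have ms: "AE x in M. \<forall>t. matched (f ((T ^^ t) x)) (g ((T ^^ t) x)) r" by (rule AE_all_shifts[OF d])
  have compare: "ereal (c - 2 * r * s) \<le> G.P s" if s: "0 \<le> s" and c: "ereal c < F.P s" for c s
  proof (rule G.P_ge[OF s])
    show "AE x in M. eventually (\<lambda>n. (c - 2 * r * s) * real n \<le> G.X s n x) sequentially"
      using F.P_gt[OF s c] ms AE_space
    proof eventually_elim
      case (elim x)
      from elim(1) show ?case
      proof (rule eventually_mono)
        fix n assume le: "c * real n \<le> F.X s n x"
        have "F.X s n x - 2 * r * real n * s \<le> G.X s n x"
          unfolding F.X_def G.X_def
        proof (rule ln_pinf_shadow[OF F.conf_seq_orbit[OF elim(3)] G.conf_seq_orbit[OF elim(3)] r s])
          fix k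
          show "matched (orbit_seq T f x (Suc k)) (orbit_seq T g x (Suc k)) r" using elim(2) by (simp add: orbit_seq_def)
        qed
        then show "(c - 2 * r * s) * real n \<le> G.X s n x" using le by (simp add: algebra_simps)
      qed
    qed
  qed
  have "ennreal (exp (- 2 * r / ln \<beta>)) * ennreal s \<le> G.dim" if s: "0 \<le> s" "0 < F.P s" for s
  proof -
    define s' where "s' = s * ln \<beta> / (ln \<beta> + 2 * r)"
    have den: "0 < ln \<beta> + 2 * r" using lb r by linarith
    have s'0: "0 \<le> s'" using s(1) lb den by (simp add: s'_def)
    have eq: "s' * (ln \<beta> + 2 * r) = s * ln \<beta>" using den by (simp add: s'_def)
    then have gain: "(s - s') * ln \<beta> = 2 * r * s'" by (simp add: algebra_simps)
    have "0 \<le> s' * (2 * r)" using s'0 r(1) by simp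
    then have "s' * ln \<beta> \<le> s * ln \<beta>" using eq by (simp only: distrib_left)
    then have s's: "s' \<le> s" using lb by simp
    obtain c where c: "0 < c" "ereal c < F.P s" using ereal_dense2[OF s(2)] by auto
    have "ereal (c + (s - s') * ln \<beta>) \<le> F.P s'"
      by (rule F.P_exponent_upper[OF s'0]) (use s's c(2) in simp_all)
    moreover have "ereal (c / 2 + 2 * r * s') < ereal (c + (s - s') * ln \<beta>)" unfolding gain using c(1) by simp
    ultimately have "ereal (c / 2 + 2 * r * s') < F.P s'" by (rule less_le_trans[rotated])
    from compare[OF s'0 this] have "ereal (c / 2) \<le> G.P s'" by simp
    moreover have "0 < ereal (c / 2)" using c(1) by simp
    ultimately have "0 < G.P s'" by (rule less_le_trans[rotated])
    then have "ennreal s' \<le> G.dim" by (rule G.le_dim[OF s'0])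
    moreover have "exp (- 2 * r / ln \<beta>) * s \<le> s'"
    proof -
      have "(ln \<beta> + 2 * r) / ln \<beta> = 1 + 2 * r / ln \<beta>" using lb by (simp add: add_divide_distrib)
      also have "\<dots> \<le> exp (2 * r / ln \<beta>)" by (rule exp_ge_add_one_self)
      finally have "exp (- 2 * r / ln \<beta>) * ((ln \<beta> + 2 * r) / ln \<beta>) \<le> exp (- 2 * r / ln \<beta>) * exp (2 * r / ln \<beta>)"
        by (intro mult_left_mono) auto
      also have "\<dots> = 1" by (simp add: exp_minus)
      finally have "exp (- 2 * r / ln \<beta>) * ((ln \<beta> + 2 * r) / ln \<beta>) * s' \<le> 1 * s'" using s'0 by (rule mult_right_mono)
      moreover have B: "(ln \<beta> + 2 * r) / ln \<beta> * s' = s" using eq lb by (simp add: field_simps)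
      ultimately show ?thesis by (simp only: mult.assoc B mult_1)
    qed
    ultimately show ?thesis
      by (metis (no_types, lifting) ennreal_leI ennreal_mult exp_ge_zero order_trans s(1))
  qed
  then show ?thesis unfolding F.dim_def SUP_mult_left_ennreal
    by (intro SUP_least) (simp only: mem_Collect_eq)
qed

theorem theorem4p4:
  fixes M :: "'w measure" and \<tau> :: "'w \<Rightarrow> 'w"
    and \<Delta> \<beta> :: real and \<epsilon> :: "real \<Rightarrow> real"
    and f :: "'w \<Rightarrow> ('a::{complete_space, perfect_space} \<rightharpoonup> 'a)"
    and n0 :: nat
  assumes "0 < \<Delta>"
    and "finitely_covered TYPE('a) \<Delta>"
    and "homogeneous TYPE('a) \<Delta>"
    and "1 < \<beta>"
    and "continuous_on {0..} \<epsilon>" "strict_mono_on {0..} \<epsilon>" "concave_on {0..} \<epsilon>" "\<epsilon> 0 = 0"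
    and "prob_space M"
    and "ergodic_transformation M \<tau>"
    and "f \<in> random_maps M \<Delta> \<beta> \<epsilon>"
    and "AE \<omega> in M. mixing n0 \<Delta> (orbit_seq \<tau> f \<omega>)"
    and "expect M (\<lambda>\<omega>. ln (norm_D (f \<omega>))) < \<infinity>"
  shows "\<exists>(P :: real \<Rightarrow> ereal) (D :: ennreal).
     (\<forall>s\<ge>0. AE \<omega> in M. lower_pressure s (orbit_seq \<tau> f \<omega>) = P s) \<and>
     (AE \<omega> in M. all_dims_eq (repeller (orbit_seq \<tau> f \<omega>)) D) \<and>
     D = (SUP s\<in>{s. 0 \<le> s \<and> P s > 0}. ennreal s) \<and>
     (D < \<infinity> \<longleftrightarrow> P 0 < \<infinity>) \<and>
     (expect M (\<lambda>\<omega>. ln (real (dmax (f \<omega>)))) < \<infinity> \<longrightarrow> P 0 < \<infinity>) \<and>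
     expect M (\<lambda>\<omega>. ln (real (dmin (f \<omega>)))) / expect M (\<lambda>\<omega>. ln (norm_D (f \<omega>)))
       \<le> enn2ereal D \<and>
     enn2ereal D \<le>
       expect M (\<lambda>\<omega>. ln (real (dmax (f \<omega>)))) / (- expect M (\<lambda>\<omega>. ln (norm_inv_D (f \<omega>)))) \<and>
     (\<forall>g\<in>random_maps M \<Delta> \<beta> \<epsilon>.
        (\<exists>n1. (AE \<omega> in M. mixing n1 \<Delta> (orbit_seq \<tau> f \<omega>)) \<and>
              (AE \<omega> in M. mixing n1 \<Delta> (orbit_seq \<tau> g \<omega>))) \<and>
        expect M (\<lambda>\<omega>. ln (norm_D (g \<omega>))) < \<infinity> \<and>
        dE_random M \<beta> \<epsilon> f g \<le> ennreal (\<epsilon> \<Delta>) \<longrightarrow>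
        (\<exists>D'. (AE \<omega> in M. all_dims_eq (repeller (orbit_seq \<tau> g \<omega>)) D') \<and>
              (let r = enn2real (dE_random M \<beta> \<epsilon> f g)
               in ennreal (exp (- 2 * r / ln \<beta>)) * D' \<le> D \<and>
                  D \<le> ennreal (exp (2 * r / ln \<beta>)) * D')))"
proof -
  obtain \<delta> where \<delta>: "0 < \<delta>" "\<delta> < \<Delta>" and homog: "\<And>y::'a. ball y \<Delta> - ball y \<delta> \<noteq> {}"
    using assms(3) unfolding homogeneous_def by (elim exE conjE) (rule that, auto)
  interpret conf_params \<Delta> \<beta> \<epsilon> by (rule conf_params.intro) (rule assms)+
  interpret random_conf M \<tau> \<Delta> \<beta> \<epsilon>
    by (intro random_conf.intro ergodic_system.intro ergodic_system_axioms.intro assms conf_params_axioms)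
  have repeller: "random_repeller M \<tau> \<Delta> \<beta> \<epsilon> h n \<delta>"
    if "h \<in> random_maps M \<Delta> \<beta> \<epsilon>" "AE \<omega> in M. mixing n \<Delta> (orbit_seq \<tau> h \<omega>)"
      "expect M (\<lambda>\<omega>. ln (norm_D (h \<omega>))) < \<infinity>" for h :: "'w \<Rightarrow> 'a \<rightharpoonup> 'a" and n
    by (intro random_repeller.intro random_repeller_axioms.intro random_conf_axioms that \<delta> homog)
  have F: "random_repeller M \<tau> \<Delta> \<beta> \<epsilon> f n0 \<delta>" by (rule repeller) (rule assms)+
  interpret F: random_repeller M \<tau> \<Delta> \<beta> \<epsilon> f n0 \<delta> by (rule F)
  have lip: "\<exists>D'. (AE \<omega> in M. all_dims_eq (repeller (orbit_seq \<tau> g \<omega>)) D') \<and>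
              (let r = enn2real (dE_random M \<beta> \<epsilon> f g)
               in ennreal (exp (- 2 * r / ln \<beta>)) * D' \<le> F.dim \<and>
                  F.dim \<le> ennreal (exp (2 * r / ln \<beta>)) * D')"
    if g: "g \<in> random_maps M \<Delta> \<beta> \<epsilon>" and mg: "AE \<omega> in M. mixing n1 \<Delta> (orbit_seq \<tau> g \<omega>)"
      and eg: "expect M (\<lambda>\<omega>. ln (norm_D (g \<omega>))) < \<infinity>" and d: "dE_random M \<beta> \<epsilon> f g \<le> ennreal (\<epsilon> \<Delta>)" for g n1
  proof -
    have G: "random_repeller M \<tau> \<Delta> \<beta> \<epsilon> g n1 \<delta>" by (rule repeller[OF g mg eg])
    interpret G: random_repeller M \<tau> \<Delta> \<beta> \<epsilon> g n1 \<delta> by (rule G)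
    define r where "r = enn2real (dE_random M \<beta> \<epsilon> f g)"
    have "dE_random M \<beta> \<epsilon> f g < top" using d by (rule le_less_trans) simp
    then have r: "dE_random M \<beta> \<epsilon> f g = ennreal r" "0 \<le> r" by (simp_all add: r_def)
    have e0: "0 \<le> \<epsilon> \<Delta>" using \<epsilon>_nonneg \<Delta>_pos by simp
    have r\<epsilon>: "r \<le> \<epsilon> \<Delta>" using d e0 unfolding r(1) by simp
    have m: "AE \<omega> in M. matched (f \<omega>) (g \<omega>) r"
      using dE_random_attained[where M = M and \<beta> = \<beta> and \<epsilon> = \<epsilon> and f = f and g = g] AE_space
    proof eventually_elim
      case (elim x)
      then show ?case using dE_imp_matched[OF F.conf_f[OF elim(2)] G.conf_f[OF elim(2)] r(2)] unfolding r(1) by simp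
    qed
    have m': "AE \<omega> in M. matched (g \<omega>) (f \<omega>) r"
      using m AE_space by eventually_elim (use matched_sym F.conf_f G.conf_f in blast)
    have 1: "ennreal (exp (- 2 * r / ln \<beta>)) * F.dim \<le> G.dim" by (rule dim_lipschitz[OF F G r(2) r\<epsilon> m])
    have 2: "ennreal (exp (- 2 * r / ln \<beta>)) * G.dim \<le> F.dim" by (rule dim_lipschitz[OF G F r(2) r\<epsilon> m'])
    have "F.dim = ennreal (exp (2 * r / ln \<beta>)) * (ennreal (exp (- 2 * r / ln \<beta>)) * F.dim)"
      by (simp add: mult.assoc[symmetric] ennreal_mult[symmetric] exp_minus)
    also have "\<dots> \<le> ennreal (exp (2 * r / ln \<beta>)) * G.dim" using 1 by (rule mult_left_mono) simp
    finally show ?thesis using 2 G.all_dims_AE unfolding Let_def r_def[symmetric] by blast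
  qed
  show ?thesis
    by (rule exI[of _ F.P], rule exI[of _ F.dim])
       (use F.P_AE F.all_dims_AE F.dim_def F.dim_finite_iff F.P_0_finite_of_dmax F.dim_lower_bound F.dim_upper_bound lip in blast)
qed

end
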